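(* Let $\mu$ be a cardinal with $2\le\mu\le\omega_1$. It is consistent (relative to the consistency of ZFC) that GCH holds and there is a colouring $f:[\omega_2]^2\to\mu$ establishing $\omega_2\not\rightarrow[(\omega_1;\omega)]^2_\mu$ such that $g\not\Rightarrow f$ for some colouring $g:[\omega_1]^2\to 2$.
   Context: $[X]^2$ is the set of two-element subsets of $X$. For sets $A,B$ of ordinals, $[A,B]=\{\{\alpha,\beta\}:\alpha\in A,\ \beta\in B,\ \alpha\ne\beta\}$, and $f''[A,B]$ is the image of this set under $f$. A function $f:[\omega_2]^2\to\mu$ establishes $\omega_2\not\rightarrow[(\omega_1;\omega)]^2_\mu$ if $f''[A,B]=\mu$ whenever $A\subseteq\omega_2$ has order type $\omega_1$, $B\subseteq\omega_2$ has order type $\omega$, and every element of $A$ is smaller than every element of $B$. For functions $f:[X]^2\to C$ and $d:[Y]^2\to C$ we write $d\Rightarrow f$ ($d$ can be embedded into $f$) if there is a one-to-one map $\Phi:Y\to X$ such that $d(\{y,y'\})=f(\{\Phi(y),\Phi(y')\})$ for each $\{y,y'\}\in[Y]^2$. Here $2=\{0,1\}\subseteq\mu$, so $g$ is regarded as a function into $\mu$. *)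

theory Defs
  imports Main
begin

section \<open>First-order logic in the language of set theory\<close>

text \<open>Variables are natural numbers; the only non-logical symbol is membership, so the
  variables are the only terms.\<close>

datatype fm =
    Mem nat nat
  | Eq nat nat
  | Neg fm
  | Imp fm fm
  | All nat fm

definition Conj :: "fm \<Rightarrow> fm \<Rightarrow> fm" where "Conj p q = Neg (Imp p (Neg q))"
definition Disj :: "fm \<Rightarrow> fm \<Rightarrow> fm" where "Disj p q = Imp (Neg p) q"
definition Iff :: "fm \<Rightarrow> fm \<Rightarrow> fm" where "Iff p q = Conj (Imp p q) (Imp q p)"
definition Ex :: "nat \<Rightarrow> fm \<Rightarrow> fm" where "Ex x p = Neg (All x (Neg p))"

primrec fv :: "fm \<Rightarrow> nat set" where
  "fv (Mem x y) = {x, y}"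
| "fv (Eq x y) = {x, y}"
| "fv (Neg p) = fv p"
| "fv (Imp p q) = fv p \<union> fv q"
| "fv (All x p) = fv p - {x}"

text \<open>All variables occurring in a formula, free or bound.\<close>

primrec vars :: "fm \<Rightarrow> nat set" where
  "vars (Mem x y) = {x, y}"
| "vars (Eq x y) = {x, y}"
| "vars (Neg p) = vars p"
| "vars (Imp p q) = vars p \<union> vars q"
| "vars (All x p) = insert x (vars p)"

text \<open>\<open>subst x y p\<close> replaces the free occurrences of \<open>x\<close> in \<open>p\<close> by \<open>y\<close>. It does not rename
  bound variables; it is only used when \<open>free_for x y p\<close>, i.e. when no such occurrence
  lies in the scope of a quantifier over \<open>y\<close>.\<close>

primrec subst :: "nat \<Rightarrow> nat \<Rightarrow> fm \<Rightarrow> fm" where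
  "subst x y (Mem u v) = Mem (if u = x then y else u) (if v = x then y else v)"
| "subst x y (Eq u v) = Eq (if u = x then y else u) (if v = x then y else v)"
| "subst x y (Neg p) = Neg (subst x y p)"
| "subst x y (Imp p q) = Imp (subst x y p) (subst x y q)"
| "subst x y (All z p) = (if z = x then All z p else All z (subst x y p))"

primrec free_for :: "nat \<Rightarrow> nat \<Rightarrow> fm \<Rightarrow> bool" where
  "free_for x y (Mem u v) = True"
| "free_for x y (Eq u v) = True"
| "free_for x y (Neg p) = free_for x y p"
| "free_for x y (Imp p q) = (free_for x y p \<and> free_for x y q)"
| "free_for x y (All z p) = (x \<notin> fv (All z p) \<or> z \<noteq> y \<and> free_for x y p)"

text \<open>A Hilbert calculus for classical first-order logic with equality, in the style of
  Mendelson. Generalisation is unrestricted, which is sound because the calculus is only applied to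
  theories consisting of sentences.\<close>

inductive provable :: "fm set \<Rightarrow> fm \<Rightarrow> bool" for T where
  hyp: "p \<in> T \<Longrightarrow> provable T p"
| ax_K: "provable T (Imp p (Imp q p))"
| ax_S: "provable T (Imp (Imp p (Imp q r)) (Imp (Imp p q) (Imp p r)))"
| ax_contra: "provable T (Imp (Imp (Neg q) (Neg p)) (Imp (Imp (Neg q) p) q))"
| ax_inst: "free_for x y p \<Longrightarrow> provable T (Imp (All x p) (subst x y p))"
| ax_dist: "x \<notin> fv p \<Longrightarrow> provable T (Imp (All x (Imp p q)) (Imp p (All x q)))"
| eq_refl: "provable T (Eq x x)"
| eq_Eq: "provable T (Imp (Eq x y) (Imp (Eq x z) (Eq y z)))"
| eq_Mem_left: "provable T (Imp (Eq x y) (Imp (Mem x z) (Mem y z)))"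
| eq_Mem_right: "provable T (Imp (Eq x y) (Imp (Mem z x) (Mem z y)))"
| mp: "provable T (Imp p q) \<Longrightarrow> provable T p \<Longrightarrow> provable T q"
| gen: "provable T p \<Longrightarrow> provable T (All x p)"

definition consistent :: "fm set \<Rightarrow> bool" where
  "consistent T \<longleftrightarrow> \<not> (\<exists>p. provable T p \<and> provable T (Neg p))"


section \<open>Readable formulas\<close>

text \<open>To write concrete formulas with binders, a formula is represented as a function of a
  level \<open>n\<close> above all its free variables; a quantifier at level \<open>n\<close> binds the
  variable \<open>n\<close> and its body is read at level \<open>n + 1\<close>, so capture cannot occur. A
  sentence is obtained by evaluating at level 0.\<close>

type_synonym form = "nat \<Rightarrow> fm"

definition mem :: "nat \<Rightarrow> nat \<Rightarrow> form" (infix "\<^bold>\<in>" 50) where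
  "(x \<^bold>\<in> y) = (\<lambda>n. Mem x y)"
definition eq :: "nat \<Rightarrow> nat \<Rightarrow> form" (infix "\<^bold>=" 50) where
  "(x \<^bold>= y) = (\<lambda>n. Eq x y)"
definition neg :: "form \<Rightarrow> form" ("\<^bold>\<not> _" [40] 40) where
  "(\<^bold>\<not> p) = (\<lambda>n. Neg (p n))"
definition conj :: "form \<Rightarrow> form \<Rightarrow> form" (infixr "\<^bold>\<and>" 35) where
  "(p \<^bold>\<and> q) = (\<lambda>n. Conj (p n) (q n))"
definition disj :: "form \<Rightarrow> form \<Rightarrow> form" (infixr "\<^bold>\<or>" 30) where
  "(p \<^bold>\<or> q) = (\<lambda>n. Disj (p n) (q n))"
definition imp :: "form \<Rightarrow> form \<Rightarrow> form" (infixr "\<^bold>\<longrightarrow>" 25) where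
  "(p \<^bold>\<longrightarrow> q) = (\<lambda>n. Imp (p n) (q n))"
definition iff :: "form \<Rightarrow> form \<Rightarrow> form" (infixr "\<^bold>\<longleftrightarrow>" 25) where
  "(p \<^bold>\<longleftrightarrow> q) = (\<lambda>n. Iff (p n) (q n))"
definition all :: "(nat \<Rightarrow> form) \<Rightarrow> form" (binder "\<^bold>\<forall>" 10) where
  "all P = (\<lambda>n. All n (P n (Suc n)))"
definition ex :: "(nat \<Rightarrow> form) \<Rightarrow> form" (binder "\<^bold>\<exists>" 10) where
  "ex P = (\<lambda>n. Ex n (P n (Suc n)))"
definition ex1 :: "(nat \<Rightarrow> form) \<Rightarrow> form" (binder "\<^bold>\<exists>\<^bold>!" 10) where
  "ex1 P = (\<^bold>\<exists>x. P x \<^bold>\<and> (\<^bold>\<forall>y. P y \<^bold>\<longrightarrow> y \<^bold>= x))"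


section \<open>ZFC\<close>

definition is_empty :: "nat \<Rightarrow> form" where
  "is_empty x = (\<^bold>\<forall>z. \<^bold>\<not> z \<^bold>\<in> x)"

definition subset :: "nat \<Rightarrow> nat \<Rightarrow> form" (infix "\<^bold>\<subseteq>" 50) where
  "(x \<^bold>\<subseteq> y) = (\<^bold>\<forall>z. z \<^bold>\<in> x \<^bold>\<longrightarrow> z \<^bold>\<in> y)"

text \<open>\<open>is_upair a b p\<close>: \<open>p = {a, b}\<close>.\<close>

definition is_upair :: "nat \<Rightarrow> nat \<Rightarrow> nat \<Rightarrow> form" where
  "is_upair a b p = (\<^bold>\<forall>z. z \<^bold>\<in> p \<^bold>\<longleftrightarrow> z \<^bold>= a \<^bold>\<or> z \<^bold>= b)"

text \<open>\<open>is_succ x y\<close>: \<open>y = x \<union> {x}\<close>.\<close>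

definition is_succ :: "nat \<Rightarrow> nat \<Rightarrow> form" where
  "is_succ x y = (\<^bold>\<forall>z. z \<^bold>\<in> y \<^bold>\<longleftrightarrow> z \<^bold>\<in> x \<^bold>\<or> z \<^bold>= x)"

definition is_power :: "nat \<Rightarrow> nat \<Rightarrow> form" where
  "is_power x P = (\<^bold>\<forall>z. z \<^bold>\<in> P \<^bold>\<longleftrightarrow> z \<^bold>\<subseteq> x)"

definition extensionality :: form where
  "extensionality = (\<^bold>\<forall>x. \<^bold>\<forall>y. (\<^bold>\<forall>z. z \<^bold>\<in> x \<^bold>\<longleftrightarrow> z \<^bold>\<in> y) \<^bold>\<longrightarrow> x \<^bold>= y)"

definition foundation :: form where
  "foundation = (\<^bold>\<forall>x. (\<^bold>\<exists>y. y \<^bold>\<in> x) \<^bold>\<longrightarrow>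
     (\<^bold>\<exists>y. y \<^bold>\<in> x \<^bold>\<and> \<^bold>\<not> (\<^bold>\<exists>z. z \<^bold>\<in> x \<^bold>\<and> z \<^bold>\<in> y)))"

definition pairing :: form where
  "pairing = (\<^bold>\<forall>a. \<^bold>\<forall>b. \<^bold>\<exists>p. is_upair a b p)"

definition union :: form where
  "union = (\<^bold>\<forall>F. \<^bold>\<exists>U. \<^bold>\<forall>z. z \<^bold>\<in> U \<^bold>\<longleftrightarrow> (\<^bold>\<exists>x. x \<^bold>\<in> F \<^bold>\<and> z \<^bold>\<in> x))"

definition power_set :: form where
  "power_set = (\<^bold>\<forall>x. \<^bold>\<exists>P. is_power x P)"

definition infinity :: form where
  "infinity = (\<^bold>\<exists>w. (\<^bold>\<exists>z. is_empty z \<^bold>\<and> z \<^bold>\<in> w) \<^bold>\<and>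
     (\<^bold>\<forall>x. x \<^bold>\<in> w \<^bold>\<longrightarrow> (\<^bold>\<exists>y. is_succ x y \<^bold>\<and> y \<^bold>\<in> w)))"

definition choice :: form where
  "choice = (\<^bold>\<forall>F. (\<^bold>\<forall>x. x \<^bold>\<in> F \<^bold>\<longrightarrow> (\<^bold>\<exists>z. z \<^bold>\<in> x)) \<^bold>\<and>
       (\<^bold>\<forall>x. \<^bold>\<forall>y. x \<^bold>\<in> F \<^bold>\<and> y \<^bold>\<in> F \<^bold>\<and> \<^bold>\<not> x \<^bold>= y \<^bold>\<longrightarrow> \<^bold>\<not> (\<^bold>\<exists>z. z \<^bold>\<in> x \<^bold>\<and> z \<^bold>\<in> y))
     \<^bold>\<longrightarrow> (\<^bold>\<exists>C. \<^bold>\<forall>x. x \<^bold>\<in> F \<^bold>\<longrightarrow> (\<^bold>\<exists>\<^bold>!z. z \<^bold>\<in> x \<^bold>\<and> z \<^bold>\<in> C)))"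

text \<open>The schemas, before universal closure over the parameters: in each case \<open>n\<close> is a number
  above all variables involved, which makes \<open>n\<close>, \<open>n + 1\<close>, \<open>n + 2\<close> fresh.
  Separation says \<open>\<forall>A. \<exists>B. \<forall>x. x \<in> B \<longleftrightarrow> x \<in> A \<and> p(x)\<close>. Replacement says
  \<open>\<forall>A. (\<forall>x\<in>A. \<exists>c. \<forall>y. p(x,y) \<longleftrightarrow> y = c) \<longrightarrow> (\<exists>B. \<forall>x\<in>A. \<exists>y\<in>B. p(x,y))\<close>.\<close>

definition separation_inst :: "nat \<Rightarrow> fm \<Rightarrow> nat \<Rightarrow> fm" where
  "separation_inst x p n =
     All n (Ex (n + 1) (All x (Iff (Mem x (n + 1)) (Conj (Mem x n) p))))"

definition replacement_inst :: "nat \<Rightarrow> nat \<Rightarrow> fm \<Rightarrow> nat \<Rightarrow> fm" where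
  "replacement_inst x y p n =
     All n (Imp
       (All x (Imp (Mem x n) (Ex (n + 2) (All y (Iff p (Eq y (n + 2)))))))
       (Ex (n + 1) (All x (Imp (Mem x n) (Ex y (Conj (Mem y (n + 1)) p))))))"

definition closures :: "fm \<Rightarrow> fm set" where
  "closures p = {q. fv q = {} \<and> (\<exists>xs. q = foldr All xs p)}"

definition separation_axioms :: "fm set" where
  "separation_axioms =
     \<Union> {closures (separation_inst x p n) | x p n. \<forall>v \<in> insert x (vars p). v < n}"

definition replacement_axioms :: "fm set" where
  "replacement_axioms =
     \<Union> {closures (replacement_inst x y p n) | x y p n.
          x \<noteq> y \<and> (\<forall>v \<in> insert x (insert y (vars p)). v < n)}"

definition ZFC :: "fm set" where
  "ZFC = {extensionality 0, foundation 0, pairing 0, union 0, power_set 0, infinity 0, choice 0}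
         \<union> separation_axioms \<union> replacement_axioms"


section \<open>Functions, ordinals and cardinals\<close>

text \<open>\<open>is_opair a b p\<close>: \<open>p\<close> is the Kuratowski pair \<open>(a, b) = {{a}, {a, b}}\<close>.\<close>

definition is_opair :: "nat \<Rightarrow> nat \<Rightarrow> nat \<Rightarrow> form" where
  "is_opair a b p = (\<^bold>\<exists>u. \<^bold>\<exists>v. is_upair a a u \<^bold>\<and> is_upair a b v \<^bold>\<and> is_upair u v p)"

text \<open>\<open>maps f a b\<close>: \<open>(a, b) \<in> f\<close>, i.e. \<open>f(a) = b\<close> when \<open>f\<close> is a function.\<close>

definition maps :: "nat \<Rightarrow> nat \<Rightarrow> nat \<Rightarrow> form" where
  "maps f a b = (\<^bold>\<exists>p. is_opair a b p \<^bold>\<and> p \<^bold>\<in> f)"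

definition is_function :: "nat \<Rightarrow> nat \<Rightarrow> nat \<Rightarrow> form" where
  "is_function f X Y =
     ((\<^bold>\<forall>p. p \<^bold>\<in> f \<^bold>\<longrightarrow> (\<^bold>\<exists>x. \<^bold>\<exists>y. x \<^bold>\<in> X \<^bold>\<and> y \<^bold>\<in> Y \<^bold>\<and> is_opair x y p)) \<^bold>\<and>
      (\<^bold>\<forall>x. x \<^bold>\<in> X \<^bold>\<longrightarrow> (\<^bold>\<exists>\<^bold>!y. maps f x y)))"

definition is_injection :: "nat \<Rightarrow> nat \<Rightarrow> nat \<Rightarrow> form" where
  "is_injection f X Y =
     (is_function f X Y \<^bold>\<and>
      (\<^bold>\<forall>x. \<^bold>\<forall>x'. \<^bold>\<forall>y. maps f x y \<^bold>\<and> maps f x' y \<^bold>\<longrightarrow> x \<^bold>= x'))"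

definition is_bijection :: "nat \<Rightarrow> nat \<Rightarrow> nat \<Rightarrow> form" where
  "is_bijection f X Y =
     (is_injection f X Y \<^bold>\<and> (\<^bold>\<forall>y. y \<^bold>\<in> Y \<^bold>\<longrightarrow> (\<^bold>\<exists>x. maps f x y)))"

definition equinumerous :: "nat \<Rightarrow> nat \<Rightarrow> form" where
  "equinumerous X Y = (\<^bold>\<exists>f. is_bijection f X Y)"

text \<open>Transitive and linearly ordered by membership; well-foundedness is automatic by
  Foundation.\<close>

definition is_ordinal :: "nat \<Rightarrow> form" where
  "is_ordinal a =
     ((\<^bold>\<forall>x. x \<^bold>\<in> a \<^bold>\<longrightarrow> x \<^bold>\<subseteq> a) \<^bold>\<and>
      (\<^bold>\<forall>x. \<^bold>\<forall>y. x \<^bold>\<in> a \<^bold>\<and> y \<^bold>\<in> a \<^bold>\<longrightarrow> x \<^bold>\<in> y \<^bold>\<or> x \<^bold>= y \<^bold>\<or> y \<^bold>\<in> x))"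

definition is_limit :: "nat \<Rightarrow> form" where
  "is_limit a =
     (is_ordinal a \<^bold>\<and> \<^bold>\<not> is_empty a \<^bold>\<and> (\<^bold>\<forall>x. x \<^bold>\<in> a \<^bold>\<longrightarrow> (\<^bold>\<exists>y. y \<^bold>\<in> a \<^bold>\<and> x \<^bold>\<in> y)))"

text \<open>\<open>\<omega>\<close> is the least limit ordinal.\<close>

definition is_omega :: "nat \<Rightarrow> form" where
  "is_omega w = (is_limit w \<^bold>\<and> \<^bold>\<not> (\<^bold>\<exists>x. x \<^bold>\<in> w \<^bold>\<and> is_limit x))"

primrec is_numeral :: "nat \<Rightarrow> nat \<Rightarrow> form" where
  "is_numeral 0 x = is_empty x"
| "is_numeral (Suc k) x = (\<^bold>\<exists>y. is_numeral k y \<^bold>\<and> is_succ y x)"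

definition is_cardinal :: "nat \<Rightarrow> form" where
  "is_cardinal k = (is_ordinal k \<^bold>\<and> \<^bold>\<not> (\<^bold>\<exists>x. x \<^bold>\<in> k \<^bold>\<and> equinumerous x k))"

definition is_infinite_cardinal :: "nat \<Rightarrow> form" where
  "is_infinite_cardinal k = (is_cardinal k \<^bold>\<and> (\<^bold>\<exists>w. is_omega w \<^bold>\<and> w \<^bold>\<subseteq> k))"

text \<open>\<open>is_succ_cardinal k l\<close>: \<open>l\<close> is the least cardinal above \<open>k\<close>.\<close>

definition is_succ_cardinal :: "nat \<Rightarrow> nat \<Rightarrow> form" where
  "is_succ_cardinal k l =
     (is_cardinal l \<^bold>\<and> k \<^bold>\<in> l \<^bold>\<and> (\<^bold>\<forall>m. is_cardinal m \<^bold>\<and> k \<^bold>\<in> m \<^bold>\<longrightarrow> l \<^bold>\<subseteq> m))"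

text \<open>\<open>is_omega_sub i x\<close>: \<open>x = \<omega>\<^sub>i\<close>.\<close>

primrec is_omega_sub :: "nat \<Rightarrow> nat \<Rightarrow> form" where
  "is_omega_sub 0 x = is_omega x"
| "is_omega_sub (Suc i) x = (\<^bold>\<exists>y. is_omega_sub i y \<^bold>\<and> is_succ_cardinal y x)"

definition GCH :: form where
  "GCH = (\<^bold>\<forall>k. \<^bold>\<forall>l. \<^bold>\<forall>P.
     is_infinite_cardinal k \<^bold>\<and> is_succ_cardinal k l \<^bold>\<and> is_power k P \<^bold>\<longrightarrow> equinumerous P l)"


section \<open>Colourings\<close>

text \<open>\<open>is_pairs X D\<close>: \<open>D = [X]\<^sup>2\<close>.\<close>

definition is_pairs :: "nat \<Rightarrow> nat \<Rightarrow> form" where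
  "is_pairs X D =
     (\<^bold>\<forall>p. p \<^bold>\<in> D \<^bold>\<longleftrightarrow> (\<^bold>\<exists>x. \<^bold>\<exists>y. x \<^bold>\<in> X \<^bold>\<and> y \<^bold>\<in> X \<^bold>\<and> \<^bold>\<not> x \<^bold>= y \<^bold>\<and> is_upair x y p))"

text \<open>\<open>is_pairs_between A B D\<close>: \<open>D = [A, B]\<close>.\<close>

definition is_pairs_between :: "nat \<Rightarrow> nat \<Rightarrow> nat \<Rightarrow> form" where
  "is_pairs_between A B D =
     (\<^bold>\<forall>p. p \<^bold>\<in> D \<^bold>\<longleftrightarrow> (\<^bold>\<exists>a. \<^bold>\<exists>b. a \<^bold>\<in> A \<^bold>\<and> b \<^bold>\<in> B \<^bold>\<and> \<^bold>\<not> a \<^bold>= b \<^bold>\<and> is_upair a b p))"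

text \<open>\<open>is_image f D I\<close>: \<open>I = f''D\<close>.\<close>

definition is_image :: "nat \<Rightarrow> nat \<Rightarrow> nat \<Rightarrow> form" where
  "is_image f D I = (\<^bold>\<forall>c. c \<^bold>\<in> I \<^bold>\<longleftrightarrow> (\<^bold>\<exists>p. p \<^bold>\<in> D \<^bold>\<and> maps f p c))"

text \<open>\<open>is_colouring f X C\<close>: \<open>f : [X]\<^sup>2 \<rightarrow> C\<close>.\<close>

definition is_colouring :: "nat \<Rightarrow> nat \<Rightarrow> nat \<Rightarrow> form" where
  "is_colouring f X C = (\<^bold>\<exists>D. is_pairs X D \<^bold>\<and> is_function f D C)"

text \<open>\<open>has_order_type A a\<close>: the set of ordinals \<open>A\<close> has order type the ordinal \<open>a\<close>.\<close>

definition has_order_type :: "nat \<Rightarrow> nat \<Rightarrow> form" where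
  "has_order_type A a =
     (\<^bold>\<exists>h. is_bijection h a A \<^bold>\<and>
       (\<^bold>\<forall>x. \<^bold>\<forall>y. \<^bold>\<forall>u. \<^bold>\<forall>v. maps h x u \<^bold>\<and> maps h y v \<^bold>\<and> x \<^bold>\<in> y \<^bold>\<longrightarrow> u \<^bold>\<in> v))"

text \<open>\<open>establishes f w w1 w2 m\<close>: the function \<open>f\<close> establishes the negative relation
  \<open>w2 \<rightarrow>/ [(w1; w)]\<^sup>2\<close> with \<open>m\<close> colours; \<open>w\<close>, \<open>w1\<close>, \<open>w2\<close> will be \<open>\<omega>\<close>, \<open>\<omega>\<^sub>1\<close>, \<open>\<omega>\<^sub>2\<close>.\<close>

definition establishes :: "nat \<Rightarrow> nat \<Rightarrow> nat \<Rightarrow> nat \<Rightarrow> nat \<Rightarrow> form" where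
  "establishes f w w1 w2 m =
     (is_colouring f w2 m \<^bold>\<and>
      (\<^bold>\<forall>A. \<^bold>\<forall>B. A \<^bold>\<subseteq> w2 \<^bold>\<and> has_order_type A w1 \<^bold>\<and> B \<^bold>\<subseteq> w2 \<^bold>\<and> has_order_type B w \<^bold>\<and>
           (\<^bold>\<forall>a. \<^bold>\<forall>b. a \<^bold>\<in> A \<^bold>\<and> b \<^bold>\<in> B \<^bold>\<longrightarrow> a \<^bold>\<in> b)
         \<^bold>\<longrightarrow> (\<^bold>\<exists>D. is_pairs_between A B D \<^bold>\<and> is_image f D m)))"

text \<open>\<open>embeds d Y f X\<close>: \<open>d \<Rightarrow> f\<close> for colourings \<open>d\<close> of \<open>[Y]\<^sup>2\<close> and \<open>f\<close> of \<open>[X]\<^sup>2\<close>. Colourings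
  are sets of ordered pairs, so enlarging the target set of \<open>d\<close> does not change \<open>d\<close>.\<close>

definition embeds :: "nat \<Rightarrow> nat \<Rightarrow> nat \<Rightarrow> nat \<Rightarrow> form" where
  "embeds d Y f X =
     (\<^bold>\<exists>\<Phi>. is_injection \<Phi> Y X \<^bold>\<and>
       (\<^bold>\<forall>y. \<^bold>\<forall>y'. y \<^bold>\<in> Y \<^bold>\<and> y' \<^bold>\<in> Y \<^bold>\<and> \<^bold>\<not> y \<^bold>= y' \<^bold>\<longrightarrow>
         (\<^bold>\<exists>x. \<^bold>\<exists>x'. \<^bold>\<exists>p. \<^bold>\<exists>q. \<^bold>\<exists>c. maps \<Phi> y x \<^bold>\<and> maps \<Phi> y' x' \<^bold>\<and>
            is_upair y y' p \<^bold>\<and> is_upair x x' q \<^bold>\<and> maps d p c \<^bold>\<and> maps f q c)))"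

text \<open>Names for the cardinals that are at most \<open>\<omega>\<^sub>1\<close>.\<close>

datatype colours = Fin nat | Omega | Omega1

primrec is_colours :: "colours \<Rightarrow> nat \<Rightarrow> form" where
  "is_colours (Fin k) x = is_numeral k x"
| "is_colours Omega x = is_omega_sub 0 x"
| "is_colours Omega1 x = is_omega_sub 1 x"

definition non_embedding :: "colours \<Rightarrow> form" where
  "non_embedding \<mu> =
     (\<^bold>\<exists>w. \<^bold>\<exists>w1. \<^bold>\<exists>w2. \<^bold>\<exists>m. \<^bold>\<exists>t.
       is_omega_sub 0 w \<^bold>\<and> is_omega_sub 1 w1 \<^bold>\<and> is_omega_sub 2 w2 \<^bold>\<and>
       is_colours \<mu> m \<^bold>\<and> is_numeral 2 t \<^bold>\<and>
       (\<^bold>\<exists>f. establishes f w w1 w2 m \<^bold>\<and>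
         (\<^bold>\<exists>g. is_colouring g w1 t \<^bold>\<and> \<^bold>\<not> embeds g w1 f w2)))"

end

theory Submission
  imports Defs "HOL-Library.Countable_Set"
begin

text \<open>By completeness, a consistent ZFC has a model on the natural numbers; its constructible universe
  satisfies V = L, and having countably many dense sets it has a generic extension. First-order schemas are
  handled without syntax: \<open>dfp E P\<close> says that a predicate is definable, and the locale \<open>zf\<close> has separation and
  replacement for definable predicates.

  We force with \<open>P \<times> C\<close>, where \<open>C\<close> is Cohen forcing. A condition of \<open>P\<close> is a countable part of a colouring \<open>f\<close> of
  \<open>[\<omega>\<^sub>2]\<^sup>2\<close> by \<open>\<omega>\<^sub>1\<close> colours together with countably many promises, infinite sets \<open>B\<close> on which every later point below
  \<open>B\<close> must realize all colours known to the condition. \<open>P\<close> is \<open>\<sigma>\<close>-closed and two conditions that cohere amalgamate, so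
  cardinals and GCH are preserved. A sequence \<open>\<tau>\<close> of the extension of length \<open>\<omega>\<close> is decided by one condition of
  \<open>P\<close> up to the Cohen part; for a Cohen condition \<open>r\<close>, the values of \<open>\<tau>\<close> that \<open>r\<close> still allows form a set of the ground
  model. These countably many sets can be promised, hence all but countably many points below \<open>\<tau>\<close> realize all colours
  on the range of \<open>\<tau>\<close>. Composing \<open>f\<close> with a retraction onto \<open>\<mu>\<close> gives the colouring for \<open>\<mu>\<close>.

  Let \<open>c\<close> be the Cohen real, \<open>e\<^sub>\<xi> : \<xi> \<rightarrow> \<omega>\<close> injections in the ground model, and \<open>g {\<alpha>, \<xi>} = c (e\<^sub>\<xi> \<alpha>)\<close> for
  \<open>\<alpha> < \<xi> < \<omega>\<^sub>1\<close>. If \<open>\<Phi>\<close> embeds \<open>g\<close> into \<open>f\<close>, then a single Cohen condition \<open>q\<close> decides uncountably many values of \<open>\<Phi>\<close>, and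
  some pair of these arguments has \<open>e\<^sub>\<xi> \<alpha>\<close> outside the domain of \<open>q\<close>. The colour of the image pair is decided by the
  \<open>P\<close>-part, so \<open>q\<close> can be extended to give the pair the other colour.\<close>

text \<open>Consistency only gives a model that may be ill-founded, so recursion, satisfaction and
  collapsing take place inside it and only for definable functions. V = L then supplies GCH, the
  choice of witnesses and names by least index, and initial segments of size \<open>w1\<close> that
  act like elementary submodels. The colouring \<open>g\<close> is read off a Cohen real because
  that real is generic even over the extension by \<open>P\<close>: however \<open>f\<close> colours
  an image pair, an undecided bit can still be chosen against it. The price is that the Cohen part
  adds infinite sets that may contain no infinite set of the ground model, so that no promise refers
  to them; this is why promises are made for sets of possible values. Promised sets are infinite so
  that each of countably many tasks gets an element of its own. In place of a chain condition,
  \<open>w2\<close> is kept by restricting conditions to an ordinal \<open>d\<close> that contains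
  \<open>w1\<close>: all colours of the condition remain visible to its restriction, and an
  extension of the restriction inside \<open>d\<close> still fits the whole condition.\<close>

section \<open>Definable predicates and functions\<close>

definition atm :: "((nat => 'a) => 'a) => bool" where
  "atm t \<longleftrightarrow> (EX i. t = (%e. e i)) | (EX c. t = (%e. c))"

text \<open>\<open>dfp E P\<close>: the predicate \<open>P\<close> of assignments is first-order definable over \<open>E\<close> with parameters;
  \<open>dff E t\<close> is the same for functions. The rules in \<open>df\<close> prove definability by following the syntax.\<close>

inductive dfp :: "('a => 'a => bool) => ((nat => 'a) => bool) => bool" for E where
  dfp_mem: "atm t ==> atm s ==> dfp E (%e. E (t e) (s e))"
| dfp_eq: "atm t ==> atm s ==> dfp E (%e. t e = s e)"
| dfp_not: "dfp E P ==> dfp E (%e. ~ P e)"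
| dfp_conj: "dfp E P ==> dfp E Q ==> dfp E (%e. P e & Q e)"
| dfp_ex: "dfp E P ==> dfp E (%e. EX x. P (case_nat x e))"

definition dff :: "('a => 'a => bool) => ((nat => 'a) => 'a) => bool" where
  "dff E t \<longleftrightarrow> dfp E (%e. t (%n. e (Suc n)) = e 0)"

lemma atm_var: "atm (%e. e i)" and atm_const: "atm (%e. c)"
  by (auto simp: atm_def)

lemma atm_subst: "atm t ==> (!!n. atm (a n)) ==> atm (%e. t (%n. a n e))"
  unfolding atm_def by (elim disjE exE) auto

text \<open>Variables and parameters can be put for variables without any new quantifier. This case
  comes first because the atomic case of general substitution already has to eliminate defined
  terms.\<close>

lemma dfp_subst_atm: "dfp E P ==> (!!n. atm (a n)) ==> dfp E (%e. P (%n. a n e))"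
proof (induction arbitrary: a rule: dfp.induct)
  case (dfp_ex P)
  \<comment> \<open>The substitution lifted below the binder: variable 0 is kept, and the old terms
    read the shifted assignment.\<close>
  let ?b = "case_nat (%e. e 0) (%n e. a n (%k. e (Suc k)))"
  have b: "atm (?b n)" for n
    using dfp_ex.prems by (cases n) (simp_all add: atm_var atm_subst[where a="%n e. e (Suc n)"])
  have eq: "(%n. ?b n (case_nat x e)) = case_nat x (%n. a n e)" for x e
    by (auto simp: fun_eq_iff split: nat.split)
  have "dfp E (%e. P (%n. ?b n e))" by (rule dfp_ex.IH) (rule b)
  from dfp.dfp_ex[OF this] show ?case by (simp only: eq)
next
  case (dfp_mem t s)
  show ?case by (rule dfp.dfp_mem[OF atm_subst[OF dfp_mem(1)] atm_subst[OF dfp_mem(2)]]; rule dfp_mem.prems)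
next
  case (dfp_eq t s)
  show ?case by (rule dfp.dfp_eq[OF atm_subst[OF dfp_eq(1)] atm_subst[OF dfp_eq(2)]]; rule dfp_eq.prems)
next
  case (dfp_not P) show ?case by (rule dfp.dfp_not, rule dfp_not.IH, rule dfp_not.prems)
next
  case (dfp_conj P Q)
  show ?case by (rule dfp.dfp_conj; rule dfp_conj.IH, rule dfp_conj.prems)
qed

lemma dfp_ren: "dfp E P ==> dfp E (%e. P (%n. e (r n)))"
  by (rule dfp_subst_atm) (auto intro: atm_var)

named_theorems df

lemma df_not[df]: "dfp E P ==> dfp E (%e. ~ P e)" by (rule dfp_not)
lemma df_conj[df]: "dfp E P ==> dfp E Q ==> dfp E (%e. P e & Q e)" by (rule dfp_conj)
lemma df_disj[df]: "dfp E P ==> dfp E Q ==> dfp E (%e. P e | Q e)"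
  using dfp_not[OF dfp_conj[OF dfp_not dfp_not], of E P Q] by simp
lemma df_imp[df]: "dfp E P ==> dfp E Q ==> dfp E (%e. P e --> Q e)"
  unfolding imp_conv_disj by (intro df_disj dfp_not)
lemma df_iff[df]: "dfp E P ==> dfp E Q ==> dfp E (%e. P e = Q e)"
  unfolding iff_conv_conj_imp by (intro df_conj df_imp)
lemma df_ex[df]: "dfp E (%e. P (e 0) (%n. e (Suc n))) ==> dfp E (%e. EX x. P x e)"
  using dfp_ex[of E "%e. P (e 0) (%n. e (Suc n))"] by simp
lemma df_all[df]: "dfp E (%e. P (e 0) (%n. e (Suc n))) ==> dfp E (%e. ALL x. P x e)"
  using dfp_not[OF df_ex[OF dfp_not[of E "%e. P (e 0) (%n. e (Suc n))"]]] by simp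

lemma dff_D: "dff E t ==> dfp E (%e. t (%n. e (Suc n)) = e 0)" by (simp add: dff_def)
lemma dff_ren: "dff E t ==> dff E (%e. t (%n. e (r n)))"
  unfolding dff_def using dfp_ren[of E _ "case_nat 0 (%n. Suc (r n))"] by fastforce
lemma df_var[df]: "dff E (%e. e i)"
  unfolding dff_def by (intro dfp_eq atm_var)
lemma df_const[df]: "dff E (%e. c)"
  unfolding dff_def by (intro dfp_eq atm_var atm_const)

text \<open>A defined term is removed by quantifying over its value; this is why \<open>dff\<close>
  asks only for a definable graph.\<close>

lemma df_let1: assumes "dff E t" "dfp E (%e. P (e 0) (%n. e (Suc n)))" shows "dfp E (%e. P (t e) e)"
proof -
  have "dfp E (%e. EX x. t e = x & P x e)" by (intro df) (use assms dff_def in auto)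
  thus ?thesis by simp
qed

lemma dfp_Suc: "dfp E P ==> dfp E (%e. P (%n. e (Suc n)))" by (rule dfp_ren)
lemma dff_Suc: "dff E t ==> dff E (%e. t (%n. e (Suc n)))" by (rule dff_ren)

lemma df_mem[df]: assumes "dff E t" "dff E s" shows "dfp E (%e. E (t e) (s e))"
  by (rule df_let1[OF assms(1)], rule df_let1[OF dff_Suc[OF assms(2)]])
    (intro dfp.intros atm_var)
lemma df_eq[df]: assumes "dff E t" "dff E s" shows "dfp E (%e. t e = s e)"
  by (rule df_let1[OF assms(1)], rule df_let1[OF dff_Suc[OF assms(2)]])
    (intro dfp.intros atm_var)

lemma dfp_subst: "dfp E P ==> (!!n. dff E (a n)) ==> dfp E (%e. P (%n. a n e))"
proof (induction arbitrary: a rule: dfp.induct)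
  case (dfp_mem t s)
  have "dff E (%e. r (%n. a n e))" if "atm r" for r :: "(nat => 'a) => 'a"
    using that dfp_mem.prems unfolding atm_def by (elim disjE exE) (simp_all add: df_const)
  from this[OF dfp_mem(1)] this[OF dfp_mem(2)] show ?case by (rule df_mem)
next
  case (dfp_eq t s)
  have "dff E (%e. r (%n. a n e))" if "atm r" for r :: "(nat => 'a) => 'a"
    using that dfp_eq.prems unfolding atm_def by (elim disjE exE) (simp_all add: df_const)
  from this[OF dfp_eq(1)] this[OF dfp_eq(2)] show ?case by (rule df_eq)
next
  case (dfp_ex P)
  let ?b = "case_nat (%e. e 0) (%n e. a n (%k. e (Suc k)))"
  have b: "dff E (?b n)" for n
    using dfp_ex.prems by (cases n) (simp_all add: df_var dff_Suc)
  have eq: "(%n. ?b n (case_nat x e)) = case_nat x (%n. a n e)" for x e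
    by (auto simp: fun_eq_iff split: nat.split)
  have "dfp E (%e. P (%n. ?b n e))" by (rule dfp_ex.IH) (rule b)
  from dfp.dfp_ex[OF this] show ?case by (simp only: eq)
next
  case (dfp_not P) show ?case by (rule df, rule dfp_not.IH, rule dfp_not.prems)
next
  case (dfp_conj P Q)
  show ?case by (rule df; rule dfp_conj.IH, rule dfp_conj.prems)
qed

lemma dff_subst: assumes "dff E t" "!!n. dff E (a n)" shows "dff E (%e. t (%n. a n e))"
proof -
  define b where "b = case_nat (%e. e 0) (%n e. a n (%k. e (Suc k)))"
  have b: "dff E (b n)" for n
    unfolding b_def by (cases n) (simp_all add: df_var dff_Suc assms(2))
  from dfp_subst[OF dff_D[OF assms(1)], of b, OF b] show ?thesis by (simp add: dff_def b_def)
qed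

lemma dfp1: assumes "dfp E (%e. P (e 0))" "dff E t" shows "dfp E (%e. P (t e))"
  using dfp_subst[OF assms(1), of "%_. t"] assms(2) by simp
lemma dfp2: assumes "dfp E (%e. P (e 0) (e 1))" "dff E t" "dff E s" shows "dfp E (%e. P (t e) (s e))"
  using dfp_subst[OF assms(1), of "%n. if n = 0 then t else s"] assms(2-) by simp
lemma dfp3: assumes "dfp E (%e. P (e 0) (e 1) (e 2))" "dff E t" "dff E s" "dff E r" shows "dfp E (%e. P (t e) (s e) (r e))"
  using dfp_subst[OF assms(1), of "%n. if n = 0 then t else if n = 1 then s else r"] assms(2-) by simp
lemma dff1: assumes "dff E (%e. P (e 0))" "dff E t" shows "dff E (%e. P (t e))"
  using dff_subst[OF assms(1), of "%_. t"] assms(2) by simp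
lemma dff2: assumes "dff E (%e. P (e 0) (e 1))" "dff E t" "dff E s" shows "dff E (%e. P (t e) (s e))"
  using dff_subst[OF assms(1), of "%n. if n = 0 then t else s"] assms(2-) by simp
lemma df_Bool[df]: "dfp E (%e. b)"
proof -
  have "dfp E (%e::nat=>'a. e 0 = e 0)" "dfp E (%e. ~ e 0 = e 0)" by (intro df)+
  thus ?thesis by (cases b) auto
qed

lemma df_if[df]: assumes "dfp E P" "dff E t" "dff E s" shows "dff E (%e. if P e then t e else s e)"
proof -
  have "dfp E (%e. (P (%n. e (Suc n)) & t (%n. e (Suc n)) = e 0) | (~ P (%n. e (Suc n)) & s (%n. e (Suc n)) = e 0))"
    by (intro df dfp_Suc dff_Suc assms)
  thus ?thesis unfolding dff_def by (rule back_subst[of "dfp E"]) (auto simp: fun_eq_iff)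
qed

text \<open>The set of all \<open>x\<close> with \<open>P x\<close>, and the empty set if these \<open>x\<close> do not form a set.\<close>

definition Cl :: "('a => 'a => bool) => ('a => bool) => 'a" where
  "Cl E P = (THE b. ALL x. E x b \<longleftrightarrow> P x & (EX c. ALL y. E y c \<longleftrightarrow> P y))"

section \<open>Set theory for definable predicates\<close>

text \<open>Pairing, union and power set are asked only in the form of a large enough set, which is
  what the constructible universe and the generic extension provide directly; separation cuts it
  down.\<close>

locale zf =
  fixes E :: "'a => 'a => bool" (infix "\<E>" 50)
  assumes ext: "(!!z. z \<E> x \<longleftrightarrow> z \<E> y) ==> x = y"
    and foundation: "y \<E> x ==> EX y. y \<E> x & (ALL z. z \<E> y --> ~ z \<E> x)"
    and weak_pairing: "EX p. a \<E> p & b \<E> p"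
    and weak_union: "EX u. ALL x z. x \<E> a --> z \<E> x --> z \<E> u"
    and weak_power: "EX p. ALL z. (ALL y. y \<E> z --> y \<E> a) --> z \<E> p"
    and infinity: "EX w. (EX z. z \<E> w & (ALL y. ~ y \<E> z)) &
       (ALL x. x \<E> w --> (EX y. y \<E> w & (ALL z. z \<E> y \<longleftrightarrow> z \<E> x | z = x)))"
    and separation: "dfp E (%e. P (e 0)) ==> EX b. ALL x. x \<E> b \<longleftrightarrow> x \<E> a & P x"
    and replacement: "dfp E (%e. Q (e 0) (e 1)) ==> (!!x. x \<E> a ==> EX c. ALL y. Q x y \<longleftrightarrow> y = c) ==>
       EX b. ALL x. x \<E> a --> (EX y. y \<E> b & Q x y)"
begin

abbreviation "Df \<equiv> dfp E"
abbreviation "Dt \<equiv> dff E"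
abbreviation "Dp P \<equiv> dfp E (%e. P (e 0))"
abbreviation "Dg F \<equiv> dff E (%e. F (e 0))"
abbreviation "set_of \<equiv> Cl E"
definition "isset P \<longleftrightarrow> (EX c. ALL y. y \<E> c \<longleftrightarrow> P y)"

lemma empty_ex: "EX b. ALL x. ~ x \<E> b"
  using separation[of "%x. False"] df_Bool by blast

lemma Cl_iff: "x \<E> set_of P \<longleftrightarrow> P x & isset P"
proof -
  have "EX! b. ALL x. x \<E> b \<longleftrightarrow> P x & isset P"
  proof (rule ex_ex1I)
    show "EX b. ALL x. x \<E> b \<longleftrightarrow> P x & isset P"
    proof (cases "isset P")
      case True thus ?thesis by (auto simp: isset_def)
    next
      case False thus ?thesis using empty_ex by auto
    qed
    fix b c assume "ALL x. x \<E> b \<longleftrightarrow> P x & isset P" "ALL x. x \<E> c \<longleftrightarrow> P x & isset P"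
    thus "b = c" by (intro ext) auto
  qed
  from theI'[OF this] show ?thesis unfolding Cl_def isset_def by auto
qed

lemma mem_Cl: "isset P ==> x \<E> set_of P \<longleftrightarrow> P x" by (simp add: Cl_iff)
lemma Cl_eqI: "(!!x. x \<E> b \<longleftrightarrow> P x) ==> set_of P = b"
  by (rule ext) (auto simp: Cl_iff isset_def)

lemma isset_bounded: assumes "Dp P" "!!x. P x ==> x \<E> a" shows "isset P"
  using separation[OF assms(1), of a] assms(2) unfolding isset_def by blast

text \<open>The default for proper classes is expressed in the graph itself, so the term is
  definable without knowing that the set exists.\<close>

lemma df_Cl[df]: assumes "Df (%e. P (e 0) (%n. e (Suc n)))" shows "Dt (%e. set_of (%x. P x e))"
proof -
  have eq: "set_of (%x. P x e) = b \<longleftrightarrow> (ALL x. x \<E> b \<longleftrightarrow> P x e & (EX c. ALL y. y \<E> c \<longleftrightarrow> P y e))" for b e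
    by (rule iffI, metis Cl_iff isset_def, rule ext, metis Cl_iff isset_def)
  have 1: "Df (%e. P (e 0) (%n. e (Suc (Suc n))))"
    using dfp_ren[OF assms, of "case_nat 0 (%n. Suc (Suc n))"] by simp
  have 2: "Df (%e. P (e 0) (%n. e (Suc (Suc (Suc (Suc n))))))"
    using dfp_ren[OF assms, of "case_nat 0 (%n. Suc (Suc (Suc (Suc n))))"] by simp
  show ?thesis unfolding dff_def eq by (intro df 1 2)
qed

definition "emp = set_of (%x. False)"
definition "upair a b = set_of (%x. x = a | x = b)"
definition "Unn a = set_of (%x. EX y. y \<E> a & x \<E> y)"
definition "sub a b \<longleftrightarrow> (ALL x. x \<E> a --> x \<E> b)"
definition "Pw a = set_of (%x. sub x a)"
definition "Sep a P = set_of (%x. x \<E> a & P x)"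
definition "Im F a = set_of (%y. EX x. x \<E> a & y = F x)"
definition "sing a = upair a a"
definition "un a b = Unn (upair a b)"
definition "suc a = un a (sing a)"
definition "opr a b = upair (sing a) (upair a b)"
definition "Th P = (if EX! x. P x then THE x. P x else emp)"
definition "fs p = Th (%a. EX b. p = opr a b)"
definition "sn p = Th (%b. EX a. p = opr a b)"
definition "prd a b = set_of (%z. EX x y. x \<E> a & y \<E> b & z = opr x y)"
definition "lam a F = Im (%x. opr x (F x)) a"
definition "ap f x = Th (%y. opr x y \<E> f)"

lemma mem_emp[simp]: "~ x \<E> emp" unfolding emp_def by (simp add: Cl_iff)
lemma subI: "(!!x. x \<E> a ==> x \<E> b) ==> sub a b" by (simp add: sub_def)
lemma subD: "sub a b ==> x \<E> a ==> x \<E> b" by (simp add: sub_def)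
lemma sub_refl[simp]: "sub a a" by (simp add: sub_def)
lemma sub_trans: "sub a b ==> sub b c ==> sub a c" by (simp add: sub_def)
lemma sub_antisym: "sub a b ==> sub b a ==> a = b" by (rule ext) (auto simp: sub_def)

lemma df_sub[df]: "Dt t ==> Dt s ==> Df (%e. sub (t e) (s e))"
  unfolding sub_def by (intro df dff_Suc)
lemma mem_upair[simp]: "x \<E> upair a b \<longleftrightarrow> x = a | x = b"
proof -
  obtain p where "a \<E> p" "b \<E> p" using weak_pairing by blast
  hence "isset (%x. x = a | x = b)" by (intro isset_bounded[where a=p]) (auto intro!: df)
  thus ?thesis unfolding upair_def by (simp add: mem_Cl)
qed
lemma mem_Un[simp]: "x \<E> Unn a \<longleftrightarrow> (EX y. y \<E> a & x \<E> y)"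
proof -
  obtain u where "ALL x z. x \<E> a --> z \<E> x --> z \<E> u" using weak_union by blast
  hence "isset (%x. EX y. y \<E> a & x \<E> y)" by (intro isset_bounded[where a=u]) (auto intro!: df)
  thus ?thesis unfolding Unn_def by (simp add: mem_Cl)
qed
lemma mem_Pw[simp]: "x \<E> Pw a \<longleftrightarrow> sub x a"
proof -
  obtain u where "ALL z. (ALL y. y \<E> z --> y \<E> a) --> z \<E> u" using weak_power by blast
  hence "isset (%x. sub x a)" by (intro isset_bounded[where a=u]) (auto intro!: df simp: sub_def)
  thus ?thesis unfolding Pw_def by (simp add: mem_Cl)
qed
lemma mem_Sep: "Dp P ==> x \<E> Sep a P \<longleftrightarrow> x \<E> a & P x"
  unfolding Sep_def by (subst mem_Cl, rule isset_bounded[where a=a]) (auto intro!: df)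
lemma mem_Im: assumes "Dg F" shows "y \<E> Im F a \<longleftrightarrow> (EX x. x \<E> a & y = F x)"
proof -
  have d: "Df (%e. e 1 = F (e 0))" by (intro df dff1[OF assms])
  obtain b where b: "ALL x. x \<E> a --> (EX y. y \<E> b & y = F x)"
    using replacement[OF d, of a] by auto
  have "isset (%y. EX x. x \<E> a & y = F x)"
    by (rule isset_bounded[where a=b]) (use b in \<open>auto intro!: df dff1[OF assms]\<close>)
  thus ?thesis unfolding Im_def by (simp add: mem_Cl)
qed
lemma mem_sing[simp]: "x \<E> sing a \<longleftrightarrow> x = a" by (simp add: sing_def)
lemma mem_un[simp]: "x \<E> un a b \<longleftrightarrow> x \<E> a | x \<E> b" by (auto simp: un_def)
lemma mem_suc[simp]: "x \<E> suc a \<longleftrightarrow> x \<E> a | x = a" by (auto simp: suc_def)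

lemma df_emp[df]: "Dt (%e. emp)" by (rule df)
lemma df_upair[df]: "Dt t ==> Dt s ==> Dt (%e. upair (t e) (s e))"
  unfolding upair_def by (intro df dff_Suc)
lemma df_Un[df]: "Dt t ==> Dt (%e. Unn (t e))" unfolding Unn_def by (intro df dff_Suc)
lemma df_Pw[df]: "Dt t ==> Dt (%e. Pw (t e))" unfolding Pw_def by (intro df dff_Suc)
lemma df_Sep[df]: "Dt t ==> Df (%e. P (e 0) (%n. e (Suc n))) ==> Dt (%e. Sep (t e) (%x. P x e))"
  unfolding Sep_def by (intro df dff_Suc)
lemma df_Im[df]: assumes "Dt t" "Dt (%e. F (e 0) (%n. e (Suc n)))" shows "Dt (%e. Im (%x. F x e) (t e))"
proof -
  have "Dt (%e. F (e 0) (%n. e (Suc (Suc n))))"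
    using dff_ren[OF assms(2), of "case_nat 0 (%n. Suc (Suc n))"] by simp
  thus ?thesis unfolding Im_def by (intro df dff_Suc assms)
qed
lemma df_sing[df]: "Dt t ==> Dt (%e. sing (t e))" unfolding sing_def by (intro df)
lemma df_un[df]: "Dt t ==> Dt s ==> Dt (%e. un (t e) (s e))" unfolding un_def by (intro df)
lemma df_suc[df]: "Dt t ==> Dt (%e. suc (t e))" unfolding suc_def by (intro df)
lemma df_opr[df]: "Dt t ==> Dt s ==> Dt (%e. opr (t e) (s e))" unfolding opr_def by (intro df)

lemma Th_eq: assumes "P a" "!!x. P x ==> x = a" shows "Th P = a"
proof -
  have "EX! x. P x" using assms by blast
  moreover have "(THE x. P x) = a" using assms by (rule the_equality)
  ultimately show ?thesis by (simp add: Th_def)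
qed
lemma df_Th[df]: assumes "Df (%e. P (e 0) (%n. e (Suc n)))" shows "Dt (%e. Th (%x. P x e))"
proof -
  have eq: "Th (%x. P x e) = b \<longleftrightarrow> (if EX x. ALL y. P y e \<longleftrightarrow> y = x then P b e else b = emp)" for b e
  proof (cases "EX! x. P x e")
    case True
    then obtain a where a: "!!x. P x e \<longleftrightarrow> x = a" by blast
    have "Th (%x. P x e) = a" by (rule Th_eq) (simp_all add: a)
    thus ?thesis by (auto simp: a)
  next
    case False
    hence "~ (EX x. ALL y. P y e \<longleftrightarrow> y = x)" by metis
    thus ?thesis using False unfolding Th_def by auto
  qed
  have 1: "Df (%e. P (e 0) (%n. e (Suc (Suc (Suc n)))))"
    using dfp_ren[OF assms, of "case_nat 0 (%n. Suc (Suc (Suc n)))"] by simp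
  show ?thesis unfolding dff_def eq if_bool_eq_conj by (intro df 1 assms)
qed

lemma upair_eq: "upair a b = upair c d \<longleftrightarrow> (a = c & b = d) | (a = d & b = c)"
proof
  assume "upair a b = upair c d"
  hence *: "(x = a | x = b) \<longleftrightarrow> (x = c | x = d)" for x by (metis mem_upair)
  show "(a = c & b = d) | (a = d & b = c)"
    using *[of a] *[of b] *[of c] *[of d] by auto
next
  assume "(a = c & b = d) | (a = d & b = c)"
  thus "upair a b = upair c d" by (intro ext) auto
qed
lemma opr_inj[simp]: "opr a b = opr c d \<longleftrightarrow> a = c & b = d"
  unfolding opr_def sing_def upair_eq by auto
lemma fs_opr[simp]: "fs (opr a b) = a" unfolding fs_def by (rule Th_eq) auto
lemma sn_opr[simp]: "sn (opr a b) = b" unfolding sn_def by (rule Th_eq) auto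
lemma df_fs[df]: "Dt t ==> Dt (%e. fs (t e))" unfolding fs_def by (intro df dff_Suc)
lemma df_sn[df]: "Dt t ==> Dt (%e. sn (t e))" unfolding sn_def by (intro df dff_Suc)
lemma mem_prd: "z \<E> prd a b \<longleftrightarrow> (EX x y. x \<E> a & y \<E> b & z = opr x y)"
proof -
  have "isset (%z. EX x y. x \<E> a & y \<E> b & z = opr x y)"
    by (rule isset_bounded[where a="Pw (Pw (un a b))"]) (auto intro!: df simp: opr_def sub_def)
  thus ?thesis unfolding prd_def by (simp add: mem_Cl)
qed
lemma opr_prd[simp]: "opr x y \<E> prd a b \<longleftrightarrow> x \<E> a & y \<E> b" by (auto simp: mem_prd)
lemma df_prd[df]: "Dt t ==> Dt s ==> Dt (%e. prd (t e) (s e))"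
  unfolding prd_def by (intro df dff_Suc)
lemma df_lam[df]: "Dt t ==> Dt (%e. F (e 0) (%n. e (Suc n))) ==> Dt (%e. lam (t e) (%x. F x e))"
  unfolding lam_def by (intro df)
lemma df_ap[df]: "Dt t ==> Dt s ==> Dt (%e. ap (t e) (s e))"
  unfolding ap_def by (intro df dff_Suc)
lemma mem_lam: "Dg F ==> z \<E> lam a F \<longleftrightarrow> (EX x. x \<E> a & z = opr x (F x))"
  unfolding lam_def by (rule mem_Im) (intro df)
lemma ap_lam: "Dg F ==> x \<E> a ==> ap (lam a F) x = F x"
  unfolding ap_def by (rule Th_eq) (auto simp: mem_lam)
lemma lam_cong: "(!!x. x \<E> a ==> F x = G x) ==> lam a F = lam a G"
  unfolding lam_def Im_def by (intro arg_cong[where f="Cl E"] HOL.ext) metis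
lemma Im_cong: "(!!x. x \<E> a ==> F x = G x) ==> Im F a = Im G a"
  unfolding Im_def by (intro arg_cong[where f="Cl E"] HOL.ext) metis
lemma mem_irrefl[simp]: "~ x \<E> x"
  using foundation[of x "sing x"] by auto
lemma mem_asym: "x \<E> y ==> ~ y \<E> x"
  using foundation[of x "upair x y"] by auto

text \<open>Well-founded recursion along a definable relation \<open>R\<close> all of whose points lie in an
  \<open>R\<close>-closed set.\<close>

definition "wrec R G x = Th (%y. EX f d. x \<E> d & (ALL u. u \<E> d --> (ALL v. R v u --> v \<E> d) &
   ap f u = G u (lam (set_of (%v. R v u)) (ap f))) & y = ap f x)"

lemma df_wrec[df]:
  assumes "Df (%e. R (e 0) (e 1) (%n. e (Suc (Suc n))))"
    "Dt (%e. G (e 0) (e 1) (%n. e (Suc (Suc n))))" "Dt t"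
  shows "Dt (%e. wrec (%v u. R v u e) (%u f. G u f e) (t e))"
proof -
  have R: "Df (%e. R (t e) (s e) (%n. e (r n)))" if "Dt t" "Dt s" for t s r
  proof -
    have "Dt (case_nat t (case_nat s (%n e. e (r n))) n)" for n
      using that by (auto split: nat.split intro: df_var)
    from dfp_subst[OF assms(1), of "case_nat t (case_nat s (%n e. e (r n)))", OF this] show ?thesis by simp
  qed
  have G: "Dt (%e. G (t e) (s e) (%n. e (r n)))" if "Dt t" "Dt s" for t s r
  proof -
    have "Dt (case_nat t (case_nat s (%n e. e (r n))) n)" for n
      using that by (auto split: nat.split intro: df_var)
    from dff_subst[OF assms(2), of "case_nat t (case_nat s (%n e. e (r n)))", OF this] show ?thesis by simp
  qed
  show ?thesis unfolding wrec_def by (intro df R G dff_Suc assms(3))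
qed

text \<open>An approximation obeys the recursion on an \<open>R\<close>-closed set. Two of them
  agree on common points, since a minimal disagreement has equal restrictions below it; and a
  minimal point without approximation could be given one.\<close>

lemma wrec:
  assumes R: "Df (%e. R (e 0) (e 1))" and G: "Dt (%e. G (e 0) (e 1))"
    and cl: "!!x. EX d. x \<E> d & (ALL u v. u \<E> d --> R v u --> v \<E> d)"
    and wf: "!!s x. x \<E> s ==> EX u. u \<E> s & (ALL v. R v u --> ~ v \<E> s)"
  shows "wrec R G x = G x (lam (set_of (%v. R v x)) (wrec R G))"
proof -
  note [df] = dfp2[OF R] dff2[OF G]
  define A where "A f d \<longleftrightarrow> (ALL u. u \<E> d --> (ALL v. R v u --> v \<E> d) &
    ap f u = G u (lam (set_of (%v. R v u)) (ap f)))" for f d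
  have w: "wrec R G x = Th (%y. EX f d. x \<E> d & A f d & y = ap f x)" for x
    unfolding wrec_def A_def by simp
  have irr: "~ R u u" for u using wf[of u "sing u"] by auto
  have pr: "v \<E> set_of (%v. R v u) \<longleftrightarrow> R v u" for u v
  proof (rule mem_Cl)
    obtain d where "u \<E> d" "ALL u v. u \<E> d --> R v u --> v \<E> d" using cl by blast
    thus "isset (%v. R v u)" by (intro isset_bounded[where a=d]) (auto intro!: df)
  qed
  have uniq: "ap f x = ap g x" if "A f d" "A g c" "x \<E> d" "x \<E> c" for f g d c x
  proof (rule ccontr)
    assume ne: "ap f x ~= ap g x"
    let ?s = "Sep d (%u. u \<E> c & ap f u ~= ap g u)"
    have s: "u \<E> ?s \<longleftrightarrow> u \<E> d & u \<E> c & ap f u ~= ap g u" for u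
      by (rule mem_Sep) (intro df)
    have "x \<E> ?s" using that ne s by blast
    from wf[OF this] obtain u where u: "u \<E> ?s" "!!v. R v u ==> ~ v \<E> ?s" by blast
    have "lam (set_of (%v. R v u)) (ap f) = lam (set_of (%v. R v u)) (ap g)"
    proof (rule lam_cong)
      fix v assume "v \<E> set_of (%v. R v u)"
      hence v: "R v u" by (simp add: pr)
      with u(1) that(1,2) have "v \<E> d" "v \<E> c" unfolding s A_def by blast+
      with u(2)[OF v] show "ap f v = ap g v" using s by blast
    qed
    moreover have "ap f u = G u (lam (set_of (%v. R v u)) (ap f))"
      "ap g u = G u (lam (set_of (%v. R v u)) (ap g))"
      using that u(1) s unfolding A_def by blast+
    ultimately show False using u(1) s by simp
  qed
  have val: "wrec R G x = ap f x" if "A f d" "x \<E> d" for f d x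
    unfolding w using that uniq by (intro Th_eq) blast+
  have step: "wrec R G x = G x (lam (set_of (%v. R v x)) (wrec R G))" if "A f d" "x \<E> d" for f d x
  proof -
    have "lam (set_of (%v. R v x)) (wrec R G) = lam (set_of (%v. R v x)) (ap f)"
    proof (rule lam_cong)
      fix v assume "v \<E> set_of (%v. R v x)"
      hence "v \<E> d" using that by (auto simp: pr A_def)
      thus "wrec R G v = ap f v" using val that(1) by blast
    qed
    thus ?thesis using val[OF that] that unfolding A_def by simp
  qed
  have "EX f d. A f d & x \<E> d"
  proof (rule ccontr)
    assume no: "~ (EX f d. A f d & x \<E> d)"
    obtain d0 where d0: "x \<E> d0" "ALL u v. u \<E> d0 --> R v u --> v \<E> d0" using cl by blast
    have dA: "Df (%e. A (e 0) (e 1))" unfolding A_def by (intro df)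
    note [df] = dfp2[OF dA]
    define B where "B u \<longleftrightarrow> (EX f d. A f d & u \<E> d)" for u
    have dB: "Dp B" unfolding B_def by (intro df)
    note [df] = dfp1[OF dB]
    have s: "u \<E> Sep d0 (%u. ~ B u) \<longleftrightarrow> u \<E> d0 & ~ B u" for u by (rule mem_Sep) (intro df)
    have "x \<E> Sep d0 (%u. ~ B u)" using s d0 no by (simp add: B_def)
    from wf[OF this] obtain y where y: "y \<E> d0" "~ B y" "!!v. R v y ==> v \<E> d0 & B v"
      using s d0 by blast
    have dw: "Dt (%e. wrec R G (e 0))" by (intro df)
    note [df] = dff1[OF dw]
    \<comment> \<open>The values known below \<open>y\<close>, extended by the value that the
      recursion demands at \<open>y\<close>.\<close>
    define H where "H u = (if u = y then G y (lam (set_of (%v. R v y)) (wrec R G)) else wrec R G u)" for u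
    have dH: "Dg H" unfolding H_def by (intro df)
    let ?d1 = "Sep d0 B"
    have d1: "u \<E> ?d1 \<longleftrightarrow> u \<E> d0 & B u" for u by (rule mem_Sep) (rule dB)
    have d1cl: "v \<E> ?d1" if "u \<E> ?d1" "R v u" for u v
      using that d0(2) unfolding d1 B_def A_def by blast
    define d2 where "d2 = un ?d1 (sing y)"
    have m2: "u \<E> d2 \<longleftrightarrow> u \<E> ?d1 | u = y" for u by (simp add: d2_def)
    have pr2: "v \<E> ?d1" if "u \<E> d2" "R v u" for u v
      using that d1cl y unfolding m2 d1 by blast
    have "A (lam d2 H) d2" unfolding A_def
    proof (intro allI impI conjI)
      fix u assume u: "u \<E> d2"
      show "R v u ==> v \<E> d2" for v using pr2[OF u] m2 by blast
      have "lam (set_of (%v. R v u)) (ap (lam d2 H)) = lam (set_of (%v. R v u)) (wrec R G)"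
      proof (rule lam_cong)
        fix v assume "v \<E> set_of (%v. R v u)"
        hence v: "v \<E> ?d1" using pr2[OF u] pr by blast
        moreover have "v ~= y" using v y d1 by blast
        ultimately show "ap (lam d2 H) v = wrec R G v" using m2 by (simp add: ap_lam[OF dH] H_def)
      qed
      moreover have "ap (lam d2 H) u = G u (lam (set_of (%v. R v u)) (wrec R G))"
      proof (cases "u = y")
        case True thus ?thesis using u by (simp add: ap_lam[OF dH] H_def)
      next
        case False
        hence "B u" using u m2 d1 by blast
        then obtain f d where "A f d" "u \<E> d" unfolding B_def by blast
        from step[OF this] show ?thesis using u False by (simp add: ap_lam[OF dH] H_def)
      qed
      ultimately show "ap (lam d2 H) u = G u (lam (set_of (%v. R v u)) (ap (lam d2 H)))" by simp
    qed
    hence "B y" unfolding B_def using m2 by blast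
    thus False using y by blast
  qed
  thus ?thesis using step by blast
qed

end

context zf
begin

section \<open>Ordinals\<close>

definition "Ord x \<longleftrightarrow> (ALL y. y \<E> x --> sub y x) & (ALL y z. y \<E> x & z \<E> x --> y \<E> z | y = z | z \<E> y)"
text \<open>By the default of \<open>Th\<close> this is \<open>emp\<close> when there is no such
  ordinal, hence an ordinal in every case.\<close>

definition "lst P = Th (%x. Ord x & P x & (ALL y. y \<E> x --> ~ P y))"

lemma df_Ord[df]: "Dt t ==> Df (%e. Ord (t e))" unfolding Ord_def by (intro df dff_Suc)
lemma df_lst[df]: assumes "Df (%e. P (e 0) (%n. e (Suc n)))" shows "Dt (%e. lst (%x. P x e))"
proof -
  have "Df (%e. P (e 0) (%n. e (Suc (Suc n))))"
    using dfp_ren[OF assms, of "case_nat 0 (%n. Suc (Suc n))"] by simp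
  thus ?thesis unfolding lst_def by (intro df assms)
qed

lemma mem_asym3: "x \<E> y ==> y \<E> z ==> ~ z \<E> x"
proof
  assume *: "x \<E> y" "y \<E> z" "z \<E> x"
  let ?s = "un (upair x y) (sing z)"
  have "x \<E> ?s" by simp
  from foundation[OF this] obtain u where "u \<E> ?s" "ALL z. z \<E> u --> ~ z \<E> ?s" by blast
  thus False using * by auto
qed

lemma Ord_trans: "Ord c ==> a \<E> b ==> b \<E> c ==> a \<E> c" unfolding Ord_def sub_def by blast
lemma Ord_lin_mem: "Ord c ==> a \<E> c ==> b \<E> c ==> a \<E> b | a = b | b \<E> a" unfolding Ord_def by blast
lemma Ord_memD: assumes "Ord a" "x \<E> a" shows "Ord x"
  unfolding Ord_def
proof (intro conjI allI impI)
  fix y assume y: "y \<E> x"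
  show "sub y x"
  proof (rule subI)
    fix z assume z: "z \<E> y"
    have "y \<E> a" "z \<E> a" using Ord_trans[OF assms(1)] y z assms(2) by blast+
    with Ord_lin_mem[OF assms(1), of z x] assms(2) show "z \<E> x" using y z mem_asym mem_asym3 by blast
  qed
next
  fix y z assume "y \<E> x & z \<E> x"
  thus "y \<E> z | y = z | z \<E> y" using Ord_trans[OF assms(1)] Ord_lin_mem[OF assms(1)] assms(2) by blast
qed
lemma Ord_subD: "Ord a ==> x \<E> a ==> sub x a" unfolding Ord_def by blast
lemma OrdI: "(!!x y. x \<E> a ==> y \<E> x ==> y \<E> a) ==> (!!x y. x \<E> a ==> y \<E> a ==> x \<E> y | x = y | y \<E> x) ==> Ord a"
  unfolding Ord_def sub_def by blast

text \<open>The least element of \<open>b\<close> outside \<open>a\<close> has exactly the elements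
  of \<open>a\<close>.\<close>

lemma Ord_sub_cases: assumes "Ord a" "Ord b" "sub a b" shows "a \<E> b | a = b"
proof (rule ccontr)
  assume n: "~ (a \<E> b | a = b)"
  let ?s = "Sep b (%x. ~ x \<E> a)"
  have s: "x \<E> ?s \<longleftrightarrow> x \<E> b & ~ x \<E> a" for x by (rule mem_Sep) (intro df)
  obtain x where "x \<E> b" "~ x \<E> a" using n sub_antisym[OF assms(3)] unfolding sub_def by blast
  hence "x \<E> ?s" using s by blast
  from foundation[OF this] obtain u where u: "u \<E> b" "~ u \<E> a" "!!z. z \<E> u ==> z \<E> b ==> z \<E> a"
    using s by blast
  have "u = a"
  proof (rule ext)
    fix z
    show "z \<E> u \<longleftrightarrow> z \<E> a"
    proof
      assume "z \<E> u" thus "z \<E> a" using u Ord_trans[OF assms(2)] by blast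
    next
      assume z: "z \<E> a"
      hence "z \<E> b" using assms(3) subD by blast
      with Ord_lin_mem[OF assms(2), of z u] u(1) have "z \<E> u | z = u | u \<E> z" by blast
      thus "z \<E> u" using z u(2) Ord_trans[OF assms(1)] by blast
    qed
  qed
  thus False using u n by blast
qed

text \<open>The intersection is an ordinal that cannot belong to both, so by the preceding
  comparison it equals one of them.\<close>

lemma Ord_lin: assumes "Ord a" "Ord b" shows "a \<E> b | a = b | b \<E> a"
proof -
  let ?c = "Sep a (%x. x \<E> b)"
  have c: "x \<E> ?c \<longleftrightarrow> x \<E> a & x \<E> b" for x by (rule mem_Sep) (intro df)
  have "Ord ?c" by (rule OrdI) (use c Ord_trans Ord_lin_mem assms in blast)+
  moreover have "sub ?c a" "sub ?c b" using c by (auto simp: sub_def)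
  ultimately have "?c \<E> a | ?c = a" "?c \<E> b | ?c = b" using Ord_sub_cases assms by blast+
  moreover have "~ (?c \<E> a & ?c \<E> b)" using c[of ?c] by simp
  ultimately show ?thesis by metis
qed
lemma Ord_cases: "Ord a ==> Ord b ==> a \<E> b | sub b a" using Ord_lin Ord_subD sub_refl by metis
lemma Ord_sub_iff: "Ord a ==> Ord b ==> sub a b \<longleftrightarrow> a \<E> b | a = b" using Ord_sub_cases Ord_subD sub_refl by metis
lemma Ord_not_mem: "Ord a ==> Ord b ==> ~ a \<E> b \<longleftrightarrow> sub b a" using Ord_cases subD mem_irrefl by blast
lemma Ord_le_less: "Ord b ==> Ord c ==> Ord a ==> sub a b ==> b \<E> c ==> a \<E> c"
  using Ord_sub_iff Ord_trans by metis

lemma Ord_emp[simp]: "Ord emp" by (rule OrdI) auto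
lemma Ord_suc[simp]: "Ord a ==> Ord (suc a)"
proof (rule OrdI)
  fix x y assume "Ord a" "x \<E> suc a" "y \<E> x" thus "y \<E> suc a" using Ord_trans[of a y x] by auto
next
  fix x y assume "Ord a" "x \<E> suc a" "y \<E> suc a"
  thus "x \<E> y | x = y | y \<E> x" using Ord_lin_mem[of a x y] by auto
qed
lemma Ord_Unn: assumes "!!x. x \<E> s ==> Ord x" shows "Ord (Unn s)"
proof (rule OrdI)
  fix x y assume *: "x \<E> Unn s" "y \<E> x"
  then obtain z where "z \<E> s" "x \<E> z" by auto
  thus "y \<E> Unn s" using *(2) Ord_trans[OF assms] by auto
next
  fix x y assume "x \<E> Unn s" "y \<E> Unn s"
  hence "Ord x" "Ord y" using assms Ord_memD by auto
  thus "x \<E> y | x = y | y \<E> x" by (rule Ord_lin)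
qed
lemma Ord_un: "Ord a ==> Ord b ==> Ord (un a b)" unfolding un_def by (rule Ord_Unn) auto
lemma un_absorb: "sub a b ==> un a b = b" "sub b a ==> un a b = a" by (rule ext; auto simp: sub_def)+
lemma un_max: "Ord a ==> Ord b ==> un a b = a | un a b = b"
  using Ord_cases Ord_subD un_absorb by metis
lemma Ord_Unn_suc[simp]: "Ord a ==> Unn (suc a) = a"
  using Ord_trans[of a] by (intro ext) auto
lemma suc_inj: "suc a = suc b \<longleftrightarrow> a = b"
  using mem_suc[of a b] mem_suc[of b a] mem_suc[of a a] mem_suc[of b b] mem_asym by metis
lemma suc_le: "Ord a ==> Ord b ==> a \<E> b \<longleftrightarrow> sub (suc a) b"
  unfolding sub_def using Ord_trans[of b] by auto
lemma lst:
  assumes "Dp P" "Ord a" "P a"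
  shows lst_Ord: "Ord (lst P)" and lst_P: "P (lst P)" and lst_min: "!!y. y \<E> lst P ==> ~ P y"
    and lst_le: "sub (lst P) a"
proof -
  let ?s = "Sep (suc a) P"
  have s: "x \<E> ?s \<longleftrightarrow> x \<E> suc a & P x" for x by (rule mem_Sep) (rule assms)
  have "a \<E> ?s" using s assms by simp
  from foundation[OF this] obtain u where u: "u \<E> suc a" "P u" "!!z. z \<E> u ==> z \<E> suc a ==> ~ P z"
    using s by blast
  have ou: "Ord u" using u(1) assms(2) Ord_memD[OF Ord_suc] by blast
  have m: "~ P z" if "z \<E> u" for z using u(3)[OF that] Ord_trans[OF Ord_suc[OF assms(2)] that u(1)] by blast
  have e: "lst P = u" unfolding lst_def
  proof (rule Th_eq)
    fix x assume x: "Ord x & P x & (ALL y. y \<E> x --> ~ P y)"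
    thus "x = u" using Ord_lin[OF _ ou, of x] m u(2) by blast
  qed (use ou u m in blast)
  show "Ord (lst P)" "P (lst P)" "!!y. y \<E> lst P ==> ~ P y" using e ou u m by auto
  show "sub (lst P) a" unfolding e using u(1) Ord_subD[OF assms(2)] by auto
qed
lemma lst_eqI: "Ord a ==> P a ==> (!!y. y \<E> a ==> ~ P y) ==> lst P = a"
  unfolding lst_def by (rule Th_eq) (use Ord_lin in blast)+

lemma Ord_induct: assumes "Dp P" "!!a. Ord a ==> (!!x. x \<E> a ==> P x) ==> P a" "Ord a" shows "P a"
proof (rule ccontr)
  assume n: "~ P a"
  have d: "Df (%e. ~ P (e 0))" by (intro df assms(1))
  note l = lst[of "%x. ~ P x", OF d assms(3) n]
  show False using l(2) assms(2)[OF l(1)] l(3) by blast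
qed

subsection \<open>Natural numbers\<close>

text \<open>All quantifiers are bounded, which makes the notion absolute for transitive
  embeddings.\<close>

definition "Nt x \<longleftrightarrow> Ord x & (ALL y. y \<E> suc x --> y = emp | (EX z. z \<E> y & y = suc z))"
definition "om = set_of Nt"
lemma df_Nt: "Dp Nt" unfolding Nt_def by (intro df)
lemma Nt_mem: "Nt x ==> y \<E> x ==> Nt y"
  unfolding Nt_def using Ord_memD[of x y] Ord_trans[of x _ y] by auto
lemma Nt_ind: assumes "Dp P" "P emp" "!!n. Nt n ==> P n ==> P (suc n)" "Nt n" shows "P n"
proof -
  have d: "Df (%e. Nt (e 0) --> P (e 0))" by (intro df dfp1[OF df_Nt] assms(1))
  have "Nt n --> P n"
  proof (rule Ord_induct[of "%n. Nt n --> P n", OF d])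
    show "Ord n" using assms(4) by (simp add: Nt_def)
    fix a assume a: "Ord a" "!!x. x \<E> a ==> Nt x --> P x"
    show "Nt a --> P a"
    proof
      assume n: "Nt a"
      hence "a = emp | (EX z. z \<E> a & a = suc z)" by (auto simp: Nt_def)
      thus "P a"
      proof
        assume "EX z. z \<E> a & a = suc z"
        then obtain z where "z \<E> a" "a = suc z" by blast
        thus ?thesis using a(2)[of z] Nt_mem[OF n] assms(3) by blast
      qed (use assms(2) in simp)
    qed
  qed
  thus ?thesis using assms(4) by blast
qed
lemma mem_om': "x \<E> om \<longleftrightarrow> Nt x"
proof -
  obtain w z where w: "z \<E> w" "ALL y. ~ y \<E> z" "ALL x. x \<E> w --> (EX y. y \<E> w & (ALL z. z \<E> y \<longleftrightarrow> z \<E> x | z = x))"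
    using infinity by blast
  have "z = emp" by (rule ext) (use w(2) in simp)
  hence e: "emp \<E> w" using w(1) by simp
  have s: "suc x \<E> w" if x: "x \<E> w" for x
  proof -
    obtain y where y: "y \<E> w" "ALL z. z \<E> y \<longleftrightarrow> z \<E> x | z = x" using w(3) x by blast
    have "y = suc x" by (rule ext) (use y(2) in simp)
    thus ?thesis using y(1) by simp
  qed
  have "x \<E> w" if "Nt x" for x
    by (rule Nt_ind[of "%x. x \<E> w", OF _ e s that]) (intro df)
  hence "isset Nt" using isset_bounded[OF df_Nt] by blast
  thus ?thesis unfolding om_def by (simp add: mem_Cl)
qed
lemma om_emp[simp]: "emp \<E> om" unfolding mem_om' Nt_def by simp
lemma om_suc[simp]: assumes "n \<E> om" shows "suc n \<E> om"
proof -
  have n: "Ord n" "!!y. y \<E> suc n ==> y = emp | (EX z. z \<E> y & y = suc z)"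
    using assms unfolding mem_om' Nt_def by blast+
  show ?thesis unfolding mem_om' Nt_def
  proof (intro conjI allI impI)
    fix y assume "y \<E> suc (suc n)"
    hence "y \<E> suc n | y = suc n" by simp
    thus "y = emp | (EX z. z \<E> y & y = suc z)" using n(2) mem_suc[of n n] by blast
  qed (use n(1) in simp)
qed
lemma om_Ord: "n \<E> om ==> Ord n" by (simp add: mem_om' Nt_def)
lemma Ord_om[simp]: "Ord om"
proof (rule OrdI)
  fix x y assume "x \<E> om" "y \<E> x" thus "y \<E> om" unfolding mem_om' by (rule Nt_mem)
next
  fix x y assume "x \<E> om" "y \<E> om" thus "x \<E> y | x = y | y \<E> x" using om_Ord Ord_lin by blast
qed
lemma om_ind: "Dp P ==> n \<E> om ==> P emp ==> (!!n. n \<E> om ==> P n ==> P (suc n)) ==> P n"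
  using Nt_ind[of P n] mem_om' by blast
lemma om_mem: "n \<E> om ==> m \<E> n ==> m \<E> om" using Ord_trans[OF Ord_om] by blast
lemma om_least: assumes "Ord a" "emp \<E> a" "!!x. x \<E> a ==> suc x \<E> a" shows "sub om a"
proof (rule subI)
  have d: "Dp (%n. n \<E> a)" by (intro df)
  show "x \<E> a" if "x \<E> om" for x by (rule om_ind[of "%n. n \<E> a", OF d that]) (use assms in blast)+
qed
lemma suc_ne_emp[simp]: "suc a ~= emp" "emp ~= suc a" by (metis mem_emp mem_suc)+

primrec nm :: "nat => 'a" where "nm 0 = emp" | "nm (Suc k) = suc (nm k)"
lemma nm_om[simp]: "nm k \<E> om" by (induction k) auto
lemma nm_Ord[simp]: "Ord (nm k)" using om_Ord by simp
lemma nm_inj[simp]: "nm i = nm j \<longleftrightarrow> i = j"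
  by (induction i arbitrary: j) (case_tac j; simp add: suc_inj)+

subsection \<open>Recursion on ordinals\<close>

text \<open>Only ordinals have predecessors here, so every point lies in a closed set: an ordinal in
  its successor, anything else in its singleton.\<close>

definition "orec G = wrec (%v u. v \<E> u & Ord u) G"
lemma df_orec[df]:
  assumes "Dt (%e. G (e 0) (e 1) (%n. e (Suc (Suc n))))" "Dt t"
  shows "Dt (%e. orec (%u f. G u f e) (t e))"
  unfolding orec_def by (intro df assms)
lemma orec: assumes G: "Dt (%e. G (e 0) (e 1))" and x: "Ord x"
  shows "orec G x = G x (lam x (orec G))"
proof -
  have "orec G x = G x (lam (set_of (%v. v \<E> x & Ord x)) (orec G))"
    unfolding orec_def
  proof (rule wrec[OF _ G])
    show "Df (%e. e 0 \<E> e 1 & Ord (e 1))" by (intro df)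
    show "EX d. x \<E> d & (ALL u v. u \<E> d --> v \<E> u & Ord u --> v \<E> d)" for x
    proof (cases "Ord x")
      case True thus ?thesis by (intro exI[of _ "suc x"]) (auto dest: Ord_trans)
    next
      case False thus ?thesis by (intro exI[of _ "sing x"]) auto
    qed
    show "x \<E> s ==> EX u. u \<E> s & (ALL v. v \<E> u & Ord u --> ~ v \<E> s)" for s x
      using foundation[of x s] by blast
  qed
  moreover have "set_of (%v. v \<E> x & Ord x) = x" by (rule Cl_eqI) (simp add: x)
  ultimately show ?thesis by simp
qed

text \<open>\<open>Unn\<close> takes a successor ordinal to its predecessor.\<close>

definition "iter F a = orec (%u f. if u = emp then a else F (ap f (Unn u)))"
lemma df_iter[df]: assumes "Dt (%e. F (e 0) (%n. e (Suc n)))" "Dt a" "Dt t"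
  shows "Dt (%e. iter (%x. F x e) (a e) (t e))"
proof -
  have F: "Dt (%e. F (s e) (%n. e (Suc (Suc n))))" if "Dt s" for s
  proof -
    have "Dt (case_nat s (%n e. e (Suc (Suc n))) n)" for n using that by (auto split: nat.split intro: df_var)
    from dff_subst[OF assms(1), of "case_nat s (%n e. e (Suc (Suc n)))", OF this] show ?thesis by simp
  qed
  have a: "Dt (%e. a (%n. e (Suc (Suc n))))" by (intro dff_Suc assms)
  show ?thesis unfolding iter_def by (intro df F a assms)
qed
lemma iter_0: "Dg F ==> iter F a emp = a"
  unfolding iter_def by (subst orec) (auto intro!: df dff1[of E F])
lemma iter_suc: assumes F: "Dg F" and n: "Ord n" shows "iter F a (suc n) = F (iter F a n)"
proof -
  note [df] = dff1[OF F]
  have "Dt (%e. iter F a (e 0))" by (intro df)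
  thus ?thesis unfolding iter_def using n by (subst orec) (auto intro!: df simp: ap_lam)
qed

subsection \<open>The Mostowski collapse of a set\<close>

text \<open>\<open>f\<close> arrives as a set of pairs, so \<open>Im sn f\<close> collects the
  collapses of those elements of \<open>u\<close> that lie in \<open>X\<close>.\<close>

definition "col X = wrec (%v u. v \<E> u & v \<E> X & u \<E> X) (%u f. Im sn f)"
lemma df_col[df]: assumes "Dt X" "Dt t" shows "Dt (%e. col (X e) (t e))"
proof -
  have X: "Dt (%e. X (%n. e (Suc (Suc n))))" by (intro dff_Suc assms)
  show ?thesis unfolding col_def by (intro df X assms)
qed
lemma Im_sn_lam: assumes "Dg F" shows "Im sn (lam a F) = Im F a"
  by (rule ext) (auto simp: mem_Im[OF assms] mem_Im[OF df_sn[OF df_var]] mem_lam[OF assms])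
lemma col: assumes "x \<E> X" shows "z \<E> col X x \<longleftrightarrow> (EX y. y \<E> x & y \<E> X & z = col X y)"
proof -
  have d: "Dg (col X)" by (intro df)
  have "col X x = Im sn (lam (set_of (%v. v \<E> x & v \<E> X & x \<E> X)) (col X))"
    unfolding col_def
  proof (rule wrec)
    show "Df (%e. e 0 \<E> e 1 & e 0 \<E> X & e 1 \<E> X)" "Dt (%e. Im sn (e 1))" by (intro df)+
    show "EX d. x \<E> d & (ALL u v. u \<E> d --> v \<E> u & v \<E> X & u \<E> X --> v \<E> d)" for x
      by (rule exI[of _ "un X (sing x)"]) auto
    show "x \<E> s ==> EX u. u \<E> s & (ALL v. v \<E> u & v \<E> X & u \<E> X --> ~ v \<E> s)" for s x
      using foundation[of x s] by blast
  qed
  moreover have "set_of (%v. v \<E> x & v \<E> X & x \<E> X) = Sep x (%v. v \<E> X)"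
    unfolding Sep_def using assms by simp
  ultimately have "col X x = Im (col X) (Sep x (%v. v \<E> X))" using Im_sn_lam[OF d] by simp
  moreover have "v \<E> Sep x (%v. v \<E> X) \<longleftrightarrow> v \<E> x & v \<E> X" for v by (rule mem_Sep) (intro df)
  ultimately show ?thesis by (auto simp: mem_Im[OF d])
qed

lemma set_induct: assumes "Dp P" "!!x. x \<E> X ==> (!!y. y \<E> x ==> y \<E> X ==> P y) ==> P x" "x \<E> X" shows "P x"
proof (rule ccontr)
  assume n: "~ P x"
  have s: "x \<E> Sep X (%x. ~ P x) \<longleftrightarrow> x \<E> X & ~ P x" for x by (rule mem_Sep) (intro df assms(1))
  have "x \<E> Sep X (%x. ~ P x)" using s n assms(3) by blast
  from foundation[OF this] show False using s assms(2) by blast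
qed

definition "extnl X \<longleftrightarrow> (ALL x y. x \<E> X --> y \<E> X --> (ALL z. z \<E> X --> (z \<E> x \<longleftrightarrow> z \<E> y)) --> x = y)"
lemma col_inj: assumes X: "extnl X" and "x \<E> X" "y \<E> X" "col X x = col X y" shows "x = y"
proof -
  have "ALL y. y \<E> X --> col X x = col X y --> x = y"
  proof (rule set_induct[of "%x. ALL y. y \<E> X --> col X x = col X y --> x = y", OF _ _ assms(2)])
    show "Df (%e. ALL y. y \<E> X --> col X (e 0) = col X y --> e 0 = y)" by (intro df)
    fix x assume x: "x \<E> X" and ih: "!!y. y \<E> x ==> y \<E> X ==> ALL z. z \<E> X --> col X y = col X z --> y = z"
    show "ALL y. y \<E> X --> col X x = col X y --> x = y"
    proof (intro allI impI)
      fix y assume y: "y \<E> X" "col X x = col X y"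
      have "z \<E> x \<longleftrightarrow> z \<E> y" if z: "z \<E> X" for z
      proof
        assume "z \<E> x"
        hence "col X z \<E> col X y" using y(2) col[OF x] z by metis
        then obtain w where "w \<E> y" "w \<E> X" "col X z = col X w" using col[OF y(1)] by blast
        thus "z \<E> y" using ih \<open>z \<E> x\<close> z by blast
      next
        assume "z \<E> y"
        hence "col X z \<E> col X x" using y(2) col[OF y(1)] z by metis
        then obtain w where "w \<E> x" "w \<E> X" "col X z = col X w" using col[OF x] by blast
        thus "z \<E> x" using ih z by metis
      qed
      thus "x = y" using X x y unfolding extnl_def by blast
    qed
  qed
  thus ?thesis using assms by blast
qed
lemma col_mem: assumes "extnl X" "x \<E> X" "y \<E> X" shows "col X x \<E> col X y \<longleftrightarrow> x \<E> y"
  using col[OF assms(3)] col_inj[OF assms(1)] assms by metis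
text \<open>A transitive part of \<open>X\<close> is not moved, by induction, and a subset of it is
  recomputed from unmoved elements.\<close>

lemma col_id: assumes "!!u v. u \<E> t ==> v \<E> u ==> v \<E> t" "sub t X" "x \<E> X" "sub x t" shows "col X x = x"
proof -
  have 1: "col X x = x" if "x \<E> t" for x
  proof (rule set_induct[of "%x. col X x = x", OF _ _ that])
    show "Df (%e. col X (e 0) = e 0)" by (intro df)
    fix x assume "x \<E> t" "!!y. y \<E> x ==> y \<E> t ==> col X y = y"
    thus "col X x = x" using col[of x X] assms by (intro ext) (metis subD)
  qed
  show ?thesis by (rule ext) (use col[OF assms(3)] 1 assms subD in metis)
qed
lemma extnl_Ord: "(!!x. x \<E> X ==> Ord x) ==> extnl X"
  unfolding extnl_def using Ord_lin mem_irrefl by metis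
lemma col_Ord: assumes "!!x. x \<E> X ==> Ord x" "x \<E> X" shows "Ord (col X x)" "sub (col X x) x"
proof -
  have "Ord (col X x) & sub (col X x) x"
  proof (rule set_induct[of "%x. Ord (col X x) & sub (col X x) x", OF _ _ assms(2)])
    show "Df (%e. Ord (col X (e 0)) & sub (col X (e 0)) (e 0))" by (intro df)
    fix x assume x: "x \<E> X" and ih: "!!y. y \<E> x ==> y \<E> X ==> Ord (col X y) & sub (col X y) y"
    have ox: "Ord x" using assms(1) x .
    have o: "Ord (col X x)"
    proof (rule OrdI)
      fix u v assume "u \<E> col X x" "v \<E> u"
      then obtain y where y: "y \<E> x" "y \<E> X" "v \<E> col X y" using col[OF x, of u] by blast
      then obtain z where "z \<E> y" "z \<E> X" "v = col X z" using col[OF y(2)] by blast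
      thus "v \<E> col X x" using col[OF x] Ord_trans[OF ox _ y(1)] by blast
    next
      fix u v assume "u \<E> col X x" "v \<E> col X x"
      hence "Ord u" "Ord v" using col[OF x] ih by auto
      thus "u \<E> v | u = v | v \<E> u" by (rule Ord_lin)
    qed
    moreover have "sub (col X x) x"
    proof (rule subI)
      fix u assume "u \<E> col X x"
      then obtain y where y: "y \<E> x" "y \<E> X" "u = col X y" using col[OF x] by blast
      thus "u \<E> x" using ih[OF y(1,2)] Ord_le_less[OF _ ox] assms(1) by blast
    qed
    ultimately show "Ord (col X x) & sub (col X x) x" by blast
  qed
  thus "Ord (col X x)" "sub (col X x) x" by blast+
qed

definition "otp X = Im (col X) X"
lemma mem_otp: "z \<E> otp X \<longleftrightarrow> (EX x. x \<E> X & z = col X x)"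
  unfolding otp_def by (rule mem_Im) (intro df)
lemma otp_trans: "x \<E> otp X ==> y \<E> x ==> y \<E> otp X" using mem_otp col by metis
lemma otp_Ord: assumes "!!x. x \<E> X ==> Ord x" shows "Ord (otp X)"
  by (rule OrdI, rule otp_trans, assumption+) (use mem_otp col_Ord(1)[OF assms] Ord_lin in metis)

end

context zf
begin

subsection \<open>Comparing sizes by surjections\<close>

text \<open>\<open>sj a b\<close>: some partial function maps \<open>a\<close> onto \<open>b\<close>, so that \<open>sj a emp\<close> always holds.\<close>

definition "sj a b \<longleftrightarrow> (EX f. ALL y. y \<E> b --> (EX x. x \<E> a & ap f x = y))"
definition "fin a \<longleftrightarrow> (EX n. n \<E> om & sj n a)"
definition "Card k \<longleftrightarrow> Ord k & (ALL x. x \<E> k --> ~ sj x k)"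

lemma df_sj[df]: "Dt t ==> Dt s ==> Df (%e. sj (t e) (s e))" unfolding sj_def by (intro df dff_Suc)
lemma df_fin[df]: "Dt t ==> Df (%e. fin (t e))" unfolding fin_def by (intro df dff_Suc)
lemma df_Card[df]: "Dt t ==> Df (%e. Card (t e))" unfolding Card_def by (intro df dff_Suc)

lemma sjI: assumes "Dg F" "!!y. y \<E> b ==> EX x. x \<E> a & F x = y" shows "sj a b"
  unfolding sj_def
proof (rule exI[of _ "lam a F"], intro allI impI)
  fix y assume "y \<E> b"
  then obtain x where "x \<E> a" "F x = y" using assms(2) by blast
  thus "EX x. x \<E> a & ap (lam a F) x = y" using ap_lam[OF assms(1)] by metis
qed
lemma sj_refl: "sj a a" by (rule sjI[where F="%x. x"]) (auto intro: df)
lemma sj_sub: "sub b a ==> sj a b" by (rule sjI[where F="%x. x"]) (auto intro: df dest: subD)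
lemma sj_trans: assumes "sj a b" "sj b c" shows "sj a c"
proof -
  obtain f g where fg: "ALL y. y \<E> b --> (EX x. x \<E> a & ap f x = y)" "ALL y. y \<E> c --> (EX x. x \<E> b & ap g x = y)"
    using assms unfolding sj_def by blast
  show ?thesis by (rule sjI[where F="%x. ap g (ap f x)"]) (intro df, use fg in metis)
qed
lemma sj_mono: "sj a b ==> sub a a' ==> sub b' b ==> sj a' b'"
  by (meson sj_sub sj_trans)
lemma sj_Im: "Dg F ==> sj a (Im F a)" by (rule sjI[where F=F]) (auto simp: mem_Im)
lemma sj_inj: assumes "Dg H" "!!y. y \<E> b ==> H y \<E> a" "!!y z. y \<E> b ==> z \<E> b ==> H y = H z ==> y = z"
  shows "sj a b"
proof (rule sjI[where F="%x. Th (%y. y \<E> b & H y = x)"])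
  show "Dg (%x. Th (%y. y \<E> b & H y = x))" by (intro df dff1[OF assms(1)])
  fix y assume y: "y \<E> b"
  have "Th (%z. z \<E> b & H z = H y) = y" by (rule Th_eq) (use y assms(3) in blast)+
  thus "EX x. x \<E> a & Th (%z. z \<E> b & H z = x) = y" using assms(2)[OF y] by blast
qed
lemma sj_prd: assumes "sj a c" "sj b d" shows "sj (prd a b) (prd c d)"
proof -
  obtain f g where fg: "ALL y. y \<E> c --> (EX x. x \<E> a & ap f x = y)" "ALL y. y \<E> d --> (EX x. x \<E> b & ap g x = y)"
    using assms unfolding sj_def by blast
  show ?thesis
  proof (rule sjI[where F="%x. opr (ap f (fs x)) (ap g (sn x))"])
    show "Dg (%x. opr (ap f (fs x)) (ap g (sn x)))" by (intro df)
    fix y assume "y \<E> prd c d"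
    then obtain u v where y: "u \<E> c" "v \<E> d" "y = opr u v" by (auto simp: mem_prd)
    then obtain p q where "p \<E> a" "ap f p = u" "q \<E> b" "ap g q = v" using fg by metis
    thus "EX x. x \<E> prd a b & opr (ap f (fs x)) (ap g (sn x)) = y"
      using y by (intro exI[of _ "opr p q"]) simp
  qed
qed
lemma cantor: "~ sj a (Pw a)"
proof
  assume "sj a (Pw a)"
  then obtain f where f: "ALL y. y \<E> Pw a --> (EX x. x \<E> a & ap f x = y)" unfolding sj_def by blast
  let ?d = "Sep a (%x. ~ x \<E> ap f x)"
  have d: "x \<E> ?d \<longleftrightarrow> x \<E> a & ~ x \<E> ap f x" for x by (rule mem_Sep) (intro df)
  have "?d \<E> Pw a" using d by (simp add: sub_def)
  then obtain x where "x \<E> a" "ap f x = ?d" using f by blast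
  thus False using d[of x] by metis
qed

subsection \<open>Finite sets\<close>

lemma fin_sub: "fin b ==> sub a b ==> fin a" unfolding fin_def using sj_mono sub_refl by blast
lemma fin_insert: assumes "fin a" shows "fin (un a (sing y))"
proof -
  obtain n f where n: "n \<E> om" and f: "ALL y. y \<E> a --> (EX x. x \<E> n & ap f x = y)"
    using assms unfolding fin_def sj_def by blast
  have "sj (suc n) (un a (sing y))"
  proof (rule sjI[where F="%x. if x = n then y else ap f x"])
    show "Dg (%x. if x = n then y else ap f x)" by (intro df)
    fix z assume "z \<E> un a (sing y)"
    hence "z = y | z \<E> a" by auto
    thus "EX x. x \<E> suc n & (if x = n then y else ap f x) = z"
    proof
      assume "z = y" thus ?thesis by (intro exI[of _ n]) simp
    next
      assume "z \<E> a"
      then obtain x where "x \<E> n" "ap f x = z" using f by blast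
      moreover hence "x ~= n" by auto
      ultimately show ?thesis by (intro exI[of _ x]) simp
    qed
  qed
  thus ?thesis unfolding fin_def using om_suc[OF n] by blast
qed
lemma fin_emp[simp]: "fin emp" unfolding fin_def sj_def by (rule exI[of _ emp]) simp
lemma fin_nat: "n \<E> om ==> fin n" unfolding fin_def using sj_refl by blast
lemma fin_induct:
  assumes d: "Dp P" and 0: "P emp" and 1: "!!a y. P a ==> P (un a (sing y))"
    and 2: "!!a b. P a ==> sub b a ==> P b" and a: "fin a"
  shows "P a"
proof -
  obtain n f where n: "n \<E> om" and f: "ALL y. y \<E> a --> (EX x. x \<E> n & ap f x = y)"
    using a unfolding fin_def sj_def by blast
  have m: "y \<E> Im (ap f) k \<longleftrightarrow> (EX x. x \<E> k & y = ap f x)" for y k by (rule mem_Im) (intro df)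
  have "P (Im (ap f) n)"
  proof (rule om_ind[of "%n. P (Im (ap f) n)", OF _ n])
    show "Df (%e. P (Im (ap f) (e 0)))" by (rule dfp1[OF d]) (intro df)
    have "Im (ap f) emp = emp" by (rule ext) (simp add: m)
    thus "P (Im (ap f) emp)" using 0 by simp
    fix k assume "P (Im (ap f) k)"
    moreover have "Im (ap f) (suc k) = un (Im (ap f) k) (sing (ap f k))" by (rule ext) (auto simp: m)
    ultimately show "P (Im (ap f) (suc k))" using 1 by simp
  qed
  thus ?thesis by (rule 2) (use f m in \<open>auto simp: sub_def\<close>)
qed
lemma un_sub: "sub b a ==> sub (un c b) (un c a)" by (auto simp: sub_def)
lemma fin_un: assumes "fin a" "fin b" shows "fin (un a b)"
proof (rule fin_induct[of "%b. fin (un a b)"])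
  show "Dp (%b. fin (un a b))" by (intro df)
  have "un a emp = a" by (rule ext) simp
  thus "fin (un a emp)" using assms by simp
  fix c y assume "fin (un a c)"
  moreover have "un a (un c (sing y)) = un (un a c) (sing y)" by (rule ext) auto
  ultimately show "fin (un a (un c (sing y)))" using fin_insert by simp
next
  fix c b assume "fin (un a c)" "sub b c" thus "fin (un a b)" using fin_sub un_sub by blast
qed (rule assms)
lemma fin_Im: assumes "Dg F" "fin a" shows "fin (Im F a)"
  using assms sj_trans[OF _ sj_Im[OF assms(1)]] unfolding fin_def by blast
lemma fin_sj: "fin a ==> sj a b ==> fin b" unfolding fin_def using sj_trans by blast
lemma fin_prd: assumes "fin a" "fin b" shows "fin (prd a b)"
proof (rule fin_induct[of "%a. fin (prd a b)"])
  show "Dp (%a. fin (prd a b))" by (intro df)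
  have "prd emp b = emp" by (rule ext) (simp add: mem_prd)
  thus "fin (prd emp b)" by simp
  fix c y assume "fin (prd c b)"
  moreover have "prd (un c (sing y)) b = un (prd c b) (Im (opr y) b)"
    by (rule ext) (auto simp: mem_prd mem_Im df)
  moreover have "fin (Im (opr y) b)" using assms(2) by (intro fin_Im df)
  ultimately show "fin (prd (un c (sing y)) b)" using fin_un by simp
next
  fix c d assume *: "fin (prd c b)" "sub d c"
  hence "sub (prd d b) (prd c b)" by (auto simp: sub_def mem_prd)
  thus "fin (prd d b)" using fin_sub * by blast
qed (rule assms)

lemma pigeonhole: assumes "n \<E> om" shows "~ sj n (suc n)"
proof (rule om_ind[of "%n. ~ sj n (suc n)", OF _ assms])
  show "Dp (%n. ~ sj n (suc n))" by (intro df)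
  show "~ sj emp (suc emp)" unfolding sj_def by auto
  fix n assume n: "n \<E> om" "~ sj n (suc n)"
  show "~ sj (suc n) (suc (suc n))"
  proof
    assume "sj (suc n) (suc (suc n))"
    then obtain f where f: "!!y. y \<E> suc (suc n) ==> EX x. x \<E> suc n & ap f x = y" unfolding sj_def by blast
    have "sj n (suc n)"
    \<comment> \<open>Whatever was sent to the top value \<open>suc n\<close> takes over the value
      at \<open>n\<close>, since \<open>n\<close> itself ceases to be an argument.\<close>
    proof (rule sjI[where F="%x. if ap f x = suc n then ap f n else ap f x"])
      show "Dg (%x. if ap f x = suc n then ap f n else ap f x)" by (intro df)
      fix y assume y: "y \<E> suc n"
      then obtain x where x: "x \<E> suc n" "ap f x = y" using f[of y] by auto
      obtain z where z: "z \<E> suc n" "ap f z = suc n" using f[of "suc n"] by auto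
      have ne: "y ~= suc n" using y mem_irrefl[of "suc n"] by metis
      show "EX x. x \<E> n & (if ap f x = suc n then ap f n else ap f x) = y"
      proof (cases "x = n")
        case True thus ?thesis using x z ne by (intro exI[of _ z]) auto
      next
        case False thus ?thesis using x ne by (intro exI[of _ x]) auto
      qed
    qed
    thus False using n by blast
  qed
qed
lemma not_fin_om: "~ fin om"
proof
  assume "fin om"
  then obtain n where "n \<E> om" "sj n om" unfolding fin_def by blast
  thus False using pigeonhole sj_mono[of n om n "suc n"] Ord_subD[OF Ord_om om_suc] sub_refl by blast
qed
lemma Card_om: "Card om" unfolding Card_def using not_fin_om fin_def by auto
lemma infinite_om: "Card k ==> ~ k \<E> om ==> sub om k" using Ord_not_mem unfolding Card_def by simp

subsection \<open>Pairing of ordinals\<close>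

text \<open>Goedel's order of pairs, by maximum and then lexicographically; for ordinals the union
  is the maximum.\<close>

definition "plt a b c d \<longleftrightarrow> un a b \<E> un c d | (un a b = un c d & (a \<E> c | (a = c & b \<E> d)))"
definition "prel v u \<longleftrightarrow> (EX a b c d. Ord a & Ord b & Ord c & Ord d & v = opr a b & u = opr c d & plt a b c d)"
text \<open>Goedel pairing as the rank of a pair in this order: the range of the restricted function
  is the set of values at earlier pairs.\<close>

definition "J a b = wrec prel (%u f. Im sn f) (opr a b)"

lemma df_plt[df]: "Dt a ==> Dt b ==> Dt c ==> Dt d ==> Df (%e. plt (a e) (b e) (c e) (d e))"
  unfolding plt_def by (intro df)
lemma df_prel[df]: "Dt a ==> Dt b ==> Df (%e. prel (a e) (b e))"
  unfolding prel_def by (intro df dff_Suc)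
lemma df_J[df]: "Dt a ==> Dt b ==> Dt (%e. J (a e) (b e))"
  unfolding J_def by (intro df)

lemma plt_lin: "Ord a ==> Ord b ==> Ord c ==> Ord d ==> plt a b c d | (a = c & b = d) | plt c d a b"
  using Ord_lin[of a c] Ord_lin[of b d] Ord_lin[OF Ord_un[of a b] Ord_un[of c d]] unfolding plt_def by auto
lemma plt_trans: assumes o: "Ord c" "Ord d" and p: "plt a b a1 b1" "plt a1 b1 c d" shows "plt a b c d"
  using p Ord_trans[OF Ord_un[OF o], of "un a b" "un a1 b1"] Ord_trans[OF o(1), of a a1]
    Ord_trans[OF o(2), of b b1] unfolding plt_def by (auto simp del: mem_un)
lemma mem_suc_un: assumes "Ord a" "Ord b" shows "a \<E> suc (un a b)" "b \<E> suc (un a b)"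
proof -
  have "sub a (un a b)" "sub b (un a b)" by (auto simp: sub_def)
  thus "a \<E> suc (un a b)" "b \<E> suc (un a b)"
    using Ord_sub_cases[OF _ Ord_un[OF assms]] assms unfolding mem_suc by blast+
qed
lemma plt_bound: assumes "Ord a" "Ord b" "Ord c" "Ord d" "plt a b c d" shows "a \<E> suc (un c d)" "b \<E> suc (un c d)"
proof -
  have o: "Ord (un a b)" "Ord (un c d)" using Ord_un assms by auto
  have "un a b \<E> un c d | un a b = un c d" using assms(5) unfolding plt_def by blast
  hence s: "sub (un a b) (un c d)" using Ord_subD[OF o(2)] sub_refl by metis
  have "sub a (un c d)" "sub b (un c d)" using s by (auto simp: sub_def)
  thus "a \<E> suc (un c d)" "b \<E> suc (un c d)" using Ord_sub_cases[OF _ o(2)] assms by auto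
qed

text \<open>Minimize the maximum, then the first component, then the second. An element that is not
  a pair of ordinals has no predecessor and is minimal at once.\<close>

lemma prel_wf: assumes x: "x \<E> s" shows "EX u. u \<E> s & (ALL v. prel v u --> ~ v \<E> s)"
proof (cases "EX u. u \<E> s & ~ (EX a b. Ord a & Ord b & u = opr a b)")
  case True
  then obtain u where "u \<E> s" "~ (EX a b. Ord a & Ord b & u = opr a b)" by blast
  moreover hence "~ prel v u" for v unfolding prel_def by blast
  ultimately show ?thesis by blast
next
  case False
  hence all: "!!u. u \<E> s ==> EX a b. Ord a & Ord b & u = opr a b" by blast
  define P1 where "P1 m \<longleftrightarrow> (EX a b. Ord a & Ord b & opr a b \<E> s & m = un a b)" for m
  have d1: "Dp P1" unfolding P1_def by (intro df)
  obtain a b where ab: "Ord a" "Ord b" "opr a b \<E> s" using all[OF x] x by blast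
  have "Ord (un a b)" "P1 (un a b)" using Ord_un ab unfolding P1_def by blast+
  note m = lst[OF d1 this]
  define m where "m = lst P1"
  define P2 where "P2 a \<longleftrightarrow> (EX b. Ord a & Ord b & opr a b \<E> s & m = un a b)" for a
  have d2: "Dp P2" unfolding P2_def by (intro df)
  obtain a' where a': "P2 a'" using m(2) unfolding P1_def P2_def m_def by blast
  hence "Ord a'" unfolding P2_def by blast
  note a = lst[OF d2 this a']
  define a where "a = lst P2"
  define P3 where "P3 b \<longleftrightarrow> (Ord a & Ord b & opr a b \<E> s & m = un a b)" for b
  have d3: "Dp P3" unfolding P3_def by (intro df)
  obtain b' where b': "P3 b'" using a(2) unfolding P3_def P2_def a_def by blast
  hence "Ord b'" unfolding P3_def by blast
  note b = lst[OF d3 this b']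
  define b where "b = lst P3"
  have abs: "Ord a" "Ord b" "opr a b \<E> s" "m = un a b" using b(2) unfolding P3_def b_def by blast+
  have "~ v \<E> s" if "prel v (opr a b)" for v
  proof
    assume v: "v \<E> s"
    from that obtain c d where cd: "Ord c" "Ord d" "v = opr c d" "plt c d a b" unfolding prel_def by auto
    have "un c d \<E> m ==> ~ P1 (un c d)" "c \<E> a ==> ~ P2 c" "d \<E> b ==> ~ P3 d"
      using m(3) a(3) b(3) unfolding m_def[symmetric] a_def[symmetric] b_def[symmetric] by blast+
    note n = this
    have "~ un c d \<E> m" using n(1) cd v unfolding P1_def by blast
    hence e: "un c d = m" and "c \<E> a | (c = a & d \<E> b)" using cd(4) abs(4) unfolding plt_def by auto
    thus False using n(2,3) cd v unfolding P2_def P3_def by blast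
  qed
  thus ?thesis using abs by blast
qed

lemma mem_J: assumes o: "Ord a" "Ord b"
  shows "x \<E> J a b \<longleftrightarrow> (EX c d. Ord c & Ord d & plt c d a b & x = J c d)"
proof -
  let ?W = "wrec prel (%u f. Im sn f)"
  have dW: "Dg ?W" by (intro df)
  have bd: "v \<E> prd (suc (un c d)) (suc (un c d))" if "prel v (opr c d)" for v c d
    using that plt_bound unfolding prel_def mem_prd by auto
  have "?W (opr a b) = Im sn (lam (set_of (%v. prel v (opr a b))) ?W)"
  proof (rule wrec)
    show "Df (%e. prel (e 0) (e 1))" "Dt (%e. Im sn (e 1))" by (intro df)+
    show "!!s x. x \<E> s ==> EX u. u \<E> s & (ALL v. prel v u --> ~ v \<E> s)" by (rule prel_wf)
    fix x
    show "EX d. x \<E> d & (ALL u v. u \<E> d --> prel v u --> v \<E> d)"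
    proof (cases "EX a b. Ord a & Ord b & x = opr a b")
      case False
      hence "~ prel v x" for v unfolding prel_def by blast
      thus ?thesis by (intro exI[of _ "sing x"]) auto
    next
      case True
      then obtain a b where x: "Ord a" "Ord b" "x = opr a b" by blast
      let ?m = "suc (un a b)"
      have om: "Ord ?m" using Ord_un x by simp
      have "v \<E> prd ?m ?m" if u: "u \<E> prd ?m ?m" and v: "prel v u" for u v
      proof -
        obtain c d where cd: "u = opr c d" "c \<E> ?m" "d \<E> ?m" "Ord c" "Ord d" using u v unfolding mem_prd prel_def by auto
        have "un c d \<E> ?m" using un_max[of c d] cd by metis
        hence "sub (suc (un c d)) ?m" using suc_le om Ord_un cd by blast
        thus ?thesis using bd[of v c d] v cd unfolding mem_prd sub_def by blast
      qed
      moreover have "x \<E> prd ?m ?m"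
        unfolding x(3) opr_prd using mem_suc_un[OF x(1,2)] by blast
      ultimately show ?thesis by blast
    qed
  qed
  also have "\<dots> = Im ?W (set_of (%v. prel v (opr a b)))" by (rule Im_sn_lam[OF dW])
  finally have e: "J a b = Im ?W (set_of (%v. prel v (opr a b)))" unfolding J_def .
  have "isset (%v. prel v (opr a b))" by (rule isset_bounded[OF _ bd]) (intro df)
  hence "x \<E> J a b \<longleftrightarrow> (EX v. prel v (opr a b) & x = ?W v)" unfolding e mem_Im[OF dW] by (simp add: mem_Cl)
  also have "\<dots> \<longleftrightarrow> (EX c d. Ord c & Ord d & plt c d a b & x = J c d)"
    using o unfolding J_def prel_def by auto
  finally show ?thesis .
qed

lemma J_less: "Ord a ==> Ord b ==> Ord c ==> Ord d ==> plt c d a b ==> J c d \<E> J a b"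
  using mem_J by blast
lemma J_inj: "Ord a ==> Ord b ==> Ord c ==> Ord d ==> J a b = J c d \<longleftrightarrow> a = c & b = d"
  using J_less[of a b c d] J_less[of c d a b] plt_lin[of a b c d] mem_irrefl by metis
lemma Ord_J[simp]: assumes o: "Ord a" "Ord b" shows "Ord (J a b)"
proof (rule OrdI)
  fix x y assume "x \<E> J a b" "y \<E> x"
  then obtain c d where cd: "Ord c" "Ord d" "plt c d a b" "y \<E> J c d" using mem_J[OF o, of x] by blast
  then obtain c' d' where "Ord c'" "Ord d'" "plt c' d' c d" "y = J c' d'" using mem_J[of c d y] by blast
  thus "y \<E> J a b" using mem_J[OF o, of y] plt_trans[OF o _ cd(3), of c' d'] by blast
next
  fix x y assume "x \<E> J a b" "y \<E> J a b"
  then obtain c d c' d' where "Ord c" "Ord d" "x = J c d" "Ord c'" "Ord d'" "y = J c' d'"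
    unfolding mem_J[OF o] by blast
  thus "x \<E> y | x = y | y \<E> x" using plt_lin[of c d c' d'] J_less by blast
qed
lemma J0_ge: assumes "Ord b" shows "sub b (J emp b)"
proof (rule Ord_induct[of "%b. sub b (J emp b)", OF _ _ assms])
  show "Dp (%b. sub b (J emp b))" by (intro df)
  fix a assume a: "Ord a" "!!x. x \<E> a ==> sub x (J emp x)"
  show "sub a (J emp a)"
  proof (rule subI)
    fix x assume x: "x \<E> a"
    have o: "Ord x" using Ord_memD[OF a(1) x] .
    have e: "un emp y = y" for y by (rule ext) simp
    have "J emp x \<E> J emp a" by (rule J_less) (use a o x e in \<open>auto simp: plt_def\<close>)
    thus "x \<E> J emp a" using Ord_le_less[OF _ _ o a(2)[OF x]] o a(1) by simp
  qed
qed
lemma emp_mem: "Ord a ==> a ~= emp ==> emp \<E> a" using Ord_lin[of a emp] by auto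
lemma J_gt2: assumes "Ord a" "Ord b" "a ~= emp" shows "b \<E> J a b"
proof -
  have e: "un emp b = b" by (rule ext) simp
  have "sub b (un a b)" by (auto simp: sub_def)
  hence "plt emp b a b" unfolding plt_def e using Ord_sub_cases[OF assms(2) Ord_un[OF assms(1,2)]] emp_mem[OF assms(1,3)] by blast
  hence "J emp b \<E> J a b" using J_less assms by simp
  thus ?thesis using Ord_le_less[OF _ _ assms(2) J0_ge[OF assms(2)]] assms by simp
qed
lemma J_ge2: assumes "Ord a" "Ord b" shows "sub b (J a b)"
  using J_gt2[OF assms] J0_ge[OF assms(2)] Ord_subD[OF Ord_J[OF assms]] by metis
lemma J_ge1: assumes "Ord a" "Ord b" shows "sub a (J a b)"
proof (cases "emp = a & a = b")
  case True thus ?thesis using mem_emp by (metis subI)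
next
  case False
  have e: "un emp a = a" by (rule ext) simp
  have s: "sub a (un a b)" by (auto simp: sub_def)
  have "plt emp a a b"
  proof (cases "a = un a b")
    case True
    have "a ~= emp"
    proof
      assume "a = emp"
      moreover have "b = emp" by (rule ext) (use True \<open>a = emp\<close> in \<open>metis mem_un mem_emp\<close>)
      ultimately show False using False by simp
    qed
    thus ?thesis unfolding plt_def e using True emp_mem[OF assms(1)] by auto
  next
    case False thus ?thesis unfolding plt_def e using Ord_sub_cases[OF assms(1) Ord_un[OF assms] s] by blast
  qed
  hence "J emp a \<E> J a b" using J_less assms by simp
  thus ?thesis using Ord_subD[OF Ord_J[OF assms]] sub_trans J0_ge assms(1) by blast
qed
text \<open>The range is transitive by \<open>mem_J\<close>, and \<open>J emp t\<close> is at least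
  \<open>t\<close>.\<close>

lemma J_surj: assumes "Ord t" shows "EX a b. Ord a & Ord b & t = J a b"
proof -
  have "t \<E> J emp t | t = J emp t" using J0_ge[OF assms] Ord_sub_cases assms by simp
  thus ?thesis using mem_J[of emp t] assms Ord_emp by blast
qed

definition "J1 t = Th (%a. EX b. Ord a & Ord b & t = J a b)"
definition "J2 t = Th (%b. EX a. Ord a & Ord b & t = J a b)"
lemma df_J1[df]: "Dt t ==> Dt (%e. J1 (t e))" unfolding J1_def by (intro df dff_Suc)
lemma df_J2[df]: "Dt t ==> Dt (%e. J2 (t e))" unfolding J2_def by (intro df dff_Suc)
lemma J1[simp]: "Ord a ==> Ord b ==> J1 (J a b) = a"
  unfolding J1_def by (rule Th_eq) (auto simp: J_inj)
lemma J2[simp]: "Ord a ==> Ord b ==> J2 (J a b) = b"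
  unfolding J2_def by (rule Th_eq) (auto simp: J_inj)
lemma J12: assumes "Ord t" shows "Ord (J1 t)" "Ord (J2 t)" "J (J1 t) (J2 t) = t" "sub (J1 t) t" "sub (J2 t) t"
  using J_surj[OF assms] J_ge1 J_ge2 by auto
definition "Jcl m \<longleftrightarrow> Ord m & (ALL a b. a \<E> m --> b \<E> m --> J a b \<E> m)"
lemma df_Jcl[df]: "Dt t ==> Df (%e. Jcl (t e))" unfolding Jcl_def by (intro df dff_Suc)
lemma Jcl_J12: assumes "Jcl m" "t \<E> m" shows "J1 t \<E> m" "J2 t \<E> m"
  using assms Ord_le_less[of t m] J12[of t] Ord_memD unfolding Jcl_def by blast+

text \<open>Pairs before \<open>a\<close>, \<open>b\<close> have components at most the maximum, and
  their codes cover \<open>k\<close>.\<close>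

lemma not_Jcl_sj: assumes "Ord k" "Ord a" "Ord b" "~ J a b \<E> k"
  shows "sj (prd (suc (un a b)) (suc (un a b))) k"
proof (rule sjI[where F="%p. J (fs p) (sn p)"])
  show "Dg (%p. J (fs p) (sn p))" by (intro df)
  fix y assume "y \<E> k"
  moreover have "sub k (J a b)" using Ord_not_mem assms by simp
  ultimately have "y \<E> J a b" using subD by blast
  then obtain c d where "Ord c" "Ord d" "plt c d a b" "y = J c d" using mem_J assms by blast
  thus "EX x. x \<E> prd (suc (un a b)) (suc (un a b)) & J (fs x) (sn x) = y"
    using plt_bound[of c d a b] assms by (intro exI[of _ "opr c d"]) simp
qed
lemma Jcl_sj: assumes "Jcl k" shows "sj k (prd k k)"
proof (rule sjI[where F="%t. opr (J1 t) (J2 t)"])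
  show "Dg (%t. opr (J1 t) (J2 t))" by (intro df)
  fix y assume "y \<E> prd k k"
  then obtain a b where "a \<E> k" "b \<E> k" "y = opr a b" by (auto simp: mem_prd)
  thus "EX x. x \<E> k & opr (J1 x) (J2 x) = y"
    using assms Ord_memD unfolding Jcl_def by (intro exI[of _ "J a b"]) auto
qed
text \<open>Shifting the finite ordinals by one frees the argument \<open>emp\<close>.\<close>

lemma sj_suc: assumes "sub om a" "sj a b" shows "sj a (un b (sing y))"
proof -
  obtain f where f: "ALL y. y \<E> b --> (EX x. x \<E> a & ap f x = y)" using assms unfolding sj_def by blast
  show ?thesis
  proof (rule sjI[where F="%x. if x = emp then y else if x \<E> om then ap f (Unn x) else ap f x"])
    show "Dg (%x. if x = emp then y else if x \<E> om then ap f (Unn x) else ap f x)" by (intro df)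
    fix z assume "z \<E> un b (sing y)"
    hence "z = y | z \<E> b" by auto
    thus "EX x. x \<E> a & (if x = emp then y else if x \<E> om then ap f (Unn x) else ap f x) = z"
    proof
      assume "z = y" thus ?thesis using assms(1) by (intro exI[of _ emp]) (simp add: sub_def)
    next
      assume "z \<E> b"
      then obtain x where x: "x \<E> a" "ap f x = z" using f by blast
      show ?thesis
      proof (cases "x \<E> om")
        case True
        thus ?thesis using x assms(1) om_Ord by (intro exI[of _ "suc x"]) (simp add: sub_def)
      next
        case False
        hence "x ~= emp" by auto
        thus ?thesis using False x by (intro exI[of _ x]) simp
      qed
    qed
  qed
qed
lemma Card_size: assumes "Ord m" defines "n \<equiv> lst (%x. sj x m)" shows "Card n" "sj n m" "sub n m" "sub om m ==> sub om n"
proof -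
  have d: "Dp (%x. sj x m)" by (intro df)
  note l = lst[of "%x. sj x m", OF d assms(1) sj_refl, folded n_def]
  show "sj n m" "sub n m" using l by blast+
  show c: "Card n" unfolding Card_def using l sj_trans by blast
  assume "sub om m"
  hence "~ n \<E> om" using l(2) not_fin_om fin_sub unfolding fin_def by blast
  thus "sub om n" by (rule infinite_om[OF c])
qed
text \<open>If \<open>J a b\<close> left \<open>k\<close>, the square of an ordinal below
  \<open>k\<close> would map onto \<open>k\<close>. That square is finite or, by the induction
  hypothesis at the cardinality of the ordinal, an image of a smaller cardinal.\<close>

lemma Card_Jcl: assumes "Card k" "sub om k" shows "Jcl k"
proof -
  have "Card k --> sub om k --> Jcl k"
  proof (rule Ord_induct[of "%k. Card k --> sub om k --> Jcl k"])
    show "Dp (%k. Card k --> sub om k --> Jcl k)" by (intro df)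
    show "Ord k" using assms Card_def by blast
    fix k assume k: "Ord k" and ih: "!!x. x \<E> k ==> Card x --> sub om x --> Jcl x"
    show "Card k --> sub om k --> Jcl k"
    proof (intro impI)
      assume c: "Card k" and i: "sub om k"
      have "J a b \<E> k" if ab: "a \<E> k" "b \<E> k" for a b
      proof (rule ccontr)
        assume "~ J a b \<E> k"
        define m where "m = un a b"
        have o: "Ord a" "Ord b" using ab k Ord_memD by blast+
        hence m: "m \<E> k" "Ord m" using un_max[OF o] ab Ord_un unfolding m_def by metis+
        have s: "sj (prd (suc m) (suc m)) k"
          unfolding m_def by (rule not_Jcl_sj[OF k o]) fact
        show False
        proof (cases "m \<E> om")
          case True
          hence "fin (prd (suc m) (suc m))" using fin_prd fin_nat om_suc by blast
          hence "fin k" using s fin_sj by blast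
          thus False using i not_fin_om fin_sub by blast
        next
          case False
          hence om: "sub om m" using Ord_not_mem m by simp
          define n where "n = lst (%x. sj x m)"
          note n = Card_size[OF m(2), folded n_def]
          have nk: "n \<E> k" using Ord_le_less[OF m(2) k _ n(3) m(1)] n(1) unfolding Card_def by blast
          have "Jcl n" using ih[OF nk] n om by blast
          hence "sj n (prd n n)" by (rule Jcl_sj)
          moreover have "sj n (suc m)" unfolding suc_def using sj_suc n om by blast
          ultimately have "sj n k" using sj_trans[OF sj_trans[OF _ sj_prd] s, of n n n] by blast
          thus False using c nk unfolding Card_def by blast
        qed
      qed
      thus "Jcl k" unfolding Jcl_def using k by blast
    qed
  qed
  thus ?thesis using assms by blast
qed

end

section \<open>The constructible universe\<close>

context zf
begin

text \<open>Codes of formulas and finite sequences of ordinals are ordinals, decoded by \<open>J\<close>. A sequence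
  \<open>u = J x (J y \<dots>)\<close> is read as an assignment with values \<open>ap a x, ap a y, \<dots>\<close>; the first component
  of a code \<open>e\<close> selects: membership of the first value in the second, their equality, equality of the
  first with a constant, nand, existential quantification, and deletion of the second value.\<close>

definition "sat m a = orec (%e f. Sep m (%u.
     (J1 e = nm 0 & ap a (J1 u) \<E> ap a (J1 (J2 u)))
   | (J1 e = nm 1 & ap a (J1 u) = ap a (J1 (J2 u)))
   | (J1 e = nm 2 & J2 e \<E> m & ap a (J1 u) = ap a (J2 e))
   | (J1 e = nm 3 & ~ (u \<E> ap f (J1 (J2 e)) & u \<E> ap f (J2 (J2 e))))
   | (J1 e = nm 4 & (EX x. x \<E> m & J x u \<E> ap f (J2 e)))
   | (J1 e = nm 5 & J (J1 u) (J2 (J2 u)) \<E> ap f (J2 e))))"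
text \<open>The ordinal \<open>J m e\<close> names the subset that the code \<open>e\<close> defines
  in the collection of all \<open>Lf y\<close> with \<open>y\<close> below \<open>m\<close>, where
  constants of \<open>e\<close> are names below \<open>m\<close>. So L is indexed by ordinals
  directly, and elements have smaller names. Since \<open>sat\<close> keeps only sequences below
  \<open>m\<close>, it is the intended satisfaction when \<open>m\<close> is closed under
  \<open>J\<close>.\<close>

definition "Lf = orec (%x f. Im (ap f) (Sep (J1 x) (%y. J y emp \<E> sat (J1 x) (lam (J1 x) (ap f)) (J2 x))))"
definition "inL x \<longleftrightarrow> (EX y. Ord y & x = Lf y)"

lemma df_sat[df]: assumes "Dt m" "Dt a" "Dt t" shows "Dt (%e. sat (m e) (a e) (t e))"
proof -
  have 1: "Dt (%e. m (%n. e (Suc (Suc n))))" "Dt (%e. a (%n. e (Suc (Suc n))))"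
    "Dt (%e. m (%n. e (Suc (Suc (Suc n)))))" "Dt (%e. a (%n. e (Suc (Suc (Suc n)))))"
    "Dt (%e. m (%n. e (Suc (Suc (Suc (Suc n))))))" "Dt (%e. a (%n. e (Suc (Suc (Suc (Suc n))))))"
    by (intro dff_Suc assms)+
  show ?thesis unfolding sat_def by (intro df 1 assms)
qed
lemma df_Lf[df]: assumes "Dt t" shows "Dt (%e. Lf (t e))" unfolding Lf_def by (intro df assms)
lemma df_inL[df]: assumes "Dt t" shows "Df (%e. inL (t e))" unfolding inL_def by (intro df dff_Suc assms)

lemma sat_unfold: assumes "Ord e"
  shows "u \<E> sat m a e \<longleftrightarrow> u \<E> m & (
     (J1 e = nm 0 & ap a (J1 u) \<E> ap a (J1 (J2 u)))
   | (J1 e = nm 1 & ap a (J1 u) = ap a (J1 (J2 u)))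
   | (J1 e = nm 2 & J2 e \<E> m & ap a (J1 u) = ap a (J2 e))
   | (J1 e = nm 3 & ~ (u \<E> sat m a (J1 (J2 e)) & u \<E> sat m a (J2 (J2 e))))
   | (J1 e = nm 4 & (EX x. x \<E> m & J x u \<E> sat m a (J2 e)))
   | (J1 e = nm 5 & J (J1 u) (J2 (J2 u)) \<E> sat m a (J2 e)))"
proof -
  define f where "f = lam e (sat m a)"
  have dsat: "Dg (sat m a)" by (intro df)
  have j: "J2 e \<E> e" if "J1 e ~= emp" using J_gt2[OF J12(1,2)[OF assms] that] J12(3)[OF assms] by simp
  have a2: "ap f (J2 e) = sat m a (J2 e)" if "J1 e ~= emp"
    unfolding f_def by (rule ap_lam[OF dsat j[OF that]])
  have a3: "ap f (J1 (J2 e)) = sat m a (J1 (J2 e))" "ap f (J2 (J2 e)) = sat m a (J2 (J2 e))" if "J1 e ~= emp"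
    unfolding f_def using j[OF that] J12[OF J12(2)[OF assms]] Ord_le_less[OF J12(2)[OF assms] assms]
    by (auto intro!: ap_lam[OF dsat])
  have n: "nm (Suc k) ~= emp" for k by simp
  have "sat m a e = Sep m (%u.
     (J1 e = nm 0 & ap a (J1 u) \<E> ap a (J1 (J2 u)))
   | (J1 e = nm 1 & ap a (J1 u) = ap a (J1 (J2 u)))
   | (J1 e = nm 2 & J2 e \<E> m & ap a (J1 u) = ap a (J2 e))
   | (J1 e = nm 3 & ~ (u \<E> ap f (J1 (J2 e)) & u \<E> ap f (J2 (J2 e))))
   | (J1 e = nm 4 & (EX x. x \<E> m & J x u \<E> ap f (J2 e)))
   | (J1 e = nm 5 & J (J1 u) (J2 (J2 u)) \<E> ap f (J2 e)))"
    unfolding f_def unfolding sat_def by (rule orec[OF _ assms]) (intro df)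
  hence "u \<E> sat m a e \<longleftrightarrow> u \<E> m & (
     (J1 e = nm 0 & ap a (J1 u) \<E> ap a (J1 (J2 u)))
   | (J1 e = nm 1 & ap a (J1 u) = ap a (J1 (J2 u)))
   | (J1 e = nm 2 & J2 e \<E> m & ap a (J1 u) = ap a (J2 e))
   | (J1 e = nm 3 & ~ (u \<E> ap f (J1 (J2 e)) & u \<E> ap f (J2 (J2 e))))
   | (J1 e = nm 4 & (EX x. x \<E> m & J x u \<E> ap f (J2 e)))
   | (J1 e = nm 5 & J (J1 u) (J2 (J2 u)) \<E> ap f (J2 e)))"
    by (simp only:) (rule mem_Sep, intro df)
  also have "\<dots> \<longleftrightarrow> u \<E> m & (
     (J1 e = nm 0 & ap a (J1 u) \<E> ap a (J1 (J2 u)))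
   | (J1 e = nm 1 & ap a (J1 u) = ap a (J1 (J2 u)))
   | (J1 e = nm 2 & J2 e \<E> m & ap a (J1 u) = ap a (J2 e))
   | (J1 e = nm 3 & ~ (u \<E> sat m a (J1 (J2 e)) & u \<E> sat m a (J2 (J2 e))))
   | (J1 e = nm 4 & (EX x. x \<E> m & J x u \<E> sat m a (J2 e)))
   | (J1 e = nm 5 & J (J1 u) (J2 (J2 u)) \<E> sat m a (J2 e)))"
  \<comment> \<open>Components of \<open>e\<close> are sure to be smaller than \<open>e\<close> only
    if the tag \<open>J1 e\<close> is not zero; with tag zero no recursive clause applies.\<close>
  proof (cases "J1 e = emp")
    case True
    hence "J1 e ~= nm 3" "J1 e ~= nm 4" "J1 e ~= nm 5" unfolding numeral_eq_Suc nm.simps by auto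
    thus ?thesis by simp
  next
    case False show ?thesis by (simp only: a2[OF False] a3[OF False])
  qed
  finally show ?thesis .
qed

lemma Lf_unfold: assumes "Ord x"
  shows "z \<E> Lf x \<longleftrightarrow> (EX y. y \<E> J1 x & J y emp \<E> sat (J1 x) (lam (J1 x) Lf) (J2 x) & z = Lf y)"
proof -
  define f where "f = lam x Lf"
  have d: "Dg Lf" by (intro df)
  have e: "ap f y = Lf y" if "y \<E> J1 x" for y
    unfolding f_def using that J12[OF assms] by (intro ap_lam[OF d]) (rule subD)
  have "Lf x = Im (ap f) (Sep (J1 x) (%y. J y emp \<E> sat (J1 x) (lam (J1 x) (ap f)) (J2 x)))"
    unfolding f_def unfolding Lf_def by (rule orec[OF _ assms]) (intro df)
  also have "lam (J1 x) (ap f) = lam (J1 x) Lf" by (rule lam_cong) (rule e)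
  finally have 1: "Lf x = Im (ap f) (Sep (J1 x) (%y. J y emp \<E> sat (J1 x) (lam (J1 x) Lf) (J2 x)))" .
  have 2: "Dg (ap f)" by (intro df)
  have 3: "y \<E> Sep (J1 x) (%y. J y emp \<E> sat (J1 x) (lam (J1 x) Lf) (J2 x)) \<longleftrightarrow>
     y \<E> J1 x & J y emp \<E> sat (J1 x) (lam (J1 x) Lf) (J2 x)" for y
    by (rule mem_Sep) (intro df)
  show ?thesis unfolding 1 mem_Im[OF 2] 3 using e by metis
qed
definition "St m e = sat m (lam m Lf) e"
lemma mem_Lf_J: "Ord m ==> Ord e ==> z \<E> Lf (J m e) \<longleftrightarrow> (EX y. y \<E> m & J y emp \<E> St m e & z = Lf y)"
  unfolding St_def by (subst Lf_unfold) simp_all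
lemma Lf_mem: assumes "Ord x" "z \<E> Lf x" shows "EX y. y \<E> x & z = Lf y"
  using Lf_unfold[OF assms(1)] assms(2) J12(4)[OF assms(1)] subD by blast
lemma inL_mem: "inL x ==> y \<E> x ==> inL y" unfolding inL_def using Lf_mem Ord_memD by blast
lemma inL_bound: assumes "!!y. y \<E> s ==> inL y" shows "EX g. Ord g & (ALL y. y \<E> s --> (EX x. x \<E> g & y = Lf x))"
proof -
  let ?F = "%y. suc (lst (%x. y = Lf x))"
  have d: "Dg ?F" by (intro df)
  have l: "Ord (lst (%x. y = Lf x)) & y = Lf (lst (%x. y = Lf x))" if y: "y \<E> s" for y
  proof -
    obtain x where x: "Ord x" "y = Lf x" using assms[OF y] unfolding inL_def by blast
    have "Dp (%x. y = Lf x)" by (intro df)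
    from lst(1,2)[of "%x. y = Lf x", OF this x] show ?thesis by blast
  qed
  have o: "Ord (Unn (Im ?F s))" by (rule Ord_Unn) (use l mem_Im[OF d] in auto)
  moreover have "EX x. x \<E> Unn (Im ?F s) & y = Lf x" if y: "y \<E> s" for y
    using l[OF y] y by (intro exI[of _ "lst (%x. y = Lf x)"]) (auto simp: mem_Im[OF d])
  ultimately show ?thesis by blast
qed

lemma Ord_lst_any: "Ord (lst P)"
proof (cases "EX! x. Ord x & P x & (ALL y. y \<E> x --> ~ P y)")
  case True
  then obtain x where "Ord x" "P x" "ALL y. y \<E> x --> ~ P y" by blast
  thus ?thesis using lst_eqI[of x P] by simp
next
  case False thus ?thesis unfolding lst_def Th_def if_not_P[OF False] by simp
qed

text \<open>Iterate along \<open>om\<close>, each step adding the values of \<open>H\<close> and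
  \<open>J\<close> on the ordinal reached so far. Finitely many arguments from the limit occur
  together at some stage.\<close>

lemma closed_ordinal:
  assumes dH: "Dg H" and oH: "!!x. Ord x ==> Ord (H x)" and g: "Ord g"
  shows "EX m. Jcl m & g \<E> m & (ALL x. x \<E> m --> H x \<E> m)"
proof -
  note [df] = dff1[OF dH]
  define K where "K x = un (Im H x) (Im (%p. J (fs p) (sn p)) (prd x x))" for x
  define s where "s x = suc (un x (Unn (Im suc (K x))))" for x
  have ds: "Dg s" unfolding s_def K_def by (intro df)
  note [df] = dff1[OF ds]
  have mK: "y \<E> K x \<longleftrightarrow> (EX z. z \<E> x & y = H z) | (EX a b. a \<E> x & b \<E> x & y = J a b)" for x y
  proof -
    have "Dg (%p. J (fs p) (sn p))" by (intro df)
    note 1 = mem_Im[OF this]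
    have "(EX p. p \<E> prd x x & y = J (fs p) (sn p)) \<longleftrightarrow> (EX a b. a \<E> x & b \<E> x & y = J a b)"
      unfolding mem_prd by (metis fs_opr sn_opr)
    thus ?thesis unfolding K_def mem_un 1 mem_Im[OF dH] by simp
  qed
  have KO: "Ord y" if "Ord x" "y \<E> K x" for x y
  proof -
    from that(2) consider z where "z \<E> x" "y = H z" | a b where "a \<E> x" "b \<E> x" "y = J a b"
      unfolding mK by blast
    thus ?thesis by cases (use oH Ord_J Ord_memD[OF that(1)] in simp_all)
  qed
  have dsuc: "Dg suc" by (intro df)
  have so: "Ord (s x)" if "Ord x" for x
    unfolding s_def using that KO[OF that]
    by (intro Ord_suc Ord_un Ord_Unn) (auto simp: mem_Im[OF dsuc])
  have sK: "y \<E> s x" if "Ord x" "y \<E> K x" for x y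
    using that unfolding s_def by (auto simp: mem_Im[OF dsuc])
  define T where "T n = iter s (suc g) n" for n
  have dT: "Dg T" unfolding T_def by (intro df)
  note [df] = dff1[OF dT]
  have T0: "T emp = suc g" unfolding T_def by (rule iter_0[OF ds])
  have TS: "T (suc n) = s (T n)" if "n \<E> om" for n
    unfolding T_def by (rule iter_suc[OF ds om_Ord[OF that]])
  have TO: "Ord (T n)" if "n \<E> om" for n
    by (rule om_ind[of "%n. Ord (T n)", OF _ that]) (intro df, use T0 TS so g in auto)
  have up: "sub (T n) (T (suc n))" if "n \<E> om" for n
    unfolding TS[OF that] s_def by (auto simp: sub_def)
  have mono: "k \<E> n --> sub (T k) (T n)" if "n \<E> om" for n k
  proof (rule om_ind[of "%n. k \<E> n --> sub (T k) (T n)", OF _ that])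
    show "Dp (%n. k \<E> n --> sub (T k) (T n))" by (intro df)
  qed (use up sub_trans in auto)
  define m where "m = Unn (Im T om)"
  have mm: "x \<E> m \<longleftrightarrow> (EX n. n \<E> om & x \<E> T n)" for x
    unfolding m_def by (auto simp: mem_Im[OF dT])
  have om: "Ord m" unfolding m_def by (rule Ord_Unn) (auto simp: mem_Im[OF dT] TO)
  have cl: "y \<E> m" if "n \<E> om" "y \<E> K (T n)" for n y
    using sK[OF TO[OF that(1)] that(2)] TS[OF that(1)] mm om_suc[OF that(1)] by metis
  have "J a b \<E> m" if ab: "a \<E> m" "b \<E> m" for a b
  proof -
    obtain n k where nk: "n \<E> om" "a \<E> T n" "k \<E> om" "b \<E> T k" using ab mm by blast
    have "EX j. j \<E> om & a \<E> T j & b \<E> T j"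
      using Ord_lin[OF om_Ord[OF nk(1)] om_Ord[OF nk(3)]] mono[OF nk(1)] mono[OF nk(3)] nk subD by metis
    thus ?thesis using cl mK by blast
  qed
  moreover have "H x \<E> m" if "x \<E> m" for x
    using that cl mm mK by blast
  moreover have "g \<E> m" using mm[of g] T0 by (metis mem_suc om_emp)
  ultimately show ?thesis unfolding Jcl_def using om by blast
qed

end

section \<open>The constructible universe as a model of V = L\<close>

text \<open>L is transported to a type of its own by the enumeration \<open>h\<close>, so that set
  theory can be interpreted in it as in any other model.\<close>

locale constr = zf E for E :: "'a => 'a => bool" (infix "\<E>" 50) +
  fixes h :: "'b => 'a"
  assumes h_inj: "h x = h y \<longleftrightarrow> x = y" and h_ran: "inL z \<longleftrightarrow> (EX x. z = h x)"
begin

definition "EL x y \<longleftrightarrow> h x \<E> h y"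
definition "hi z = (THE x. h x = z)"
lemma hi_h[simp]: "hi (h x) = x" unfolding hi_def by (rule the_equality) (auto simp: h_inj)
lemma h_hi: "inL z ==> h (hi z) = z" using h_ran by auto
lemma inL_h[simp]: "inL (h x)" using h_ran by blast
lemma inL_Lf[simp]: "Ord x ==> inL (Lf x)" unfolding inL_def by blast

text \<open>Unpairing never stops, so each ordinal codes values for all variables at once and no
  length has to be recorded.\<close>

definition "ev u n = hi (Lf (J1 ((J2 ^^ n) u)))"
lemma J2n_swap: "(J2 ^^ n) (J2 u) = J2 ((J2 ^^ n) u)" by (induction n) simp_all
lemma ev_J: assumes "Ord x" "Ord u" shows "ev (J x u) = case_nat (hi (Lf x)) (ev u)"
proof (rule HOL.ext)
  fix n show "ev (J x u) n = case_nat (hi (Lf x)) (ev u) n"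
    using assms by (cases n) (simp_all add: ev_def J2n_swap[symmetric])
qed
lemma ev_0: "ev u 0 = hi (Lf (J1 u))" by (simp add: ev_def)
lemma ev_Suc: "ev u (Suc n) = ev (J2 u) n" by (simp add: ev_def J2n_swap)
lemma EL_hi: "inL x ==> inL y ==> EL (hi x) (hi y) \<longleftrightarrow> x \<E> y" unfolding EL_def by (simp add: h_hi)
lemma hi_eq: "inL x ==> hi x = y \<longleftrightarrow> x = h y" using h_hi by force
lemma ex_L: "(EX x. P x) \<longleftrightarrow> (EX z. Ord z & P (hi (Lf z)))"
proof
  assume "EX x. P x"
  then obtain x where x: "P x" by blast
  obtain z where "Ord z" "h x = Lf z" using inL_h[of x] unfolding inL_def by blast
  hence "hi (Lf z) = x" by (metis hi_h)
  thus "EX z. Ord z & P (hi (Lf z))" using x \<open>Ord z\<close> by blast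
qed blast

text \<open>\<open>codes P c H\<close>: the code \<open>c\<close> expresses \<open>P\<close> in every initial segment of the constructible universe whose
  ordinal is closed under pairing and \<open>H\<close>. This is the reflection principle for a single formula, without a
  global truth predicate.\<close>

definition "rdef P \<longleftrightarrow> Df (%e. Ord (e 0) & P (ev (e 0)))"
definition "codes P c H \<longleftrightarrow> Ord c & Dg H & (ALL x. Ord x --> Ord (H x)) &
  (ALL m. Jcl m --> (ALL x. x \<E> m --> H x \<E> m) --> c \<E> m --> (ALL u. u \<E> m --> (u \<E> St m c \<longleftrightarrow> P (ev u))))"
definition "coded P \<longleftrightarrow> rdef P & (EX c H. codes P c H)"

lemma rdef_D: assumes "rdef P" "Dt t" shows "Df (%e. Ord (t e) & P (ev (t e)))"
  using dfp1[of E "%u. Ord u & P (ev u)", OF _ assms(2)] assms(1) unfolding rdef_def .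
lemma rdef_I: "Df (%e. Q (e 0)) ==> (!!u. Ord u ==> Q u \<longleftrightarrow> P (ev u)) ==> rdef P"
  unfolding rdef_def by (rule back_subst[of Df "%e. Ord (e 0) & Q (e 0)"]) (intro df, assumption, auto)
lemma code_mem: assumes "Jcl m" "J a b \<E> m" "Ord a" "Ord b" shows "a \<E> m" "b \<E> m"
  using Jcl_J12[OF assms(1,2)] assms by simp_all
lemma St_unfold: assumes m: "Jcl m" and "Ord k" "Ord b" "u \<E> m" "b \<E> m"
  shows "u \<E> St m (J k b) \<longleftrightarrow> 
     (k = nm 0 & Lf (J1 u) \<E> Lf (J1 (J2 u)))
   | (k = nm 1 & Lf (J1 u) = Lf (J1 (J2 u)))
   | (k = nm 2 & Lf (J1 u) = Lf b)
   | (k = nm 3 & ~ (u \<E> St m (J1 b) & u \<E> St m (J2 b)))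
   | (k = nm 4 & (EX x. x \<E> m & J x u \<E> St m b))
   | (k = nm 5 & J (J1 u) (J2 (J2 u)) \<E> St m b)"
proof -
  have d: "Dg Lf" by (intro df)
  have a: "ap (lam m Lf) x = Lf x" if "x \<E> m" for x by (rule ap_lam[OF d that])
  show ?thesis unfolding St_def using assms Jcl_J12[OF m]
    by (subst sat_unfold) (simp_all add: a)
qed

lemma coded_mem01: "coded (%v. EL (v 0) (v 1))"
proof -
  have e: "EL (ev u 0) (ev u 1) \<longleftrightarrow> Lf (J1 u) \<E> Lf (J1 (J2 u))" if "Ord u" for u
    using that J12 unfolding One_nat_def ev_Suc ev_0 by (intro EL_hi inL_Lf) blast+
  have "rdef (%v. EL (v 0) (v 1))"
    by (rule rdef_I[where Q="%u. Lf (J1 u) \<E> Lf (J1 (J2 u))"]) (intro df, use e in simp)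
  moreover have "codes (%v. EL (v 0) (v 1)) (J (nm 0) emp) (%x. x)"
    unfolding codes_def
  proof (intro conjI allI impI df)
    fix m u assume m: "Jcl m" "J (nm 0) emp \<E> m" "u \<E> m"
    show "(u \<E> St m (J (nm 0) emp)) = EL (ev u 0) (ev u 1)"
      using m e[of u] Jcl_def Ord_memD[of m u] code_mem[OF m(1,2)]
      by (subst St_unfold) (simp_all del: nm.simps)
  qed auto
  ultimately show ?thesis unfolding coded_def by blast
qed
lemma coded_eq01: "coded (%v. v 0 = v 1)"
proof -
  have e: "ev u 0 = ev u 1 \<longleftrightarrow> Lf (J1 u) = Lf (J1 (J2 u))" if "Ord u" for u
    using that J12 h_hi unfolding One_nat_def ev_Suc ev_0 by (metis inL_Lf)
  have "rdef (%v. v 0 = v 1)"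
    by (rule rdef_I[where Q="%u. Lf (J1 u) = Lf (J1 (J2 u))"]) (intro df, use e in simp)
  moreover have "codes (%v. v 0 = v 1) (J (nm 1) emp) (%x. x)"
    unfolding codes_def
  proof (intro conjI allI impI df)
    fix m u assume m: "Jcl m" "J (nm 1) emp \<E> m" "u \<E> m"
    show "(u \<E> St m (J (nm 1) emp)) = (ev u 0 = ev u 1)"
      using m e[of u] Jcl_def Ord_memD[of m u] code_mem[OF m(1,2)]
      by (subst St_unfold) (simp_all del: nm.simps)
  qed auto
  ultimately show ?thesis unfolding coded_def by blast
qed
lemma coded_const: "coded (%v. v 0 = c)"
proof -
  obtain b where b: "Ord b" "h c = Lf b" using inL_h[of c] unfolding inL_def by blast
  have e: "ev u 0 = c \<longleftrightarrow> Lf (J1 u) = Lf b" if "Ord u" for u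
    using that J12 unfolding ev_0 b(2)[symmetric] by (intro hi_eq inL_Lf)
  have "rdef (%v. v 0 = c)"
    by (rule rdef_I[where Q="%u. Lf (J1 u) = Lf b"]) (intro df, use e in simp)
  moreover have "codes (%v. v 0 = c) (J (nm 2) b) (%x. x)"
    unfolding codes_def
  proof (intro conjI allI impI df)
    fix m u assume m: "Jcl m" "J (nm 2) b \<E> m" "u \<E> m"
    show "(u \<E> St m (J (nm 2) b)) = (ev u 0 = c)"
      using m e[of u] b Jcl_def Ord_memD[of m u] code_mem[OF m(1,2)]
      by (subst St_unfold) (simp_all del: nm.simps)
  qed (use b in auto)
  ultimately show ?thesis unfolding coded_def by blast
qed
text \<open>The two reflecting functions are joined by their maximum: an ordinal closed under it is
  closed under each.\<close>

lemma coded_nand: assumes "coded P" "coded Q" shows "coded (%v. ~ (P v & Q v))"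
proof -
  obtain c H d K where cd: "codes P c H" "codes Q d K" using assms unfolding coded_def by blast
  have "rdef P" "rdef Q" using assms unfolding coded_def by blast+
  hence "rdef (%v. ~ (P v & Q v))"
    by (intro rdef_I[where Q="%u. ~ ((Ord u & P (ev u)) & (Ord u & Q (ev u)))"]) (intro df rdef_D, auto)
  moreover have "codes (%v. ~ (P v & Q v)) (J (nm 3) (J c d)) (%x. un (H x) (K x))"
    unfolding codes_def
  proof (intro conjI allI impI)
    have dHK: "Dg H" "Dg K" "Ord c" "Ord d" and oHK: "!!x. Ord x ==> Ord (H x)" "!!x. Ord x ==> Ord (K x)"
      using cd unfolding codes_def by blast+
    show "Ord (J (nm 3) (J c d))" using dHK by simp
    show "Dg (%x. un (H x) (K x))" by (intro df dHK)
    show "Ord (un (H x) (K x))" if "Ord x" for x using oHK[OF that] by (rule Ord_un)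
    fix m u assume m: "Jcl m" "ALL x. x \<E> m --> un (H x) (K x) \<E> m" "J (nm 3) (J c d) \<E> m" "u \<E> m"
    have om: "Ord m" using m(1) Jcl_def by blast
    have i: "H x \<E> m & K x \<E> m" if "x \<E> m" for x
    proof -
      have ox: "Ord x" using Ord_memD[OF om that] .
      have "sub (H x) (un (H x) (K x))" "sub (K x) (un (H x) (K x))" by (auto simp: sub_def)
      moreover have "un (H x) (K x) \<E> m" using m(2) that by blast
      ultimately show ?thesis using Ord_le_less[OF Ord_un om] oHK[OF ox] by blast
    qed
    have j: "J c d \<E> m" using code_mem(2)[OF m(1,3)] dHK by simp
    hence k: "c \<E> m" "d \<E> m" using code_mem[OF m(1)] dHK by blast+
    have "u \<E> St m c \<longleftrightarrow> P (ev u)" "u \<E> St m d \<longleftrightarrow> Q (ev u)"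
      using cd m(1,4) i k unfolding codes_def by blast+
    thus "(u \<E> St m (J (nm 3) (J c d))) = (~ (P (ev u) & Q (ev u)))"
      using m(4) dHK j by (subst St_unfold[OF m(1)]) (simp_all del: nm.simps)
  qed
  ultimately show ?thesis unfolding coded_def by blast
qed
lemma coded_not: "coded P ==> coded (%v. ~ P v)" using coded_nand[of P P] by simp
lemma coded_conj: "coded P ==> coded Q ==> coded (%v. P v & Q v)" using coded_not[OF coded_nand[of P Q]] by simp
text \<open>Repeated deletion of the second value carries an equation between the variables 0 and 1
  to an equation between 0 and any later variable.\<close>

lemma coded_drop: assumes "coded P" shows "coded (%v. P (case_nat (v 0) (%n. v (Suc (Suc n)))))"
proof -
  let ?Q = "%v. P (case_nat (v 0) (%n. v (Suc (Suc n))))"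
  have e: "?Q (ev u) \<longleftrightarrow> P (ev (J (J1 u) (J2 (J2 u))))" if "Ord u" for u
  proof -
    have "(%n. ev u (Suc (Suc n))) = ev (J2 (J2 u))" by (simp add: ev_Suc)
    thus ?thesis using that J12 by (simp add: ev_J ev_0)
  qed
  obtain c H where c: "codes P c H" and r: "rdef P" using assms unfolding coded_def by blast
  have "rdef ?Q"
  proof (rule rdef_I[where Q="%u. Ord (J (J1 u) (J2 (J2 u))) & P (ev (J (J1 u) (J2 (J2 u))))"])
    show "Df (%e. Ord (J (J1 (e 0)) (J2 (J2 (e 0)))) & P (ev (J (J1 (e 0)) (J2 (J2 (e 0))))))"
      by (intro rdef_D[OF r] df)
  qed (use e J12 in simp)
  moreover have "codes ?Q (J (nm 5) c) H"
    unfolding codes_def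
  proof (intro conjI allI impI)
    show "Ord (J (nm 5) c)" "Dg H" "Ord x ==> Ord (H x)" for x using c unfolding codes_def by simp_all
    fix m u assume m: "Jcl m" "ALL x. x \<E> m --> H x \<E> m" "J (nm 5) c \<E> m" "u \<E> m"
    have oc: "Ord c" using c codes_def by blast
    have cm: "c \<E> m" using code_mem[OF m(1,3)] oc by simp
    have "J1 u \<E> m" "J2 (J2 u) \<E> m" using m(4) Jcl_J12[OF m(1)] by blast+
    hence "J (J1 u) (J2 (J2 u)) \<E> m" using m(1) unfolding Jcl_def by blast
    hence "J (J1 u) (J2 (J2 u)) \<E> St m c \<longleftrightarrow> P (ev (J (J1 u) (J2 (J2 u))))"
      using c m(1,2) cm unfolding codes_def by blast
    moreover have "Ord u" using m Jcl_def Ord_memD by blast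
    ultimately show "(u \<E> St m (J (nm 5) c)) = ?Q (ev u)"
      using m(4) oc cm e by (subst St_unfold[OF m(1)]) (simp_all del: nm.simps)
  qed
  ultimately show ?thesis unfolding coded_def by blast
qed
text \<open>Closing under least witnesses makes the quantifier over the segment agree with the
  quantifier over all of L.\<close>

lemma coded_ex: assumes "coded P" shows "coded (%v. EX x. P (case_nat x v))"
proof -
  let ?Q = "%v. EX x. P (case_nat x v)"
  have e: "?Q (ev u) \<longleftrightarrow> (EX z. Ord z & P (ev (J z u)))" if "Ord u" for u
    unfolding ex_L[of "%x. P (case_nat x (ev u))"] using that ev_J by metis
  obtain c H where c: "codes P c H" and r: "rdef P" using assms unfolding coded_def by blast
  have dP: "Df (%e. Ord (J (t e) (s e)) & P (ev (J (t e) (s e))))" if "Dt t" "Dt s" for t s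
    by (intro rdef_D[OF r] df that)
  have "rdef ?Q"
  proof (rule rdef_I[where Q="%u. EX z. Ord z & (Ord (J z u) & P (ev (J z u)))"])
    show "Df (%e. EX z. Ord z & (Ord (J z (e 0)) & P (ev (J z (e 0)))))"
      by (intro dP df)
  qed (use e in auto)
  moreover define K where "K u = un (H u) (lst (%z. Ord (J z u) & P (ev (J z u))))" for u
  have dH: "Dg H" "Ord c" and oH: "!!x. Ord x ==> Ord (H x)" using c unfolding codes_def by blast+
  have "codes ?Q (J (nm 4) c) K"
    unfolding codes_def
  proof (intro conjI allI impI)
    show "Ord (J (nm 4) c)" using dH by simp
    show "Dg K" unfolding K_def by (intro dP df dH)
    show "Ord (K x)" if "Ord x" for x unfolding K_def by (intro Ord_un Ord_lst_any oH that)
    fix m u assume m: "Jcl m" "ALL x. x \<E> m --> K x \<E> m" "J (nm 4) c \<E> m" "u \<E> m"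
    have om: "Ord m" using m(1) Jcl_def by blast
    have ou: "Ord u" using Ord_memD[OF om m(4)] .
    have i: "H x \<E> m & lst (%z. Ord (J z x) & P (ev (J z x))) \<E> m" if "x \<E> m" for x
    proof -
      have ox: "Ord x" using Ord_memD[OF om that] .
      have "sub (H x) (K x)" "sub (lst (%z. Ord (J z x) & P (ev (J z x)))) (K x)" by (auto simp: sub_def K_def)
      moreover have "K x \<E> m" "Ord (K x)" using m(2) that Ord_memD[OF om] by blast+
      ultimately show ?thesis using Ord_le_less[OF _ om] oH[OF ox] Ord_lst_any by blast
    qed
    have cm: "c \<E> m" using code_mem[OF m(1,3)] dH by simp
    have "(EX x. x \<E> m & J x u \<E> St m c) \<longleftrightarrow> ?Q (ev u)"
    proof
      assume "EX x. x \<E> m & J x u \<E> St m c"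
      then obtain x where x: "x \<E> m" "J x u \<E> St m c" by blast
      have "J x u \<E> m" using m(1,4) x(1) Jcl_def by blast
      hence "P (ev (J x u))" using c m(1) cm i x unfolding codes_def by blast
      thus "?Q (ev u)" using e[OF ou] Ord_memD[OF om x(1)] by blast
    next
      assume "?Q (ev u)"
      then obtain z where z: "Ord z" "P (ev (J z u))" using e[OF ou] by blast
      have d: "Dp (%z. Ord (J z u) & P (ev (J z u)))" by (intro dP df)
      define w where "w = lst (%z. Ord (J z u) & P (ev (J z u)))"
      have w: "P (ev (J w u))" using lst_P[of "%z. Ord (J z u) & P (ev (J z u))", OF d z(1)] z ou unfolding w_def by simp
      have wm: "w \<E> m" using i[OF m(4)] unfolding w_def by blast
      have "J w u \<E> m" using m(1,4) wm Jcl_def by blast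
      hence "J w u \<E> St m c" using c m(1) cm i w unfolding codes_def by blast
      thus "EX x. x \<E> m & J x u \<E> St m c" using wm by blast
    qed
    thus "(u \<E> St m (J (nm 4) c)) = ?Q (ev u)"
      using m(4) dH cm by (subst St_unfold[OF m(1)]) (simp_all del: nm.simps)
  qed
  ultimately show ?thesis unfolding coded_def by blast
qed
lemma coded_atm: assumes "atm t" shows "coded (%v. v 0 = t (%n. v (Suc n)))"
proof -
  have "coded (%v. v 0 = v (Suc i))" for i
  proof (induction i)
    case 0 show ?case using coded_eq01 by simp
  next
    case (Suc i) from coded_drop[OF this] show ?case by simp
  qed
  thus ?thesis using assms coded_const unfolding atm_def by auto
qed

lemma dfp_coded: "dfp EL P ==> coded P"
proof (induction rule: dfp.induct)
  case (dfp_mem t s)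
  have "coded (%v. EX y. (y = s v & (EX x. (x = t v) & EL x y)))"
    using coded_ex[OF coded_conj[OF coded_atm[OF dfp_mem(2)]
       coded_ex[OF coded_conj[OF coded_drop[OF coded_atm[OF dfp_mem(1)]] coded_mem01]]]] by simp
  thus ?case by simp
next
  case (dfp_eq t s)
  have "coded (%v. EX x. (x = t v & x = s v))"
    using coded_ex[OF coded_conj[OF coded_atm[OF dfp_eq(1)] coded_atm[OF dfp_eq(2)]]] by simp
  moreover have "(%v. EX x. (x = t v & x = s v)) = (%v. t v = s v)" by auto
  ultimately show ?case by simp
qed (rule coded_not coded_conj coded_ex; assumption)+

text \<open>In a large closed segment the code of \<open>Q\<close> defines exactly the part of
  \<open>Q\<close> that lies in it, and \<open>J m c\<close> names this part.\<close>

lemma L_comp: assumes Q: "dfp EL (%e. Q (e 0))" and g: "Ord g"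
  shows "EX m b. Ord m & g \<E> m & (ALL y. EL y b \<longleftrightarrow> Q y & (EX x. x \<E> m & h y = Lf x))"
proof -
  obtain c H where c: "codes (%e. Q (e 0)) c H" using dfp_coded[OF Q] unfolding coded_def by blast
  have oc: "Ord c" "Dg H" "!!x. Ord x ==> Ord (H x)" using c unfolding codes_def by blast+
  obtain m where m: "Jcl m" "un g c \<E> m" "ALL x. x \<E> m --> H x \<E> m"
    using closed_ordinal[OF oc(2,3) Ord_un[OF g oc(1)]] by blast
  have om: "Ord m" using m(1) Jcl_def by blast
  have "sub g (un g c)" "sub c (un g c)" by (auto simp: sub_def)
  hence gm: "g \<E> m" "c \<E> m" using Ord_le_less[OF Ord_un[OF g oc(1)] om] m(2) g oc by blast+
  have em: "emp \<E> m" using emp_mem[OF om] gm(1) mem_emp by metis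
  define b where "b = hi (Lf (J m c))"
  have hb: "h b = Lf (J m c)" unfolding b_def using om oc by (intro h_hi inL_Lf) simp
  have "EL y b \<longleftrightarrow> Q y & (EX x. x \<E> m & h y = Lf x)" for y
  proof -
    have "J x emp \<E> St m c \<longleftrightarrow> Q (hi (Lf x))" if x: "x \<E> m" for x
    proof -
      have "J x emp \<E> m" using m(1) x em Jcl_def by blast
      hence "J x emp \<E> St m c \<longleftrightarrow> Q (ev (J x emp) 0)" using c m gm unfolding codes_def by blast
      thus ?thesis using Ord_memD[OF om x] by (simp add: ev_0)
    qed
    thus ?thesis unfolding EL_def hb mem_Lf_J[OF om oc(1)] by (metis hi_h)
  qed
  thus ?thesis using om gm by blast
qed

lemma L_superset: assumes "!!y. y \<E> s ==> inL y" shows "EX b. ALL y. h y \<E> s --> EL y b"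
proof -
  obtain g where g: "Ord g" "ALL y. y \<E> s --> (EX x. x \<E> g & y = Lf x)" using inL_bound[of s] assms by blast
  obtain m b where m: "Ord m" "g \<E> m" "ALL y. EL y b \<longleftrightarrow> True & (EX x. x \<E> m & h y = Lf x)"
    using L_comp[of "%_. True", OF df_Bool g(1)] by blast
  show ?thesis using g m Ord_trans[OF m(1)] by blast
qed

text \<open>Definitions over L relativize. Replacement in L relies on this, because there the values
  are collected in the outer universe.\<close>

lemma rel_def2: assumes "dfp EL (%e. Q (e 0) (e 1))"
  shows "Df (%e. inL (e 0) & inL (e 1) & Q (hi (e 0)) (hi (e 1)))"
proof -
  have r: "rdef (%e. Q (e 0) (e 1))" using dfp_coded[OF assms] unfolding coded_def by blast
  have "Df (%e. EX x y. Ord x & Ord y & e 0 = Lf x & e 1 = Lf y &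
     (Ord (J x (J y emp)) & Q (ev (J x (J y emp)) 0) (ev (J x (J y emp)) 1)))"
    by (intro df rdef_D[OF r])
  moreover have "(EX x y. Ord x & Ord y & u = Lf x & w = Lf y &
     (Ord (J x (J y emp)) & Q (ev (J x (J y emp)) 0) (ev (J x (J y emp)) 1)))
     \<longleftrightarrow> inL u & inL w & Q (hi u) (hi w)" for u w
  proof -
    have "Ord x & Ord y & u = Lf x & w = Lf y &
      (Ord (J x (J y emp)) & Q (ev (J x (J y emp)) 0) (ev (J x (J y emp)) 1)) \<longleftrightarrow>
      Ord x & Ord y & u = Lf x & w = Lf y & Q (hi u) (hi w)" for x y
      by (auto simp: ev_J)
    thus ?thesis unfolding inL_def by blast
  qed
  ultimately show ?thesis by simp
qed

definition "OrdL y \<longleftrightarrow> (ALL z. EL z y --> (ALL w. EL w z --> EL w y)) & (ALL z w. EL z y & EL w y --> EL z w | z = w | EL w z)"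
lemma EL_ex: "z \<E> h y \<longleftrightarrow> (EX x. z = h x & EL x y)"
proof
  assume z: "z \<E> h y"
  then obtain x where "z = h x" using inL_mem[OF inL_h z] h_ran by blast
  thus "EX x. z = h x & EL x y" using z unfolding EL_def by blast
qed (auto simp: EL_def)
lemma OrdL: "OrdL y \<longleftrightarrow> Ord (h y)"
proof -
  have a: "(ALL z. z \<E> h y --> P z) \<longleftrightarrow> (ALL x. EL x y --> P (h x))" for P y unfolding EL_ex by blast
  have "Ord (h y) \<longleftrightarrow> (ALL z. z \<E> h y --> (ALL w. w \<E> z --> w \<E> h y)) &
    (ALL z. z \<E> h y --> (ALL w. w \<E> h y --> z \<E> w | z = w | w \<E> z))" unfolding Ord_def sub_def by blast
  also have "\<dots> \<longleftrightarrow> OrdL y" unfolding a OrdL_def h_inj EL_def[symmetric] by blast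
  finally show ?thesis by simp
qed
text \<open>By \<open>L_comp\<close> the ordinals named below a large \<open>m\<close> form an
  element of L. It is transitive, hence an ordinal, and it includes \<open>a\<close>; L being
  transitive, \<open>a\<close> belongs to it as well.\<close>

lemma inL_Ord: "Ord a ==> inL a"
proof (rule Ord_induct[of inL])
  show "Dp inL" by (intro df)
  fix a assume a: "Ord a" "!!x. x \<E> a ==> inL x"
  obtain g where g: "Ord g" "ALL y. y \<E> a --> (EX x. x \<E> g & y = Lf x)" using inL_bound[of a] a by blast
  have d: "dfp EL (%e. OrdL (e 0))" unfolding OrdL_def by (intro df)
  obtain m b where m: "Ord m" "g \<E> m" "!!y. EL y b \<longleftrightarrow> OrdL y & (EX x. x \<E> m & h y = Lf x)"
    using L_comp[OF d g(1)] by blast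
  have mb: "z \<E> h b \<longleftrightarrow> Ord z & (EX x. x \<E> m & z = Lf x)" for z
    unfolding EL_ex m(3) OrdL using Ord_memD[OF m(1)] h_hi inL_Lf by metis
  have ob: "Ord (h b)"
  proof (rule OrdI)
    fix x y assume "x \<E> h b" "y \<E> x"
    then obtain z where z: "Ord x" "z \<E> m" "x = Lf z" "y \<E> Lf z" unfolding mb by blast
    then obtain w where "w \<E> z" "y = Lf w" using Lf_mem Ord_memD[OF m(1)] by blast
    thus "y \<E> h b" unfolding mb using z Ord_memD[of x y] Ord_trans[OF m(1)] by blast
  next
    fix x y assume "x \<E> h b" "y \<E> h b" thus "x \<E> y | x = y | y \<E> x" unfolding mb using Ord_lin by blast
  qed
  have "sub a (h b)"
  proof (rule subI)
    fix x assume x: "x \<E> a"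
    then obtain z where "z \<E> g" "x = Lf z" using g by blast
    thus "x \<E> h b" unfolding mb using Ord_memD[OF a(1) x] Ord_trans[OF m(1) _ m(2)] by blast
  qed
  hence "a \<E> h b | a = h b" using Ord_sub_cases[OF a(1) ob] by blast
  thus "inL a" using inL_mem[OF inL_h] inL_h by metis
qed

text \<open>A set of constructible sets is covered by an element of L. This gives pairing, union and
  power set, and replacement once the values are collected outside.\<close>

sublocale L: zf EL
proof
  fix x y assume "!!z. EL z x \<longleftrightarrow> EL z y"
  hence "h x = h y" by (intro ext) (simp add: EL_ex)
  thus "x = y" by (simp add: h_inj)
next
  fix x y assume "EL y x"
  hence "h y \<E> h x" by (simp add: EL_def)
  from foundation[OF this] obtain u where "u \<E> h x" "ALL z. z \<E> u --> ~ z \<E> h x" by blast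
  thus "EX y. EL y x & (ALL z. EL z y --> ~ EL z x)" unfolding EL_ex using EL_def by blast
next
  fix a b
  have "inL y" if "y \<E> upair (h a) (h b)" for y using that by auto
  from L_superset[OF this] obtain p where "ALL y. h y \<E> upair (h a) (h b) --> EL y p" by blast
  thus "EX p. EL a p & EL b p" by auto
next
  fix a
  obtain u where "ALL y. h y \<E> Unn (h a) --> EL y u" using L_superset[of "Unn (h a)"] inL_mem inL_h mem_Un by metis
  thus "EX u. ALL x z. EL x a --> EL z x --> EL z u" unfolding EL_def by auto
next
  fix a
  have s: "z \<E> Sep (Pw (h a)) inL \<longleftrightarrow> z \<E> Pw (h a) & inL z" for z by (rule mem_Sep) (intro df)
  obtain u where u: "!!y. h y \<E> Sep (Pw (h a)) inL ==> EL y u" using L_superset[of "Sep (Pw (h a)) inL"] s by blast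
  have "EL z u" if "ALL y. EL y z --> EL y a" for z
    by (rule u) (use that in \<open>auto simp: s sub_def EL_ex\<close>)
  thus "EX p. ALL z. (ALL y. EL y z --> EL y a) --> EL z p" by blast
next
  obtain w where w: "om = h w" using inL_Ord[OF Ord_om] h_ran by blast
  have x: "EX y. EL y w & (ALL z. EL z y \<longleftrightarrow> EL z x | z = x)" if "EL x w" for x
  proof -
    have "h x \<E> om" using that w unfolding EL_def by simp
    hence "suc (h x) \<E> om" by (rule om_suc)
    then obtain y where y: "suc (h x) = h y" "EL y w" unfolding w EL_ex by blast
    have "EL z y \<longleftrightarrow> EL z x | z = x" for z unfolding EL_def y(1)[symmetric] by (simp add: h_inj)
    thus ?thesis using y by blast
  qed
  have "emp \<E> h w" using w om_emp by simp
  then obtain z where "emp = h z" "EL z w" unfolding EL_ex by blast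
  moreover hence "~ EL y z" for y unfolding EL_def by (metis mem_emp)
  ultimately show "EX w. (EX z. EL z w & (ALL y. ~ EL y z)) & (ALL x. EL x w --> (EX y. EL y w & (ALL z. EL z y \<longleftrightarrow> EL z x | z = x)))"
    using x by blast
next
  fix P a assume P: "dfp EL (%e. P (e 0))"
  obtain g where g: "Ord g" "ALL y. y \<E> h a --> (EX x. x \<E> g & y = Lf x)" using inL_bound[of "h a"] inL_mem[OF inL_h] by blast
  have d: "dfp EL (%e. EL (e 0) a & P (e 0))" by (intro df P)
  obtain m b where m: "Ord m" "g \<E> m" "!!y. EL y b \<longleftrightarrow> (EL y a & P y) & (EX x. x \<E> m & h y = Lf x)"
    using L_comp[OF d g(1)] by blast
  have "EX x. x \<E> m & h y = Lf x" if "EL y a" for y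
    using that g(2) Ord_trans[OF m(1) _ m(2)] unfolding EL_def by blast
  thus "EX b. ALL x. EL x b \<longleftrightarrow> EL x a & P x" using m(3) by blast
next
  fix Q a assume Q: "dfp EL (%e. Q (e 0) (e 1))" and f: "!!x. EL x a ==> EX c. ALL y. Q x y \<longleftrightarrow> y = c"
  note [df] = dfp2[of E "%x y. inL x & inL y & Q (hi x) (hi y)", OF rel_def2[OF Q]]
  define F where "F x = Th (%y. inL x & inL y & Q (hi x) (hi y))" for x
  have dF: "Dg F" unfolding F_def by (intro df)
  have FF: "F (h x) = h c" if "ALL y. Q x y \<longleftrightarrow> y = c" for x c
    unfolding F_def by (rule Th_eq) (use that h_hi in auto)
  have "inL z" if "z \<E> Im F (h a)" for z
    using that f FF unfolding mem_Im[OF dF] EL_ex by (metis inL_h)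
  then obtain b where "ALL y. h y \<E> Im F (h a) --> EL y b" using L_superset by blast
  thus "EX b. ALL x. EL x a --> (EX y. EL y b & Q x y)"
    unfolding mem_Im[OF dF] using f FF EL_def by metis
qed

end

section \<open>Transitive embeddings\<close>

text \<open>Used twice: for L inside its universe, to see that L satisfies V = L, and for the ground
  model inside the extension by way of canonical names.\<close>

locale emb = A: zf EA + B: zf EB for EA :: "'b => 'b => bool" and EB :: "'a => 'a => bool" +
  fixes h :: "'b => 'a"
  assumes h_inj: "h x = h y \<longleftrightarrow> x = y" and h_mem: "EA x y \<longleftrightarrow> EB (h x) (h y)"
    and h_trans: "EB z (h y) ==> EX x. z = h x"
begin

lemma mem_h: "EB z (h y) \<longleftrightarrow> (EX x. z = h x & EA x y)" using h_trans h_mem by blast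
lemma all_h: "(ALL z. EB z (h y) --> P z) \<longleftrightarrow> (ALL x. EA x y --> P (h x))" unfolding mem_h by blast
lemma h_eqI: "(!!z. (EX x. z = h x & EA x y) \<longleftrightarrow> EB z t) ==> h y = t" by (rule B.ext) (simp add: mem_h)
lemma h_emp: "h A.emp = B.emp" by (rule h_eqI) simp
lemma h_upair: "h (A.upair a b) = B.upair (h a) (h b)" by (rule h_eqI) auto
lemma h_Unn: "h (A.Unn a) = B.Unn (h a)" 
proof (rule h_eqI)
  fix z
  have "EB z (B.Unn (h a)) \<longleftrightarrow> (EX x. EA x a & EB z (h x))" unfolding B.mem_Un mem_h[of _ a] by blast
  also have "\<dots> \<longleftrightarrow> (EX y. z = h y & EA y (A.Unn a))" unfolding mem_h A.mem_Un by blast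
  finally show "(EX y. z = h y & EA y (A.Unn a)) = EB z (B.Unn (h a))" by simp
qed
lemma h_sing: "h (A.sing a) = B.sing (h a)" unfolding A.sing_def B.sing_def by (rule h_upair)
lemma h_un: "h (A.un a b) = B.un (h a) (h b)" unfolding A.un_def B.un_def h_Unn h_upair ..
lemma h_suc: "h (A.suc a) = B.suc (h a)" unfolding A.suc_def B.suc_def h_un h_sing ..
lemma h_opr: "h (A.opr a b) = B.opr (h a) (h b)" unfolding A.opr_def B.opr_def h_upair h_sing ..
lemma h_nm: "h (A.nm k) = B.nm k" by (induction k) (simp_all add: h_emp h_suc)
lemma h_sub: "A.sub a b \<longleftrightarrow> B.sub (h a) (h b)" unfolding A.sub_def B.sub_def all_h h_mem ..
lemma h_Ord: "A.Ord a \<longleftrightarrow> B.Ord (h a)"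
proof -
  have "B.Ord (h a) \<longleftrightarrow> (ALL y. EB y (h a) --> B.sub y (h a)) &
     (ALL y. EB y (h a) --> (ALL z. EB z (h a) --> EB y z | y = z | EB z y))" unfolding B.Ord_def by blast
  also have "\<dots> \<longleftrightarrow> A.Ord a" unfolding all_h A.Ord_def h_sub[symmetric] h_mem[symmetric] h_inj by blast
  finally show ?thesis by simp
qed
lemma opr_h: assumes "EB (B.opr u v) (h z)" shows "EX x y. u = h x & v = h y"
proof -
  obtain p where p: "B.opr u v = h p" using h_trans[OF assms] by blast
  have "EB (B.upair u v) (h p)" unfolding p[symmetric] B.opr_def by simp
  then obtain q where q: "B.upair u v = h q" using h_trans by blast
  have "EB u (h q)" "EB v (h q)" unfolding q[symmetric] by simp_all
  thus ?thesis using h_trans by blast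
qed
text \<open>Solutions in the larger model all come from the smaller one, so unique solutions
  correspond; without a unique solution both sides are the default.\<close>

lemma h_Th: assumes "!!x. P x \<longleftrightarrow> Q (h x)" "!!z. Q z ==> EX x. z = h x" shows "h (A.Th P) = B.Th Q"
proof (cases "EX! x. P x")
  case True
  then obtain x where x: "P x" "!!y. P y ==> y = x" by blast
  have "A.Th P = x" by (rule A.Th_eq[of P, OF x(1)]) (rule x(2))
  moreover have "B.Th Q = h x"
  proof (rule B.Th_eq)
    show "Q (h x)" using x(1) assms(1) by simp
    fix z assume z: "Q z"
    then obtain y where "z = h y" using assms(2) by blast
    thus "z = h x" using z x(2) assms(1) by simp
  qed
  ultimately show ?thesis by simp
next
  case False
  hence "~ (EX! z. Q z)" using assms h_inj by metis
  thus ?thesis using False unfolding A.Th_def B.Th_def by (simp add: h_emp)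
qed
lemma h_ap: "h (A.ap f x) = B.ap (h f) (h x)"
  unfolding A.ap_def B.ap_def by (rule h_Th) (use h_mem h_opr opr_h in auto)
lemma h_Sep: assumes "A.Dp P" "B.Dp Q" "!!x. EA x a ==> P x \<longleftrightarrow> Q (h x)"
  shows "h (A.Sep a P) = B.Sep (h a) Q"
  by (rule h_eqI) (use assms in \<open>auto simp: A.mem_Sep B.mem_Sep mem_h\<close>)
lemma h_Im: assumes "A.Dg F" "B.Dg G" "!!x. EA x a ==> h (F x) = G (h x)"
  shows "h (A.Im F a) = B.Im G (h a)"
  by (rule h_eqI, unfold A.mem_Im[OF assms(1)] B.mem_Im[OF assms(2)] mem_h) (metis assms(3))
lemma h_lam: assumes "A.Dg F" "B.Dg G" "!!x. EA x a ==> h (F x) = G (h x)"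
  shows "h (A.lam a F) = B.lam (h a) G"
  unfolding A.lam_def B.lam_def
  by (rule h_Im) (intro df assms, intro df assms, simp add: h_opr assms(3))
lemma h_om: "h A.om = B.om"
proof (rule B.ext)
  have "EB (h n) B.om" if "EA n A.om" for n
  proof -
    have "B.Nt (h n) \<longleftrightarrow> A.Nt n"
    proof -
      have "(ALL y. EB y (h (A.suc n)) --> y = B.emp | (EX z. EB z y & y = B.suc z)) \<longleftrightarrow>
        (ALL y. EA y (A.suc n) --> y = A.emp | (EX z. EA z y & y = A.suc z))"
      proof -
        have "(EX z. EB z (h x) & h x = B.suc z) \<longleftrightarrow> (EX z. EA z x & x = A.suc z)" for x
          unfolding mem_h by (metis h_suc h_inj)
        thus ?thesis unfolding all_h h_emp[symmetric] h_inj by simp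
      qed
      thus ?thesis unfolding A.Nt_def B.Nt_def h_Ord h_suc by simp
    qed
    thus ?thesis using that unfolding A.mem_om' B.mem_om' by simp
  qed
  moreover have "EX m. n = h m & EA m A.om" if "EB n B.om" for n
  proof -
    have "EB n (h A.om)"
      by (rule B.om_ind[of "%n. EB n (h A.om)", OF _ that])
        (intro df, use A.om_emp h_emp h_mem in metis, use A.om_suc h_suc mem_h in metis)
    thus ?thesis unfolding mem_h .
  qed
  ultimately show "EB z (h A.om) \<longleftrightarrow> EB z B.om" for z unfolding mem_h by blast
qed

text \<open>The smaller model has the recursion up to \<open>x\<close> as a set. Its image obeys the
  recursion of the larger model, and induction there compares the two.\<close>

lemma h_orec: assumes G: "dff EA (%e. G (e 0) (e 1))" "dff EB (%e. G' (e 0) (e 1))"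
  and abs: "!!u f. A.Ord u ==> h (G u f) = G' (h u) (h f)" and x: "A.Ord x"
  shows "h (A.orec G x) = B.orec G' (h x)"
proof -
  have dA: "A.Dg (A.orec G)" by (intro A.df_orec dff2[OF G(1)] df_var)
  have dB: "B.Dg (B.orec G')" by (intro B.df_orec dff2[OF G(2)] df_var)
  define f where "f = A.lam (A.suc x) (A.orec G)"
  have f: "A.ap f y = A.orec G y" if "EA y (A.suc x)" for y unfolding f_def by (rule A.ap_lam[OF dA that])
  have dh: "B.Dg (B.ap (h f))" by (intro df)
  have ind: "EB y (h (A.suc x)) --> B.ap (h f) y = B.orec G' y" if "B.Ord y" for y
  proof (rule B.Ord_induct[of "%y. EB y (h (A.suc x)) --> B.ap (h f) y = B.orec G' y", OF _ _ that])
    show "B.Dp (%y. EB y (h (A.suc x)) --> B.ap (h f) y = B.orec G' y)" by (intro dff1[OF dB] df)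
    fix a assume a: "B.Ord a" "!!z. EB z a ==> EB z (h (A.suc x)) --> B.ap (h f) z = B.orec G' z"
    show "EB a (h (A.suc x)) --> B.ap (h f) a = B.orec G' a"
    proof
      assume ax: "EB a (h (A.suc x))"
      then obtain b where b: "a = h b" "EA b (A.suc x)" unfolding mem_h by blast
      have ob: "A.Ord b" using a(1) b(1) h_Ord by simp
      have bs: "EA y (A.suc x)" if "EA y b" for y using A.Ord_trans[OF A.Ord_suc[OF x] that b(2)] .
      have "B.ap (h f) a = h (A.orec G b)" unfolding b(1) h_ap[symmetric] f[OF b(2)] ..
      also have "\<dots> = G' a (h (A.lam b (A.orec G)))" using A.orec[OF G(1) ob] abs[OF ob] b by simp
      also have "h (A.lam b (A.orec G)) = B.lam a (B.ap (h f))"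
        unfolding b(1) by (rule h_lam[OF dA dh]) (use f bs h_ap in metis)
      also have "\<dots> = B.lam a (B.orec G')"
        by (rule B.lam_cong) (use a(2) B.Ord_trans[OF _ _ ax] x h_Ord A.Ord_suc in blast)
      also have "G' a \<dots> = B.orec G' a" using B.orec[OF G(2) a(1)] by simp
      finally show "B.ap (h f) a = B.orec G' a" .
    qed
  qed
  have "EB (h x) (h (A.suc x))" unfolding h_mem[symmetric] by simp
  hence "B.ap (h f) (h x) = B.orec G' (h x)" using ind x h_Ord by blast
  thus ?thesis unfolding h_ap[symmetric] using f[of x] by simp
qed

lemma h_plt: "A.plt a b c d \<longleftrightarrow> B.plt (h a) (h b) (h c) (h d)"
  unfolding A.plt_def B.plt_def h_un[symmetric] h_mem h_inj ..
text \<open>The argument of \<open>h_orec\<close> for the order of pairs, carried out on the square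
  of an ordinal that contains the components of all earlier pairs.\<close>

lemma h_J: assumes o: "A.Ord a" "A.Ord b" shows "h (A.J a b) = B.J (h a) (h b)"
proof -
  define m where "m = A.suc (A.un a b)"
  have om: "A.Ord m" unfolding m_def using A.Ord_un o by simp
  define f where "f = A.lam (A.prd m m) (%p. A.J (A.fs p) (A.sn p))"
  have d: "A.Dg (%p. A.J (A.fs p) (A.sn p))" by (intro df)
  have f: "A.ap f (A.opr c d) = A.J c d" if "EA c m" "EA d m" for c d
    unfolding f_def using that by (subst A.ap_lam[OF d]) simp_all
  have db: "B.Dp (%p. B.ap (h f) p ~= B.J (B.fs p) (B.sn p))" by (intro df)
  let ?s = "B.Sep (h (A.prd m m)) (%p. B.ap (h f) p ~= B.J (B.fs p) (B.sn p))"
  have ms: "EB p ?s \<longleftrightarrow> EB p (h (A.prd m m)) & B.ap (h f) p ~= B.J (B.fs p) (B.sn p)" for p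
    by (rule B.mem_Sep[OF db])
  have ok: "B.ap (h f) p = B.J (B.fs p) (B.sn p)" if "EB p (h (A.prd m m))" for p
  proof (rule ccontr)
    assume "~ ?thesis"
    hence "EB p ?s" using that ms by blast
    from B.prel_wf[OF this] obtain u where u: "EB u ?s" "!!v. B.prel v u ==> ~ EB v ?s" by blast
    obtain c d where cd: "EA c m" "EA d m" "u = B.opr (h c) (h d)"
      using u(1) unfolding ms mem_h A.mem_prd using h_opr by blast
    have oc: "A.Ord c" "A.Ord d" using cd A.Ord_memD[OF om] by blast+
    hence ob: "B.Ord (h c)" "B.Ord (h d)" using h_Ord by blast+
    have i: "h (A.J x y) = B.J (h x) (h y)" if xy: "A.Ord x" "A.Ord y" "A.plt x y c d" for x y
    proof -
      have "EA x (A.suc (A.un c d))" "EA y (A.suc (A.un c d))" using A.plt_bound[OF xy(1,2) oc xy(3)] by blast+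
      moreover have "EA (A.un c d) m" using A.un_max[OF oc] cd by metis
      hence "A.sub (A.suc (A.un c d)) m" using A.suc_le[OF A.Ord_un[OF oc] om] by blast
      ultimately have xm: "EA x m" "EA y m" using A.subD by blast+
      have p: "B.prel (B.opr (h x) (h y)) u" unfolding B.prel_def cd(3) using xy h_plt h_Ord oc by blast
      have "EB (B.opr (h x) (h y)) (h (A.prd m m))" unfolding h_opr[symmetric] h_mem[symmetric] using xm by simp
      hence "B.ap (h f) (B.opr (h x) (h y)) = B.J (h x) (h y)" using u(2)[OF p] ms by simp
      thus ?thesis unfolding h_opr[symmetric] h_ap[symmetric] using f[OF xm] by simp
    qed
    have "h (A.J c d) = B.J (h c) (h d)"
    proof (rule h_eqI)
      fix z
      have *: "EB z (B.J (h c) (h d)) \<longleftrightarrow> (EX x y. B.Ord x & B.Ord y & B.plt x y (h c) (h d) & z = B.J x y)"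
        by (rule B.mem_J[OF ob])
      have "EX x'. x = h x'" if "B.Ord x" "B.Ord y" "B.plt x y (h c) (h d) | B.plt y x (h c) (h d)" for x y
      proof -
        have "EB x (B.suc (B.un (h c) (h d)))" using that B.plt_bound[OF _ _ ob] by blast
        thus ?thesis unfolding h_un[symmetric] h_suc[symmetric] by (rule h_trans)
      qed
      hence "EB z (B.J (h c) (h d)) \<longleftrightarrow> (EX x y. A.Ord x & A.Ord y & A.plt x y c d & z = B.J (h x) (h y))"
        unfolding * h_Ord h_plt by metis
      also have "\<dots> \<longleftrightarrow> (EX x y. A.Ord x & A.Ord y & A.plt x y c d & z = h (A.J x y))" using i by metis
      also have "\<dots> \<longleftrightarrow> (EX x. z = h x & EA x (A.J c d))" unfolding A.mem_J[OF oc] by blast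
      finally show "(EX x. z = h x & EA x (A.J c d)) = EB z (B.J (h c) (h d))" by simp
    qed
    moreover have "B.ap (h f) u = h (A.J c d)" unfolding cd(3) h_opr[symmetric] h_ap[symmetric] f[OF cd(1,2)] ..
    ultimately show False using u(1) ms cd(3) by simp
  qed
  have "EA a m" "EA b m" unfolding m_def using A.mem_suc_un[OF o] by blast+
  hence "EB (B.opr (h a) (h b)) (h (A.prd m m))" "A.ap f (A.opr a b) = A.J a b"
    unfolding h_opr[symmetric] h_mem[symmetric] using f by simp_all
  thus ?thesis using ok[of "B.opr (h a) (h b)"] unfolding h_opr[symmetric] h_ap[symmetric] by (simp add: h_opr)
qed
lemma h_J1: assumes "A.Ord t" shows "h (A.J1 t) = B.J1 (h t)"
  and h_J2: "h (A.J2 t) = B.J2 (h t)"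
  using A.J_surj[OF assms] h_J h_Ord by auto

lemma h_sat: assumes m: "A.Ord m" and e: "A.Ord e" shows "h (A.sat m a e) = B.sat (h m) (h a) (h e)"
  unfolding A.sat_def B.sat_def
proof (rule h_orec[OF _ _ _ e])
  fix u f assume u: "A.Ord u"
  have j: "A.Ord (A.J1 x)" "A.Ord (A.J2 x)" if "A.Ord x" for x using A.J12[OF that] by blast+
  have x: "(EX x. EB x (h m) & EB (B.J x (h y)) (B.ap (h f) (h z))) \<longleftrightarrow> (EX x. EA x m & EA (A.J x y) (A.ap f z))"
    if "A.Ord y" for y z
    unfolding mem_h[of _ m] using that h_J A.Ord_memD[OF m] h_mem h_ap by metis
  show "h (A.Sep m (%w. A.J1 u = A.nm 0 & EA (A.ap a (A.J1 w)) (A.ap a (A.J1 (A.J2 w))) |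
             A.J1 u = A.nm 1 & A.ap a (A.J1 w) = A.ap a (A.J1 (A.J2 w)) |
             A.J1 u = A.nm 2 & EA (A.J2 u) m & A.ap a (A.J1 w) = A.ap a (A.J2 u) |
             A.J1 u = A.nm 3 & ~ (EA w (A.ap f (A.J1 (A.J2 u))) & EA w (A.ap f (A.J2 (A.J2 u)))) |
             A.J1 u = A.nm 4 & (EX x. EA x m & EA (A.J x w) (A.ap f (A.J2 u))) |
             A.J1 u = A.nm 5 & EA (A.J (A.J1 w) (A.J2 (A.J2 w))) (A.ap f (A.J2 u)))) =
       B.Sep (h m) (%w. B.J1 (h u) = B.nm 0 & EB (B.ap (h a) (B.J1 w)) (B.ap (h a) (B.J1 (B.J2 w))) |
             B.J1 (h u) = B.nm 1 & B.ap (h a) (B.J1 w) = B.ap (h a) (B.J1 (B.J2 w)) |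
             B.J1 (h u) = B.nm 2 & EB (B.J2 (h u)) (h m) & B.ap (h a) (B.J1 w) = B.ap (h a) (B.J2 (h u)) |
             B.J1 (h u) = B.nm 3 & ~ (EB w (B.ap (h f) (B.J1 (B.J2 (h u)))) & EB w (B.ap (h f) (B.J2 (B.J2 (h u))))) |
             B.J1 (h u) = B.nm 4 & (EX x. EB x (h m) & EB (B.J x w) (B.ap (h f) (B.J2 (h u)))) |
             B.J1 (h u) = B.nm 5 & EB (B.J (B.J1 w) (B.J2 (B.J2 w))) (B.ap (h f) (B.J2 (h u))))"
  proof (rule h_Sep, goal_cases)
    case 1 show ?case by (intro df)
  next
    case 2 show ?case by (intro df)
  next
    case (3 w)
    hence w: "A.Ord w" using A.Ord_memD[OF m] by blast
    show ?case
      by (simp only: h_J1[symmetric] h_J2[symmetric] h_J[symmetric] h_ap[symmetric] h_nm[symmetric] h_inj h_mem[symmetric]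
          u w j x[OF w, unfolded h_ap[symmetric]])
  qed
qed (intro df df)+

lemma h_Lf: assumes "A.Ord x" shows "h (A.Lf x) = B.Lf (h x)"
  unfolding A.Lf_def B.Lf_def
proof (rule h_orec[OF _ _ _ assms])
  fix u f assume u: "A.Ord u"
  have o: "A.Ord (A.J1 u)" "A.Ord (A.J2 u)" using A.J12[OF u] by blast+
  have l: "h (A.lam (A.J1 u) (A.ap f)) = B.lam (h (A.J1 u)) (B.ap (h f))"
    by (rule h_lam) (intro df, intro df, rule h_ap)
  have "h (A.Sep (A.J1 u) (%y. EA (A.J y A.emp) (A.sat (A.J1 u) (A.lam (A.J1 u) (A.ap f)) (A.J2 u)))) =
    B.Sep (h (A.J1 u)) (%y. EB (B.J y B.emp) (B.sat (B.J1 (h u)) (B.lam (B.J1 (h u)) (B.ap (h f))) (B.J2 (h u))))"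
  proof (rule h_Sep, goal_cases)
    case 1 show ?case by (intro df)
  next
    case 2 show ?case by (intro df)
  next
    case (3 y)
    hence y: "A.Ord y" using A.Ord_memD[OF o(1)] by blast
    show ?case unfolding l[symmetric] h_J1[OF u, symmetric] h_J2[OF u, symmetric] h_sat[OF o, symmetric]
      h_emp[symmetric] h_J[OF y A.Ord_emp, symmetric] by (rule h_mem)
  qed
  thus "h (A.Im (A.ap f) (A.Sep (A.J1 u) (%y. EA (A.J y A.emp) (A.sat (A.J1 u) (A.lam (A.J1 u) (A.ap f)) (A.J2 u))))) =
    B.Im (B.ap (h f)) (B.Sep (B.J1 (h u)) (%y. EB (B.J y B.emp) (B.sat (B.J1 (h u)) (B.lam (B.J1 (h u)) (B.ap (h f))) (B.J2 (h u)))))"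
    using h_J1[OF u] h_Im[where F="A.ap f" and G="B.ap (h f)", OF _ _ h_ap] A.df_ap[OF df_const df_var] B.df_ap[OF df_const df_var] by metis
qed (intro df df)+

end

section \<open>Choice and successor cardinals\<close>

text \<open>Choice is put as a well-ordering principle in terms of \<open>sj\<close>, which fits the
  comparison of sizes.\<close>

locale zfc = zf +
  assumes wo: "EX t. Ord t & sj t a"
begin

lemma choice_fun: assumes P: "Df (%e. P (e 0) (e 1))" and ex: "!!x. x \<E> a ==> EX y. y \<E> b & P x y"
  shows "EX f. ALL x. x \<E> a --> ap f x \<E> b & P x (ap f x)"
proof -
  note [df] = dfp2[OF P]
  obtain t s where t: "Ord t" and s: "ALL y. y \<E> b --> (EX x. x \<E> t & ap s x = y)" using wo[of b] unfolding sj_def by blast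
  define F where "F x = ap s (lst (%z. ap s z \<E> b & P x (ap s z)))" for x
  have d: "Dg F" unfolding F_def by (intro df)
  have "F x \<E> b & P x (F x)" if x: "x \<E> a" for x
  proof -
    obtain y where y: "y \<E> b" "P x y" using ex[OF x] by blast
    then obtain z where "z \<E> t" "ap s z = y" using s by blast
    hence z: "Ord z" "ap s z \<E> b & P x (ap s z)" using y Ord_memD[OF t] by blast+
    have "Dp (%z. ap s z \<E> b & P x (ap s z))" by (intro df)
    from lst_P[of "%z. ap s z \<E> b & P x (ap s z)", OF this z] show ?thesis unfolding F_def .
  qed
  thus ?thesis using ap_lam[OF d] by (intro exI[of _ "lam a F"]) simp
qed

definition "nx a = lst (%x. ~ sj a x)"
text \<open>An ordinal that maps onto the power set of \<open>a\<close> is no image of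
  \<open>a\<close> by Cantor's theorem, so there is a least ordinal of this kind.\<close>

lemma nx: "Ord (nx a)" "~ sj a (nx a)" "x \<E> nx a ==> sj a x"
proof -
  obtain t where t: "Ord t" "sj t (Pw a)" using wo by blast
  hence n: "~ sj a t" using cantor sj_trans by blast
  have "Dp (%x. ~ sj a x)" by (intro df)
  note l = lst[of "%x. ~ sj a x", OF this t(1) n, folded nx_def]
  show "Ord (nx a)" "~ sj a (nx a)" "x \<E> nx a ==> sj a x" using l by blast+
qed
lemma less_nx: assumes "Ord y" shows "y \<E> nx a \<longleftrightarrow> sj a y"
proof
  assume "sj a y"
  hence "~ sub (nx a) y" using nx(2)[of a] sj_trans[OF _ sj_sub] by blast
  thus "y \<E> nx a" using Ord_cases[OF assms nx(1)] by blast
qed (rule nx(3))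
lemma Card_nx: "Card (nx a)" unfolding Card_def using nx sj_trans by blast
lemma nx_gt: "Ord k ==> k \<E> nx k" by (simp add: less_nx sj_refl)
lemma nx_le: "Card l ==> k \<E> l ==> sub (nx k) l"
  using nx(3) Ord_cases[of l "nx k"] nx(1) unfolding Card_def by blast

lemma sj_Unn: assumes k: "sj k (prd k k)" and A: "sj k A" "!!x. x \<E> A ==> sj k x" shows "sj k (Unn A)"
proof -
  have "EX g. ALL x. x \<E> A --> ap g x \<E> Pw (prd k (Unn A)) & (ALL y. y \<E> x --> (EX i. i \<E> k & ap (ap g x) i = y))"
  proof (rule choice_fun)
    show "Df (%e. ALL y. y \<E> e 0 --> (EX i. i \<E> k & ap (e 1) i = y))" by (intro df)
    fix x assume x: "x \<E> A"
    then obtain f where f: "ALL y. y \<E> x --> (EX i. i \<E> k & ap f i = y)" using A(2) unfolding sj_def by blast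
    have d: "Dg (ap f)" by (intro df)
    \<comment> \<open>Values outside the union are cut away so that the chosen surjections come from
      one set, as \<open>choice_fun\<close> requires.\<close>
    define f' where "f' = Sep (lam k (ap f)) (%p. sn p \<E> Unn A)"
    have f': "p \<E> f' \<longleftrightarrow> (EX i. i \<E> k & p = opr i (ap f i)) & sn p \<E> Unn A" for p
      unfolding f'_def by (subst mem_Sep) (intro df, simp add: mem_lam[OF d])
    have "f' \<E> Pw (prd k (Unn A))" by (auto simp: f' sub_def)
    moreover have "EX i. i \<E> k & ap f' i = y" if y: "y \<E> x" for y
    proof -
      obtain i where i: "i \<E> k" "ap f i = y" using f y by blast
      have "ap f' i = y" unfolding ap_def[of f'] by (rule Th_eq) (use i x y in \<open>auto simp: f'\<close>)
      thus ?thesis using i by blast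
    qed
    ultimately show "EX y. y \<E> Pw (prd k (Unn A)) & (ALL ya. ya \<E> x --> (EX i. i \<E> k & ap y i = ya))" by blast
  qed
  then obtain g where g: "!!x y. x \<E> A ==> y \<E> x ==> EX i. i \<E> k & ap (ap g x) i = y" by blast
  obtain s where s: "ALL x. x \<E> A --> (EX i. i \<E> k & ap s i = x)" using A(1) unfolding sj_def by blast
  have "sj (prd k k) (Unn A)"
  proof (rule sjI[where F="%p. ap (ap g (ap s (fs p))) (sn p)"])
    show "Dg (%p. ap (ap g (ap s (fs p))) (sn p))" by (intro df)
    fix y assume "y \<E> Unn A"
    then obtain x where x: "x \<E> A" "y \<E> x" by auto
    obtain i where "i \<E> k" "ap s i = x" using s x by blast
    moreover obtain j where "j \<E> k" "ap (ap g x) j = y" using g[OF x] by blast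
    ultimately show "EX p. p \<E> prd k k & ap (ap g (ap s (fs p))) (sn p) = y" by (intro exI[of _ "opr i j"]) simp
  qed
  thus ?thesis using k sj_trans by blast
qed
lemma inf_sq: "Card k ==> sub om k ==> sj k (prd k k)" using Card_Jcl Jcl_sj by blast
lemma om_sq: "sj om (prd om om)" by (rule inf_sq[OF Card_om sub_refl])
text \<open>The union of \<open>k\<close> many sets of size at most \<open>k\<close> has size at
  most \<open>k\<close>, so the supremum stays below the successor.\<close>

lemma regular: assumes k: "sub om k" "sj k (prd k k)" and A: "sub A (nx k)" "sj k A"
  shows "EX b. b \<E> nx k & (ALL x. x \<E> A --> x \<E> b)"
proof -
  have o: "Ord x" "sj k x" if "x \<E> A" for x using that A(1) nx Ord_memD subD by blast+
  have u: "sj k (Unn A)" by (rule sj_Unn[OF k(2) A(2) o(2)])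
  have ou: "Ord (Unn A)" by (rule Ord_Unn) (rule o)
  have "sj k (suc (Unn A))" unfolding suc_def by (rule sj_suc[OF k(1) u])
  hence "suc (Unn A) \<E> nx k" using less_nx ou by simp
  moreover have "x \<E> suc (Unn A)" if x: "x \<E> A" for x
  proof -
    have "sub x (Unn A)" using x by (auto simp: sub_def)
    thus ?thesis using Ord_sub_cases[OF o(1)[OF x] ou] by (simp only: mem_suc)
  qed
  ultimately show ?thesis by blast
qed
end

section \<open>Consequences of V = L\<close>

locale VL = zf +
  assumes VL: "inL x"
begin

definition "ix x = lst (%z. x = Lf z)"
text \<open>The witness of least name: a global choice that is itself definable.\<close>

definition "cho P = Lf (lst (%z. P (Lf z)))"
text \<open>An initial segment of L in the role of the transitive closure: some transitive set that
  contains \<open>x\<close>.\<close>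

definition "tc x = Im Lf (suc (ix x))"
lemma df_ix[df]: "Dt t ==> Dt (%e. ix (t e))" unfolding ix_def by (intro df dff_Suc)
lemma df_cho[df]: assumes "Df (%e. P (e 0) (%n. e (Suc n)))" shows "Dt (%e. cho (%x. P x e))"
proof -
  have "Df (%e. P (s e) (%n. e (Suc n)))" if "Dt s" for s
  proof -
    have "Dt (case_nat s (%n e. e (Suc n)) n)" for n using that by (auto split: nat.split intro: df_var)
    from dfp_subst[OF assms(1), of "case_nat s (%n e. e (Suc n))", OF this] show ?thesis by simp
  qed
  note 1 = this
  show ?thesis unfolding cho_def by (intro df 1)
qed
lemma ix: "Ord (ix x)" "Lf (ix x) = x"
proof -
  obtain z where z: "Ord z" "x = Lf z" using VL[of x] inL_def by blast
  have "Dp (%z. x = Lf z)" by (intro df)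
  from lst(1,2)[of "%z. x = Lf z", OF this z] show "Ord (ix x)" "Lf (ix x) = x" unfolding ix_def by simp_all
qed
lemma cho: assumes "Dp P" "P x" shows "P (cho P)"
proof -
  have "Dp (%z. P (Lf z))" by (rule dfp1[OF assms(1)]) (intro df)
  from lst_P[of "%z. P (Lf z)", OF this ix(1)[of x]] show ?thesis using assms ix(2) unfolding cho_def by simp
qed
lemma tc: "x \<E> tc x" "y \<E> tc x ==> z \<E> y ==> z \<E> tc x"
proof -
  have m: "y \<E> tc x \<longleftrightarrow> (EX a. a \<E> suc (ix x) & y = Lf a)" for y unfolding tc_def by (rule mem_Im) (intro df)
  show "x \<E> tc x" unfolding m using ix by (metis mem_suc)
  have o: "Ord (suc (ix x))" using ix by simp
  assume "y \<E> tc x" "z \<E> y"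
  thus "z \<E> tc x" unfolding m using Lf_mem Ord_memD[OF o] Ord_trans[OF o] by blast
qed

sublocale zfc
proof
  fix a
  obtain g where g: "Ord g" "ALL y. y \<E> a --> (EX x. x \<E> g & y = Lf x)" using inL_bound[of a] VL by blast
  have "sj g a" by (rule sjI[where F=Lf]) (intro df, use g in blast)
  thus "EX t. Ord t & sj t a" using g by blast
qed

end

context constr
begin

sublocale LE: emb EL E h
  by unfold_locales (simp_all add: h_inj EL_def, metis EL_ex)

text \<open>All ordinals belong to L and the naming function is absolute, so a name found outside
  works inside.\<close>

sublocale V: VL EL
proof
  fix x
  obtain y where y: "Ord y" "h x = Lf y" using inL_h[of x] inL_def by blast
  obtain z where z: "y = h z" using inL_Ord[OF y(1)] h_ran by blast
  have "L.Ord z" using y(1) z LE.h_Ord by simp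
  moreover have "h x = h (L.Lf z)" using LE.h_Lf[OF calculation] y(2) z by simp
  ultimately show "L.inL x" unfolding L.inL_def h_inj by blast
qed

end

section \<open>Condensation\<close>

context zf
begin

text \<open>Tags 1 to 3 give closure under pairing and unpairing. Tag 4 finds a witness for a
  quantifier, 5 an element on which two sets differ, and 6 replaces the name of an element of
  \<open>Lf a\<close> by one below \<open>J1 a\<close> that satisfies the defining code.\<close>

definition "skolem i a b =
  (if i = nm 1 then J a b else if i = nm 2 then J1 a else if i = nm 3 then J2 a
   else if i = nm 4 then lst (%x. x \<E> a & J x (J2 b) \<E> St a (J1 b))
   else if i = nm 5 then lst (%x. (Lf x \<E> Lf a) ~= (Lf x \<E> Lf b))
   else lst (%x. x \<E> J1 a & J x emp \<E> St (J1 a) (J2 a) & Lf x = Lf b))"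

lemma df_St[df]: "Dt m ==> Dt c ==> Dt (%e. St (m e) (c e))" unfolding St_def by (intro df)
lemma df_skolem[df]: "Dt i ==> Dt a ==> Dt b ==> Dt (%e. skolem (i e) (a e) (b e))"
  unfolding skolem_def by (intro df dff_Suc)
lemma skolem_simps: "skolem (nm 1) a b = J a b" "skolem (nm 2) a b = J1 a" "skolem (nm 3) a b = J2 a"
  "skolem (nm 4) a b = lst (%x. x \<E> a & J x (J2 b) \<E> St a (J1 b))"
  "skolem (nm 5) a b = lst (%x. (Lf x \<E> Lf a) ~= (Lf x \<E> Lf b))"
  "skolem (nm 6) a b = lst (%x. x \<E> J1 a & J x emp \<E> St (J1 a) (J2 a) & Lf x = Lf b)"
  unfolding skolem_def by (simp_all del: nm.simps)
lemma Ord_skolem: "Ord a ==> Ord b ==> Ord (skolem i a b)"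
  unfolding skolem_def by (simp add: J12 Ord_lst_any)

text \<open>Ordinals serve as Skolem terms: \<open>J emp t\<close> denotes the seed
  \<open>ap s t\<close>, and \<open>J i (J a b)\<close> the function of tag \<open>i\<close> at two
  terms. The hull is thus the image of any infinite ordinal closed under \<open>J\<close> that
  indexes the seeds, which settles its size.\<close>

definition "hull s = orec (%t f. if J1 t = emp then (if Ord (ap s (J2 t)) then ap s (J2 t) else emp)
   else skolem (J1 t) (ap f (J1 (J2 t))) (ap f (J2 (J2 t))))"
lemma df_hull[df]: assumes "Dt s" "Dt t" shows "Dt (%e. hull (s e) (t e))"
proof -
  have "Dt (%e. s (%n. e (Suc (Suc n))))" by (intro dff_Suc assms)
  thus ?thesis unfolding hull_def by (intro df assms)
qed
lemma hull0: assumes "Ord t" "Ord (ap s t)" shows "hull s (J emp t) = ap s t"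
  unfolding hull_def by (subst orec) (intro df, use assms in simp_all)
lemma hullS: assumes "Ord i" "i ~= emp" "Ord a" "Ord b" shows "hull s (J i (J a b)) = skolem i (hull s a) (hull s b)"
proof -
  have o: "Ord (J a b)" "Ord (J i (J a b))" using assms by simp_all
  have d: "Dg (hull s)" by (intro df)
  have l: "J a b \<E> J i (J a b)" using J_gt2 assms o by blast
  have "a \<E> J i (J a b)" "b \<E> J i (J a b)"
    using Ord_le_less[OF o _ _ l] J_ge1[of a b] J_ge2[of a b] assms by blast+
  hence "ap (lam (J i (J a b)) (hull s)) a = hull s a" "ap (lam (J i (J a b)) (hull s)) b = hull s b"
    using ap_lam[OF d] by blast+
  moreover have "hull s (J i (J a b)) = (if J1 (J i (J a b)) = emp then
     (if Ord (ap s (J2 (J i (J a b)))) then ap s (J2 (J i (J a b))) else emp)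
   else skolem (J1 (J i (J a b))) (ap (lam (J i (J a b)) (hull s)) (J1 (J2 (J i (J a b)))))
     (ap (lam (J i (J a b)) (hull s)) (J2 (J2 (J i (J a b))))))"
    unfolding hull_def by (rule orec[OF _ o(2)]) (intro df)
  ultimately show ?thesis using assms by simp
qed
lemma Ord_hull: assumes "Ord t" shows "Ord (hull s t)"
proof (rule Ord_induct[of "%t. Ord (hull s t)", OF _ _ assms])
  show "Dp (%t. Ord (hull s t))" by (intro df)
  fix t assume t: "Ord t" and ih: "!!x. x \<E> t ==> Ord (hull s x)"
  show "Ord (hull s t)"
  proof (cases "J1 t = emp")
    case True
    have "hull s t = (if Ord (ap s (J2 t)) then ap s (J2 t) else emp)"
      unfolding hull_def by (subst orec[OF _ t]) (intro df, simp add: True)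
    thus ?thesis by simp
  next
    case False
    note j = J12[OF t]
    note k = J12[OF j(2)]
    have l: "J2 t \<E> t" using J_gt2[OF j(1,2) False] j(3) by simp
    have "J1 (J2 t) \<E> t" "J2 (J2 t) \<E> t" using Ord_le_less[OF j(2) t _ _ l] k by blast+
    moreover have "hull s t = skolem (J1 t) (hull s (J1 (J2 t))) (hull s (J2 (J2 t)))"
      using hullS[OF j(1) False k(1,2)] k(3) j(3) by simp
    ultimately show ?thesis using ih Ord_skolem by simp
  qed
qed

text \<open>A set of ordinals closed under \<open>skolem\<close> is closed under the pairing functions and is an
  elementary substructure for the satisfaction relation.\<close>

lemma collapse_Lf:
  assumes KO: "!!a. a \<E> K ==> Ord a" and om: "sub om K"
    and sk: "!!k a b. a \<E> K ==> b \<E> K ==> k ~= 0 ==> skolem (nm k) a b \<E> K" and a: "a \<E> K"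
  shows "Lf (col K a) = col (Im Lf K) (Lf a)"
proof -
  have KJ: "J a b \<E> K" "J1 a \<E> K" "J2 a \<E> K" if "a \<E> K" "b \<E> K" for a b
    using sk[OF that, of 1] sk[OF that, of 2] sk[OF that, of 3] unfolding skolem_simps by simp_all
  have K4: "lst (%x. x \<E> a & J x (J2 b) \<E> St a (J1 b)) \<E> K"
    "lst (%x. (Lf x \<E> Lf a) ~= (Lf x \<E> Lf b)) \<E> K"
    "lst (%x. x \<E> J1 a & J x emp \<E> St (J1 a) (J2 a) & Lf x = Lf b) \<E> K" if "a \<E> K" "b \<E> K" for a b
    using sk[OF that, of 4] sk[OF that, of 5] sk[OF that, of 6] unfolding skolem_simps by simp_all
  define p where "p = col K"
  define X where "X = Im Lf K"
  have dL: "Dg Lf" by (intro df)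
  have X: "z \<E> X \<longleftrightarrow> (EX a. a \<E> K & z = Lf a)" for z unfolding X_def by (rule mem_Im[OF dL])
  have dp: "Dg p" unfolding p_def by (intro df)
  note [df] = dff1[OF dp]
  have eK: "extnl K" by (rule extnl_Ord) (rule KO)
  have pO: "Ord (p x)" "sub (p x) x" if "x \<E> K" for x using col_Ord[OF KO that] unfolding p_def by blast+
  have pm: "p x \<E> p y \<longleftrightarrow> x \<E> y" if "x \<E> K" "y \<E> K" for x y using col_mem[OF eK that] p_def by simp
  have pe: "p x = p y \<longleftrightarrow> x = y" if "x \<E> K" "y \<E> K" for x y using col_inj[OF eK that] p_def by blast
  have pmem: "z \<E> p x \<longleftrightarrow> (EX y. y \<E> x & y \<E> K & z = p y)" if "x \<E> K" for x z using col[OF that] p_def by simp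
  have psurj: "EX x. x \<E> K & z = p x" if "z \<E> otp K" for z using that mem_otp p_def by auto
  have oO: "Ord (otp K)" by (rule otp_Ord) (rule KO)
  have po: "p x \<E> otp K" if "x \<E> K" for x unfolding mem_otp p_def using that by blast
  \<comment> \<open>The collapse fixes \<open>om\<close>, hence the tags of codes.\<close>
  have pnm: "p (nm k) = nm k" for k unfolding p_def
    using om nm_om Ord_subD[OF Ord_om nm_om] Ord_trans[OF Ord_om] by (intro col_id[where t=om]) (blast intro: subD)+
  have nK: "nm k \<E> K" for k using om nm_om subD by blast
  have pun: "p (un a b) = un (p a) (p b)" "un a b \<E> K" if ab: "a \<E> K" "b \<E> K" for a b
  proof -
    have o: "Ord a" "Ord b" using KO ab by auto
    show "un a b \<E> K" using un_max[OF o] ab by metis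
    show "p (un a b) = un (p a) (p b)"
    proof (cases "a \<E> b")
      case True
      hence "sub a b" "sub (p a) (p b)" using Ord_subD o pO(1) ab pm by blast+
      thus ?thesis by (simp add: un_absorb)
    next
      case False
      hence "sub b a" "sub (p b) (p a)" using Ord_not_mem o pO(1) ab pm by blast+
      thus ?thesis by (simp add: un_absorb)
    qed
  qed
  have pplt: "plt (p a) (p b) (p c) (p d) \<longleftrightarrow> plt a b c d" if "a \<E> K" "b \<E> K" "c \<E> K" "d \<E> K" for a b c d
    unfolding plt_def using that pun pm pe by (metis (no_types, lifting))
  \<comment> \<open>By a minimal pair: each side is the set of values at earlier pairs, and the
    pairs before \<open>p c\<close>, \<open>p d\<close> are collapses of pairs from
    \<open>K\<close>.\<close>
  have pJ: "p (J a b) = J (p a) (p b)" if ab: "a \<E> K" "b \<E> K" for a b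
  proof (rule ccontr)
    assume n: "~ ?thesis"
    let ?s = "Sep (prd K K) (%q. p (J (fs q) (sn q)) ~= J (p (fs q)) (p (sn q)))"
    have s: "q \<E> ?s \<longleftrightarrow> q \<E> prd K K & p (J (fs q) (sn q)) ~= J (p (fs q)) (p (sn q))" for q
      by (rule mem_Sep) (intro df)
    have "opr a b \<E> ?s" using s ab n by simp
    from prel_wf[OF this] obtain u where u: "u \<E> ?s" "!!v. prel v u ==> ~ v \<E> ?s" by blast
    obtain c d where cd: "u = opr c d" "c \<E> K" "d \<E> K" using u(1) s unfolding mem_prd by blast
    have oc: "Ord c" "Ord d" using cd KO by auto
    have ih: "p (J x y) = J (p x) (p y)" if "x \<E> K" "y \<E> K" "plt x y c d" for x y
    proof -
      have "prel (opr x y) u" unfolding prel_def cd using that KO oc by blast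
      thus ?thesis using u(2) s that by force
    qed
    have "p (J c d) = J (p c) (p d)"
    proof (rule ext)
      fix z
      have 1: "z \<E> p (J c d) \<longleftrightarrow> (EX y. y \<E> J c d & y \<E> K & z = p y)" by (rule pmem[OF KJ(1)[OF cd(2,3)]])
      have 2: "z \<E> J (p c) (p d) \<longleftrightarrow> (EX x y. Ord x & Ord y & plt x y (p c) (p d) & z = J x y)"
        by (rule mem_J[OF pO(1)[OF cd(2)] pO(1)[OF cd(3)]])
      show "z \<E> p (J c d) \<longleftrightarrow> z \<E> J (p c) (p d)"
      proof
        assume "z \<E> p (J c d)"
        then obtain y where y: "y \<E> J c d" "y \<E> K" "z = p y" using 1 by blast
        then obtain x w where xw: "Ord x" "Ord w" "plt x w c d" "y = J x w" using mem_J[OF oc] by blast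
        have "x \<E> K" "w \<E> K" using KJ(2,3)[OF y(2,2)] xw by simp_all
        hence "plt (p x) (p w) (p c) (p d)" "z = J (p x) (p w)" "Ord (p x)" "Ord (p w)"
          using ih[OF _ _ xw(3)] pplt[OF _ _ cd(2,3)] xw(3,4) y(3) pO(1) by simp_all
        thus "z \<E> J (p c) (p d)" unfolding 2 by blast
      next
        assume "z \<E> J (p c) (p d)"
        then obtain x y where xy: "Ord x" "Ord y" "plt x y (p c) (p d)" "z = J x y" unfolding 2 by blast
        have "un (p c) (p d) \<E> otp K" using pun[OF cd(2,3)] po by metis
        hence "sub (suc (un (p c) (p d))) (otp K)"
          using suc_le[OF Ord_un[OF pO(1)[OF cd(2)] pO(1)[OF cd(3)]] oO] by blast
        hence "x \<E> otp K" "y \<E> otp K" using plt_bound[OF xy(1,2) pO(1)[OF cd(2)] pO(1)[OF cd(3)] xy(3)] subD by blast+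
        then obtain x' y' where x': "x' \<E> K" "x = p x'" "y' \<E> K" "y = p y'" using psurj by metis
        have pl: "plt x' y' c d" using xy(3) pplt x' cd by blast
        have "z = p (J x' y')" using ih[OF x'(1,3) pl] xy(4) x' by simp
        thus "z \<E> p (J c d)" unfolding 1 using KJ(1)[OF x'(1,3)] J_less[OF oc _ _ pl] KO x' by blast
      qed
    qed
    thus False using u(1) s cd by simp
  qed
  have pJ1: "p (J1 a) = J1 (p a)" "p (J2 a) = J2 (p a)" if a: "a \<E> K" for a
  proof -
    have "p a = J (p (J1 a)) (p (J2 a))" using pJ[OF KJ(2,3)[OF a a]] J12[OF KO[OF a]] by simp
    thus "p (J1 a) = J1 (p a)" "p (J2 a) = J2 (p a)" using pO(1) KJ(2,3)[OF a a] by simp_all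
  qed
  \<comment> \<open>Tag 5: two different sets of the hull already differ at an element of the
    hull.\<close>
  have eX: "extnl X" unfolding extnl_def
  proof (intro allI impI, rule ccontr)
    fix x y assume xy: "x \<E> X" "y \<E> X" "ALL z. z \<E> X --> (z \<E> x \<longleftrightarrow> z \<E> y)" "x ~= y"
    obtain a b where ab: "a \<E> K" "x = Lf a" "b \<E> K" "y = Lf b" using xy X by metis
    obtain z where z: "(z \<E> x) ~= (z \<E> y)" using xy(4) ext by blast
    then obtain w where w: "Ord w" "z = Lf w" using Lf_mem ab KO Ord_memD by metis
    have d: "Dp (%x. (Lf x \<E> Lf a) ~= (Lf x \<E> Lf b))" by (intro df)
    have "(Lf w \<E> Lf a) ~= (Lf w \<E> Lf b)" using z w(2) ab(2,4) by simp
    note l = lst_P[of "%x. (Lf x \<E> Lf a) ~= (Lf x \<E> Lf b)", OF d w(1) this]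
    define c where "c = lst (%x. (Lf x \<E> Lf a) ~= (Lf x \<E> Lf b))"
    have "c \<E> K" "(Lf c \<E> x) ~= (Lf c \<E> y)" unfolding ab(2,4) c_def by (rule K4(2)[OF ab(1,3)], rule l)
    thus False using xy(3) X by blast
  qed
  have "Lf (p a) = col X (Lf a)"
  proof (rule set_induct[of "%a. Lf (p a) = col X (Lf a)", OF _ _ a])
    show "Dp (%a. Lf (p a) = col X (Lf a))" by (intro df)
    fix a assume a: "a \<E> K" and ih: "!!y. y \<E> a ==> y \<E> K ==> Lf (p y) = col X (Lf y)"
    define m where "m = J1 a"
    have oa: "Ord a" using KO a .
    have mK: "m \<E> K" using KJ(2)[OF a a] m_def by simp
    have om: "Ord m" "Ord (p m)" using KO[OF mK] pO(1)[OF mK] by auto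
    have ihm: "Lf (p y) = col X (Lf y)" if "y \<E> m" "y \<E> K" for y
      using ih[OF subD[OF J12(4)[OF oa]] that(2)] that(1) unfolding m_def by blast
    have at: "(Lf (p x) \<E> Lf (p y)) = (Lf x \<E> Lf y)" "(Lf (p x) = Lf (p y)) = (Lf x = Lf y)"
      if "x \<E> m" "x \<E> K" "y \<E> m" "y \<E> K" for x y
    proof -
      have X: "Lf x \<E> X" "Lf y \<E> X" unfolding X using that by blast+
      show "(Lf (p x) \<E> Lf (p y)) = (Lf x \<E> Lf y)" "(Lf (p x) = Lf (p y)) = (Lf x = Lf y)"
        unfolding ihm[OF that(1,2)] ihm[OF that(3,4)] by (rule col_mem[OF eX X], metis col_inj[OF eX X])
    qed
    have apm: "ap (lam m Lf) x = Lf x" "ap (lam (p m) Lf) (p x) = Lf (p x)" if "x \<E> m" "x \<E> K" for x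
      using that pm[OF that(2) mK] by (simp_all add: ap_lam[OF dL])
    \<comment> \<open>Elementarity for satisfaction in the segment \<open>m\<close>, by induction on
      codes; both sequences and constants come from \<open>K\<close>.\<close>
    have S: "ALL u. u \<E> K --> (u \<E> St m c \<longleftrightarrow> p u \<E> St (p m) (p c))" if c: "c \<E> K" for c
    proof (rule set_induct[of "%c. ALL u. u \<E> K --> (u \<E> St m c \<longleftrightarrow> p u \<E> St (p m) (p c))", OF _ _ c])
      show "Dp (%c. ALL u. u \<E> K --> (u \<E> St m c \<longleftrightarrow> p u \<E> St (p m) (p c)))" by (intro df)
      fix c assume c: "c \<E> K" and ihc: "!!y. y \<E> c ==> y \<E> K ==> ALL u. u \<E> K --> (u \<E> St m y \<longleftrightarrow> p u \<E> St (p m) (p y))"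
      have oc: "Ord c" "Ord (p c)" using KO[OF c] pO(1)[OF c] by auto
      have j12: "J1 x \<E> K" "J2 x \<E> K" if "x \<E> K" for x using KJ(2,3)[OF that that] by auto
      have cK: "J1 c \<E> K" "J2 c \<E> K" "J1 (J2 c) \<E> K" "J2 (J2 c) \<E> K" by (intro j12 c)+
      have pc: "J1 (p c) = p (J1 c)" "J2 (p c) = p (J2 c)" "J1 (p (J2 c)) = p (J1 (J2 c))" "J2 (p (J2 c)) = p (J2 (J2 c))"
        using pJ1 c cK by simp_all
      have pn: "p (J1 c) = nm k \<longleftrightarrow> J1 c = nm k" for k using pe[OF cK(1) nK] pnm by metis
      have ihJ: "u \<E> St m d \<longleftrightarrow> p u \<E> St (p m) (p d)" if "J1 c ~= emp" "u \<E> K" "d = J2 c | d = J1 (J2 c) | d = J2 (J2 c)" for u d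
      proof -
        note j = J12[OF oc(1)]
        have l: "J2 c \<E> c" using J_gt2[OF j(1,2) that(1)] j(3) by simp
        have "d \<E> c" using that(3) l Ord_le_less[OF j(2) oc(1) _ _ l] J12[OF j(2)] by blast
        thus ?thesis using ihc that cK by blast
      qed
      have mp: "x \<E> m \<longleftrightarrow> p x \<E> p m" if "x \<E> K" for x using pm that mK by blast
      show "ALL u. u \<E> K --> (u \<E> St m c \<longleftrightarrow> p u \<E> St (p m) (p c))"
      proof (intro allI impI)
        fix u assume u: "u \<E> K"
        have uK: "J1 u \<E> K" "J2 u \<E> K" "J1 (J2 u) \<E> K" "J2 (J2 u) \<E> K" by (intro j12 u)+
        have pu: "J1 (p u) = p (J1 u)" "J2 (p u) = p (J2 u)" "J1 (p (J2 u)) = p (J1 (J2 u))" "J2 (p (J2 u)) = p (J2 (J2 u))"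
          using pJ1 u uK by simp_all
        note st = sat_unfold[OF oc(1), of u m "lam m Lf", folded St_def]
        note st' = sat_unfold[OF oc(2), of "p u" "p m" "lam (p m) Lf", folded St_def, unfolded pc pu pn]
        show "u \<E> St m c \<longleftrightarrow> p u \<E> St (p m) (p c)"
        proof (cases "u \<E> m")
          case False
          hence "~ p u \<E> p m" using mp u by blast
          thus ?thesis unfolding st st' using False by blast
        next
          case True
          have ou: "Ord u" using KO u .
          note j = J12[OF ou] note j2 = J12[OF j(2)]
          have um: "J1 u \<E> m" "J2 u \<E> m" using Ord_le_less[OF ou om(1) _ _ True] j by blast+
          hence um2: "J1 (J2 u) \<E> m" using Ord_le_less[OF j(2) om(1) _ _ um(2)] j2 by blast
          have c0: "ap (lam (p m) Lf) (p (J1 u)) \<E> ap (lam (p m) Lf) (p (J1 (J2 u))) \<longleftrightarrow>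
              ap (lam m Lf) (J1 u) \<E> ap (lam m Lf) (J1 (J2 u))"
            "ap (lam (p m) Lf) (p (J1 u)) = ap (lam (p m) Lf) (p (J1 (J2 u))) \<longleftrightarrow>
              ap (lam m Lf) (J1 u) = ap (lam m Lf) (J1 (J2 u))"
            using at[OF um(1) uK(1) um2 uK(3)] apm[OF um(1) uK(1)] apm[OF um2 uK(3)] by simp_all
          have c2: "(p (J2 c) \<E> p m & ap (lam (p m) Lf) (p (J1 u)) = ap (lam (p m) Lf) (p (J2 c))) \<longleftrightarrow>
              (J2 c \<E> m & ap (lam m Lf) (J1 u) = ap (lam m Lf) (J2 c))"
            using at(2)[OF um(1) uK(1) _ cK(2)] apm[OF um(1) uK(1)] apm[OF _ cK(2)] mp[OF cK(2)] by auto
          show ?thesis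
          proof (cases "J1 c = emp")
            case e: True
            hence "J1 c ~= nm 3" "J1 c ~= nm 4" "J1 c ~= nm 5" unfolding numeral_eq_Suc nm.simps by auto
            thus ?thesis unfolding st st' c0 c2 using True mp[OF u] by simp
          next
            case e: False
            have c4: "(EX x. x \<E> p m & J x (p u) \<E> St (p m) (p (J2 c))) \<longleftrightarrow> (EX x. x \<E> m & J x u \<E> St m (J2 c))"
            proof
              assume "EX x. x \<E> p m & J x (p u) \<E> St (p m) (p (J2 c))"
              then obtain x where x: "x \<E> p m" "J x (p u) \<E> St (p m) (p (J2 c))" by blast
              then obtain y where y: "y \<E> m" "y \<E> K" "x = p y" using pmem[OF mK] by blast
              have "J y u \<E> St m (J2 c)" using x(2) ihJ[OF e KJ(1)[OF y(2) u], of "J2 c"] pJ[OF y(2) u] y(3) by simp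
              thus "EX x. x \<E> m & J x u \<E> St m (J2 c)" using y by blast
            next
              assume "EX x. x \<E> m & J x u \<E> St m (J2 c)"
              then obtain x where x: "x \<E> m & J x u \<E> St m (J2 c)" by blast
              \<comment> \<open>Tag 4 applied to \<open>m\<close> and \<open>J (J2 c) u\<close>, so
                the witness lies in \<open>K\<close>.\<close>
              define y where "y = lst (%x. x \<E> m & J x u \<E> St m (J2 c))"
              have d: "Dp (%x. x \<E> m & J x u \<E> St m (J2 c))" by (intro df)
              have y: "y \<E> m & J y u \<E> St m (J2 c)"
                using lst_P[of "%x. x \<E> m & J x u \<E> St m (J2 c)", OF d _ x] Ord_memD[OF om(1)] x unfolding y_def by blast
              have yK: "y \<E> K" using K4(1)[OF mK KJ(1)[OF cK(2) u]] KO[OF cK(2)] ou unfolding y_def by simp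
              have "J (p y) (p u) \<E> St (p m) (p (J2 c))"
                using y ihJ[OF e KJ(1)[OF yK u], of "J2 c"] pJ[OF yK u] by simp
              thus "EX x. x \<E> p m & J x (p u) \<E> St (p m) (p (J2 c))" using y mp[OF yK] by blast
            qed
            have c5: "J (p (J1 u)) (p (J2 (J2 u))) \<E> St (p m) (p (J2 c)) \<longleftrightarrow> J (J1 u) (J2 (J2 u)) \<E> St m (J2 c)"
              using ihJ[OF e KJ(1)[OF uK(1,4)], of "J2 c"] pJ[OF uK(1,4)] by simp
            have c3: "p u \<E> St (p m) (p (J1 (J2 c))) \<longleftrightarrow> u \<E> St m (J1 (J2 c))"
              "p u \<E> St (p m) (p (J2 (J2 c))) \<longleftrightarrow> u \<E> St m (J2 (J2 c))" using ihJ[OF e u] by simp_all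
            show ?thesis unfolding st st' c0 c2 c3 c4 c5 using True mp[OF u] by simp
          qed
        qed
      qed
    qed
    have oe: "Ord (J2 a)" "J2 a \<E> K" "emp \<E> K" using J12[OF oa] KJ(3)[OF a a] nK[of 0] by simp_all
    have pemp: "p emp = emp" using pnm[of 0] by simp
    have aJ: "a = J m (J2 a)" unfolding m_def using J12[OF oa] by simp
    have pa: "p a = J (p m) (p (J2 a))" using aJ pJ[OF mK oe(2)] by simp
    have SJ: "J (p y) emp \<E> St (p m) (p (J2 a)) \<longleftrightarrow> J y emp \<E> St m (J2 a)" if "y \<E> K" for y
      using S[OF oe(2)] KJ(1)[OF that oe(3)] pJ[OF that oe(3)] pemp by metis
    show "Lf (p a) = col X (Lf a)"
    proof (rule ext)
      fix z
      have aX: "Lf a \<E> X" using X a by blast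
      have "z \<E> Lf (p a) \<longleftrightarrow> (EX y. y \<E> p m & J y emp \<E> St (p m) (p (J2 a)) & z = Lf y)"
        unfolding pa using mem_Lf_J om pO(1)[OF oe(2)] by blast
      also have "\<dots> \<longleftrightarrow> (EX y. y \<E> m & y \<E> K & J y emp \<E> St m (J2 a) & z = col X (Lf y))"
        unfolding pmem[OF mK] using SJ ihm by metis
      also have "\<dots> \<longleftrightarrow> (EX w. w \<E> Lf a & w \<E> X & z = col X w)"
      proof
        assume "EX y. y \<E> m & y \<E> K & J y emp \<E> St m (J2 a) & z = col X (Lf y)"
        then obtain y where y: "y \<E> m" "y \<E> K" "J y emp \<E> St m (J2 a)" "z = col X (Lf y)" by blast
        have "Lf y \<E> Lf a" using mem_Lf_J[OF om(1) oe(1), of "Lf y"] aJ y by metis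
        thus "EX w. w \<E> Lf a & w \<E> X & z = col X w" using y X by blast
      next
        assume "EX w. w \<E> Lf a & w \<E> X & z = col X w"
        then obtain w where w: "w \<E> Lf a" "w \<E> X" "z = col X w" by blast
        obtain k where k: "k \<E> K" "w = Lf k" using w X by blast
        obtain y where y: "y \<E> m" "J y emp \<E> St m (J2 a)" "w = Lf y"
          using w(1) mem_Lf_J[OF om(1) oe(1), of w] aJ by metis
        \<comment> \<open>The name \<open>y\<close> may lie outside \<open>K\<close>; tag 6 replaces
          it by one inside.\<close>
        define x where "x = lst (%x. x \<E> J1 a & J x emp \<E> St (J1 a) (J2 a) & Lf x = Lf k)"
        have d: "Dp (%x. x \<E> J1 a & J x emp \<E> St (J1 a) (J2 a) & Lf x = Lf k)" by (intro df)
        have "y \<E> J1 a & J y emp \<E> St (J1 a) (J2 a) & Lf y = Lf k" using y k m_def by simp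
        from lst_P[of "%x. x \<E> J1 a & J x emp \<E> St (J1 a) (J2 a) & Lf x = Lf k", OF d _ this]
        have x: "x \<E> m" "J x emp \<E> St m (J2 a)" "Lf x = w" using Ord_memD[OF om(1) y(1)] k unfolding x_def m_def by blast+
        have "x \<E> K" unfolding x_def by (rule K4(3)[OF a k(1)])
        thus "EX y. y \<E> m & y \<E> K & J y emp \<E> St m (J2 a) & z = col X (Lf y)" using x w by blast
      qed
      also have "\<dots> \<longleftrightarrow> z \<E> col X (Lf a)" using col[OF aX] by blast
      finally show "z \<E> Lf (p a) \<longleftrightarrow> z \<E> col X (Lf a)" .
    qed
  qed
  thus ?thesis unfolding p_def X_def .
qed

lemma sj_un2: assumes "sub om k" "sj k (prd k k)" "sj k a" "sj k b" shows "sj k (un a b)"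
proof -
  obtain f g where fg: "ALL y. y \<E> a --> (EX x. x \<E> k & ap f x = y)" "ALL y. y \<E> b --> (EX x. x \<E> k & ap g x = y)"
    using assms(3,4) unfolding sj_def by blast
  have "sj (prd k k) (un a b)"
  proof (rule sjI[where F="%q. if fs q = emp then ap f (sn q) else ap g (sn q)"])
    show "Dg (%q. if fs q = emp then ap f (sn q) else ap g (sn q))" by (intro df)
    fix y assume "y \<E> un a b"
    hence "y \<E> a | y \<E> b" by simp
    moreover have "nm 0 \<E> k" "nm 1 \<E> k" using assms(1) nm_om subD by blast+
    ultimately show "EX q. q \<E> prd k k & (if fs q = emp then ap f (sn q) else ap g (sn q)) = y"
    proof (elim disjE)
      assume "y \<E> a"
      then obtain x where "x \<E> k" "ap f x = y" using fg by blast
      thus ?thesis using \<open>nm 0 \<E> k\<close> by (intro exI[of _ "opr (nm 0) x"]) simp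
    next
      assume "y \<E> b"
      then obtain x where "x \<E> k" "ap g x = y" using fg by blast
      thus ?thesis using \<open>nm 1 \<E> k\<close> by (intro exI[of _ "opr (nm 1) x"]) simp
    qed
  qed
  thus ?thesis using assms(2) sj_trans by blast
qed

text \<open>Collapse the hull of \<open>d\<close>, \<open>om\<close> and a name of \<open>x\<close>.
  The sets named below \<open>d\<close> form a transitive set and do not move, so neither does
  \<open>x\<close>, and the collapsed name is an element of an ordinal onto which \<open>k\<close>
  maps.\<close>

lemma condensation:
  assumes k: "Jcl k" "sub om k" and d: "Ord d" "sj k d" and x: "inL x" "!!y. y \<E> x ==> EX a. a \<E> d & y = Lf a"
  shows "EX a. Ord a & sj k (suc a) & x = Lf a"
proof -
  obtain a0 where a0: "Ord a0" "x = Lf a0" using x unfolding inL_def by blast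
  have kk: "sj k (prd k k)" by (rule Jcl_sj[OF k(1)])
  have ok: "Ord k" using k(1) Jcl_def by blast
  have "sj k (sing a0)"
  proof -
    have "fin (sing a0)" using fin_insert[OF fin_emp, of a0] fin_sub by (auto simp: sub_def)
    then obtain n where "n \<E> om" "sj n (sing a0)" unfolding fin_def by blast
    thus ?thesis using sj_mono[of n "sing a0" k] sub_refl Ord_subD[OF Ord_om] k(2) sub_trans by blast
  qed
  hence "sj k (un (un d om) (sing a0))" using sj_un2[OF k(2) kk] sj_sub[OF k(2)] d(2) by blast
  then obtain s where s: "!!y. y \<E> un (un d om) (sing a0) ==> EX x. x \<E> k & ap s x = y" unfolding sj_def by blast
  define K where "K = Im (hull s) k"
  have dh: "Dg (hull s)" by (intro df)
  have K: "y \<E> K \<longleftrightarrow> (EX x. x \<E> k & y = hull s x)" for y unfolding K_def by (rule mem_Im[OF dh])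
  have KO: "Ord y" if "y \<E> K" for y using that[unfolded K] Ord_hull Ord_memD[OF ok] by blast
  have nk: "nm i \<E> k" for i using nm_om k(2) subD by blast
  have seed: "y \<E> K" if y: "y \<E> un (un d om) (sing a0)" for y
  proof -
    obtain t where t: "t \<E> k" "ap s t = y" using s[OF y] by blast
    have "Ord y" using y d(1) om_Ord a0 Ord_memD by auto
    hence "hull s (J emp t) = y" using hull0[of t s] t Ord_memD[OF ok] by simp
    moreover have "J emp t \<E> k" using k(1) nk[of 0] t unfolding Jcl_def by simp
    ultimately show ?thesis unfolding K by metis
  qed
  have sk: "skolem (nm i) a b \<E> K" if ab: "a \<E> K" "b \<E> K" "i ~= 0" for a b i
  proof -
    obtain u v where uv: "u \<E> k" "a = hull s u" "v \<E> k" "b = hull s v" using ab K by metis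
    have "nm i ~= emp" using nm_inj[of i 0] ab(3) by simp
    hence "skolem (nm i) a b = hull s (J (nm i) (J u v))"
      using hullS[of "nm i" u v s] uv Ord_memD[OF ok] by simp
    moreover have "J (nm i) (J u v) \<E> k" using k(1) nk uv unfolding Jcl_def by simp
    ultimately show ?thesis unfolding K by metis
  qed
  have omK: "sub om K" "sub d K" "a0 \<E> K" using seed by (auto simp: sub_def)
  have c: "Lf (col K a0) = col (Im Lf K) x"
    unfolding a0(2) by (rule collapse_Lf[OF KO omK(1) sk omK(3)])
  have dL: "Dg Lf" by (intro df)
  have "col (Im Lf K) x = x"
  proof (rule col_id[where t="Im Lf d"])
    fix u v assume "u \<E> Im Lf d" "v \<E> u"
    thus "v \<E> Im Lf d" unfolding mem_Im[OF dL] using Lf_mem Ord_memD[OF d(1)] Ord_trans[OF d(1)] by metis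
  next
    show "sub (Im Lf d) (Im Lf K)" using omK(2) by (auto simp: sub_def mem_Im[OF dL])
    show "x \<E> Im Lf K" unfolding mem_Im[OF dL] using a0 omK(3) by blast
    show "sub x (Im Lf d)" using x(2) by (auto simp: sub_def mem_Im[OF dL])
  qed
  moreover have "sj k (suc (col K a0))"
  proof -
    have "sj k K" unfolding K_def by (rule sj_Im[OF dh])
    moreover have dc: "Dg (col K)" by (intro df)
    ultimately have "sj k (otp K)" unfolding otp_def using sj_Im[OF dc] sj_trans by blast
    moreover have "col K a0 \<E> otp K" using omK(3) mem_otp by blast
    hence "sub (suc (col K a0)) (otp K)" using otp_trans by (auto simp: sub_def)
    ultimately show ?thesis using sj_mono sub_refl by blast
  qed
  ultimately show ?thesis using c col_Ord(1)[OF KO omK(3)] by metis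
qed

end

context VL
begin

text \<open>For an infinite cardinal \<open>k\<close> these are the sets of hereditary size at most
  \<open>k\<close>; \<open>HL_I\<close> is the closure property.\<close>

definition "HL k = Im Lf (nx k)"
lemma mem_HL: "x \<E> HL k \<longleftrightarrow> (EX a. a \<E> nx k & x = Lf a)" unfolding HL_def by (rule mem_Im) (intro df)
lemma sj_HL: "sj (nx k) (HL k)" unfolding HL_def by (rule sj_Im) (intro df)

text \<open>By regularity the names of the elements are bounded below the successor of
  \<open>k\<close>, so condensation applies.\<close>

lemma HL_I: assumes k: "Card k" "sub om k" and s: "sj k x" "!!y. y \<E> x ==> y \<E> HL k" shows "x \<E> HL k"
proof -
  have di: "Dg ix" by (intro df)
  have ixn: "ix y \<E> nx k" if "y \<E> HL k" for y
  proof -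
    from that[unfolded mem_HL] obtain a where a: "a \<E> nx k" "y = Lf a" by blast
    have d: "Dp (%z. y = Lf z)" by (intro df)
    have "Ord a" using Ord_memD[OF nx(1) a(1)] .
    hence "sub (ix y) a" using lst_le[of "%z. y = Lf z", OF d _ a(2)] unfolding ix_def by blast
    thus ?thesis using Ord_le_less[OF \<open>Ord a\<close> nx(1) ix(1) _ a(1)] by blast
  qed
  have "sub (Im ix x) (nx k)" using s(2) ixn by (auto simp: sub_def mem_Im[OF di])
  moreover have "sj k (Im ix x)" using s(1) sj_Im[OF di] sj_trans by blast
  ultimately obtain b where b: "b \<E> nx k" "ALL y. y \<E> Im ix x --> y \<E> b" using regular[OF k(2) inf_sq[OF k]] by blast
  have "EX a. Ord a & sj k (suc a) & x = Lf a"
  proof (rule condensation[OF Card_Jcl[OF k] k(2) _ _ VL])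
    show "Ord b" "sj k b" using b nx Ord_memD by blast+
    fix y assume "y \<E> x"
    hence "ix y \<E> b" using b(2) by (auto simp: mem_Im[OF di])
    thus "EX a. a \<E> b & y = Lf a" using ix(2) by metis
  qed
  then obtain a where a: "Ord a" "sj k (suc a)" "x = Lf a" by blast
  have "sj k a" using sj_mono[OF a(2) sub_refl] by (auto simp: sub_def)
  thus ?thesis unfolding mem_HL using less_nx a by blast
qed
lemma Ord_HL: assumes k: "Card k" "sub om k" and x: "x \<E> nx k" shows "x \<E> HL k"
proof -
  have "x \<E> nx k --> x \<E> HL k"
  proof (rule Ord_induct[of "%x. x \<E> nx k --> x \<E> HL k"])
    show "Dp (%x. x \<E> nx k --> x \<E> HL k)" by (intro df)
    show "Ord x" using Ord_memD[OF nx(1) x] .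
    fix x assume "Ord x" "!!y. y \<E> x ==> y \<E> nx k --> y \<E> HL k"
    thus "x \<E> nx k --> x \<E> HL k" using HL_I[OF k nx(3)] Ord_trans[OF nx(1)] by blast
  qed
  thus ?thesis using x by blast
qed
end

section \<open>Forcing over a model of V = L\<close>

context VL
begin

lemma ix_mem: assumes "y \<E> x" shows "ix y \<E> ix x"
proof -
  have "y \<E> Lf (ix x)" using assms ix(2) by simp
  then obtain a where a: "a \<E> ix x" "y = Lf a" using Lf_mem ix(1) by blast
  have o: "Ord a" using Ord_memD ix(1) a by blast
  have "Dp (%z. y = Lf z)" by (intro df)
  from lst_le[of "%z. y = Lf z", OF this o a(2)] have "sub (ix y) a" unfolding ix_def .
  thus ?thesis using Ord_le_less[OF o ix(1) ix(1) _ a(1)] by blast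
qed
lemma ix_trans: "ix x \<E> ix y ==> ix y \<E> ix z ==> ix x \<E> ix z" using Ord_trans ix(1) by blast
lemma ix_opr: assumes "opr z s \<E> x" shows "ix z \<E> ix x"
proof -
  have "z \<E> sing z" "sing z \<E> opr z s" by (simp_all add: opr_def)
  thus ?thesis using assms ix_mem ix_trans by blast
qed
lemma tc_opr: assumes "x \<E> tc a" "opr z s \<E> x" shows "z \<E> tc a"
proof -
  have "z \<E> sing z" "sing z \<E> opr z s" by (simp_all add: opr_def)
  thus ?thesis using assms tc(2) by blast
qed
text \<open>Serves as induction on names: a name that occurs as first component in an element of
  \<open>x\<close> has a smaller index than \<open>x\<close>.\<close>

lemma ix_induct: assumes "Dp P" "!!x. (!!y. ix y \<E> ix x ==> P y) ==> P x" shows "P x"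
proof -
  have "ALL x. ix x = a --> P x" if "Ord a" for a
  proof (rule Ord_induct[of "%a. ALL x. ix x = a --> P x", OF _ _ that])
    show "Dp (%a. ALL x. ix x = a --> P x)" by (intro df dfp1[OF assms(1)])
  qed (use assms(2) in blast)
  thus ?thesis using ix(1) by blast
qed

end

section \<open>The forcing relation for equality and membership\<close>

locale forcing = VL E for E :: "nat => nat => bool" (infix "\<E>" 50) +
  fixes P :: nat and le :: "nat => nat => bool" and one :: nat
  assumes le_Df: "Df (%e. le (e 0) (e 1))"
    and le_P: "le p q ==> p \<E> P & q \<E> P"
    and le_refl: "p \<E> P ==> le p p"
    and le_trans: "le p q ==> le q r ==> le p r"
    and one: "p \<E> P ==> le p one" and one_P: "one \<E> P"
begin

lemma df_le[df]: "Dt t ==> Dt s ==> Df (%e. le (t e) (s e))" by (rule dfp2[OF le_Df])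

text \<open>A name is an arbitrary set; its elements that are not ordered pairs are ignored.\<close>

definition "nrel v u \<longleftrightarrow> (EX z w x y s t. v = opr z w & u = opr x y & opr z s \<E> x & opr w t \<E> y)"
definition "eqs u = wrec nrel (%u f. Sep P (%p.
   (ALL z s q. opr z s \<E> fs u --> le q p --> le q s --> (EX r w t. le r q & opr w t \<E> sn u & le r t & r \<E> ap f (opr z w))) &
   (ALL w t q. opr w t \<E> sn u --> le q p --> le q t --> (EX r z s. le r q & opr z s \<E> fs u & le r s & r \<E> ap f (opr z w))))) u"
definition "feq p x y \<longleftrightarrow> p \<E> eqs (opr x y)"
text \<open>Stronger than the usual relation, which asks for such conditions densely below
  \<open>p\<close>. A generic filter meets that dense set, so membership in the extension is the
  same.\<close>

definition "fm p x y \<longleftrightarrow> (EX w s. opr w s \<E> y & le p s & feq p x w)"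

lemma df_eqs[df]: "Dt t ==> Dt (%e. eqs (t e))" unfolding eqs_def nrel_def by (intro df)
lemma df_feq[df]: "Dt t ==> Dt s ==> Dt r ==> Df (%e. feq (t e) (s e) (r e))" unfolding feq_def by (intro df)
lemma df_fm[df]: "Dt t ==> Dt s ==> Dt r ==> Df (%e. fm (t e) (s e) (r e))"
  unfolding fm_def by (intro df dff_Suc)

text \<open>Recursion along \<open>nrel\<close>: the index of the first name decreases, and the
  pairs of names below \<open>x\<close>, \<open>y\<close> lie in the square of a transitive
  set.\<close>

lemma feq: "feq p x y \<longleftrightarrow> p \<E> P &
   (ALL z s q. opr z s \<E> x --> le q p --> le q s --> (EX r w t. le r q & opr w t \<E> y & le r t & feq r z w)) &
   (ALL w t q. opr w t \<E> y --> le q p --> le q t --> (EX r z s. le r q & opr z s \<E> x & le r s & feq r z w))"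
proof -
  define G where "G u f = Sep P (%p.
   (ALL z s q. opr z s \<E> fs u --> le q p --> le q s --> (EX r w t. le r q & opr w t \<E> sn u & le r t & r \<E> ap f (opr z w))) &
   (ALL w t q. opr w t \<E> sn u --> le q p --> le q t --> (EX r z s. le r q & opr z s \<E> fs u & le r s & r \<E> ap f (opr z w))))" for u f
  have eqs: "eqs = wrec nrel G" unfolding eqs_def G_def by (rule HOL.ext) simp
  have dR: "Df (%e. nrel (e 0) (e 1))" unfolding nrel_def by (intro df)
  have dG: "Dt (%e. G (e 0) (e 1))" unfolding G_def by (intro df)
  have dE: "Dg eqs" by (intro df)
  let ?u = "opr x y"
  define T where "T = tc (upair x y)"
  have Tx: "x \<E> T" "y \<E> T" unfolding T_def using tc[of "upair x y"] by (meson mem_upair)+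
  have cl: "EX d. u \<E> d & (ALL u v. u \<E> d --> nrel v u --> v \<E> d)" for u
  proof (cases "EX x y. u = opr x y")
    case False thus ?thesis by (intro exI[of _ "sing u"]) (auto simp: nrel_def)
  next
    case True
    then obtain x y where u: "u = opr x y" by blast
    define T where "T = tc (upair x y)"
    have Tx: "x \<E> T" "y \<E> T" unfolding T_def using tc[of "upair x y"] by (meson mem_upair)+
    have "v \<E> prd T T" if w: "w \<E> prd T T" and v: "nrel v w" for v w
    proof -
      obtain z z' a b s t where *: "v = opr z z'" "w = opr a b" "opr z s \<E> a" "opr z' t \<E> b"
        using v unfolding nrel_def by blast
      have "a \<E> T" "b \<E> T" using w *(2) by simp_all
      hence "z \<E> T" "z' \<E> T" using * tc_opr unfolding T_def by blast+
      thus ?thesis using *(1) by simp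
    qed
    thus ?thesis using Tx u by (intro exI[of _ "prd T T"]) auto
  qed
  have wf: "EX u. u \<E> s & (ALL v. nrel v u --> ~ v \<E> s)" if "x \<E> s" for s x
  proof -
    let ?P = "%a. EX u. u \<E> s & a = ix (fs u)"
    have d: "Dp ?P" by (intro df)
    have "?P (ix (fs x))" using that by blast
    note l = lst(2,3)[of ?P, OF d ix(1) this]
    obtain u where u: "u \<E> s" "lst ?P = ix (fs u)" using l(1) by blast
    have "~ v \<E> s" if "nrel v u" for v
    proof -
      have "ix (fs v) \<E> ix (fs u)" using that ix_opr unfolding nrel_def by auto
      thus ?thesis using l(2) u(2) by metis
    qed
    thus ?thesis using u(1) by blast
  qed
  have pr: "v \<E> set_of (%v. nrel v ?u) \<longleftrightarrow> nrel v ?u" for v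
  proof (rule mem_Cl)
    obtain d where "?u \<E> d" "ALL u v. u \<E> d --> nrel v u --> v \<E> d" using cl by blast
    thus "isset (%v. nrel v ?u)" by (intro isset_bounded[where a=d] dfp2[OF dR] df) blast
  qed
  have "eqs ?u = G ?u (lam (set_of (%v. nrel v ?u)) eqs)" unfolding eqs by (rule wrec[OF dR dG cl wf])
  moreover have "ap (lam (set_of (%v. nrel v ?u)) eqs) (opr z w) = eqs (opr z w)" if "opr z s \<E> x" "opr w t \<E> y" for z w s t
  proof (rule ap_lam[OF dE])
    show "opr z w \<E> set_of (%v. nrel v ?u)" by (subst pr) (use that in \<open>unfold nrel_def, blast\<close>)
  qed
  moreover define g where "g = lam (set_of (%v. nrel v ?u)) eqs"
  ultimately have g: "eqs ?u = G ?u g" "!!z w s t. opr z s \<E> x ==> opr w t \<E> y ==> ap g (opr z w) = eqs (opr z w)" by blast+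
  have "p \<E> G ?u g \<longleftrightarrow> p \<E> P &
   (ALL z s q. opr z s \<E> x --> le q p --> le q s --> (EX r w t. le r q & opr w t \<E> y & le r t & r \<E> ap g (opr z w))) &
   (ALL w t q. opr w t \<E> y --> le q p --> le q t --> (EX r z s. le r q & opr z s \<E> x & le r s & r \<E> ap g (opr z w)))"
    unfolding G_def by (subst mem_Sep) (intro df, simp)
  moreover have "(r \<E> ap g (opr z w)) = (r \<E> eqs (opr z w))" if "opr z s \<E> x" "opr w t \<E> y" for r z s w t
    using g(2)[OF that] by simp
  ultimately show ?thesis unfolding feq_def g(1) by (simp cong: conj_cong imp_cong)
qed

lemma feq_mono: assumes "feq p x y" "le q p" shows "feq q x y"
  using assms(1) le_trans[OF _ assms(2)] le_P[OF assms(2)] unfolding feq[of _ x y] by meson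
lemma fm_mono: "fm p x y ==> le q p ==> fm q x y"
  unfolding fm_def using feq_mono le_trans by blast
lemma feq_refl: "p \<E> P ==> feq p x x"
proof -
  have "ALL p. p \<E> P --> feq p x x"
  proof (rule ix_induct[of "%x. ALL p. p \<E> P --> feq p x x"])
    show "Dp (%x. ALL p. p \<E> P --> feq p x x)" by (intro df)
    fix x assume ih: "!!y. ix y \<E> ix x ==> ALL p. p \<E> P --> feq p y y"
    show "ALL p. p \<E> P --> feq p x x"
    proof (intro allI impI)
      fix p assume p: "p \<E> P"
      have *: "EX r w t. le r q & opr w t \<E> x & le r t & feq r z w" "EX r w t. le r q & opr w t \<E> x & le r t & feq r w z"
        if "opr z s \<E> x" "le q s" for z s q
        using ih[OF ix_opr[OF that(1)]] that le_refl le_P by blast+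
      show "feq p x x" by (subst feq) (use p * in blast)
    qed
  qed
  thus "p \<E> P ==> feq p x x" by blast
qed
lemma feq_sym: "feq p x y ==> feq p y x"
proof -
  have "ALL y p. feq p x y \<longleftrightarrow> feq p y x"
  proof (rule ix_induct[of "%x. ALL y p. feq p x y \<longleftrightarrow> feq p y x"])
    show "Dp (%x. ALL y p. feq p x y \<longleftrightarrow> feq p y x)" by (intro df)
    fix x assume ih: "!!y. ix y \<E> ix x ==> ALL w p. feq p y w \<longleftrightarrow> feq p w y"
    have *: "opr z s \<E> x & le r s & feq r z w \<longleftrightarrow> opr z s \<E> x & le r s & feq r w z" for z s r w
      using ih[OF ix_opr, of z s] by blast
    have **: "opr z s \<E> x --> le q p --> le q s --> (EX r w t. le r q & opr w t \<E> y & le r t & feq r z w)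
      \<longleftrightarrow> opr z s \<E> x --> le q p --> le q s --> (EX r w t. le r q & opr w t \<E> y & le r t & feq r w z)" for z s q p y
      using ih[OF ix_opr, of z s] by blast
    show "ALL y p. feq p x y \<longleftrightarrow> feq p y x"
      unfolding feq[of _ x] feq[of _ _ x] * using ih[OF ix_opr] by meson
  qed
  thus "feq p x y ==> feq p y x" by blast
qed
lemma feq_trans: "feq p x y ==> feq p y u ==> feq p x u"
proof -
  have "ALL y u p. feq p x y --> feq p y u --> feq p x u"
  proof (rule ix_induct[of "%x. ALL y u p. feq p x y --> feq p y u --> feq p x u"])
    show "Dp (%x. ALL y u p. feq p x y --> feq p y u --> feq p x u)" by (intro df)
    fix x assume ih: "!!y. ix y \<E> ix x ==> ALL w u p. feq p y w --> feq p w u --> feq p y u"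
    show "ALL y u p. feq p x y --> feq p y u --> feq p x u"
    proof (intro allI impI)
      fix y u p assume xy: "feq p x y" and yu: "feq p y u"
      note a = xy[unfolded feq[of p x y]] and b = yu[unfolded feq[of p y u]]
      show "feq p x u"
      proof (subst feq, intro conjI allI impI)
        show "p \<E> P" using a by blast
        fix z s q assume z: "opr z s \<E> x" "le q p" "le q s"
        then obtain r w t where r: "le r q" "opr w t \<E> y" "le r t" "feq r z w" using a by blast
        have "le r p" using le_trans r z by blast
        then obtain r' v t' where r': "le r' r" "opr v t' \<E> u" "le r' t'" "feq r' w v" using b r by blast
        have "feq r' z v" using ih[OF ix_opr[OF z(1)]] feq_mono r r' by blast
        thus "EX r w t. le r q & opr w t \<E> u & le r t & feq r z w" using r r' le_trans by blast
      next
        fix v t q assume v: "opr v t \<E> u" "le q p" "le q t"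
        then obtain r w s where r: "le r q" "opr w s \<E> y" "le r s" "feq r w v" using b by blast
        have "le r p" using le_trans r v by blast
        then obtain r' z s' where r': "le r' r" "opr z s' \<E> x" "le r' s'" "feq r' z w" using a r by blast
        have "feq r' z v" using ih[OF ix_opr[OF r'(2)]] feq_mono r r' by blast
        thus "EX r z s. le r q & opr z s \<E> x & le r s & feq r z v" using r r' le_trans by blast
      qed
    qed
  qed
  thus "feq p x y ==> feq p y u ==> feq p x u" by blast
qed

definition "ck = wrec (%v u. v \<E> u) (%u f. Im (%z. opr (ap f z) one) u)"
lemma df_ck[df]: "Dt t ==> Dt (%e. ck (t e))" unfolding ck_def by (intro df)
lemma mem_ck: "w \<E> ck x \<longleftrightarrow> (EX z. z \<E> x & w = opr (ck z) one)"
proof -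
  have d: "Dg ck" by (intro df)
  have "ck x = Im (%z. opr (ap (lam (set_of (%v. v \<E> x)) ck) z) one) x"
    unfolding ck_def
  proof (rule wrec)
    show "Df (%e. e 0 \<E> e 1)" "Dt (%e. Im (%z. opr (ap (e 1) z) one) (e 0))" by (intro df)+
    show "EX d. x \<E> d & (ALL u v. u \<E> d --> v \<E> u --> v \<E> d)" for x using tc by blast
  qed (use foundation in blast)
  also have "set_of (%v. v \<E> x) = x" by (rule Cl_eqI) simp
  also have "Im (%z. opr (ap (lam x ck) z) one) x = Im (%z. opr (ck z) one) x"
    by (rule Im_cong) (simp add: ap_lam[OF d])
  finally show ?thesis by (simp add: mem_Im df)
qed
lemma opr_ck: "opr w s \<E> ck x \<longleftrightarrow> s = one & (EX z. z \<E> x & w = ck z)" unfolding mem_ck by auto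
text \<open>Every condition is below \<open>one\<close>, so an element on one side finds on the
  other an element with a canonical name forced equal; induction does the rest.\<close>

lemma feq_ck: "feq p (ck x) (ck y) ==> x = y"
proof -
  have "ALL y p. feq p (ck x) (ck y) --> x = y"
  proof (rule ix_induct[of "%x. ALL y p. feq p (ck x) (ck y) --> x = y"])
    show "Dp (%x. ALL y p. feq p (ck x) (ck y) --> x = y)" by (intro df)
    fix x assume ih: "!!y. ix y \<E> ix x ==> ALL w p. feq p (ck y) (ck w) --> y = w"
    show "ALL y p. feq p (ck x) (ck y) --> x = y"
    proof (intro allI impI)
      fix y p assume f: "feq p (ck x) (ck y)"
      note a = f[unfolded feq[of p "ck x"]]
      have p: "le p p" "le p one" using a le_refl one by blast+
      show "x = y"
      proof (rule ext)
        fix z show "z \<E> x \<longleftrightarrow> z \<E> y"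
        proof
          assume z: "z \<E> x"
          hence "opr (ck z) one \<E> ck x" unfolding opr_ck by blast
          then obtain r w t where "opr w t \<E> ck y" "feq r (ck z) w" using a p by blast
          then obtain z' where "z' \<E> y" "feq r (ck z) (ck z')" unfolding opr_ck by blast
          thus "z \<E> y" using ih[OF ix_mem[OF z]] by blast
        next
          assume z: "z \<E> y"
          hence "opr (ck z) one \<E> ck y" unfolding opr_ck by blast
          then obtain r w t where "opr w t \<E> ck x" "feq r w (ck z)" using a p by blast
          then obtain z' where "z' \<E> x" "feq r (ck z') (ck z)" unfolding opr_ck by blast
          thus "z \<E> x" using ih[OF ix_mem] by blast
        qed
      qed
    qed
  qed
  thus "feq p (ck x) (ck y) ==> x = y" by blast
qed

definition "generic_filter G \<longleftrightarrow> (ALL p. G p --> p \<E> P) & (ALL p q. G p --> le p q --> G q) & G one &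
  (ALL p q. G p --> G q --> (EX r. G r & le r p & le r q)) &
  (ALL d. (ALL p. p \<E> P --> (EX q. le q p & q \<E> d)) --> (EX p. G p & p \<E> d))"

text \<open>Elements of the model are natural numbers, so a dense set of the model is itself a
  number and is met at the step of that number.\<close>

lemma generic_exists: "EX G. generic_filter G"
proof -
  define step where "step n p = (if EX q. le q p & q \<E> n then SOME q. le q p & q \<E> n else p)" for n p
  define s where "s = rec_nat one step"
  have s0: "s 0 = one" and sS: "s (Suc n) = step n (s n)" for n unfolding s_def by simp_all
  have st: "le (step n p) p" if "p \<E> P" for n p
    unfolding step_def using that le_refl someI_ex[of "%q. le q p & q \<E> n"] by auto
  have sP: "s n \<E> P" for n
  proof (induction n)
    case (Suc n) from le_P[OF st[OF this]] show ?case unfolding sS by blast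
  qed (simp add: s0 one_P)
  have mono: "n \<le> m ==> le (s m) (s n)" for n m
    by (induction rule: dec_induct) (use sS st sP le_refl le_trans in \<open>metis+\<close>)
  define G where "G p \<longleftrightarrow> (EX n. le (s n) p)" for p
  have dense: "EX p. G p & p \<E> d" if "ALL p. p \<E> P --> (EX q. le q p & q \<E> d)" for d
  proof -
    have "EX q. le q (s d) & q \<E> d" using that sP by blast
    hence "s (Suc d) \<E> d" unfolding sS step_def using someI_ex[of "%q. le q (s d) & q \<E> d"] by auto
    thus ?thesis unfolding G_def using le_refl sP by blast
  qed
  have dir: "EX r. G r & le r p & le r q" if pq: "G p" "G q" for p q
  proof -
    obtain n m where "le (s n) p" "le (s m) q" using pq G_def by blast
    hence "le (s (max n m)) p" "le (s (max n m)) q"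
      using le_trans[OF mono[OF max.cobounded1]] le_trans[OF mono[OF max.cobounded2]] by blast+
    thus ?thesis unfolding G_def using le_refl sP by blast
  qed
  have "generic_filter G" unfolding generic_filter_def
  proof (intro conjI allI impI)
    show "p \<E> P" if "G p" for p using that le_P unfolding G_def by blast
    show "G q" if "G p" "le p q" for p q using that le_trans unfolding G_def by blast
    show "G one" unfolding G_def using one[OF sP] by blast
  qed (use dense dir in blast)+
  thus ?thesis by blast
qed

end

section \<open>The generic extension and the truth lemma\<close>

locale generic = forcing E P le one for E :: "nat => nat => bool" (infix "\<E>" 50) and P le one +
  fixes G :: "nat => bool"
  assumes gen: "generic_filter G"
begin

lemma G_P: "G p ==> p \<E> P" and G_up: "G p ==> le p q ==> G q" and G_one: "G one"
  and G_dir: "G p ==> G q ==> EX r. G r & le r p & le r q"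
  and G_dense: "(!!p. p \<E> P ==> EX q. le q p & q \<E> d) ==> EX p. G p & p \<E> d"
  using gen unfolding generic_filter_def by blast+
lemma G_meet: assumes D: "Dp D" and d: "!!p. p \<E> P ==> EX q. le q p & D q" shows "EX p. G p & D p"
proof -
  have s: "q \<E> Sep P D \<longleftrightarrow> q \<E> P & D q" for q by (rule mem_Sep[OF D])
  thus ?thesis using G_dense[of "Sep P D"] d le_P by blast
qed
text \<open>The conditions below \<open>q\<close> with property \<open>D\<close>, together with
  those incompatible with \<open>q\<close>, are dense.\<close>

lemma G_below: assumes D: "Dp D" and q: "G q" and d: "!!p. le p q ==> EX r. le r p & D r" shows "EX p. G p & le p q & D p"
proof -
  let ?D = "%p. (D p & le p q) | (ALL r. le r p --> ~ le r q)"
  have dd: "Dp ?D" by (intro df D)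
  have "EX r. le r p & ?D r" if "p \<E> P" for p
  proof (cases "EX r. le r p & le r q")
    case True thus ?thesis using d le_trans by blast
  next
    case False thus ?thesis using le_refl[OF that] by blast
  qed
  from G_meet[of ?D, OF dd this] obtain p where p: "G p" "?D p" by blast
  obtain r where "G r" "le r p" "le r q" using G_dir[OF p(1) q] by blast
  thus ?thesis using p by blast
qed

definition "sim x y \<longleftrightarrow> (EX p. G p & feq p x y)"
lemma sim_refl: "sim x x" unfolding sim_def using G_one feq_refl G_P by blast
lemma sim_sym: "sim x y ==> sim y x" unfolding sim_def using feq_sym by blast
lemma sim_trans: "sim x y ==> sim y z ==> sim x z"
  unfolding sim_def using G_dir feq_mono feq_trans by meson
lemma sim_ck: "sim (ck x) (ck y) \<longleftrightarrow> x = y" using feq_ck sim_refl unfolding sim_def by blast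

text \<open>Classes of names are numbered, so the universe of the extension is again the natural
  numbers; canonical names provide infinitely many classes.\<close>

definition "cl x = to_nat_on (range (%x. {y. sim x y})) {y. sim x y}"
lemma cls_eq: "{z. sim x z} = {z. sim y z} \<longleftrightarrow> sim x y" using sim_refl sim_sym sim_trans by blast
lemma cl_bij: "bij_betw (to_nat_on (range (%x. {y. sim x y}))) (range (%x. {y. sim x y})) UNIV"
proof (rule to_nat_on_infinite)
  have "inj (%x. {y. sim (ck x) y})" by (rule injI) (simp add: cls_eq sim_ck)
  hence "infinite (range (%x. {y. sim (ck x) y}))" by (simp add: finite_image_iff)
  moreover have "range (%x. {y. sim (ck x) y}) \<subseteq> range (%x. {y. sim x y})" by blast
  ultimately show "infinite (range (%x. {y. sim x y}))" using finite_subset by blast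
qed simp
lemma cl_eq: "cl x = cl y \<longleftrightarrow> sim x y"
  unfolding cl_def inj_on_eq_iff[OF bij_betw_imp_inj_on[OF cl_bij] rangeI rangeI] by (rule cls_eq)
lemma cl_surj: "EX x. a = cl x"
proof -
  have "a \<in> to_nat_on (range (%x. {y. sim x y})) ` range (%x. {y. sim x y})"
    using bij_betw_imp_surj_on[OF cl_bij] by blast
  thus ?thesis unfolding cl_def by blast
qed
definition "rep a = (SOME x. a = cl x)"
lemma cl_rep[simp]: "cl (rep a) = a" unfolding rep_def using someI_ex[OF cl_surj] by metis

definition "N a b \<longleftrightarrow> (EX w s. opr w s \<E> rep b & G s & a = cl w)"
lemma fm_G: "(EX p. G p & fm p x y) \<longleftrightarrow> (EX w s. opr w s \<E> y & G s & sim x w)"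
proof
  assume "EX p. G p & fm p x y"
  thus "EX w s. opr w s \<E> y & G s & sim x w" unfolding fm_def sim_def using G_up by blast
next
  assume "EX w s. opr w s \<E> y & G s & sim x w"
  then obtain w s p where "opr w s \<E> y" "G s" "G p" "feq p x w" unfolding sim_def by blast
  thus "EX p. G p & fm p x y" unfolding fm_def using G_dir feq_mono by meson
qed
lemma sim_mem: assumes "sim y y'" "opr w s \<E> y" "G s" shows "EX w' s'. opr w' s' \<E> y' & G s' & sim w w'"
proof -
  obtain p where p: "G p" "feq p y y'" using assms(1) sim_def by blast
  obtain q where q: "G q" "le q p" "le q s" using G_dir[OF p(1) assms(3)] by blast
  have d: "Dp (%r. fm r w y')" by (intro df)
  have "EX p. G p & le p q & fm p w y'"
  proof (rule G_below[of "%r. fm r w y'", OF d q(1)])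
    fix r assume "le r q"
    hence "le r p" "le r s" using q le_trans by blast+
    then obtain t w' s' where "le t r" "opr w' s' \<E> y'" "le t s'" "feq t w w'"
      using p(2)[unfolded feq[of p y]] assms(2) by blast
    thus "EX t. le t r & fm t w y'" unfolding fm_def by blast
  qed
  thus ?thesis using fm_G by blast
qed
lemma mem_cl: "N z (cl y) \<longleftrightarrow> (EX w s. opr w s \<E> y & G s & z = cl w)"
proof -
  have s: "sim y (rep (cl y))" using cl_eq cl_rep by metis
  show ?thesis unfolding N_def using sim_mem[OF s] sim_mem[OF sim_sym[OF s]] cl_eq by metis
qed
lemma N_cl: "N (cl x) (cl y) \<longleftrightarrow> (EX p. G p & fm p x y)" unfolding mem_cl fm_G cl_eq ..
lemma N_eq: "cl x = cl y \<longleftrightarrow> (EX p. G p & feq p x y)" unfolding cl_eq sim_def ..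

text \<open>Truth is required for the fixed filter only, so \<open>F\<close> is any definable
  relation with these properties; neither syntax nor quantification over filters enters.\<close>

definition "forces F Q \<longleftrightarrow> Df (%e. F (e 0) (%n. e (Suc n))) & (ALL p q v. F p v --> le q p --> F q v) &
  (ALL v. Q (%n. cl (v n)) \<longleftrightarrow> (EX p. G p & F p v))"
lemma forces_df: assumes "forces F Q" "Dt t" "!!n. Dt (%e. a e n)" shows "Df (%e. F (t e) (a e))"
proof -
  have b: "Dt (case_nat t (%n e. a e n) n)" for n using assms(2,3) by (auto split: nat.split)
  have "Df (%e. F (e 0) (%n. e (Suc n)))" using assms(1) unfolding forces_def by blast
  from dfp_subst[OF this, of "case_nat t (%n e. a e n)", OF b] show ?thesis by simp
qed
lemma forces_mono: "forces F Q ==> F p v ==> le q p ==> F q v" unfolding forces_def by blast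
lemma forces_true: "forces F Q ==> Q (%n. cl (v n)) \<longleftrightarrow> (EX p. G p & F p v)" unfolding forces_def by blast

text \<open>A negation is forced when no extension forces the statement, an existential statement
  when some name is a witness. Density of the conditions that decide a statement makes the negation
  step work.\<close>

lemma truth: "dfp N Q ==> EX F. forces F Q"
proof (induction rule: dfp.induct)
  case (dfp_mem t s)
  have a: "EX t'. (ALL v. t (%n. cl (v n)) = cl (t' v)) & Dt (%e. t' (%n. e (Suc n)))" if "atm t" for t
    using that unfolding atm_def
  proof (elim disjE exE)
    fix i assume "t = (%e. e i)" thus ?thesis by (intro exI[of _ "%e. e i"]) (auto intro: df_var)
  next
    fix c assume "t = (%e. c)" thus ?thesis by (intro exI[of _ "%e. rep c"]) (auto intro: df_const)
  qed
  obtain t' where t: "!!v. t (%n. cl (v n)) = cl (t' v)" "Dt (%e. t' (%n. e (Suc n)))" using a[OF dfp_mem(1)] by blast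
  obtain s' where s: "!!v. s (%n. cl (v n)) = cl (s' v)" "Dt (%e. s' (%n. e (Suc n)))" using a[OF dfp_mem(2)] by blast
  note ts = t s
  have "forces (%p v. fm p (t' v) (s' v)) (%e. N (t e) (s e))"
    unfolding forces_def ts(1,3) N_cl using fm_mono by (intro conjI df ts) blast+
  thus ?case by blast
next
  case (dfp_eq t s)
  have a: "EX t'. (ALL v. t (%n. cl (v n)) = cl (t' v)) & Dt (%e. t' (%n. e (Suc n)))" if "atm t" for t
    using that unfolding atm_def
  proof (elim disjE exE)
    fix i assume "t = (%e. e i)" thus ?thesis by (intro exI[of _ "%e. e i"]) (auto intro: df_var)
  next
    fix c assume "t = (%e. c)" thus ?thesis by (intro exI[of _ "%e. rep c"]) (auto intro: df_const)
  qed
  obtain t' where t: "!!v. t (%n. cl (v n)) = cl (t' v)" "Dt (%e. t' (%n. e (Suc n)))" using a[OF dfp_eq(1)] by blast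
  obtain s' where s: "!!v. s (%n. cl (v n)) = cl (s' v)" "Dt (%e. s' (%n. e (Suc n)))" using a[OF dfp_eq(2)] by blast
  note ts = t s
  have "forces (%p v. feq p (t' v) (s' v)) (%e. t e = s e)"
    unfolding forces_def ts(1,3) N_eq using feq_mono by (intro conjI df ts) blast+
  thus ?case by blast
next
  case (dfp_not Q)
  then obtain F where F: "forces F Q" by blast
  define F' where "F' p v \<longleftrightarrow> (ALL q. le q p --> ~ F q v)" for p v
  have "(~ Q (%n. cl (v n))) = (EX p. G p & F' p v)" for v
  proof -
    have d: "Dp (%p. F p v | F' p v)" unfolding F'_def by (intro df forces_df[OF F])
    have "EX q. le q p & (F q v | F' q v)" if "p \<E> P" for p unfolding F'_def using le_refl[OF that] by blast
    from G_meet[of "%p. F p v | F' p v", OF d this] obtain p where p: "G p" "F p v | F' p v" by blast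
    have "~ (F q v & F' r v)" if "G q" "G r" for q r
      using G_dir[OF that] forces_mono[OF F] unfolding F'_def by blast
    thus ?thesis unfolding forces_true[OF F] using p by blast
  qed
  moreover have "Df (%e. F' (e 0) (%n. e (Suc n)))" unfolding F'_def by (intro df forces_df[OF F])
  ultimately have "forces F' (%e. ~ Q e)" unfolding forces_def F'_def using le_trans by blast
  thus ?case by blast
next
  case (dfp_conj Q R)
  then obtain F H where F: "forces F Q" and H: "forces H R" by blast
  have "(Q (%n. cl (v n)) & R (%n. cl (v n))) = (EX p. G p & F p v & H p v)" for v
    unfolding forces_true[OF F] forces_true[OF H] using G_dir forces_mono[OF F] forces_mono[OF H] by metis
  moreover have "Df (%e. F (e 0) (%n. e (Suc n)) & H (e 0) (%n. e (Suc n)))" using F H unfolding forces_def by (intro df) auto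
  ultimately have "forces (%p v. F p v & H p v) (%e. Q e & R e)"
    unfolding forces_def using forces_mono[OF F] forces_mono[OF H] by blast
  thus ?case by blast
next
  case (dfp_ex Q)
  then obtain F where F: "forces F Q" by blast
  have e: "(EX x. Q (case_nat x (%n. cl (v n)))) = (EX p. G p & (EX x. F p (case_nat x v)))" for v
  proof -
    have "case_nat (cl x) (%n. cl (v n)) = (%n. cl (case_nat x v n))" for x by (auto simp: fun_eq_iff split: nat.split)
    hence "Q (case_nat (cl x) (%n. cl (v n))) = (EX p. G p & F p (case_nat x v))" for x using forces_true[OF F] by simp
    thus ?thesis using cl_surj by metis
  qed
  have c: "Dt (%e. case_nat (e 0) (%n. e (Suc (Suc n))) n)" for n by (cases n) (simp_all add: df_var)
  have "Df (%e. EX x. F (e 0) (case_nat x (%n. e (Suc n))))" by (intro df forces_df[OF F] c)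
  hence "forces (%p v. EX x. F p (case_nat x v)) (%e. EX x. Q (case_nat x e))"
    unfolding forces_def using e forces_mono[OF F] by blast
  thus ?case by blast
qed

end

section \<open>The extension is a model of ZFC with the same ordinals\<close>

context generic
begin

lemma mem_ck_cl: "N z (cl (ck y)) \<longleftrightarrow> (EX x. x \<E> y & z = cl (ck x))"
  unfolding mem_cl opr_ck using G_one by blast
lemma cl_ck_inj: "cl (ck x) = cl (ck y) \<longleftrightarrow> x = y" unfolding cl_eq sim_ck ..
lemma name_mem: "N u (cl a) ==> EX w s. opr w s \<E> a & G s & u = cl w & w \<E> tc a"
  unfolding mem_cl using tc_opr[OF tc(1)] by blast
lemma fm_N: "G p ==> fm p w a ==> N (cl w) (cl a)" unfolding N_cl by blast

text \<open>Below every condition there is one that forces equality or satisfies \<open>D1\<close>,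
  which exhibits an element of one name that is kept out of the other; the latter does not happen in
  \<open>G\<close>.\<close>

lemma N_ext: assumes "!!z. N z x \<longleftrightarrow> N z y" shows "x = y"
proof -
  obtain a b where ab: "x = cl a" "y = cl b" using cl_surj by metis
  define D1 where "D1 q a b \<longleftrightarrow> (EX z s. opr z s \<E> a & le q s & (ALL r w t. le r q & opr w t \<E> b & le r t --> ~ feq r z w))" for q a b
  have n1: "~ D1 q a b" if qG: "G q" and sb: "!!z. N z (cl a) ==> N z (cl b)" for q a b
  proof
    assume "D1 q a b"
    then obtain z s where z: "opr z s \<E> a" "le q s" "!!r w t. le r q ==> opr w t \<E> b ==> le r t ==> ~ feq r z w"
      unfolding D1_def by blast
    have "N (cl z) (cl b)" by (rule sb, unfold mem_cl) (use z(1,2) G_up[OF qG] in blast)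
    then obtain p where p: "G p" "fm p z b" unfolding N_cl by blast
    obtain r where r: "G r" "le r q" "le r p" using G_dir[OF qG p(1)] by blast
    show False using fm_mono[OF p(2) r(3)] z(3)[OF r(2)] unfolding fm_def by blast
  qed
  let ?D = "%q. feq q a b | D1 q a b | D1 q b a"
  have d: "Dp ?D" unfolding D1_def by (intro df)
  have "EX q. le q p & ?D q" if p: "p \<E> P" for p
  proof (cases "feq p a b")
    case True thus ?thesis using le_refl[OF p] by blast
  next
    case False
    then consider z s q where "opr z s \<E> a" "le q p" "le q s" "~ (EX r w t. le r q & opr w t \<E> b & le r t & feq r z w)"
      | w t q where "opr w t \<E> b" "le q p" "le q t" "~ (EX r z s. le r q & opr z s \<E> a & le r s & feq r z w)"
      using p unfolding feq[of p] by blast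
    thus ?thesis
    proof cases
      case 1
      hence "D1 q a b" unfolding D1_def by blast
      thus ?thesis using 1 by blast
    next
      case 2
      hence "D1 q b a" unfolding D1_def using feq_sym by blast
      thus ?thesis using 2 by blast
    qed
  qed
  from G_meet[of ?D, OF d this] obtain q where q: "G q" "?D q" by blast
  have "~ D1 q a b" "~ D1 q b a" using n1[OF q(1)] assms unfolding ab by blast+
  thus ?thesis unfolding ab N_eq using q by blast
qed

text \<open>Take a forced element of \<open>a\<close> of least index. The names inside it have
  smaller indices, so no extension forces one of them into \<open>a\<close>.\<close>

lemma N_foundation: assumes "N y x" shows "EX y. N y x & (ALL z. N z y --> ~ N z x)"
proof -
  obtain a b where ab: "x = cl a" "y = cl b" using cl_surj by metis
  obtain q0 where q0: "G q0" "fm q0 b a" using assms unfolding ab N_cl by blast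
  let ?D = "%q. EX z. fm q z a & (ALL u s r. opr u s \<E> z & le r q --> ~ fm r u a)"
  have d: "Dp ?D" by (intro df)
  have "EX r. le r p & ?D r" if p: "le p q0" for p
  proof -
    let ?Q = "%i. EX z r. ix z = i & le r p & fm r z a"
    have dQ: "Dp ?Q" by (intro df)
    have "?Q (ix b)" using fm_mono[OF q0(2) p] le_refl le_P p by blast
    note l = lst(2,3)[of ?Q, OF dQ ix(1) this]
    obtain z r where z: "ix z = lst ?Q" "le r p" "fm r z a" using l(1) by blast
    have "~ fm r' u a" if "opr u s \<E> z" "le r' r" for u s r'
      using l(2)[of "ix u"] ix_opr[OF that(1)] z(1,2) le_trans that(2) by metis
    thus ?thesis using z by blast
  qed
  from G_below[of ?D, OF d q0(1) this] obtain q z where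
    q: "G q" "fm q z a" "!!u s r. opr u s \<E> z ==> le r q ==> ~ fm r u a" by blast
  have "~ N u x" if "N u (cl z)" for u
  proof
    assume "N u x"
    from that[unfolded mem_cl] obtain w s where w: "opr w s \<E> z" "u = cl w" by blast
    then obtain p where p: "G p" "fm p w a" using \<open>N u x\<close> unfolding ab w N_cl by blast
    obtain r where "le r q" "le r p" using G_dir[OF q(1) p(1)] by blast
    thus False using q(3)[OF w(1)] fm_mono[OF p(2)] by blast
  qed
  thus ?thesis using fm_N[OF q(1,2)] ab by blast
qed

text \<open>The name for a separated subset: \<open>w\<close> occurs with every condition that
  forces both \<open>w\<close> into \<open>a\<close> and \<open>Q\<close>. Elements of
  \<open>a\<close> have names in \<open>tc a\<close>, so a set of pairs is enough.\<close>

definition "cmp Q a = cl (Sep (prd (tc a) P) (%z. fm (sn z) (fs z) a & Q (sn z) (fs z)))"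
lemma cmp: assumes Q: "Df (%e. Q (e 0) (e 1))" and mono: "!!p q w. Q p w ==> le q p ==> Q q w"
  shows "N u (cmp Q a) \<longleftrightarrow> (EX w. u = cl w & N u (cl a) & w \<E> tc a & (EX p. G p & fm p w a & Q p w))"
proof -
  note [df] = dfp2[OF Q]
  have "opr w p \<E> Sep (prd (tc a) P) (%z. fm (sn z) (fs z) a & Q (sn z) (fs z)) \<longleftrightarrow>
    w \<E> tc a & p \<E> P & fm p w a & Q p w" for w p
    by (subst mem_Sep) (intro df, simp)
  thus ?thesis unfolding cmp_def mem_cl[of u "Sep _ _"] using fm_N G_P by blast
qed

sublocale N: zf N
proof
  fix x y assume "!!z. N z x \<longleftrightarrow> N z y" thus "x = y" by (rule N_ext)
next
  fix x y assume "N y x" thus "EX y. N y x & (ALL z. N z y --> ~ N z x)" by (rule N_foundation)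
next
  fix a b
  obtain x y where xy: "a = cl x" "b = cl y" using cl_surj by metis
  have "N a (cl (upair (opr x one) (opr y one))) & N b (cl (upair (opr x one) (opr y one)))"
    unfolding xy mem_cl using G_one by auto
  thus "EX p. N a p & N b p" by blast
next
  fix a
  obtain x where x: "a = cl x" using cl_surj by metis
  have d: "Dg (%w. opr w one)" by (intro df)
  have "N z (cl (Im (%w. opr w one) (tc x)))" if z: "N y a" "N z y" for y z
  proof -
    obtain v s where v: "y = cl v" "v \<E> tc x" using name_mem z(1) x by blast
    obtain w t where w: "opr w t \<E> v" "z = cl w" using z(2) unfolding v mem_cl by blast
    have "w \<E> tc x" using tc_opr v w by blast
    thus ?thesis unfolding mem_cl mem_Im[OF d] w(2) using G_one by blast
  qed
  thus "EX u. ALL x z. N x a --> N z x --> N z u" by blast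
next
  fix a
  obtain x where x: "a = cl x" using cl_surj by metis
  have d: "Dg (%w. opr w one)" by (intro df)
  have "N b (cl (Im (%w. opr w one) (Pw (prd (tc x) P))))" if sub: "ALL y. N y b --> N y a" for b
  proof -
    obtain y where y: "b = cl y" using cl_surj by metis
    \<comment> \<open>A name for the subset \<open>b\<close> that uses only names from
      \<open>tc x\<close>; all names of this kind form a set.\<close>
    define s where "s = Sep (prd (tc x) P) (%z. fm (sn z) (fs z) y)"
    have s: "z \<E> s \<longleftrightarrow> z \<E> prd (tc x) P & fm (sn z) (fs z) y" for z
      unfolding s_def by (rule mem_Sep) (intro df)
    have "cl s = b"
    proof (rule N_ext)
      fix u
      have "N u (cl s) \<longleftrightarrow> (EX w p. w \<E> tc x & G p & fm p w y & u = cl w)"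
        unfolding mem_cl s using G_P by auto
      also have "\<dots> \<longleftrightarrow> N u b"
      proof
        assume u: "N u b"
        then obtain w where w: "w \<E> tc x" "u = cl w" using sub name_mem x by blast
        then obtain p where "G p" "fm p w y" using u unfolding y w N_cl by blast
        thus "EX w p. w \<E> tc x & G p & fm p w y & u = cl w" using w by blast
      qed (use fm_N y in blast)
      finally show "N u (cl s) \<longleftrightarrow> N u b" .
    qed
    moreover have "sub s (prd (tc x) P)" using s by (simp add: sub_def)
    hence "N (cl s) (cl (Im (%w. opr w one) (Pw (prd (tc x) P))))"
      unfolding mem_cl[of _ "Im _ _"] mem_Im[OF d] mem_Pw using G_one by blast
    ultimately show ?thesis by simp
  qed
  thus "EX p. ALL z. (ALL y. N y z --> N y a) --> N z p" by blast
next
  let ?w = "cl (ck om)"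
  have 1: "EX y. N y ?w & (ALL z. N z y \<longleftrightarrow> N z x | z = x)" if "N x ?w" for x
  proof -
    from that[unfolded mem_ck_cl] obtain n where n: "n \<E> om" "x = cl (ck n)" by blast
    have "N (cl (ck (suc n))) ?w" unfolding mem_ck_cl using om_suc[OF n(1)] by blast
    moreover have "N z (cl (ck (suc n))) \<longleftrightarrow> N z x | z = x" for z unfolding n(2) mem_ck_cl by auto
    ultimately show ?thesis by blast
  qed
  have 2: "N (cl (ck emp)) ?w & (ALL y. ~ N y (cl (ck emp)))" unfolding mem_ck_cl using om_emp mem_emp by blast
  show "EX w. (EX z. N z w & (ALL y. ~ N y z)) & (ALL x. N x w --> (EX y. N y w & (ALL z. N z y \<longleftrightarrow> N z x | z = x)))"
    using 1 2 by blast
next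
  fix Q a assume Q: "dfp N (%e. Q (e 0))"
  obtain F where F: "forces F (%e. Q (e 0))" using truth[OF Q] by blast
  obtain x where x: "a = cl x" using cl_surj by metis
  define R where "R p w \<longleftrightarrow> F p (%n. w)" for p w
  have R: "Df (%e. R (e 0) (e 1))" unfolding R_def by (intro forces_df[OF F] df)
  have m: "R p w ==> le q p ==> R q w" for p q w unfolding R_def using forces_mono[OF F] by blast
  have t: "Q (cl w) \<longleftrightarrow> (EX p. G p & R p w)" for w using forces_true[OF F, of "%n. w"] unfolding R_def by simp
  have c: "N u (cmp R x) \<longleftrightarrow> (EX w. u = cl w & N u (cl x) & w \<E> tc x & (EX p. G p & fm p w x & R p w))" for u
    by (rule cmp[of R, OF R]) (rule m)
  have "N u (cmp R x) \<longleftrightarrow> N u a & Q u" for u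
  proof
    assume "N u (cmp R x)"
    then obtain w p where "u = cl w" "N u (cl x)" "G p" "R p w" using c by blast
    thus "N u a & Q u" using t x by blast
  next
    assume u: "N u a & Q u"
    then obtain w s where w: "u = cl w" "w \<E> tc x" using name_mem x by blast
    obtain p q where pq: "G p" "fm p w x" "G q" "R q w" using u t unfolding w x N_cl by blast
    obtain r where "G r" "le r p" "le r q" using G_dir[OF pq(1,3)] by blast
    hence "G r" "fm r w x" "R r w" using fm_mono pq(2) m pq(4) by blast+
    thus "N u (cmp R x)" using c u w x by blast
  qed
  thus "EX b. ALL x. N x b \<longleftrightarrow> N x a & Q x" by blast
next
  fix Q a assume Q: "dfp N (%e. Q (e 0) (e 1))" and ex: "!!x. N x a ==> EX c. ALL y. Q x y \<longleftrightarrow> y = c"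
  obtain F where F: "forces F (%e. Q (e 0) (e 1))" using truth[OF Q] by blast
  obtain x where x: "a = cl x" using cl_surj by metis
  define R where "R p w y \<longleftrightarrow> F p (case_nat w (%n. y))" for p w y
  have "Dt (%e. case_nat (e 1) (%n. e 2) n)" for n by (cases n) (simp_all add: df_var)
  hence R: "Df (%e. R (e 0) (e 1) (e 2))" unfolding R_def by (intro forces_df[OF F] df)
  note [df] = dfp3[OF R]
  have t: "Q (cl w) (cl y) \<longleftrightarrow> (EX p. G p & R p w y)" for w y
    using forces_true[OF F, of "case_nat w (%n. y)"] unfolding R_def by simp
  \<comment> \<open>One name of least index for every pair of an element and a condition covers all
    the values.\<close>
  define f where "f z = opr (cho (%y. R (sn z) (fs z) y)) one" for z
  have d: "Dg f" unfolding f_def by (intro df)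
  have "EX y. N y (cl (Im f (prd (tc x) P))) & Q u y" if u: "N u a" for u
  proof -
    obtain w s where w: "u = cl w" "w \<E> tc x" using u name_mem x by blast
    obtain y where "Q u y" using ex[OF u] by blast
    then obtain y' p where p: "G p" "R p w y'" using w t cl_surj by metis
    define v where "v = cho (%y. R p w y)"
    have dR: "Dp (%y. R p w y)" by (intro df)
    have "R p w v" unfolding v_def by (rule cho[of "%y. R p w y", OF dR p(2)])
    hence "Q u (cl v)" using w t p by blast
    moreover have "opr v one \<E> Im f (prd (tc x) P)"
      unfolding mem_Im[OF d] using w(2) G_P[OF p(1)] by (intro exI[of _ "opr w p"]) (simp add: f_def v_def)
    hence "N (cl v) (cl (Im f (prd (tc x) P)))" unfolding mem_cl using G_one by blast
    ultimately show ?thesis by blast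
  qed
  thus "EX b. ALL x. N x a --> (EX y. N y b & Q x y)" by blast
qed

abbreviation "j x \<equiv> cl (ck x)"
sublocale Ck: emb E N j
proof unfold_locales
  show "j x = j y \<longleftrightarrow> x = y" for x y by (rule cl_ck_inj)
  show "x \<E> y \<longleftrightarrow> N (j x) (j y)" for x y unfolding mem_ck_cl cl_ck_inj by blast
  show "N z (j y) ==> EX x. z = j x" for z y unfolding mem_ck_cl by blast
qed

definition "opn x y = upair (opr (upair (opr x one) (opr x one)) one) (opr (upair (opr x one) (opr y one)) one)"
lemma df_opn[df]: "Dt t ==> Dt s ==> Dt (%e. opn (t e) (s e))" unfolding opn_def by (intro df)
lemma cl_upair: "cl (upair (opr x one) (opr y one)) = N.upair (cl x) (cl y)"
  by (rule N_ext) (use G_one in \<open>auto simp: mem_cl\<close>)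
lemma cl_opn: "cl (opn x y) = N.opr (cl x) (cl y)"
  unfolding opn_def cl_upair N.opr_def N.sing_def ..
lemma name_fun: assumes d: "Dg H" shows "EX f. ALL x. x \<E> b --> N.ap f (j x) = cl (H x)"
proof -
  note [df] = dff1[OF d]
  define K where "K x = opr (opn (ck x) (H x)) one" for x
  have dK: "Dg K" unfolding K_def by (intro df)
  define f where "f = cl (Im K b)"
  have f: "N z f \<longleftrightarrow> (EX x. x \<E> b & z = N.opr (j x) (cl (H x)))" for z
    unfolding f_def mem_cl mem_Im[OF dK] K_def opr_inj using G_one cl_opn by metis
  have "N.ap f (j x) = cl (H x)" if "x \<E> b" for x
    unfolding N.ap_def by (rule N.Th_eq) (use that in \<open>auto simp: f cl_ck_inj\<close>)
  thus ?thesis by blast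
qed

sublocale N: zfc N
proof
  fix a
  obtain x where x: "a = cl x" using cl_surj by metis
  obtain g where g: "Ord g" "ALL y. y \<E> tc x --> (EX z. z \<E> g & y = Lf z)" using inL_bound[of "tc x"] VL by blast
  have dL: "Dg Lf" by (intro df)
  obtain f where f: "!!z. z \<E> g ==> N.ap f (j z) = cl (Lf z)" using name_fun[OF dL] by blast
  have "N.sj (j g) a" unfolding N.sj_def
  proof (rule exI[of _ f], intro allI impI)
    fix y assume "N y a"
    then obtain w where "w \<E> tc x" "y = cl w" using name_mem x by blast
    thus "EX z. N z (j g) & N.ap f z = y" using g(2) f unfolding mem_ck_cl by blast
  qed
  thus "EX t. N.Ord t & N.sj t a" using Ck.h_Ord g(1) by blast
qed

text \<open>Otherwise all ordinals of the ground model are elements of \<open>a\<close>, each forced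
  equal to some name from a fixed set. Sending a name and a condition to the ordinal they determine
  would then map a set onto all ordinals.\<close>

lemma N_Ord: assumes "N.Ord a" shows "EX b. Ord b & a = j b"
proof (rule ccontr)
  assume n: "~ ?thesis"
  have all: "N (j b) a" if "Ord b" for b
  proof -
    have "N.Ord (j b)" using that Ck.h_Ord by blast
    hence "N (j b) a | j b = a | N a (j b)" using N.Ord_lin assms by blast
    thus ?thesis using n that Ord_memD unfolding mem_ck_cl by blast
  qed
  obtain x where x: "a = cl x" using cl_surj by metis
  define F where "F z = Th (%b. Ord b & feq (sn z) (fs z) (ck b))" for z
  have d: "Dg F" unfolding F_def by (intro df)
  have F: "F (opr w p) = b" if "Ord b" "feq p w (ck b)" for w p b
    unfolding F_def
  proof (rule Th_eq)
    fix z assume "Ord z & feq (sn (opr w p)) (fs (opr w p)) (ck z)"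
    hence "feq p w (ck z)" by simp
    thus "z = b" using that(2) feq_sym feq_trans feq_ck by blast
  qed (use that in simp)
  have s: "y \<E> Sep (Im F (prd (tc x) P)) Ord \<longleftrightarrow> y \<E> Im F (prd (tc x) P) & Ord y" for y
    by (rule mem_Sep) (intro df)
  have i: "b \<E> Sep (Im F (prd (tc x) P)) Ord" if b: "Ord b" for b
  proof -
    obtain w where w: "w \<E> tc x" "j b = cl w" using name_mem all[OF b] x by blast
    then obtain p where p: "G p" "feq p w (ck b)" using N_eq[of w "ck b"] by auto
    have "F (opr w p) = b" using F b p by blast
    thus ?thesis unfolding s mem_Im[OF d] using w(1) G_P[OF p(1)] b by (metis opr_prd)
  qed
  have o: "Ord (Unn (Sep (Im F (prd (tc x) P)) Ord))" by (rule Ord_Unn) (simp add: s)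
  from i[OF Ord_suc[OF o]] have "Unn (Sep (Im F (prd (tc x) P)) Ord) \<E> Unn (Sep (Im F (prd (tc x) P)) Ord)"
    unfolding mem_Un by (metis mem_suc)
  thus False by simp
qed

definition "Gn = cl (Im (%p. opr (ck p) p) P)"
lemma mem_Gn: "N z Gn \<longleftrightarrow> (EX p. G p & z = j p)"
proof -
  have "Dg (%p. opr (ck p) p)" by (intro df)
  thus ?thesis unfolding Gn_def mem_cl using G_P by (auto simp: mem_Im)
qed

end

section \<open>The partial order\<close>

context VL
begin

definition "w1 = nx om"
definition "w2 = nx w1"
lemma w1: "Card w1" "Ord w1" "sub om w1" and w2: "Card w2" "Ord w2" "sub w1 w2" "sub om w2"
proof -
  show "Card w1" "Card w2" unfolding w1_def w2_def by (rule Card_nx)+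
  thus 1: "Ord w1" "Ord w2" unfolding Card_def by blast+
  show 2: "sub om w1" using Ord_subD[OF 1(1)] nx_gt[of om] unfolding w1_def by simp
  show "sub w1 w2" using Ord_subD[OF 1(2)] nx_gt[OF 1(1)] unfolding w2_def by simp
  thus "sub om w2" using 2 sub_trans by blast
qed
lemma sj_w1: "sj om x ==> sj w1 x" using sj_mono w1(3) sub_refl by blast
lemma om_un: "sj om a ==> sj om b ==> sj om (un a b)" using sj_un2[OF sub_refl om_sq] by blast
lemma om_prd: "sj om a ==> sj om b ==> sj om (prd a b)" using sj_prd om_sq sj_trans by blast
lemma om_sub: "sj om a ==> sub b a ==> sj om b" using sj_mono sub_refl by blast
lemma fin_om: "fin a ==> sj om a" unfolding fin_def using sj_mono sub_refl Ord_subD[OF Ord_om] by blast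
lemma om_Im: "Dg F ==> sj om a ==> sj om (Im F a)" using sj_Im sj_trans by blast
lemma fin_sing: "fin (sing x)" using fin_insert[OF fin_emp, of x] fin_sub by (auto simp: sub_def)

lemma HL_upair: assumes k: "Card k" "sub om k" "x \<E> HL k" "y \<E> HL k" shows "upair x y \<E> HL k"
proof (rule HL_I[OF k(1,2)])
  have "upair x y = un (sing x) (sing y)" by (rule ext) auto
  hence "sj om (upair x y)" using fin_om fin_un fin_sing by simp
  thus "sj k (upair x y)" using sj_mono k(2) sub_refl by blast
qed (use k in auto)
lemma HL_opr: "Card k ==> sub om k ==> x \<E> HL k ==> y \<E> HL k ==> opr x y \<E> HL k"
  unfolding opr_def sing_def using HL_upair by blast

text \<open>Recursion along an enumeration of \<open>T\<close>: an infinite set always has an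
  element different from the finitely many chosen before.\<close>

lemma distinct_choice:
  assumes T: "sj om T" and dU: "Dg U" and inf: "!!t. t \<E> T ==> ~ fin (U t)"
  shows "EX g. ALL t. t \<E> T --> ap g t \<E> U t & (ALL t'. t' \<E> T --> ap g t = ap g t' --> t = t')"
proof -
  note [df] = dff1[OF dU]
  obtain e where e: "ALL t. t \<E> T --> (EX k. k \<E> om & ap e k = t)" using T unfolding sj_def by blast
  define H where "H k f = cho (%b. b \<E> U (ap e k) & (ALL i. i \<E> k --> ap f i ~= b))" for k f
  have dH: "Dt (%e. H (e 0) (e 1))" unfolding H_def by (intro df)
  note [df] = dff2[OF dH]
  define h where "h = orec H"
  have dh: "Dg h" unfolding h_def by (intro df)
  note [df] = dff1[OF dh]
  have h: "h k \<E> U (ap e k) & (ALL i. i \<E> k --> h i ~= h k)" if k: "k \<E> om" "ap e k \<E> T" for k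
  proof -
    have hk: "h k = H k (lam k h)" unfolding h_def by (rule orec[OF dH om_Ord[OF k(1)]])
    have a: "ap (lam k h) i = h i" if "i \<E> k" for i by (rule ap_lam[OF dh that])
    have "~ sub (U (ap e k)) (Im h k)" using fin_sub[OF fin_Im[OF dh fin_nat[OF k(1)]]] inf[OF k(2)] by blast
    then obtain b where b: "b \<E> U (ap e k)" "~ b \<E> Im h k" unfolding sub_def by blast
    have "Dp (%b. b \<E> U (ap e k) & (ALL i. i \<E> k --> ap (lam k h) i ~= b))" by (intro df)
    moreover have "b \<E> U (ap e k) & (ALL i. i \<E> k --> ap (lam k h) i ~= b)" using a b mem_Im[OF dh] by auto
    ultimately have "H k (lam k h) \<E> U (ap e k) & (ALL i. i \<E> k --> ap (lam k h) i ~= H k (lam k h))"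
      unfolding H_def by (rule cho)
    thus ?thesis using hk a by metis
  qed
  \<comment> \<open>An enumeration may repeat; the first index of \<open>t\<close> picks one of its
    representatives.\<close>
  define kk where "kk t = lst (%k. k \<E> om & ap e k = t)" for t
  have dk: "Dg kk" unfolding kk_def by (intro df)
  note [df] = dff1[OF dk]
  have kk: "kk t \<E> om & ap e (kk t) = t" if t: "t \<E> T" for t
  proof -
    obtain k where k: "k \<E> om & ap e k = t" using e t by blast
    have "Dp (%k. k \<E> om & ap e k = t)" by (intro df)
    from lst_P[of "%k. k \<E> om & ap e k = t", OF this _ k] show ?thesis using k om_Ord unfolding kk_def by blast
  qed
  have dg: "Dg (%t. h (kk t))" by (intro df)
  have g: "ap (lam T (%t. h (kk t))) t = h (kk t)" if "t \<E> T" for t by (rule ap_lam[OF dg that])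
  have inj: "t = t'" if t: "t \<E> T" "t' \<E> T" "h (kk t) = h (kk t')" for t t'
  proof -
    have "kk t = kk t'" using Ord_lin[of "kk t" "kk t'"] om_Ord kk t h[of "kk t"] h[of "kk t'"] by metis
    thus ?thesis using kk t by metis
  qed
  show ?thesis using g inj h kk by (intro exI[of _ "lam T (%t. h (kk t))"]) metis
qed

definition "aP p = fs p"
definition "fP p = fs (sn p)"
definition "sP p = sn (sn p)"
text \<open>A condition consists of a countable set \<open>a\<close>, a colouring \<open>f\<close> of its pairs, given by the triples
  \<open>opr x (opr y c)\<close> with \<open>x \<E> y\<close>, and countably many infinite subsets of \<open>a\<close>, the promises: a new
  point \<open>x\<close> below a promised set \<open>B\<close> has to realize on \<open>B\<close> all colours that belong to \<open>a\<close>.\<close>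
definition "isP p \<longleftrightarrow> p = opr (aP p) (opr (fP p) (sP p)) & sub (aP p) w2 & sj om (aP p) & sj om (sP p) &
  (ALL B. B \<E> sP p --> sub B (aP p) & ~ fin B) &
  (ALL z. z \<E> fP p --> (EX x y c. x \<E> aP p & y \<E> aP p & x \<E> y & c \<E> w1 & z = opr x (opr y c))) &
  (ALL x y. x \<E> aP p & y \<E> aP p & x \<E> y --> (EX c. ALL d. opr x (opr y d) \<E> fP p \<longleftrightarrow> d = c))"
text \<open>Only colours of the older condition are demanded, because a countable \<open>B\<close>
  cannot show all \<open>w1\<close> colours. A colour is an element of \<open>w2\<close> and can be
  added to a condition beforehand.\<close>

definition "leP p q \<longleftrightarrow> isP p & isP q & sub (aP q) (aP p) & sub (fP q) (fP p) & sub (sP q) (sP p) &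
  (ALL x B c. x \<E> aP p & ~ x \<E> aP q & B \<E> sP q & (ALL b. b \<E> B --> x \<E> b) & c \<E> aP q & c \<E> w1 -->
     (EX b. b \<E> B & opr x (opr b c) \<E> fP p))"
lemma df_P[df]: "Dt t ==> Dt (%e. aP (t e))" "Dt t ==> Dt (%e. fP (t e))" "Dt t ==> Dt (%e. sP (t e))"
  unfolding aP_def fP_def sP_def by (intro df; assumption)+
lemma df_isP[df]: "Dt t ==> Df (%e. isP (t e))" unfolding isP_def by (intro df dff_Suc)
lemma df_leP[df]: "Dt t ==> Dt s ==> Df (%e. leP (t e) (s e))" unfolding leP_def by (intro df dff_Suc)
lemma P_sel[simp]: "aP (opr a (opr f s)) = a" "fP (opr a (opr f s)) = f" "sP (opr a (opr f s)) = s"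
  by (simp_all add: aP_def fP_def sP_def)
lemma leP_isP: "leP p q ==> isP p" "leP p q ==> isP q" unfolding leP_def by blast+
lemma leP_refl: "isP p ==> leP p p" unfolding leP_def using sub_refl by blast
lemma leP_sub: assumes "leP p q" shows "sub (aP q) (aP p)" "sub (fP q) (fP p)" "sub (sP q) (sP p)"
  using assms unfolding leP_def by blast+
lemma leP_new: "leP p q ==> x \<E> aP p ==> ~ x \<E> aP q ==> B \<E> sP q ==> (!!b. b \<E> B ==> x \<E> b) ==>
  c \<E> aP q ==> c \<E> w1 ==> EX b. b \<E> B & opr x (opr b c) \<E> fP p"
  unfolding leP_def by blast
lemma leP_I: "isP p ==> isP q ==> sub (aP q) (aP p) ==> sub (fP q) (fP p) ==> sub (sP q) (sP p) ==>
  (!!x B c. x \<E> aP p ==> ~ x \<E> aP q ==> B \<E> sP q ==> (!!b. b \<E> B ==> x \<E> b) ==> c \<E> aP q ==> c \<E> w1 ==>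
     EX b. b \<E> B & opr x (opr b c) \<E> fP p) ==> leP p q"
  unfolding leP_def by blast
lemma leP_trans: assumes "leP p q" "leP q r" shows "leP p r"
proof (rule leP_I)
  show "isP p" "isP r" using assms leP_isP by blast+
  show "sub (aP r) (aP p)" "sub (fP r) (fP p)" "sub (sP r) (sP p)" using assms leP_sub sub_trans by blast+
  fix x B c assume x: "x \<E> aP p" "~ x \<E> aP r" "B \<E> sP r" "!!b. b \<E> B ==> x \<E> b" "c \<E> aP r" "c \<E> w1"
  show "EX b. b \<E> B & opr x (opr b c) \<E> fP p"
  proof (cases "x \<E> aP q")
    case True
    from leP_new[OF assms(2) True x(2-6)] show ?thesis using leP_sub(2)[OF assms(1)] subD by blast
  next
    case False
    show ?thesis
      by (rule leP_new[OF assms(1) x(1) False _ x(4) _ x(6)])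
        (use leP_sub[OF assms(2)] x subD in blast)+
  qed
qed
lemma isP_D: assumes "isP p" shows isP_eq: "p = opr (aP p) (opr (fP p) (sP p))" and isP_a: "sub (aP p) w2" "sj om (aP p)"
  and isP_s: "sj om (sP p)" "!!B. B \<E> sP p ==> sub B (aP p)" "!!B. B \<E> sP p ==> ~ fin B"
  and isP_f: "!!x y c. opr x (opr y c) \<E> fP p ==> x \<E> aP p & y \<E> aP p & x \<E> y & c \<E> w1"
  and isP_f2: "!!x y. x \<E> aP p ==> y \<E> aP p ==> x \<E> y ==> EX c. ALL d. opr x (opr y d) \<E> fP p \<longleftrightarrow> d = c"
  and isP_f3: "!!z. z \<E> fP p ==> EX x y c. x \<E> aP p & y \<E> aP p & x \<E> y & c \<E> w1 & z = opr x (opr y c)"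
proof -
  note a = assms[unfolded isP_def]
  show "p = opr (aP p) (opr (fP p) (sP p))" "sub (aP p) w2" "sj om (aP p)" "sj om (sP p)"
    "!!B. B \<E> sP p ==> sub B (aP p)" "!!B. B \<E> sP p ==> ~ fin B"
    "!!x y. x \<E> aP p ==> y \<E> aP p ==> x \<E> y ==> EX c. ALL d. opr x (opr y d) \<E> fP p \<longleftrightarrow> d = c"
    "!!z. z \<E> fP p ==> EX x y c. x \<E> aP p & y \<E> aP p & x \<E> y & c \<E> w1 & z = opr x (opr y c)" using a by blast+
  fix x y c assume "opr x (opr y c) \<E> fP p"
  then obtain x' y' c' where "x' \<E> aP p & y' \<E> aP p & x' \<E> y' & c' \<E> w1 & opr x (opr y c) = opr x' (opr y' c')" using a by blast
  thus "x \<E> aP p & y \<E> aP p & x \<E> y & c \<E> w1" by simp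
qed
lemma isP_Ord: "isP p ==> x \<E> aP p ==> Ord x" using isP_a(1) Ord_memD[OF w2(2)] subD by blast

lemma isP_I: assumes "sub a w2" "sj om a" "sj om s" "!!B. B \<E> s ==> sub B a & ~ fin B"
  "!!z. z \<E> f ==> EX x y c. x \<E> a & y \<E> a & x \<E> y & c \<E> w1 & z = opr x (opr y c)"
  "!!x y. x \<E> a ==> y \<E> a ==> x \<E> y ==> EX c. ALL d. opr x (opr y d) \<E> f \<longleftrightarrow> d = c"
  shows "isP (opr a (opr f s))"
  unfolding isP_def P_sel using assms by blast

text \<open>The components are countable and built from elements of \<open>HL w1\<close>. So the
  conditions form a set, of size at most \<open>w2\<close>.\<close>

lemma isP_HL: assumes "isP p" shows "p \<E> HL w1"
proof -
  note i = w1(1,3)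
  have el: "x \<E> HL w1" if "x \<E> w2" for x using Ord_HL[OF i] that unfolding w2_def .
  have a: "aP p \<E> HL w1" "B \<E> HL w1" if "sub B (aP p)" for B
  proof -
    have e: "x \<E> HL w1" if "x \<E> aP p" for x using el isP_a(1)[OF assms] that subD by blast
    show "aP p \<E> HL w1" by (rule HL_I[OF i sj_w1[OF isP_a(2)[OF assms]] e])
    show "B \<E> HL w1" by (rule HL_I[OF i sj_w1[OF om_sub[OF isP_a(2)[OF assms] that]] e]) (rule subD[OF that])
  qed
  have s: "sP p \<E> HL w1"
    by (rule HL_I[OF i sj_w1[OF isP_s(1)[OF assms]]]) (use a isP_s(2)[OF assms] in blast)
  have f: "fP p \<E> HL w1"
  proof (rule HL_I[OF i])
    define F where "F z = opr (fs z) (opr (sn z) (Th (%c. opr (fs z) (opr (sn z) c) \<E> fP p)))" for z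
    have d: "Dg F" unfolding F_def by (intro df)
    have "sj (prd (aP p) (aP p)) (fP p)"
    proof (rule sjI[OF d])
      fix z assume z: "z \<E> fP p"
      obtain x y c where xy: "x \<E> aP p" "y \<E> aP p" "x \<E> y" "z = opr x (opr y c)" using isP_f3[OF assms z] by blast
      obtain c' where c': "!!d. opr x (opr y d) \<E> fP p \<longleftrightarrow> d = c'" using isP_f2[OF assms xy(1-3)] by blast
      have "Th (%c. opr x (opr y c) \<E> fP p) = c" by (rule Th_eq) (use c' z xy(4) in auto)
      thus "EX w. w \<E> prd (aP p) (aP p) & F w = z" using xy by (intro exI[of _ "opr x y"]) (simp add: F_def)
    qed
    thus "sj w1 (fP p)" using sj_w1[OF om_prd[OF isP_a(2)[OF assms] isP_a(2)[OF assms]]] sj_trans by blast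
    fix z assume "z \<E> fP p"
    then obtain x y c where "x \<E> aP p" "y \<E> aP p" "c \<E> w1" "z = opr x (opr y c)" using isP_f3[OF assms] by blast
    thus "z \<E> HL w1" using HL_opr[OF i] el isP_a(1)[OF assms] w2(3) subD by blast
  qed
  show ?thesis using isP_eq[OF assms] HL_opr[OF i] a(1)[OF sub_refl] s f by metis
qed

text \<open>Cross pairs of the union of two conditions are coloured so that every pair consisting of a promise
  of \<open>r\<close> and a colour is served by its own element of the promised set.\<close>
lemma glue:
  assumes r: "isP r" and r': "isP r'"
    and agr: "!!x y c. x \<E> aP r ==> x \<E> aP r' ==> y \<E> aP r ==> y \<E> aP r' ==> opr x (opr y c) \<E> fP r \<longleftrightarrow> opr x (opr y c) \<E> fP r'"
    and 1: "!!x B c. x \<E> aP r' ==> ~ x \<E> aP r ==> B \<E> sP r ==> (!!b. b \<E> B ==> x \<E> b) ==> c \<E> aP r ==> c \<E> w1 ==>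
      (EX b. b \<E> B & opr x (opr b c) \<E> fP r') | ~ fin (Sep B (%b. ~ b \<E> aP r'))"
    and 2: "!!x B. x \<E> aP r ==> ~ x \<E> aP r' ==> B \<E> sP r' ==> EX b. b \<E> B & ~ x \<E> b"
  shows "EX s. leP s r & leP s r' & aP s = un (aP r) (aP r') & sP s = un (sP r) (sP r')"
proof -
  define U where "U t = Sep (fs t) (%b. ~ b \<E> aP r')" for t
  have dU: "Dg U" unfolding U_def by (intro df)
  note [df] = dff1[OF dU]
  \<comment> \<open>The tasks left to the new pairs: a promise of \<open>r\<close>, a colour and a
    point of \<open>r'\<close>, where infinitely many elements of the promise lie outside
    \<open>r'\<close>.\<close>
  define T where "T = Sep (prd (sP r) (prd (Sep (aP r) (%c. c \<E> w1)) (aP r'))) (%t. ~ fin (U t))"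
  have mT: "opr B (opr c x) \<E> T \<longleftrightarrow> B \<E> sP r & c \<E> aP r & c \<E> w1 & x \<E> aP r' & ~ fin (Sep B (%b. ~ b \<E> aP r'))" for B c x
  proof -
    have "c \<E> Sep (aP r) (%c. c \<E> w1) \<longleftrightarrow> c \<E> aP r & c \<E> w1" by (rule mem_Sep) (intro df)
    moreover have "t \<E> T \<longleftrightarrow> t \<E> prd (sP r) (prd (Sep (aP r) (%c. c \<E> w1)) (aP r')) & ~ fin (U t)" for t
      unfolding T_def by (rule mem_Sep) (intro df)
    ultimately show ?thesis by (auto simp: U_def)
  qed
  have T3: "t \<E> T ==> ~ fin (U t)" for t unfolding T_def by (subst (asm) mem_Sep) (intro df, blast)
  have s1: "sub (Sep (aP r) (%c. c \<E> w1)) (aP r)" unfolding sub_def by (subst mem_Sep) (intro df, blast)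
  have "sub T (prd (sP r) (prd (Sep (aP r) (%c. c \<E> w1)) (aP r')))"
    unfolding T_def sub_def by (subst mem_Sep) (intro df, blast)
  hence "sj om T" using om_sub[OF om_prd[OF isP_s(1)[OF r] om_prd[OF om_sub[OF isP_a(2)[OF r] s1] isP_a(2)[OF r']]]] by blast
  from distinct_choice[OF this dU T3] obtain g where
    g: "!!t. t \<E> T ==> ap g t \<E> U t" "!!t t'. t \<E> T ==> t' \<E> T ==> ap g t = ap g t' ==> t = t'" by blast
  \<comment> \<open>The pair of \<open>x\<close> and the representative of one of its tasks gets the
    colour of that task; representatives are distinct, so there is no conflict. All other pairs get
    \<open>emp\<close> by the default of \<open>Th\<close>.\<close>
  define v where "v x y = Th (%c. EX B. opr B (opr c x) \<E> T & ap g (opr B (opr c x)) = y)" for x y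
  have dv: "Dt (%e. v (e 0) (e 1))" unfolding v_def by (intro df)
  note [df] = dff2[OF dv]
  have v: "v x (ap g (opr B (opr c x))) = c" if "opr B (opr c x) \<E> T" for B c x
    unfolding v_def
  proof (rule Th_eq)
    fix c' assume "EX B'. opr B' (opr c' x) \<E> T & ap g (opr B' (opr c' x)) = ap g (opr B (opr c x))"
    then obtain B' where "opr B' (opr c' x) \<E> T" "ap g (opr B' (opr c' x)) = ap g (opr B (opr c x))" by blast
    from g(2)[OF this(1) that this(2)] show "c' = c" by simp
  qed (use that in blast)
  have vw: "v x y \<E> w1" for x y
  proof (cases "EX c B. opr B (opr c x) \<E> T & ap g (opr B (opr c x)) = y")
    case True
    then obtain c B where "opr B (opr c x) \<E> T" "ap g (opr B (opr c x)) = y" by blast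
    thus ?thesis using v mT by metis
  next
    case False
    hence "v x y = emp" unfolding v_def Th_def by auto
    thus ?thesis using w1(3) om_emp subD by simp
  qed
  define a where "a = un (aP r) (aP r')"
  define cr where "cr x y \<longleftrightarrow> ~ (x \<E> aP r & y \<E> aP r) & ~ (x \<E> aP r' & y \<E> aP r')" for x y
  define X where "X = Im (%z. opr (fs z) (opr (sn z) (v (fs z) (sn z)))) (Sep (prd a a) (%z. fs z \<E> sn z & cr (fs z) (sn z)))"
  have X: "z \<E> X \<longleftrightarrow> (EX x y. x \<E> a & y \<E> a & x \<E> y & cr x y & z = opr x (opr y (v x y)))" for z
  proof -
    have "w \<E> Sep (prd a a) (%z. fs z \<E> sn z & cr (fs z) (sn z)) \<longleftrightarrow> w \<E> prd a a & fs w \<E> sn w & cr (fs w) (sn w)" for w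
      unfolding cr_def by (rule mem_Sep) (intro df)
    moreover have "Dg (%z. opr (fs z) (opr (sn z) (v (fs z) (sn z))))" by (intro df)
    ultimately show ?thesis unfolding X_def mem_prd by (subst mem_Im) (assumption, auto, metis fs_opr sn_opr)
  qed
  define f where "f = un (un (fP r) (fP r')) X"
  define s where "s = opr a (opr f (un (sP r) (sP r')))"
  have f1: "opr x (opr y c) \<E> f \<longleftrightarrow> opr x (opr y c) \<E> fP r" if "x \<E> aP r" "y \<E> aP r" for x y c
  proof -
    have "~ opr x (opr y c) \<E> X" unfolding X cr_def opr_inj using that by blast
    thus ?thesis unfolding f_def mem_un using that agr[of x y c] isP_f[OF r', of x y c] by blast
  qed
  have f2: "opr x (opr y c) \<E> f \<longleftrightarrow> opr x (opr y c) \<E> fP r'" if "x \<E> aP r'" "y \<E> aP r'" for x y c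
  proof -
    have "~ opr x (opr y c) \<E> X" unfolding X cr_def opr_inj using that by blast
    thus ?thesis unfolding f_def mem_un using that agr[of x y c] isP_f[OF r, of x y c] by blast
  qed
  have f3: "opr x (opr y c) \<E> f \<longleftrightarrow> c = v x y" if "x \<E> a" "y \<E> a" "x \<E> y" "cr x y" for x y c
  proof -
    have "~ opr x (opr y c) \<E> fP r" "~ opr x (opr y c) \<E> fP r'"
      using that(4) isP_f[OF r, of x y c] isP_f[OF r', of x y c] unfolding cr_def by blast+
    thus ?thesis unfolding f_def mem_un X opr_inj using that by blast
  qed
  have ps: "isP s" unfolding s_def
  proof (rule isP_I)
    show "sub a w2" using isP_a(1)[OF r] isP_a(1)[OF r'] unfolding a_def by (auto simp: sub_def)
    show "sj om a" unfolding a_def by (rule om_un[OF isP_a(2)[OF r] isP_a(2)[OF r']])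
    show "sj om (un (sP r) (sP r'))" by (rule om_un[OF isP_s(1)[OF r] isP_s(1)[OF r']])
    show "sub B a & ~ fin B" if "B \<E> un (sP r) (sP r')" for B
      using that isP_s(2,3)[OF r, of B] isP_s(2,3)[OF r', of B] unfolding a_def sub_def by auto
    show "EX x y c. x \<E> a & y \<E> a & x \<E> y & c \<E> w1 & z = opr x (opr y c)" if "z \<E> f" for z
    proof -
      from that consider "z \<E> fP r" | "z \<E> fP r'" | "z \<E> X" unfolding f_def by auto
      thus ?thesis
      proof cases
        case 1 from isP_f3[OF r this] show ?thesis unfolding a_def mem_un by blast
      next
        case 2 from isP_f3[OF r' this] show ?thesis unfolding a_def mem_un by blast
      next
        case 3 thus ?thesis unfolding X using vw by blast
      qed
    qed
    show "EX c. ALL d. opr x (opr y d) \<E> f \<longleftrightarrow> d = c" if xy: "x \<E> a" "y \<E> a" "x \<E> y" for x y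
    proof -
      consider "x \<E> aP r & y \<E> aP r" | "x \<E> aP r' & y \<E> aP r'" | "cr x y" unfolding cr_def by blast
      thus ?thesis
      proof cases
        case 1 thus ?thesis using isP_f2[OF r, of x y] f1 xy by simp
      next
        case 2 thus ?thesis using isP_f2[OF r', of x y] f2 xy by simp
      next
        case 3 thus ?thesis using f3 xy by blast
      qed
    qed
  qed
  have sel: "aP s = a" "fP s = f" "sP s = un (sP r) (sP r')" unfolding s_def by simp_all
  have "leP s r"
  proof (rule leP_I[OF ps r], unfold sel)
    show "sub (aP r) a" "sub (fP r) f" "sub (sP r) (un (sP r) (sP r'))" unfolding a_def f_def by (auto simp: sub_def)
    fix x B c assume x: "x \<E> a" "~ x \<E> aP r" "B \<E> sP r" "!!b. b \<E> B ==> x \<E> b" "c \<E> aP r" "c \<E> w1"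
    have xr: "x \<E> aP r'" using x(1,2) unfolding a_def by simp
    from 1[OF xr x(2-6)] show "EX b. b \<E> B & opr x (opr b c) \<E> f"
    proof
      assume "EX b. b \<E> B & opr x (opr b c) \<E> fP r'" thus ?thesis unfolding f_def mem_un by blast
    next
      assume nf: "~ fin (Sep B (%b. ~ b \<E> aP r'))"
      hence t: "opr B (opr c x) \<E> T" using mT x xr by blast
      define b where "b = ap g (opr B (opr c x))"
      have "b \<E> Sep B (%b. ~ b \<E> aP r')" using g(1)[OF t] unfolding U_def b_def by simp
      hence b: "b \<E> B" "~ b \<E> aP r'" by (subst (asm) mem_Sep; (intro df)?; blast)+
      have "b \<E> aP r" using b(1) isP_s(2)[OF r x(3)] subD by blast
      hence "opr x (opr b (v x b)) \<E> f" using f3[OF x(1) _ x(4)[OF b(1)]] b x(2) unfolding cr_def a_def by simp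
      thus ?thesis using v[OF t] b(1) unfolding b_def by auto
    qed
  qed
  moreover have "leP s r'"
  proof (rule leP_I[OF ps r'], unfold sel)
    show "sub (aP r') a" "sub (fP r') f" "sub (sP r') (un (sP r) (sP r'))" unfolding a_def f_def by (auto simp: sub_def)
    fix x B c assume x: "x \<E> a" "~ x \<E> aP r'" "B \<E> sP r'" "!!b. b \<E> B ==> x \<E> b"
    hence "x \<E> aP r" unfolding a_def by simp
    from 2[OF this x(2,3)] x(4) show "EX b. b \<E> B & opr x (opr b c) \<E> f" by blast
  qed
  ultimately show ?thesis using sel unfolding a_def by blast
qed

text \<open>Glue with a condition that has just the new points, coloured constantly and without
  promises. Every promise of \<open>r\<close> lies entirely outside it, so all tasks can be
  served.\<close>

lemma add_points: assumes r: "isP r" and X: "sub X w2" "sj om X" shows "EX s. leP s r & sub X (aP s) & sP s = sP r"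
proof -
  define Y where "Y = Sep X (%x. ~ x \<E> aP r)"
  have Y: "x \<E> Y \<longleftrightarrow> x \<E> X & ~ x \<E> aP r" for x unfolding Y_def by (rule mem_Sep) (intro df)
  define f where "f = Im (%z. opr (fs z) (opr (sn z) emp)) (Sep (prd Y Y) (%z. fs z \<E> sn z))"
  have f: "z \<E> f \<longleftrightarrow> (EX x y. x \<E> Y & y \<E> Y & x \<E> y & z = opr x (opr y emp))" for z
  proof -
    have "w \<E> Sep (prd Y Y) (%z. fs z \<E> sn z) \<longleftrightarrow> w \<E> prd Y Y & fs w \<E> sn w" for w by (rule mem_Sep) (intro df)
    moreover have "Dg (%z. opr (fs z) (opr (sn z) emp))" by (intro df)
    ultimately show ?thesis unfolding f_def mem_prd by (subst mem_Im) (assumption, auto, metis fs_opr sn_opr)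
  qed
  define r' where "r' = opr Y (opr f emp)"
  have sel: "aP r' = Y" "fP r' = f" "sP r' = emp" unfolding r'_def by simp_all
  have YX: "sub Y X" using Y by (simp add: sub_def)
  have pr: "isP r'" unfolding r'_def
  proof (rule isP_I)
    show "sub Y w2" using YX X(1) sub_trans by blast
    show "sj om Y" using YX om_sub[OF X(2)] by blast
    show "sj om emp" using fin_om by simp
    show "EX x y c. x \<E> Y & y \<E> Y & x \<E> y & c \<E> w1 & z = opr x (opr y c)" if "z \<E> f" for z
      using that w1(3) om_emp subD unfolding f by blast
    show "EX c. ALL d. opr x (opr y d) \<E> f \<longleftrightarrow> d = c" if "x \<E> Y" "y \<E> Y" "x \<E> y" for x y
      using that unfolding f by (intro exI[of _ emp]) auto
  qed simp
  have "EX s. leP s r & leP s r' & aP s = un (aP r) (aP r') & sP s = un (sP r) (sP r')"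
  proof (rule glue[OF r pr], unfold sel)
    fix x y c assume "x \<E> aP r" "x \<E> Y" thus "opr x (opr y c) \<E> fP r \<longleftrightarrow> opr x (opr y c) \<E> f" using Y by blast
  next
    fix x B c assume B: "B \<E> sP r"
    have "Sep B (%b. ~ b \<E> Y) = B"
    proof (rule ext)
      fix z have "z \<E> Sep B (%b. ~ b \<E> Y) \<longleftrightarrow> z \<E> B & ~ z \<E> Y" by (rule mem_Sep) (intro df)
      thus "z \<E> Sep B (%b. ~ b \<E> Y) \<longleftrightarrow> z \<E> B" using isP_s(2)[OF r B] Y subD by blast
    qed
    thus "(EX b. b \<E> B & opr x (opr b c) \<E> f) | ~ fin (Sep B (%b. ~ b \<E> Y))" using isP_s(3)[OF r B] by simp
  qed simp
  then obtain s where s: "leP s r" "aP s = un (aP r) Y" "sP s = un (sP r) emp" unfolding sel by blast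
  moreover have "un (sP r) emp = sP r" by (rule ext) simp
  moreover have "sub X (aP s)" unfolding s(2) sub_def mem_un Y by blast
  ultimately show ?thesis by metis
qed

text \<open>No point is added, so no promise has to be served.\<close>

lemma add_promises: assumes r: "isP r" and S: "sj om S" "!!B. B \<E> S ==> sub B (aP r) & ~ fin B"
  shows "EX s. leP s r & sub S (sP s) & aP s = aP r"
proof -
  define s where "s = opr (aP r) (opr (fP r) (un (sP r) S))"
  have sel: "aP s = aP r" "fP s = fP r" "sP s = un (sP r) S" unfolding s_def by simp_all
  have "isP s" unfolding s_def
  proof (rule isP_I)
    show "sub (aP r) w2" "sj om (aP r)" by (rule isP_a[OF r])+
    show "sj om (un (sP r) S)" by (rule om_un[OF isP_s(1)[OF r] S(1)])
    show "sub B (aP r) & ~ fin B" if "B \<E> un (sP r) S" for B using that isP_s(2,3)[OF r, of B] S(2) by auto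
    show "EX x y c. x \<E> aP r & y \<E> aP r & x \<E> y & c \<E> w1 & z = opr x (opr y c)" if "z \<E> fP r" for z by (rule isP_f3[OF r that])
    show "EX c. ALL d. opr x (opr y d) \<E> fP r \<longleftrightarrow> d = c" if "x \<E> aP r" "y \<E> aP r" "x \<E> y" for x y by (rule isP_f2[OF r that])
  qed
  hence "leP s r" by (rule leP_I[OF _ r]; unfold sel) (auto simp: sub_def)
  thus ?thesis using sel by (intro exI[of _ s]) (auto simp: sub_def)
qed

text \<open>The union works: any point or pair of it is present at some stage below
  \<open>F n\<close>, where the obligations of \<open>F n\<close> were met.\<close>

lemma leP_limit: assumes dF: "Dg F" and F: "!!n. n \<E> om ==> leP (F (suc n)) (F n)"
  shows "EX s. ALL n. n \<E> om --> leP s (F n)"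
proof -
  note [df] = dff1[OF dF]
  have FP: "isP (F n)" if "n \<E> om" for n using F[OF that] leP_isP by blast
  have mono: "k \<E> n --> leP (F n) (F k)" if "n \<E> om" for n k
  proof (rule om_ind[of "%n. k \<E> n --> leP (F n) (F k)", OF _ that])
    show "Dp (%n. k \<E> n --> leP (F n) (F k))" by (intro df)
  qed (use F leP_trans in auto)
  have mono2: "leP (F n) (F k) | leP (F k) (F n)" if "n \<E> om" "k \<E> om" for n k
    using Ord_lin[OF om_Ord[OF that(1)] om_Ord[OF that(2)]] mono[OF that(1), of k] mono[OF that(2), of n] leP_refl[OF FP[OF that(1)]] by metis
  define a where "a = Unn (Im (%n. aP (F n)) om)"
  define f where "f = Unn (Im (%n. fP (F n)) om)"
  define S where "S = Unn (Im (%n. sP (F n)) om)"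
  have d: "Dg (%n. aP (F n))" "Dg (%n. fP (F n))" "Dg (%n. sP (F n))" by (intro df)+
  have a: "x \<E> a \<longleftrightarrow> (EX n. n \<E> om & x \<E> aP (F n))" for x unfolding a_def by (auto simp: mem_Im[OF d(1)])
  have f: "x \<E> f \<longleftrightarrow> (EX n. n \<E> om & x \<E> fP (F n))" for x unfolding f_def by (auto simp: mem_Im[OF d(2)])
  have S: "x \<E> S \<longleftrightarrow> (EX n. n \<E> om & x \<E> sP (F n))" for x unfolding S_def by (auto simp: mem_Im[OF d(3)])
  have com: "EX k. k \<E> om & leP (F k) (F n) & leP (F k) (F m)" if "n \<E> om" "m \<E> om" for n m
    using mono2[OF that] that FP leP_refl by blast
  have ps: "isP (opr a (opr f S))"
  proof (rule isP_I)
    show "sub a w2"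
    proof (rule subI)
      fix x assume "x \<E> a"
      then obtain n where "n \<E> om" "x \<E> aP (F n)" using a by blast
      thus "x \<E> w2" using isP_a(1)[OF FP] subD by blast
    qed
    show "sj om a" unfolding a_def
      by (rule sj_Unn[OF om_sq sj_Im[OF d(1)]]) (use isP_a(2)[OF FP] in \<open>auto simp: mem_Im[OF d(1)]\<close>)
    show "sj om S" unfolding S_def
      by (rule sj_Unn[OF om_sq sj_Im[OF d(3)]]) (use isP_s(1)[OF FP] in \<open>auto simp: mem_Im[OF d(3)]\<close>)
    fix B assume "B \<E> S"
    then obtain n where n: "n \<E> om" "B \<E> sP (F n)" using S by blast
    have "sub (aP (F n)) a" using a n(1) by (auto simp: sub_def)
    thus "sub B a & ~ fin B" using isP_s(2,3)[OF FP[OF n(1)] n(2)] sub_trans by blast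
  next
    fix z assume "z \<E> f"
    then obtain n where n: "n \<E> om" "z \<E> fP (F n)" using f by blast
    show "EX x y c. x \<E> a & y \<E> a & x \<E> y & c \<E> w1 & z = opr x (opr y c)" using isP_f3[OF FP[OF n(1)] n(2)] n(1) a by blast
  next
    fix x y assume xy: "x \<E> a" "y \<E> a" "x \<E> y"
    then obtain n m where nm: "n \<E> om" "x \<E> aP (F n)" "m \<E> om" "y \<E> aP (F m)" using a by blast
    obtain k where k: "k \<E> om" "leP (F k) (F n)" "leP (F k) (F m)" using com nm by blast
    have in_k: "x \<E> aP (F k)" "y \<E> aP (F k)" using nm k leP_sub(1) subD by blast+
    obtain c where c: "!!d. opr x (opr y d) \<E> fP (F k) \<longleftrightarrow> d = c" using isP_f2[OF FP[OF k(1)] in_k xy(3)] by blast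
    have "d = c" if "opr x (opr y d) \<E> f" for d
    proof -
      obtain l where l: "l \<E> om" "opr x (opr y d) \<E> fP (F l)" using \<open>opr x (opr y d) \<E> f\<close> f by blast
      obtain i where i: "i \<E> om" "leP (F i) (F k)" "leP (F i) (F l)" using com k(1) l(1) by blast
      have "x \<E> aP (F i)" "y \<E> aP (F i)" "opr x (opr y d) \<E> fP (F i)" "opr x (opr y c) \<E> fP (F i)"
        using in_k l(2) c i leP_sub subD by blast+
      thus "d = c" using isP_f2[OF FP[OF i(1)] _ _ xy(3)] by metis
    qed
    thus "EX c. ALL d. opr x (opr y d) \<E> f \<longleftrightarrow> d = c" using c f k(1) by blast
  qed
  have "leP (opr a (opr f S)) (F n)" if n: "n \<E> om" for n
  proof (rule leP_I[OF ps FP[OF n]], unfold P_sel)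
    show "sub (aP (F n)) a" "sub (fP (F n)) f" "sub (sP (F n)) S" using a f S n by (auto simp: sub_def)
    fix x B c assume x: "x \<E> a" "~ x \<E> aP (F n)" "B \<E> sP (F n)" "!!b. b \<E> B ==> x \<E> b" "c \<E> aP (F n)" "c \<E> w1"
    obtain m where m: "m \<E> om" "x \<E> aP (F m)" using x(1) a by blast
    obtain k where k: "k \<E> om" "leP (F k) (F n)" "leP (F k) (F m)" using com n m(1) by blast
    have "x \<E> aP (F k)" using m(2) leP_sub(1)[OF k(3)] subD by blast
    from leP_new[OF k(2) this x(2-6)] show "EX b. b \<E> B & opr x (opr b c) \<E> f" using f k(1) by blast
  qed
  thus ?thesis by blast
qed

text \<open>Finite traces are dropped because a condition admits only infinite promises.\<close>

definition "rs r d = opr (Sep (aP r) (%x. x \<E> d)) (opr (Sep (fP r) (%z. fs z \<E> d & fs (sn z) \<E> d))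
  (Sep (Im (%B. Sep B (%x. x \<E> d)) (sP r)) (%B. ~ fin B)))"
lemma rs_sel: "x \<E> aP (rs r d) \<longleftrightarrow> x \<E> aP r & x \<E> d"
  "opr x (opr y c) \<E> fP (rs r d) \<longleftrightarrow> opr x (opr y c) \<E> fP r & x \<E> d & y \<E> d"
  "B \<E> sP (rs r d) \<longleftrightarrow> ~ fin B & (EX B'. B' \<E> sP r & B = Sep B' (%x. x \<E> d))"
proof -
  show "x \<E> aP (rs r d) \<longleftrightarrow> x \<E> aP r & x \<E> d" unfolding rs_def P_sel by (rule mem_Sep) (intro df)
  show "opr x (opr y c) \<E> fP (rs r d) \<longleftrightarrow> opr x (opr y c) \<E> fP r & x \<E> d & y \<E> d"
    unfolding rs_def P_sel by (subst mem_Sep) (intro df, simp)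
  have d: "Dg (%B. Sep B (%x. x \<E> d))" by (intro df)
  show "B \<E> sP (rs r d) \<longleftrightarrow> ~ fin B & (EX B'. B' \<E> sP r & B = Sep B' (%x. x \<E> d))"
    unfolding rs_def P_sel by (subst mem_Sep) (intro df, unfold mem_Im[OF d], blast)
qed
lemma isP_rs: assumes r: "isP r" shows "isP (rs r d)"
proof -
  have s: "sub (aP (rs r d)) (aP r)" by (simp add: sub_def rs_sel)
  have "isP (opr (aP (rs r d)) (opr (fP (rs r d)) (sP (rs r d))))"
  proof (rule isP_I)
    show "sub (aP (rs r d)) w2" "sj om (aP (rs r d))" using s isP_a[OF r] sub_trans om_sub by blast+
    have dd: "Dg (%B. Sep B (%x. x \<E> d))" by (intro df)
    have "sub (sP (rs r d)) (Im (%B. Sep B (%x. x \<E> d)) (sP r))" unfolding sub_def rs_sel mem_Im[OF dd] by blast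
    thus "sj om (sP (rs r d))" using om_sub[OF om_Im[OF dd isP_s(1)[OF r]]] by blast
    fix B assume "B \<E> sP (rs r d)"
    then obtain B' where B: "~ fin B" "B' \<E> sP r" "B = Sep B' (%x. x \<E> d)" using rs_sel(3) by blast
    have "x \<E> B \<longleftrightarrow> x \<E> B' & x \<E> d" for x unfolding B(3) by (rule mem_Sep) (intro df)
    thus "sub B (aP (rs r d)) & ~ fin B" using B isP_s(2)[OF r B(2)] unfolding sub_def rs_sel by blast
  next
    fix z assume "z \<E> fP (rs r d)"
    hence "z \<E> fP r & fs z \<E> d & fs (sn z) \<E> d" unfolding rs_def P_sel by (subst (asm) mem_Sep) (intro df)
    moreover then obtain x y c where "x \<E> aP r" "y \<E> aP r" "x \<E> y" "c \<E> w1" "z = opr x (opr y c)" using isP_f3[OF r] by blast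
    ultimately show "EX x y c. x \<E> aP (rs r d) & y \<E> aP (rs r d) & x \<E> y & c \<E> w1 & z = opr x (opr y c)" unfolding rs_sel by auto
  next
    fix x y assume "x \<E> aP (rs r d)" "y \<E> aP (rs r d)" "x \<E> y"
    thus "EX c. ALL da. opr x (opr y da) \<E> fP (rs r d) \<longleftrightarrow> da = c" using isP_f2[OF r, of x y] unfolding rs_sel by simp
  qed
  thus ?thesis by (simp add: rs_def)
qed
text \<open>A promise of \<open>r\<close> with infinite trace on \<open>d\<close> is already obeyed
  by \<open>r'\<close>, as \<open>w1\<close> lies in \<open>d\<close> and the restriction knows all
  colours of \<open>r\<close>. A promise with finite trace has infinitely many elements outside
  \<open>r'\<close> that can be coloured freely. Promises of \<open>r'\<close> lie inside
  \<open>d\<close> and do not concern points outside \<open>d\<close>.\<close>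

lemma amalgamation:
  assumes r: "isP r" and d: "Ord d" "sub w1 d" and r': "leP r' (rs r d)" "sub (aP r') d"
  shows "EX s. leP s r & leP s r'"
proof -
  have pr': "isP r'" using r'(1) leP_isP by blast
  have "EX s. leP s r & leP s r' & aP s = un (aP r) (aP r') & sP s = un (sP r) (sP r')"
  proof (rule glue[OF r pr'])
    fix x y c assume xy: "x \<E> aP r" "x \<E> aP r'" "y \<E> aP r" "y \<E> aP r'"
    have dd: "x \<E> d" "y \<E> d" using xy r'(2) subD by blast+
    show "opr x (opr y c) \<E> fP r \<longleftrightarrow> opr x (opr y c) \<E> fP r'"
    proof
      assume "opr x (opr y c) \<E> fP r"
      hence "opr x (opr y c) \<E> fP (rs r d)" using dd unfolding rs_sel by blast
      thus "opr x (opr y c) \<E> fP r'" using leP_sub(2)[OF r'(1)] subD by blast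
    next
      assume a: "opr x (opr y c) \<E> fP r'"
      hence "x \<E> y" using isP_f[OF pr'] by blast
      then obtain e where e: "!!d. opr x (opr y d) \<E> fP r \<longleftrightarrow> d = e" using isP_f2[OF r xy(1,3)] by blast
      hence "opr x (opr y e) \<E> fP (rs r d)" using dd unfolding rs_sel by blast
      hence "opr x (opr y e) \<E> fP r'" using leP_sub(2)[OF r'(1)] subD by blast
      hence "c = e" using a isP_f2[OF pr' xy(2,4) \<open>x \<E> y\<close>] by metis
      thus "opr x (opr y c) \<E> fP r" using e by simp
    qed
  next
    fix x B c assume x: "x \<E> aP r'" "~ x \<E> aP r" "B \<E> sP r" "!!b. b \<E> B ==> x \<E> b" "c \<E> aP r" "c \<E> w1"
    define B1 where "B1 = Sep B (%x. x \<E> d)"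
    define B2 where "B2 = Sep B (%b. ~ b \<E> aP r')"
    have B1: "b \<E> B1 \<longleftrightarrow> b \<E> B & b \<E> d" for b unfolding B1_def by (rule mem_Sep) (intro df)
    have B2: "b \<E> B2 \<longleftrightarrow> b \<E> B & ~ b \<E> aP r'" for b unfolding B2_def by (rule mem_Sep) (intro df)
    have "(EX b. b \<E> B & opr x (opr b c) \<E> fP r') | ~ fin B2"
    proof (cases "fin B1")
      case True
      have "sub B (un B1 B2)" unfolding sub_def mem_un B1 B2 using r'(2) subD by blast
      thus ?thesis using isP_s(3)[OF r x(3)] fin_un[OF True] fin_sub by blast
    next
      case False
      hence "B1 \<E> sP (rs r d)" unfolding rs_sel B1_def using x(3) by blast
      moreover have "~ x \<E> aP (rs r d)" "c \<E> aP (rs r d)" using x(2,5,6) d(2) subD unfolding rs_sel by blast+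
      ultimately show ?thesis using leP_new[OF r'(1) x(1) _ _ _ _ x(6), of B1] x(4) B1 by blast
    qed
    thus "(EX b. b \<E> B & opr x (opr b c) \<E> fP r') | ~ fin (Sep B (%b. ~ b \<E> aP r'))" unfolding B2_def .
  next
    fix x B assume x: "x \<E> aP r" "~ x \<E> aP r'" "B \<E> sP r'"
    have "~ x \<E> d" using x leP_sub(1)[OF r'(1)] rs_sel(1) subD by blast
    moreover obtain b where b: "b \<E> B"
    proof -
      have "B ~= emp" using isP_s(3)[OF pr' x(3)] by auto
      thus ?thesis using that ext[of B emp] by auto
    qed
    moreover have "b \<E> d" using isP_s(2)[OF pr' x(3)] b r'(2) subD by blast
    ultimately show "EX b. b \<E> B & ~ x \<E> b" using Ord_trans[OF d(1)] by blast
  qed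
  thus ?thesis by blast
qed

subsection \<open>The Cohen part\<close>

text \<open>\<open>opr n s\<close> is the finite 0-1 sequence of length \<open>n\<close> with ones
  exactly at the places in \<open>s\<close>.\<close>

definition "isC q \<longleftrightarrow> (EX n s. n \<E> om & sub s n & q = opr n s)"
definition "leC q r \<longleftrightarrow> isC q & isC r & sub (fs r) (fs q) & (ALL i. i \<E> fs r --> (i \<E> sn r \<longleftrightarrow> i \<E> sn q))"
definition "CC = Unn (Im (%n. Im (opr n) (Pw n)) om)"
lemma df_isC[df]: "Dt t ==> Df (%e. isC (t e))" unfolding isC_def by (intro df dff_Suc)
lemma df_leC[df]: "Dt t ==> Dt s ==> Df (%e. leC (t e) (s e))" unfolding leC_def by (intro df dff_Suc)
lemma mem_CC: "q \<E> CC \<longleftrightarrow> isC q"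
proof -
  have d: "Dg (%n. Im (opr n) (Pw n))" "!!n. Dg (opr n)" by (intro df)+
  show ?thesis unfolding CC_def isC_def by (auto simp: mem_Im[OF d(1)] mem_Im[OF d(2)])
qed
lemma fin_Pw: assumes "n \<E> om" shows "fin (Pw n)"
proof (rule om_ind[of "%n. fin (Pw n)", OF _ assms])
  show "Dp (%n. fin (Pw n))" by (intro df)
  have "sub x emp ==> x = emp" for x by (rule ext) (simp add: sub_def)
  hence "sub (Pw emp) (sing emp)" by (simp add: sub_def[of "Pw emp"])
  thus "fin (Pw emp)" using fin_sing fin_sub by blast
  fix n assume "fin (Pw n)"
  have d: "Dg (%x. un x (sing n))" by (intro df)
  have "sub (Pw (suc n)) (un (Pw n) (Im (%x. un x (sing n)) (Pw n)))"
  proof (rule subI)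
    fix x assume x: "x \<E> Pw (suc n)"
    define y where "y = Sep x (%z. z ~= n)"
    have y: "z \<E> y \<longleftrightarrow> z \<E> x & z ~= n" for z unfolding y_def by (rule mem_Sep) (intro df)
    have yn: "y \<E> Pw n" using x y by (auto simp: sub_def)
    have "x = y | x = un y (sing n)"
    proof (cases "n \<E> x")
      case True
      have "x = un y (sing n)" by (rule ext) (use y True in auto)
      thus ?thesis by blast
    next
      case False
      have "x = y" by (rule ext) (use y False in auto)
      thus ?thesis by blast
    qed
    thus "x \<E> un (Pw n) (Im (%x. un x (sing n)) (Pw n))" unfolding mem_un mem_Im[OF d] using yn by metis
  qed
  thus "fin (Pw (suc n))" using fin_sub fin_un[OF \<open>fin (Pw n)\<close> fin_Im[OF d \<open>fin (Pw n)\<close>]] by blast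
qed
lemma sj_CC: "sj om CC" unfolding CC_def
proof (rule sj_Unn[OF om_sq])
  have d: "Dg (%n. Im (opr n) (Pw n))" "!!n. Dg (opr n)" by (intro df)+
  show "sj om (Im (%n. Im (opr n) (Pw n)) om)" by (rule sj_Im[OF d(1)])
  fix x assume "x \<E> Im (%n. Im (opr n) (Pw n)) om"
  then obtain n where n: "n \<E> om" "x = Im (opr n) (Pw n)" using mem_Im[OF d(1)] by blast
  show "sj om x" unfolding n(2) by (rule om_Im[OF d(2) fin_om[OF fin_Pw[OF n(1)]]])
qed
lemma leC_refl: "isC q ==> leC q q" unfolding leC_def by simp
lemma leC_trans: "leC p q ==> leC q r ==> leC p r" unfolding leC_def using sub_trans subD by blast
lemma leC_isC: "leC p q ==> isC p" "leC p q ==> isC q" unfolding leC_def by blast+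
text \<open>Lengthen the sequence to \<open>suc m\<close>, with 0 at the new places below
  \<open>m\<close>.\<close>

lemma leC_bit: assumes q: "isC q" and m: "m \<E> om" "~ m \<E> fs q"
  shows "EX r. leC r q & m \<E> fs r & (m \<E> sn r \<longleftrightarrow> b)"
proof -
  obtain n s where ns: "n \<E> om" "sub s n" "q = opr n s" using q isC_def by blast
  have nm: "sub n m" using Ord_not_mem[OF om_Ord[OF m(1)] om_Ord[OF ns(1)]] m(2) ns(3) by simp
  define t where "t = (if b then un s (sing m) else s)"
  have st: "sub t (suc m)" unfolding t_def using ns(2) nm by (auto simp: sub_def)
  have "~ m \<E> s" using ns(2) m(2) ns(3) by (auto simp: sub_def)
  hence "m \<E> t \<longleftrightarrow> b" unfolding t_def by auto
  moreover have "isC (opr (suc m) t)" unfolding isC_def using st om_suc[OF m(1)] by blast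
  moreover have "i \<E> s \<longleftrightarrow> i \<E> t" if "i \<E> n" for i
  proof -
    have "i ~= m" using that m(2) ns(3) by auto
    thus ?thesis unfolding t_def by auto
  qed
  moreover have "sub n (suc m)" using nm by (auto simp: sub_def)
  ultimately have "leC (opr (suc m) t) q" unfolding leC_def using q ns(3) by simp
  thus ?thesis using \<open>m \<E> t \<longleftrightarrow> b\<close> by (intro exI[of _ "opr (suc m) t"]) simp
qed

definition "leQ x y \<longleftrightarrow> (EX p q p' q'. x = opr p q & y = opr p' q' & leP p p' & leC q q')"
definition "QQ = Sep (prd (HL w1) CC) (%x. isP (fs x))"
definition "oneQ = opr (opr emp (opr emp emp)) (opr emp emp)"
lemma df_leQ[df]: "Dt t ==> Dt s ==> Df (%e. leQ (t e) (s e))" unfolding leQ_def by (intro df dff_Suc)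
lemma mem_QQ: "x \<E> QQ \<longleftrightarrow> (EX p q. x = opr p q & isP p & isC q)"
proof -
  have "x \<E> QQ \<longleftrightarrow> x \<E> prd (HL w1) CC & isP (fs x)" unfolding QQ_def by (rule mem_Sep) (intro df)
  thus ?thesis unfolding mem_prd mem_CC using isP_HL by auto
qed
lemma leQ_opr[simp]: "leQ (opr p q) (opr p' q') \<longleftrightarrow> leP p p' & leC q q'" unfolding leQ_def by auto

text \<open>Fusion: a condition \<open>p\<close> that decides each \<open>n\<close> as soon as some extension of it does, up to an extension
  of the Cohen part.\<close>
lemma fusion: assumes D: "Df (%e. D (e 0) (e 1) (e 2))" and p: "isP p"
  and mono: "!!p p' q n. D p q n ==> leP p' p ==> D p' q n"
  shows "EX p'. leP p' p & (ALL n p'' q. n \<E> om --> leP p'' p' --> isC q --> (EX q'. leC q' q & D p'' q' n) --> (EX q'. leC q' q & D p' q' n))"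
proof -
  note [df] = dfp3[OF D]
  \<comment> \<open>There are countably many pairs of an argument and a Cohen condition, and each
    gets a step of its own.\<close>
  obtain e where e: "ALL y. y \<E> prd om CC --> (EX k. k \<E> om & ap e k = y)"
    using om_prd[OF sj_refl sj_CC] unfolding sj_def by blast
  define W where "W k r s \<longleftrightarrow> leP s r & (EX q'. leC q' (sn (ap e k)) & D s q' (fs (ap e k)))" for k r s
  have dW: "Df (%e. W (e 0) (e 1) (e 2))" unfolding W_def by (intro df)
  note [df] = dfp3[OF dW]
  define st where "st k r = (if EX s. W k r s then cho (W k r) else r)" for k r
  have dst: "Dt (%e. st (e 0) (e 1))" unfolding st_def by (intro df)
  note [df] = dff2[OF dst]
  have st: "leP (st k r) r" "(EX s. W k r s) ==> W k r (st k r)" if r: "isP r" for k r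
  proof -
    have d: "Dp (W k r)" by (intro df)
    show w: "(EX s. W k r s) ==> W k r (st k r)" using cho[OF d] unfolding st_def by auto
    show "leP (st k r) r"
    proof (cases "EX s. W k r s")
      case True from w[OF this] show ?thesis unfolding W_def by blast
    next
      case False thus ?thesis unfolding st_def if_not_P[OF False] by (intro leP_refl r)
    qed
  qed
  define F where "F n = orec (%u f. if u = emp then p else st (Unn u) (ap f (Unn u))) n" for n
  have dG: "Dt (%e. if e 0 = emp then p else st (Unn (e 0)) (ap (e 1) (Unn (e 0))))" by (intro df)
  have dF: "Dg F" unfolding F_def by (intro df)
  have dF': "Dg (orec (%u f. if u = emp then p else st (Unn u) (ap f (Unn u))))" by (intro df)
  have F0: "F emp = p" unfolding F_def by (subst orec[OF dG Ord_emp]) simp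
  have FS: "F (suc n) = st n (F n)" if "n \<E> om" for n
    unfolding F_def using om_Ord[OF that] by (subst orec[OF dG]) (simp_all add: ap_lam[OF dF'])
  have FP: "isP (F n)" if "n \<E> om" for n
  proof (rule om_ind[of "%n. isP (F n)", OF _ that])
    show "Dp (%n. isP (F n))" by (intro df dff1[OF dF])
    show "isP (F emp)" using F0 p by simp
    show "n \<E> om ==> isP (F n) ==> isP (F (suc n))" for n using FS[of n] leP_isP(1)[OF st(1)[of "F n" n]] by simp
  qed
  obtain s where s: "!!n. n \<E> om ==> leP s (F n)" using leP_limit[OF dF] FS st(1) FP by metis
  \<comment> \<open>A later extension that decides shows that step \<open>k\<close> had a witness;
    what this step decided persists in the limit.\<close>
  have "EX q'. leC q' q & D s q' n" if n: "n \<E> om" and q: "isC q" and p'': "leP p'' s" "EX q'. leC q' q & D p'' q' n" for n q p''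
  proof -
    obtain k where k: "k \<E> om" "ap e k = opr n q" using e n q mem_CC by (metis opr_prd)
    have "leP p'' (F k)" using leP_trans[OF p''(1) s[OF k(1)]] .
    hence "EX t. W k (F k) t" unfolding W_def using k p''(2) by auto
    hence "W k (F k) (F (suc k))" using st(2)[OF FP[OF k(1)]] FS[OF k(1)] by simp
    then obtain q' where q': "leC q' q" "D (F (suc k)) q' n" unfolding W_def using k by auto
    thus ?thesis using mono s[OF om_suc[OF k(1)]] by blast
  qed
  thus ?thesis using s[OF om_emp] F0 by metis
qed

end

locale VLn = VL E for E :: "nat => nat => bool" (infix "\<E>" 50)
begin

sublocale Q: forcing E QQ leQ oneQ
proof
  show "Df (%e. leQ (e 0) (e 1))" by (intro df)
  show "leQ x y ==> x \<E> QQ & y \<E> QQ" for x y unfolding leQ_def mem_QQ using leP_isP[of "fs x" "fs y"] leC_isC[of "sn x" "sn y"] by auto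
  show "x \<E> QQ ==> leQ x x" for x unfolding mem_QQ using leP_refl leC_refl by auto
  show "leQ x y ==> leQ y z ==> leQ x z" for x y z unfolding leQ_def by (elim exE conjE) (simp, blast intro: leP_trans leC_trans)
  have 1: "isP (opr emp (opr emp emp))" by (rule isP_I) (use fin_om in \<open>simp_all add: sub_def\<close>)
  have 2: "isC (opr emp emp)" unfolding isC_def by auto
  show "oneQ \<E> QQ" unfolding mem_QQ oneQ_def using 1 2 by blast
  show "leQ x oneQ" if "x \<E> QQ" for x
  proof -
    from that[unfolded mem_QQ] obtain p q where x: "x = opr p q" "isP p" "isC q" by blast
    have "leP p (opr emp (opr emp emp))" by (rule leP_I[OF x(2) 1]) (simp_all add: sub_def)
    moreover have "leC q (opr emp emp)" unfolding leC_def using x(3) 2 by (simp add: sub_def)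
    ultimately show ?thesis unfolding x(1) oneQ_def by simp
  qed
qed

end

section \<open>Closed initial segments of size at most \<open>w1\<close>\<close>

context VL
begin

text \<open>Elements have smaller names, so by induction no ordinal exceeds its name.\<close>

lemma Lf_Ord_le: assumes "Ord x" "Ord (Lf x)" shows "sub (Lf x) x"
proof -
  have "Ord (Lf x) --> sub (Lf x) x"
  proof (rule Ord_induct[of "%x. Ord (Lf x) --> sub (Lf x) x", OF _ _ assms(1)])
    show "Dp (%x. Ord (Lf x) --> sub (Lf x) x)" by (intro df)
    fix x assume x: "Ord x" and ih: "!!y. y \<E> x ==> Ord (Lf y) --> sub (Lf y) y"
    show "Ord (Lf x) --> sub (Lf x) x"
    proof (intro impI subI)
      fix z assume o: "Ord (Lf x)" and z: "z \<E> Lf x"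
      then obtain y where y: "y \<E> x" "z = Lf y" using Lf_mem x by blast
      have oz: "Ord z" using Ord_memD[OF o z] .
      hence "sub z y" using ih[OF y(1)] y(2) by simp
      thus "z \<E> x" using Ord_le_less[OF Ord_memD[OF x y(1)] x oz _ y(1)] by blast
    qed
  qed
  thus ?thesis using assms by blast
qed

definition "Li d = Im Lf d"
lemma df_Li[df]: "Dt t ==> Dt (%e. Li (t e))" unfolding Li_def by (intro df)
lemma mem_Li: "x \<E> Li d \<longleftrightarrow> (EX a. a \<E> d & x = Lf a)" unfolding Li_def by (rule mem_Im) (intro df)
lemma sj_Li: "sj k d ==> sj k (Li d)" unfolding Li_def using sj_Im[OF df_Lf[OF df_var]] sj_trans by blast
lemma Li_HL: "d \<E> w2 ==> x \<E> Li d ==> x \<E> HL w1"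
  unfolding mem_Li mem_HL w2_def using Ord_trans[OF nx(1)] by blast
lemma Li_mono: "sub d d' ==> x \<E> Li d ==> x \<E> Li d'" unfolding mem_Li using subD by blast

text \<open>The continuum hypothesis in L: a countable subset of \<open>X\<close> is the image of a
  countable set of ordinals below \<open>w1\<close>, and all of these lie in
  \<open>HL om\<close>.\<close>

lemma countable_subsets: assumes X: "sj w1 X" shows "sj w1 (Sep (Pw X) (%x. sj om x))"
proof -
  obtain s where s: "ALL y. y \<E> X --> (EX i. i \<E> w1 & ap s i = y)" using X unfolding sj_def by blast
  have m: "x \<E> Sep (Pw X) (%x. sj om x) \<longleftrightarrow> x \<E> Pw X & sj om x" for x by (rule mem_Sep) (intro df)
  have "sj (HL om) (Sep (Pw X) (%x. sj om x))"
  proof (rule sjI[where F="%y. Im (ap s) y"])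
    show "Dg (%y. Im (ap s) y)" by (intro df)
    fix x assume "x \<E> Sep (Pw X) (%x. sj om x)"
    hence x: "sub x X" "sj om x" using m by simp_all
    define F where "F z = lst (%i. i \<E> w1 & ap s i = z)" for z
    have d: "Dg F" unfolding F_def by (intro df)
    have F: "F z \<E> w1 & ap s (F z) = z" if z: "z \<E> x" for z
    proof -
      obtain i where i: "i \<E> w1 & ap s i = z" using s subD[OF x(1) z] by blast
      have "Dp (%i. i \<E> w1 & ap s i = z)" by (intro df)
      from lst_P[of "%i. i \<E> w1 & ap s i = z", OF this _ i] show ?thesis
        unfolding F_def using Ord_memD[OF w1(2)] i by blast
    qed
    have "Im F x \<E> HL om"
    proof (rule HL_I[OF Card_om sub_refl])
      show "sj om (Im F x)" by (rule om_Im[OF d x(2)])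
      show "y \<E> HL om" if "y \<E> Im F x" for y
        using that F Ord_HL[OF Card_om sub_refl] unfolding mem_Im[OF d] w1_def by auto
    qed
    moreover have "Im (ap s) (Im F x) = x"
    proof (rule ext)
      fix z
      have da: "Dg (ap s)" by (intro df)
      show "z \<E> Im (ap s) (Im F x) \<longleftrightarrow> z \<E> x" unfolding mem_Im[OF da] mem_Im[OF d] using F by metis
    qed
    ultimately show "EX y. y \<E> HL om & Im (ap s) y = x" by blast
  qed
  thus ?thesis using sj_HL[of om] sj_trans unfolding w1_def by blast
qed

lemma HL_bounded: assumes "sj w1 Z" "!!z. z \<E> Z ==> z \<E> HL w1" shows "EX b. b \<E> w2 & (ALL z. z \<E> Z --> z \<E> Li b)"
proof -
  have di: "Dg ix" by (intro df)
  have i: "ix z \<E> w2" if z: "z \<E> Z" for z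
  proof -
    obtain a where a: "a \<E> w2" "z = Lf a" using assms(2)[OF z] unfolding mem_HL w2_def by blast
    have oa: "Ord a" using Ord_memD[OF w2(2) a(1)] .
    have "Dp (%x. z = Lf x)" by (intro df)
    from lst_le[of "%x. z = Lf x", OF this oa a(2)] have "sub (ix z) a" unfolding ix_def .
    thus ?thesis using Ord_le_less[OF oa w2(2) ix(1) _ a(1)] by blast
  qed
  have "sub (Im ix Z) (nx w1)" using i unfolding w2_def[symmetric] by (auto simp: sub_def mem_Im[OF di])
  moreover have "sj w1 (Im ix Z)" using assms(1) sj_Im[OF di] sj_trans by blast
  ultimately obtain b where b: "b \<E> nx w1" "ALL x. x \<E> Im ix Z --> x \<E> b"
    using regular[OF w1(3) inf_sq[OF w1(1,3)]] by blast
  have "z \<E> Li b" if "z \<E> Z" for z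
    using b(2) that ix(2)[of z] unfolding mem_Li mem_Im[OF di] by metis
  thus ?thesis using b(1) unfolding w2_def by blast
qed

text \<open>A chain of length \<open>w1\<close>, since a countable subset of its union lies in one
  stage already. A stage of size at most \<open>w1\<close> has at most \<open>w1\<close> countable
  subsets, so the next stage can contain them.\<close>

lemma closed_hull:
  assumes dH: "Dg H" and HH: "!!z. z \<E> HL w1 ==> H z \<E> HL w1"
  shows "EX d. d \<E> w2 & sub w1 d & (ALL x. sj om x --> sub x (Li d) --> x \<E> Li d) &
    (ALL x. x \<E> d --> x \<E> Li d) & (ALL z. z \<E> Li d --> H z \<E> Li d)"
proof -
  note [df] = dff1[OF dH]
  define Z where "Z g = un (Sep (Pw (Li g)) (%x. sj om x)) (un (Im H (Li g)) g)" for g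
  have Z: "x \<E> Z g \<longleftrightarrow> (sub x (Li g) & sj om x) | (EX z. z \<E> Li g & x = H z) | x \<E> g" for x g
  proof -
    have "x \<E> Sep (Pw (Li g)) (%x. sj om x) \<longleftrightarrow> x \<E> Pw (Li g) & sj om x" by (rule mem_Sep) (intro df)
    thus ?thesis unfolding Z_def mem_un mem_Im[OF dH] by simp
  qed
  define W where "W g b \<longleftrightarrow> sub g b & sub w1 b & g \<E> b & b \<E> w2 & (ALL z. z \<E> Z g --> z \<E> Li b)" for g b
  define s where "s g = lst (%b. W g b)" for g
  have ds: "Dg s" unfolding s_def W_def Z_def by (intro df)
  note [df] = dff1[OF ds]
  have s: "W g (s g)" if g: "g \<E> w2" for g
  proof -
    have sg: "sj w1 g" using nx(3) g unfolding w2_def by blast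
    have og: "Ord g" using Ord_memD[OF w2(2) g] .
    have "sj w1 (Z g)" unfolding Z_def
      using sj_un2[OF w1(3) inf_sq[OF w1(1,3)]] countable_subsets[OF sj_Li[OF sg]] sj_Li[OF sg] sj_Im[OF dH] sj_trans sg by meson
    moreover have "z \<E> HL w1" if "z \<E> Z g" for z
    proof -
      from that[unfolded Z] consider "sub z (Li g)" "sj om z" | w where "w \<E> Li g" "z = H w" | "z \<E> g" by blast
      thus ?thesis
      proof cases
        case 1 thus ?thesis using HL_I[OF w1(1,3) sj_w1[OF 1(2)]] Li_HL[OF g] subD by blast
      next
        case 2 thus ?thesis using HH Li_HL[OF g] by blast
      next
        case 3 thus ?thesis using Ord_HL[OF w1(1,3)] Ord_trans[OF w2(2) _ g] unfolding w2_def by blast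
      qed
    qed
    ultimately obtain b where b: "b \<E> w2" "ALL z. z \<E> Z g --> z \<E> Li b" using HL_bounded by blast
    define c where "c = suc (un (un g b) w1)"
    have ob: "Ord b" using Ord_memD[OF w2(2) b(1)] .
    have o2: "Ord (un (un g b) w1)" using Ord_un og ob w1(2) by blast
    have "un (un g b) w1 \<E> w2"
      using un_max[OF Ord_un[OF og ob] w1(2)] un_max[OF og ob] g b(1) nx_gt[OF w1(2)] unfolding w2_def by metis
    hence c: "c \<E> w2" unfolding c_def using sj_suc[OF w1(3)] less_nx Ord_suc[OF o2] nx(3) unfolding w2_def suc_def by blast
    have "sub g (un (un g b) w1)" "sub b c" "sub w1 c" "sub g c" unfolding c_def by (auto simp: sub_def)
    moreover have "g \<E> c" unfolding c_def mem_suc using Ord_sub_cases[OF og o2 \<open>sub g (un (un g b) w1)\<close>] by blast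
    ultimately have "W g c" unfolding W_def using c b(2) Li_mono by blast
    moreover have "Dp (%b. W g b)" unfolding W_def Z_def by (intro df)
    ultimately show ?thesis unfolding s_def using lst_P[of "W g"] Ord_memD[OF w2(2) c] by blast
  qed
  define F where "F = orec (%u f. s (Unn (Im sn f)))"
  have dF: "Dg F" unfolding F_def by (intro df)
  note [df] = dff1[OF dF]
  define U where "U x = Unn (Im F x)" for x
  have dU: "Dg U" unfolding U_def by (intro df)
  note [df] = dff1[OF dU]
  have F: "F x = s (U x)" if "Ord x" for x
  proof -
    have "F x = s (Unn (Im sn (lam x F)))" unfolding F_def by (rule orec[OF _ that]) (intro df)
    thus ?thesis unfolding Im_sn_lam[OF dF] U_def .
  qed
  have U: "z \<E> U x \<longleftrightarrow> (EX y. y \<E> x & z \<E> F y)" for z x unfolding U_def by (auto simp: mem_Im[OF dF])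
  have Uw: "U x \<E> w2" if x: "sj w1 x" "!!y. y \<E> x ==> F y \<E> w2" for x
  proof -
    have "sub (Im F x) (nx w1)" using x(2) unfolding w2_def[symmetric] by (auto simp: sub_def mem_Im[OF dF])
    moreover have "sj w1 (Im F x)" using x(1) sj_Im[OF dF] sj_trans by blast
    ultimately obtain b where b: "b \<E> nx w1" "ALL z. z \<E> Im F x --> z \<E> b"
      using regular[OF w1(3) inf_sq[OF w1(1,3)]] by blast
    have ob: "Ord b" using Ord_memD[OF nx(1) b(1)] .
    have ou: "Ord (U x)" unfolding U_def by (rule Ord_Unn) (use b(2) Ord_memD[OF ob] in blast)
    have "sub (U x) b" unfolding sub_def U using b(2) Ord_trans[OF ob] unfolding mem_Im[OF dF] by blast
    thus ?thesis using Ord_le_less[OF ob w2(2) ou] b(1) unfolding w2_def by blast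
  qed
  have Fw: "x \<E> w1 --> F x \<E> w2" if "Ord x" for x
  proof (rule Ord_induct[of "%x. x \<E> w1 --> F x \<E> w2", OF _ _ that])
    show "Dp (%x. x \<E> w1 --> F x \<E> w2)" by (intro df)
    fix x assume x: "Ord x" "!!y. y \<E> x ==> y \<E> w1 --> F y \<E> w2"
    show "x \<E> w1 --> F x \<E> w2"
    proof
      assume xw: "x \<E> w1"
      have "U x \<E> w2" by (rule Uw) (use x xw Ord_trans[OF w1(2)] nx(3) sj_w1 in \<open>auto simp: w1_def\<close>)
      thus "F x \<E> w2" unfolding F[OF x(1)] using s unfolding W_def by blast
    qed
  qed
  define d where "d = U w1"
  have dw: "d \<E> w2" unfolding d_def by (rule Uw[OF sj_refl]) (use Fw Ord_memD[OF w1(2)] in blast)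
  have od: "Ord d" using Ord_memD[OF w2(2) dw] .
  have Wx: "W (U x) (F x)" if "x \<E> w1" for x
  proof -
    have o: "Ord x" using Ord_memD[OF w1(2) that] .
    have "U x \<E> w2"
      by (rule Uw) (use that Fw Ord_memD[OF o] Ord_trans[OF w1(2)] nx(3) sj_w1 in \<open>auto simp: w1_def\<close>)
    thus ?thesis unfolding F[OF o] by (rule s)
  qed
  have Fd: "sub (F x) d" if "x \<E> w1" for x using that unfolding d_def sub_def U by blast
  have FU: "sub (F x) (U (suc x))" for x unfolding sub_def U by auto
  have sw: "suc x \<E> w1" if "x \<E> w1" for x
    using that sj_suc[OF sub_refl] less_nx Ord_suc[OF Ord_memD[OF w1(2) that]] nx(3) unfolding w1_def suc_def by blast
  have ZF: "z \<E> Li d" if x: "x \<E> w1" and z: "z \<E> Z (U (suc x))" for x z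
    using Wx[OF sw[OF x]] z Li_mono[OF Fd[OF sw[OF x]]] unfolding W_def by blast
  have Zm: "z \<E> Z (U (suc x))" if "sub z (Li (F x)) & sj om z | (EX w. w \<E> Li (F x) & z = H w) | z \<E> F x" for z x
    using that Li_mono[OF FU] subD[OF FU] unfolding Z sub_def by blast
  have Ld: "EX x. x \<E> w1 & z \<E> Li (F x)" if "z \<E> Li d" for z using that unfolding mem_Li d_def U by blast
  have e1: "emp \<E> w1" using w1(3) om_emp subD by blast
  have "sub w1 d" using Wx[OF e1] Fd[OF e1] sub_trans unfolding W_def by blast
  moreover have "x \<E> Li d" if x: "x \<E> d" for x
  proof -
    obtain y where "y \<E> w1" "x \<E> F y" using x unfolding d_def U by blast
    thus ?thesis using ZF Zm by blast
  qed
  moreover have "H z \<E> Li d" if "z \<E> Li d" for z using Ld[OF that] ZF Zm by blast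
  moreover have "x \<E> Li d" if x: "sj om x" "sub x (Li d)" for x
  proof -
    \<comment> \<open>The first stage at which \<open>z\<close> appears; countably many stages are
      bounded below \<open>w1\<close>.\<close>
    define K where "K z = lst (%y. y \<E> w1 & z \<E> Li (F y))" for z
    have dK: "Dg K" unfolding K_def by (intro df)
    have K: "K z \<E> w1 & z \<E> Li (F (K z))" if z: "z \<E> x" for z
    proof -
      obtain y where y: "y \<E> w1 & z \<E> Li (F y)" using Ld subD[OF x(2) z] by blast
      have "Dp (%y. y \<E> w1 & z \<E> Li (F y))" by (intro df)
      from lst_P[of "%y. y \<E> w1 & z \<E> Li (F y)", OF this _ y] show ?thesis
        unfolding K_def using Ord_memD[OF w1(2)] y by blast
    qed
    have "sub (Im K x) (nx om)" using K unfolding w1_def[symmetric] by (auto simp: sub_def mem_Im[OF dK])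
    from regular[OF sub_refl om_sq this om_Im[OF dK x(1)]] obtain b where
      b: "b \<E> w1" "ALL y. y \<E> Im K x --> y \<E> b" unfolding w1_def by blast
    have "z \<E> Li (U b)" if "z \<E> x" for z
    proof -
      have "K z \<E> b" using b(2) that unfolding mem_Im[OF dK] by blast
      hence "sub (F (K z)) (U b)" unfolding sub_def U by blast
      thus ?thesis using Li_mono K[OF that] by blast
    qed
    moreover have "sub (U b) (F b)" using Wx[OF b(1)] unfolding W_def by blast
    ultimately have "sub x (Li (F b))" using Li_mono unfolding sub_def by blast
    thus ?thesis using ZF[OF b(1)] Zm x(1) by blast
  qed
  ultimately show ?thesis using dw by blast
qed

text \<open>It is enough to add the restricted promises to \<open>r\<close>: they lie inside
  \<open>d\<close>, and a point of \<open>r\<close> below an element of \<open>d\<close> belongs to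
  the restriction already.\<close>

lemma extend_rs: assumes r: "isP r" and d: "Ord d" shows "EX s. leP s r & leP s (rs r d)"
proof -
  note i = isP_rs[OF r, of d]
  have ar: "sub (aP (rs r d)) (aP r)" by (simp add: sub_def rs_sel)
  obtain s where s: "leP s r" "sub (sP (rs r d)) (sP s)" "aP s = aP r"
    using add_promises[OF r isP_s(1)[OF i]] isP_s(2,3)[OF i] sub_trans[OF _ ar] by blast
  have "leP s (rs r d)"
  proof (rule leP_I[OF leP_isP(1)[OF s(1)] i])
    show "sub (aP (rs r d)) (aP s)" unfolding s(3) by (rule ar)
    have "z \<E> fP r" if "z \<E> fP (rs r d)" for z
      using that unfolding rs_def P_sel by (subst (asm) mem_Sep) (intro df, blast)
    thus "sub (fP (rs r d)) (fP s)" using leP_sub(2)[OF s(1)] subD unfolding sub_def by blast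
    show "sub (sP (rs r d)) (sP s)" by (rule s(2))
    fix x B c assume x: "x \<E> aP s" "~ x \<E> aP (rs r d)" "B \<E> sP (rs r d)" "!!b. b \<E> B ==> x \<E> b"
    have "B ~= emp" using isP_s(3)[OF i x(3)] by auto
    then obtain b where b: "b \<E> B" using ext[of B emp] by auto
    have "b \<E> d" using isP_s(2)[OF i x(3)] b rs_sel(1) subD by blast
    hence "x \<E> aP (rs r d)" unfolding rs_sel using x(1,4)[unfolded s(3)] b Ord_trans[OF d] by blast
    thus "EX b. b \<E> B & opr x (opr b c) \<E> fP s" using x(2) by blast
  qed
  thus ?thesis using s(1) by blast
qed

lemma CC_HL: "isC q ==> q \<E> HL om"
proof -
  assume "isC q"
  then obtain n s where q: "n \<E> om" "sub s n" "q = opr n s" unfolding isC_def by blast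
  have i: "x \<E> HL om" if "x \<E> om" for x
    using Ord_HL[OF Card_om sub_refl] that Ord_trans[OF nx(1) _ nx_gt[OF Ord_om]] by blast
  have "s \<E> HL om"
    by (rule HL_I[OF Card_om sub_refl]) (use fin_om[OF fin_sub[OF fin_nat[OF q(1)] q(2)]] i om_mem[OF q(1)] subD[OF q(2)] in blast)+
  thus ?thesis unfolding q(3) using HL_opr[OF Card_om sub_refl i[OF q(1)]] by blast
qed
lemma HL_mono: "sub k l ==> Ord k ==> Ord l ==> x \<E> HL k ==> x \<E> HL l"
proof -
  assume *: "sub k l" "Ord k" "Ord l" "x \<E> HL k"
  have "sub (nx k) (nx l)"
  proof (rule subI)
    fix y assume "y \<E> nx k"
    thus "y \<E> nx l" using less_nx Ord_memD[OF nx(1)] sj_mono[OF _ *(1) sub_refl] by blast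
  qed
  thus ?thesis using *(4) subD unfolding mem_HL by blast
qed
lemma QQ_HL: "x \<E> QQ ==> x \<E> HL w1"
  unfolding mem_QQ using HL_opr[OF w1(1,3)] isP_HL HL_mono[OF w1(3) Ord_om w1(2) CC_HL] by blast
lemma sj_QQ: "sj w2 QQ"
  using sj_HL[of w1] sj_sub[of QQ "HL w1"] QQ_HL sj_trans unfolding w2_def sub_def by blast

end

section \<open>Deciding functions of the extension\<close>

locale qgen = VLn E for E :: "nat => nat => bool" (infix "\<E>" 50) +
  fixes G :: "nat => bool"
  assumes gen_Q: "Q.generic_filter G"
begin

sublocale generic E QQ leQ oneQ G
  by unfold_locales (rule gen_Q)

lemma G_E: assumes "G x" obtains p q where "x = opr p q" "isP p" "isC q"
  using G_P[OF assms] unfolding mem_QQ by blast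
lemma G_common: assumes "G (opr p q)" "G (opr p' q')"
  obtains r s where "G (opr r s)" "leP r p" "leC s q" "leP r p'" "leC s q'"
proof -
  obtain x where x: "G x" "leQ x (opr p q)" "leQ x (opr p' q')" using G_dir[OF assms] by blast
  obtain r s where "x = opr r s" using G_E[OF x(1)] by blast
  thus ?thesis using x that by simp
qed
definition "GC q \<longleftrightarrow> (EX p. G (opr p q))"
text \<open>A common extension in \<open>G\<close> is below the recombined pair.\<close>

lemma G_mix: assumes "G (opr p q0)" "GC q" shows "G (opr p q)"
proof -
  obtain p' where p': "G (opr p' q)" using assms(2) GC_def by blast
  obtain r s where rs: "G (opr r s)" "leP r p" "leC s q" using G_common[OF assms(1) p'] by blast
  have "leQ (opr r s) (opr p q)" using rs by simp
  thus ?thesis using G_up[OF rs(1)] by blast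
qed
lemma GC_I: "G (opr p q) ==> GC q" unfolding GC_def by blast

text \<open>\<open>D g n v\<close>: the condition \<open>g\<close> decides that the value of a function of the extension at \<open>n\<close> is \<open>v\<close>.\<close>
definition "decides D A R \<longleftrightarrow> Df (%e. D (e 0) (e 1) (e 2)) & (ALL g g' n v. D g n v --> leQ g' g --> D g' n v) &
  (ALL g n v v'. D g n v --> D g n v' --> v = v') &
  (ALL n. n \<E> A --> (EX g v. G g & D g n v)) & (ALL g n v. n \<E> A --> G g --> D g n v --> R n v)"
text \<open>A condition could be related by \<open>F\<close> to two values. Demanding that no
  extension is related to another value makes the value unique, and genericity still provides such
  conditions in \<open>G\<close>.\<close>

lemma decide:
  assumes R: "dfp N (%e. R (e 0) (e 1))" and ex: "!!n. n \<E> A ==> EX v. R (j n) (j v) & (ALL v'. R (j n) (j v') --> v' = v)"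
  shows "EX D. decides D A (%n v. R (j n) (j v))"
proof -
  obtain F0 where F0: "forces F0 (%e. R (e 0) (e 1))" using truth[OF R] by blast
  define F where "F g n v \<longleftrightarrow> F0 g (case_nat (Q.ck n) (%i. Q.ck v))" for g n v
  have "Dt (%e. case_nat (Q.ck (e 1)) (%i. Q.ck (e 2)) n)" for n by (cases n) (simp_all add: Q.df_ck df_var)
  hence dF: "Df (%e. F (e 0) (e 1) (e 2))" unfolding F_def by (intro forces_df[OF F0] df)
  note [df] = dfp3[OF dF]
  have Fm: "F g n v ==> leQ g' g ==> F g' n v" for g g' n v unfolding F_def by (rule forces_mono[OF F0])
  have Ft: "R (j n) (j v) \<longleftrightarrow> (EX g. G g & F g n v)" for n v
    using forces_true[OF F0, of "case_nat (Q.ck n) (%i. Q.ck v)"] unfolding F_def by simp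
  define D where "D g n v \<longleftrightarrow> g \<E> QQ & F g n v & (ALL g' v'. leQ g' g --> F g' n v' --> v' = v)" for g n v
  have "EX g v. G g & D g n v" if n: "n \<E> A" for n
  proof -
    obtain v where v: "R (j n) (j v)" "!!v'. R (j n) (j v') ==> v' = v" using ex[OF n] by blast
    obtain g0 where g0: "G g0" "F g0 n v" using v Ft by blast
    let ?C = "%g. (ALL g' v'. leQ g' g --> F g' n v' --> v' = v) | (EX v'. v' ~= v & F g n v')"
    have d: "Dp ?C" by (intro df)
    have "EX q. leQ q p & ?C q" if "p \<E> QQ" for p using Q.le_refl[OF that] by blast
    from G_meet[of ?C, OF d this] obtain g1 where g1: "G g1" "?C g1" by blast
    hence g2: "ALL g' v'. leQ g' g1 --> F g' n v' --> v' = v" using v(2) Ft by blast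
    obtain g where g: "G g" "leQ g g0" "leQ g g1" using G_dir[OF g0(1) g1(1)] by blast
    have "D g n v" unfolding D_def using G_P[OF g(1)] Fm[OF g0(2) g(2)] g2 g(3) Q.le_trans by blast
    thus ?thesis using g by blast
  qed
  moreover have "D g' n v" if "D g n v" "leQ g' g" for g g' n v
    using that Q.le_P[OF that(2)] Fm Q.le_trans unfolding D_def by blast
  moreover have "v = v'" if "D g n v" "D g n v'" for g n v v' using that Q.le_refl unfolding D_def by blast
  moreover have "Df (%e. D (e 0) (e 1) (e 2))" unfolding D_def by (intro df)
  moreover have "R (j n) (j v)" if "G g" "D g n v" for g n v using that Ft unfolding D_def by blast
  ultimately have "decides D A (%n v. R (j n) (j v))" unfolding decides_def by blast
  thus ?thesis by blast
qed
lemma decides_D: assumes "decides D A R" shows dec_df: "Df (%e. D (e 0) (e 1) (e 2))"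
  and dec_mono: "!!g g' n v. D g n v ==> leQ g' g ==> D g' n v"
  and dec_uniq: "!!g n v v'. D g n v ==> D g n v' ==> v = v'"
  and dec_ex: "!!n. n \<E> A ==> EX g v. G g & D g n v" and dec_R: "!!g n v. n \<E> A ==> G g ==> D g n v ==> R n v"
  using assms unfolding decides_def by blast+

text \<open>Fused conditions are dense, so one occurs in \<open>G\<close>. Over its
  \<open>p\<close>, whatever a stronger condition decides is decided by extending the Cohen part
  alone.\<close>

lemma dec_fused: assumes D: "decides D om R"
  shows "EX p q0. G (opr p q0) & (ALL n. n \<E> om --> (EX q v. G (opr p q) & D (opr p q) n v))"
proof -
  note [df] = dfp3[OF dec_df[OF D]]
  define B where "B p q n \<longleftrightarrow> isC q & (EX v. D (opr p q) n v)" for p q n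
  have dB: "Df (%e. B (e 0) (e 1) (e 2))" unfolding B_def by (intro df)
  note [df] = dfp3[OF dB]
  have Bm: "B p' q' n" if "B p q n" "leP p' p" "leC q' q" for p p' q q' n
    using that leC_isC(1)[OF that(3)] dec_mono[OF D, of "opr p q" n _ "opr p' q'"] unfolding B_def by auto
  define fu where "fu p \<longleftrightarrow> (ALL n p'' q. n \<E> om --> leP p'' p --> isC q --> (EX q'. leC q' q & B p'' q' n) --> (EX q'. leC q' q & B p q' n))" for p
  have dfu: "Dp (%x. fu (fs x))" unfolding fu_def by (intro df)
  have "EX y. leQ y x & fu (fs y)" if x: "x \<E> QQ" for x
  proof -
    from x obtain p q where pq: "x = opr p q" "isP p" "isC q" unfolding mem_QQ by blast
    have m: "B p q n ==> leP p' p ==> B p' q n" for p p' q n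
      using Bm[of p q n p' q] leC_refl unfolding B_def by blast
    have "EX p'. leP p' p & fu p'" unfolding fu_def by (rule fusion[OF dB pq(2)]) (rule m)
    then obtain p' where "leP p' p" "fu p'" by blast
    thus ?thesis using pq leC_refl by (intro exI[of _ "opr p' q"]) simp
  qed
  from G_meet[of "%x. fu (fs x)", OF dfu this] obtain x where x: "G x" "fu (fs x)" by blast
  obtain p q0 where pq: "x = opr p q0" "isP p" "isC q0" using G_E[OF x(1)] by blast
  have fu: "fu p" and Gx: "G (opr p q0)" using x pq by simp_all
  have "EX q v. G (opr p q) & D (opr p q) n v" if n: "n \<E> om" for n
  proof -
    let ?C = "%y. B p (sn y) n | (ALL z. leQ z y --> ~ B (fs z) (sn z) n)"
    have d: "Dp ?C" by (intro df)
    have "EX r. leQ r y & ?C r" if y: "leQ y x" for y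
    proof (cases "EX z. leQ z y & B (fs z) (sn z) n")
      case False thus ?thesis using Q.le_refl Q.le_P[OF y] by blast
    next
      case True
      then obtain z where z: "leQ z y" "B (fs z) (sn z) n" by blast
      obtain p1 q1 where y1: "y = opr p1 q1" "leP p1 p" "leC q1 q0" using y unfolding pq(1) leQ_def by auto
      obtain p2 q2 where z1: "z = opr p2 q2" "leP p2 p1" "leC q2 q1" using z(1) unfolding y1(1) leQ_def by auto
      have "EX q'. leC q' q2 & B p2 q' n" using z(2) z1 leC_refl leC_isC by auto
      then obtain q' where q': "leC q' q2" "B p q' n"
        using fu n leP_trans[OF z1(2) y1(2)] leC_isC(1)[OF z1(3)] unfolding fu_def by blast
      have "leQ (opr p1 q') y" unfolding y1(1) using leC_trans[OF q'(1) z1(3)] leP_refl leP_isP(1)[OF y1(2)] by simp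
      thus ?thesis using q'(2) by (intro exI[of _ "opr p1 q'"]) simp
    qed
    from G_below[of ?C, OF d x(1) this] obtain y where y: "G y" "leQ y x" "?C y" by blast
    obtain p1 q1 where y1: "y = opr p1 q1" using G_E[OF y(1)] by blast
    obtain g v where g: "G g" "D g n v" using dec_ex[OF D n] by blast
    obtain z where z: "G z" "leQ z y" "leQ z g" using G_dir[OF y(1) g(1)] by blast
    obtain p2 q2 where z1: "z = opr p2 q2" "isC q2" using G_E[OF z(1)] by blast
    have "D z n v" using dec_mono[OF D g(2) z(3)] .
    hence "B (fs z) (sn z) n" unfolding B_def z1(1) using z1(2) by auto
    hence "B p q1 n" using y(3) z(2) y1 by auto
    moreover have "G (opr p q1)" by (rule G_mix[OF Gx]) (use GC_I y(1) y1 in blast)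
    ultimately show ?thesis unfolding B_def by blast
  qed
  thus ?thesis using Gx by blast
qed

text \<open>Over a fixed \<open>p\<close> only countably many Cohen conditions are left, and each
  decides at most one value at a given argument.\<close>

lemma dec_cover: assumes D: "decides D om R" shows "EX W. sj om W & (ALL n. n \<E> om --> (EX v. v \<E> W & R n v))"
proof -
  note [df] = dfp3[OF dec_df[OF D]]
  obtain p q0 where p: "G (opr p q0)" "!!n. n \<E> om ==> EX q v. G (opr p q) & D (opr p q) n v" using dec_fused[OF D] by blast
  define V where "V z = Th (%v. D (opr p (fs z)) (sn z) v)" for z
  have dV: "Dg V" unfolding V_def by (intro df)
  have V: "V (opr q n) = v" if "D (opr p q) n v" for q n v
    unfolding V_def fs_opr sn_opr by (rule Th_eq[of "D (opr p q) n", OF that]) (rule dec_uniq[OF D _ that])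
  have "EX v. v \<E> Im V (prd CC om) & R n v" if n: "n \<E> om" for n
  proof -
    obtain q v where q: "G (opr p q)" "D (opr p q) n v" using p(2)[OF n] by blast
    have "isC q" using G_E[OF q(1)] by auto
    hence "v \<E> Im V (prd CC om)" unfolding mem_Im[OF dV] using V[OF q(2)] n mem_CC by (metis opr_prd)
    thus ?thesis using dec_R[OF D n q] by blast
  qed
  thus ?thesis using om_Im[OF dV om_prd[OF sj_CC sj_refl]] by blast
qed

text \<open>The argument for the preservation of \<open>w2\<close> and for \<open>2\<^bsup>w1\<^esup> = w2\<close>: conditions in a suitable initial
  segment of \<open>L\<close> of size \<open>w1\<close> suffice to decide \<open>w1\<close> values.\<close>
lemma dec_small: assumes D: "decides D w1 R"
  shows "EX K. sj w1 K & sub K QQ & (ALL n. n \<E> w1 --> (EX g v. G g & g \<E> K & D g n v))"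
proof -
  note [df] = dfp3[OF dec_df[OF D]]
  define Bd where "Bd z w \<longleftrightarrow> leQ w (fs z) & (EX v. D w (sn z) v)" for z w
  have dBd: "Df (%e. Bd (e 0) (e 1))" unfolding Bd_def by (intro df)
  note [df] = dfp2[OF dBd]
  \<comment> \<open>A chosen extension that decides the value at the given argument; closing the
    segment under it is the elementarity used below.\<close>
  define H where "H z = (if EX w. Bd z w then cho (Bd z) else emp)" for z
  have dH: "Dg H" unfolding H_def by (intro df)
  have H: "Bd z (H z)" if "Bd z w" for z w
  proof -
    have "Dp (Bd z)" by (intro df)
    from cho[OF this that] show ?thesis unfolding H_def using that by auto
  qed
  have "H z \<E> HL w1" for z
  proof (cases "EX w. Bd z w")
    case True
    hence "H z \<E> QQ" using H Q.le_P unfolding Bd_def by blast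
    thus ?thesis by (rule QQ_HL)
  next
    case False
    hence "H z = emp" unfolding H_def if_not_P[OF False] by simp
    thus ?thesis using HL_I[OF w1(1,3), of emp] sj_w1[OF fin_om[OF fin_emp]] by simp
  qed
  from closed_hull[OF dH this] obtain d where d: "d \<E> w2" "sub w1 d"
    "!!x. sj om x ==> sub x (Li d) ==> x \<E> Li d" "!!x. x \<E> d ==> x \<E> Li d" "!!z. z \<E> Li d ==> H z \<E> Li d" by blast
  have od: "Ord d" using Ord_memD[OF w2(2) d(1)] .
  have trans: "y \<E> Li d" if "x \<E> Li d" "y \<E> x" for x y
    using that Lf_mem Ord_memD[OF od] Ord_trans[OF od] unfolding mem_Li by blast
  have fs_Li: "x \<E> Li d" if "fin x" "!!y. y \<E> x ==> y \<E> Li d" for x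
    using d(3)[OF fin_om[OF that(1)]] that(2) by (simp add: sub_def)
  have finu: "fin (upair x y)" for x y
  proof -
    have "upair x y = un (sing x) (sing y)" by (rule ext) auto
    thus ?thesis using fin_un[OF fin_sing fin_sing] by simp
  qed
  have up_Li: "upair x y \<E> Li d" if "x \<E> Li d" "y \<E> Li d" for x y
    by (rule fs_Li[OF finu]) (use that in auto)
  have opr_Li: "opr x y \<E> Li d" if "x \<E> Li d" "y \<E> Li d" for x y
    unfolding opr_def sing_def using up_Li that by blast
  have Ord_Li: "x \<E> d" if "x \<E> Li d" "Ord x" for x
  proof -
    from that(1)[unfolded mem_Li] obtain a where a: "a \<E> d" "x = Lf a" by blast
    have "sub x a" using Lf_Ord_le[OF Ord_memD[OF od a(1)]] a(2) that(2) by simp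
    thus ?thesis using Ord_le_less[OF Ord_memD[OF od a(1)] od that(2) _ a(1)] by blast
  qed
  have c_Li: "q \<E> Li d" if q: "isC q" for q
  proof -
    obtain n s where ns: "n \<E> om" "sub s n" "q = opr n s" using q isC_def by blast
    have o: "x \<E> Li d" if "x \<E> om" for x using d(2,4) w1(3) that subD by blast
    have "s \<E> Li d" by (rule fs_Li[OF fin_sub[OF fin_nat[OF ns(1)] ns(2)]]) (use o om_mem[OF ns(1)] subD[OF ns(2)] in blast)
    thus ?thesis unfolding ns(3) using opr_Li o[OF ns(1)] by blast
  qed
  \<comment> \<open>The restriction consists of countable sets of elements of the segment, and the
    segment is closed under countable subsets.\<close>
  have rs_Li: "rs p d \<E> Li d" if p: "isP p" for p
  proof -
    note i = isP_rs[OF p, of d]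
    have a: "x \<E> Li d" if "sub x (aP (rs p d))" for x
      by (rule d(3)[OF om_sub[OF isP_a(2)[OF i] that]]) (use that d(4) rs_sel(1) in \<open>auto simp: sub_def\<close>)
    have s: "sP (rs p d) \<E> Li d"
      by (rule d(3)[OF isP_s(1)[OF i]]) (use a isP_s(2)[OF i] in \<open>simp add: sub_def\<close>)
    have "fP (rs p d) \<E> Li d"
    proof (rule d(3))
      have e: "z \<E> Li d" if zf: "z \<E> fP (rs p d)" for z
      proof -
        from isP_f3[OF i zf] obtain x y c where xyc: "x \<E> aP (rs p d)" "y \<E> aP (rs p d)" "c \<E> w1" "z = opr x (opr y c)" by blast
        have "x \<E> Li d" "y \<E> Li d" "c \<E> Li d" using xyc(1,2)[unfolded rs_sel(1)] d(4) subD[OF d(2) xyc(3)] by simp_all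
        thus ?thesis unfolding xyc(4) by (intro opr_Li)
      qed
      thus "sub (fP (rs p d)) (Li d)" by (simp add: sub_def)
      define F where "F z = opr (fs z) (opr (sn z) (Th (%c. opr (fs z) (opr (sn z) c) \<E> fP (rs p d))))" for z
      have dF: "Dg F" unfolding F_def by (intro df)
      have "sj (prd (aP (rs p d)) (aP (rs p d))) (fP (rs p d))"
      proof (rule sjI[OF dF])
        fix z assume z: "z \<E> fP (rs p d)"
        obtain x y c where xy: "x \<E> aP (rs p d)" "y \<E> aP (rs p d)" "x \<E> y" "z = opr x (opr y c)" using isP_f3[OF i z] by blast
        obtain c' where c': "!!d'. opr x (opr y d') \<E> fP (rs p d) \<longleftrightarrow> d' = c'" using isP_f2[OF i xy(1-3)] by blast
        have "Th (%c. opr x (opr y c) \<E> fP (rs p d)) = c" by (rule Th_eq) (use c' z xy(4) in auto)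
        thus "EX w. w \<E> prd (aP (rs p d)) (aP (rs p d)) & F w = z" using xy by (intro exI[of _ "opr x y"]) (simp add: F_def)
      qed
      thus "sj om (fP (rs p d))" using om_prd[OF isP_a(2)[OF i] isP_a(2)[OF i]] sj_trans by blast
    qed
    thus ?thesis using isP_eq[OF i] opr_Li a[OF sub_refl] s by metis
  qed
  define K where "K = Sep QQ (%g. g \<E> Li d)"
  have K: "g \<E> K \<longleftrightarrow> g \<E> QQ & g \<E> Li d" for g unfolding K_def by (rule mem_Sep) (intro df)
  have "sj w1 d" using nx(3) d(1) unfolding w2_def by blast
  hence sK: "sj w1 K" using sj_mono[OF sj_Li sub_refl] K by (simp add: sub_def)
  have "EX g v. G g & g \<E> K & D g n v" if n: "n \<E> w1" for n
  proof -
    let ?C = "%g. (EX g1 v. g1 \<E> Li d & leQ g g1 & D g1 n v) | (ALL g' v. leQ g' g --> ~ D g' n v)"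
    have dC: "Dp ?C" by (intro df)
    have "EX r. leQ r g & ?C r" if g: "g \<E> QQ" for g
    proof (cases "EX g' v. leQ g' g & D g' n v")
      case False thus ?thesis using Q.le_refl[OF g] by blast
    next
      case True
      then obtain g1 v where g1: "leQ g1 g" "D g1 n v" by blast
      obtain p1 q1 where pq: "g1 = opr p1 q1" "isP p1" "isC q1" using Q.le_P[OF g1(1)] unfolding mem_QQ by blast
      \<comment> \<open>The restriction of \<open>p1\<close> has an extension that decides, namely
        \<open>s\<close> with \<open>q1\<close>; hence \<open>H\<close> finds one inside the
        segment. Its points lie in \<open>d\<close>, so it amalgamates with
        \<open>p1\<close>.\<close>
      obtain s where s: "leP s p1" "leP s (rs p1 d)" using extend_rs[OF pq(2) od] by blast
      have "leQ (opr s q1) g1" unfolding pq(1) using s leC_refl[OF pq(3)] by simp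
      hence "D (opr s q1) n v" using dec_mono[OF D g1(2)] by blast
      moreover have "leQ (opr s q1) (opr (rs p1 d) q1)" using s leC_refl[OF pq(3)] by simp
      ultimately have "Bd (opr (opr (rs p1 d) q1) n) (opr s q1)" unfolding Bd_def by auto
      note h = H[OF this]
      define g2 where "g2 = H (opr (opr (rs p1 d) q1) n)"
      have "opr (opr (rs p1 d) q1) n \<E> Li d" using opr_Li rs_Li[OF pq(2)] c_Li[OF pq(3)] d(2,4) n subD by blast
      hence g2d: "g2 \<E> Li d" unfolding g2_def by (rule d(5))
      obtain v2 where g2: "leQ g2 (opr (rs p1 d) q1)" "D g2 n v2" using h unfolding Bd_def g2_def by auto
      obtain p2 q2 where pq2: "g2 = opr p2 q2" "leP p2 (rs p1 d)" "leC q2 q1" using g2(1) unfolding leQ_def by auto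
      have ip2: "isP p2" using leP_isP pq2(2) by blast
      have "p2 \<E> Li d"
      proof -
        have "p2 \<E> sing p2" "sing p2 \<E> opr p2 q2" by (simp_all add: opr_def)
        thus ?thesis using trans g2d pq2(1) by blast
      qed
      moreover have "aP p2 \<E> sing (aP p2)" "sing (aP p2) \<E> p2" using isP_eq[OF ip2] by (simp, metis opr_def mem_upair)
      ultimately have "aP p2 \<E> Li d" using trans by blast
      hence "sub (aP p2) d" using trans Ord_Li isP_Ord[OF ip2] unfolding sub_def by blast
      then obtain t where t: "leP t p1" "leP t p2" using amalgamation[OF pq(2) od d(2) pq2(2)] by blast
      have "leQ (opr t q2) g1" "leQ (opr t q2) g2" unfolding pq(1) pq2(1) using t pq2(3) leC_refl leC_isC(1)[OF pq2(3)] by simp_all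
      thus ?thesis using g1(1) g2d g2(2) Q.le_trans by blast
    qed
    from G_meet[of ?C, OF dC this] obtain g where g: "G g" "?C g" by blast
    obtain g' v where g': "G g'" "D g' n v" using dec_ex[OF D n] by blast
    obtain x where x: "G x" "leQ x g" "leQ x g'" using G_dir[OF g(1) g'(1)] by blast
    have "D x n v" using dec_mono[OF D g'(2) x(3)] .
    then obtain g1 v1 where "g1 \<E> Li d" "leQ g g1" "D g1 n v1" using g(2) x(2) by blast
    thus ?thesis using G_up[OF g(1)] G_P K by blast
  qed
  thus ?thesis using sK K by (intro exI[of _ K]) (simp add: sub_def)
qed

end

section \<open>Preservation of cardinals and GCH\<close>

context emb
begin

lemma h_sj: assumes "A.sj a b" shows "B.sj (h a) (h b)"
proof -
  obtain f where f: "ALL y. EA y b --> (EX x. EA x a & A.ap f x = y)" using assms unfolding A.sj_def by blast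
  have "EX x. EB x (h a) & B.ap (h f) x = y" if y: "EB y (h b)" for y
  proof -
    from y[unfolded mem_h] obtain z where z: "y = h z" "EA z b" by blast
    obtain x where "EA x a" "A.ap f x = z" using f z(2) by blast
    thus ?thesis using z(1) h_ap[of f x] h_mem by metis
  qed
  thus ?thesis unfolding B.sj_def by blast
qed

end

context qgen
begin

lemmas h_simps = Ck.h_opr[symmetric] Ck.h_mem[symmetric] Ck.h_inj

text \<open>Values outside \<open>B\<close> are replaced by \<open>emp\<close>, which makes the
  decided function total with values in the ground model.\<close>

lemma decide_ap: "EX D. decides D A (%n v. (N.ap f (j n) = j v & v \<E> B) | (~ N (N.ap f (j n)) (j B) & v = emp))"
proof -
  define R where "R n v \<longleftrightarrow> (N.ap f n = v & N v (j B)) | (~ N (N.ap f n) (j B) & v = N.emp)" for n v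
  have "dfp N (%e. R (e 0) (e 1))" unfolding R_def by (intro df)
  moreover have R: "R (j n) (j v) \<longleftrightarrow> (N.ap f (j n) = j v & v \<E> B) | (~ N (N.ap f (j n)) (j B) & v = emp)" for n v
    unfolding R_def Ck.h_mem[symmetric] Ck.h_emp[symmetric] Ck.h_inj ..
  moreover have "EX v. R (j n) (j v) & (ALL v'. R (j n) (j v') --> v' = v)" for n
  proof (cases "N (N.ap f (j n)) (j B)")
    case True
    then obtain v where v: "N.ap f (j n) = j v" "v \<E> B" unfolding Ck.mem_h by blast
    show ?thesis unfolding R v(1) Ck.h_inj Ck.h_mem[symmetric] using v(2) by (intro exI[of _ v]) auto
  next
    case False
    thus ?thesis unfolding R by (intro exI[of _ emp]) (auto simp: Ck.h_mem)
  qed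
  ultimately show ?thesis using decide[of R A] by simp
qed

text \<open>The ground model covers the values of a surjection by an image of \<open>k\<close>:
  Cohen conditions do this for \<open>om\<close>, the set of \<open>dec_small\<close> for
  \<open>w1\<close>.\<close>

lemma sj_of_N: assumes k: "k = om | k = w1" and N: "N.sj (j k) (j B)" shows "sj k B"
proof -
  obtain f where f: "ALL y. N y (j B) --> (EX x. N x (j k) & N.ap f x = y)" using N unfolding N.sj_def by blast
  obtain D where D: "decides D k (%n v. (N.ap f (j n) = j v & v \<E> B) | (~ N (N.ap f (j n)) (j B) & v = emp))"
    using decide_ap by blast
  note [df] = dfp3[OF dec_df[OF D]]
  have "EX W. sj k W & (ALL n. n \<E> k --> (EX v. v \<E> W & ((N.ap f (j n) = j v & v \<E> B) | (~ N (N.ap f (j n)) (j B) & v = emp))))"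
  proof (cases "k = om")
    case True thus ?thesis using dec_cover D by blast
  next
    case False
    hence k1: "k = w1" using k by blast
    obtain K where K: "sj w1 K" "sub K QQ" "!!n. n \<E> w1 ==> EX g v. G g & g \<E> K & D g n v"
      using dec_small[OF D[unfolded k1]] by blast
    define V where "V z = Th (%v. D (fs z) (sn z) v)" for z
    have dV: "Dg V" unfolding V_def by (intro df)
    have V: "V (opr g n) = v" if "D g n v" for g n v
      unfolding V_def fs_opr sn_opr by (rule Th_eq[of "D g n", OF that]) (rule dec_uniq[OF D _ that])
    have "EX v. v \<E> Im V (prd K w1) & ((N.ap f (j n) = j v & v \<E> B) | (~ N (N.ap f (j n)) (j B) & v = emp))"
      if n: "n \<E> w1" for n
    proof -
      obtain g v where g: "G g" "g \<E> K" "D g n v" using K(3)[OF n] by blast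
      have "v \<E> Im V (prd K w1)" unfolding mem_Im[OF dV] using V[OF g(3)] n g(2) by (metis opr_prd)
      thus ?thesis using dec_R[OF D[unfolded k1] n g(1,3)] by blast
    qed
    moreover have "sj w1 (Im V (prd K w1))"
      using sj_trans[OF inf_sq[OF w1(1,3)] sj_trans[OF sj_prd[OF K(1) sj_refl] sj_Im[OF dV]]] .
    ultimately show ?thesis unfolding k1 by blast
  qed
  then obtain W where W: "sj k W" "!!n. n \<E> k ==> EX v. v \<E> W & ((N.ap f (j n) = j v & v \<E> B) | (~ N (N.ap f (j n)) (j B) & v = emp))"
    by blast
  have "b \<E> W" if b: "b \<E> B" for b
  proof -
    have "N (j b) (j B)" using b Ck.h_mem by blast
    then obtain x where x: "N x (j k)" "N.ap f x = j b" using f by blast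
    from x(1)[unfolded Ck.mem_h] obtain n where n: "x = j n" "n \<E> k" by blast
    obtain v where v: "v \<E> W" "(N.ap f (j n) = j v & v \<E> B) | (~ N (N.ap f (j n)) (j B) & v = emp)" using W(2)[OF n(2)] by blast
    have "v = b" using v(2) x(2) b unfolding n(1) by (auto simp: Ck.h_mem[symmetric] Ck.h_inj)
    thus ?thesis using v(1) by simp
  qed
  thus ?thesis using sj_mono[OF W(1) sub_refl] sub_def by blast
qed

lemma N_nx: assumes "k = om | k = w1" shows "N.nx (j k) = j (nx k)"
  unfolding N.nx_def
proof (rule N.lst_eqI)
  show "N.Ord (j (nx k))" using nx(1) Ck.h_Ord by blast
  show "~ N.sj (j k) (j (nx k))" using sj_of_N[OF assms] nx(2) by blast
  fix y assume "N y (j (nx k))"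
  then obtain x where "y = j x" "x \<E> nx k" unfolding Ck.mem_h by blast
  thus "~ ~ N.sj (j k) y" using Ck.h_sj nx(3) by blast
qed
lemma N_w1: "N.nx N.om = j w1" and N_w2: "N.nx (j w1) = j w2"
  using N_nx[of om] N_nx[of w1] unfolding w1_def[symmetric] w2_def[symmetric] Ck.h_om by simp_all
lemma N_nx_sub: "N.sub (j (nx k)) (N.nx (j k))"
proof (rule N.subI)
  fix y assume "N y (j (nx k))"
  then obtain x where x: "y = j x" "x \<E> nx k" unfolding Ck.mem_h by blast
  hence "N.Ord y" using Ord_memD[OF nx(1)] Ck.h_Ord by blast
  thus "N y (N.nx (j k))" using N.less_nx Ck.h_sj[OF nx(3)[OF x(2)]] x(1) by blast
qed

definition "cb x n v \<longleftrightarrow> (N n x & v = N.nm 1) | (~ N n x & v = N.emp)"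
lemma decide_cb: "EX D. decides D A (%n v. cb x (j n) (j v))"
proof (rule decide)
  show "dfp N (%e. cb x (e 0) (e 1))" unfolding cb_def by (intro df)
  fix n
  show "EX v. cb x (j n) (j v) & (ALL v'. cb x (j n) (j v') --> v' = v)"
    unfolding cb_def Ck.h_nm[symmetric] Ck.h_emp[symmetric] Ck.h_inj by (cases "N (j n) x") auto
qed
lemma cb_1: "cb x (j n) (j v) ==> N (j n) x \<longleftrightarrow> v = nm 1"
  unfolding cb_def Ck.h_nm[symmetric] Ck.h_emp[symmetric] Ck.h_inj by auto

text \<open>A subset of \<open>k\<close> is recovered from \<open>T\<close> and the ground model set
  \<open>Y\<close> of arguments paired with conditions that decide membership. \<open>Y\<close>
  belongs to \<open>HL k\<close>, so it has a name below \<open>nx k\<close>.\<close>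

lemma subs_count: assumes k: "Card k" "sub om k" and T: "!!t. N t T \<longleftrightarrow> (EX g. H g & t = j g)"
  and K: "!!x. EX K D. Df (%e. D (e 0) (e 1)) & sj k K & (ALL g. g \<E> K --> g \<E> HL k) &
    (ALL n. n \<E> k --> (N (j n) x \<longleftrightarrow> (EX g. g \<E> K & H g & D n g)))"
  shows "N.sj (j (nx k)) (N.Pw (j k))"
proof -
  define s where "s = lam (nx k) Lf"
  have dL: "Dg Lf" by (intro df)
  define F where "F y = N.Sep (j k) (%n. EX t. N t T & N (N.opr n t) (N.ap (j s) y))" for y
  show ?thesis
  proof (rule N.sjI[of F])
    show "dff N (%e. F (e 0))" unfolding F_def by (intro df)
    fix x assume "N x (N.Pw (j k))"
    hence x: "N.sub x (j k)" by simp
    obtain K D where D: "Df (%e. D (e 0) (e 1))" and K': "sj k K" "!!g. g \<E> K ==> g \<E> HL k"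
      "!!n. n \<E> k ==> N (j n) x \<longleftrightarrow> (EX g. g \<E> K & H g & D n g)" using K[of x] by blast
    note [df] = dfp2[OF D]
    define Y where "Y = Sep (prd k K) (%z. D (fs z) (sn z))"
    have Y: "opr n g \<E> Y \<longleftrightarrow> n \<E> k & g \<E> K & D n g" for n g
    proof -
      have "opr n g \<E> Y \<longleftrightarrow> opr n g \<E> prd k K & D (fs (opr n g)) (sn (opr n g))"
        unfolding Y_def by (rule mem_Sep) (intro df)
      thus ?thesis by simp
    qed
    have sY: "sub Y (prd k K)" unfolding Y_def sub_def by (subst mem_Sep) (intro df, simp)
    have "Y \<E> HL k"
    proof (rule HL_I[OF k])
      show "sj k Y" using sj_trans[OF sj_trans[OF inf_sq[OF k] sj_prd[OF sj_refl K'(1)]] sj_sub[OF sY]] .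
      fix y assume "y \<E> Y"
      then obtain n g where y: "y = opr n g" "n \<E> k" "g \<E> K" using subD[OF sY] unfolding mem_prd by blast
      have "Ord k" using k(1) Card_def by blast
      hence "n \<E> nx k" using Ord_trans[OF nx(1) y(2)] nx_gt by blast
      thus "y \<E> HL k" unfolding y(1) using HL_opr[OF k Ord_HL[OF k] K'(2)[OF y(3)]] by blast
    qed
    then obtain a where a: "a \<E> nx k" "Y = Lf a" unfolding mem_HL by blast
    have Na: "N.ap (j s) (j a) = j Y" unfolding Ck.h_ap[symmetric] s_def ap_lam[OF dL a(1)] a(2) ..
    have "F (j a) = x"
    proof (rule N_ext)
      fix z
      have m: "N z (F (j a)) \<longleftrightarrow> N z (j k) & (EX t. N t T & N (N.opr z t) (N.ap (j s) (j a)))"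
        unfolding F_def by (rule N.mem_Sep) (intro df)
      show "N z (F (j a)) \<longleftrightarrow> N z x"
      proof (cases "N z (j k)")
        case True
        then obtain n where n: "z = j n" "n \<E> k" unfolding Ck.mem_h by blast
        have e: "(EX t. (EX g. H g & t = j g) & N (N.opr (j n) t) (j Y)) \<longleftrightarrow> (EX g. H g & N (N.opr (j n) (j g)) (j Y))" by blast
        show ?thesis unfolding n(1) m[unfolded n(1)] Na T e h_simps Y using n(2) K'(3)[OF n(2)] by blast
      next
        case False thus ?thesis using m N.subD[OF x] by blast
      qed
    qed
    thus "EX y. N y (j (nx k)) & F y = x" using a(1) Ck.h_mem by blast
  qed
qed

text \<open>Few conditions suffice to decide a subset of \<open>k\<close>: the Cohen conditions over
  a fixed \<open>p\<close> for \<open>om\<close>, those of \<open>dec_small\<close> for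
  \<open>w1\<close>, all of \<open>QQ\<close> from \<open>w2\<close> on.\<close>

lemma N_gch: assumes c: "N.Card c" "N.sub N.om c" shows "N.sj (N.nx c) (N.Pw c)"
proof -
  obtain k where k: "Ord k" "c = j k" using N_Ord c(1) unfolding N.Card_def by blast
  have cc: "N.Card (j k)" using c(1) k(2) by simp
  have Ck: "Card k"
  proof -
    have "~ sj x k" if "x \<E> k" for x
      using that Ck.h_sj[of x k] Ck.h_mem[of x k] cc unfolding N.Card_def by blast
    thus ?thesis using k(1) unfolding Card_def by blast
  qed
  have ok: "sub om k" unfolding Ck.h_sub Ck.h_om k(2)[symmetric] by (rule c(2))
  have "N.sj (j (nx k)) (N.Pw (j k))"
  proof -
    \<comment> \<open>Common to the cases above \<open>om\<close>, in which full conditions are used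
      and \<open>T\<close> is the generic filter itself.\<close>
    have big: "N.sj (j (nx k)) (N.Pw (j k))" if *: "!!D x. decides D k (%n v. cb x (j n) (j v)) ==>
       EX K. sj k K & (ALL g. g \<E> K --> g \<E> HL k) & (ALL n. n \<E> k --> (EX g v. G g & g \<E> K & D g n v))"
    proof (rule subs_count[OF Ck ok mem_Gn])
      fix x
      obtain D where D: "decides D k (%n v. cb x (j n) (j v))" using decide_cb by blast
      obtain K where K: "sj k K" "ALL g. g \<E> K --> g \<E> HL k" "!!n. n \<E> k ==> EX g v. G g & g \<E> K & D g n v" using *[OF D] by blast
      note [df] = dfp3[OF dec_df[OF D]]
      have "Df (%e. D (e 1) (e 0) (nm 1))" by (intro df)
      moreover have "N (j n) x \<longleftrightarrow> (EX g. g \<E> K & G g & D g n (nm 1))" if n: "n \<E> k" for n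
        using K(3)[OF n] cb_1[OF dec_R[OF D n]] by metis
      ultimately show "EX K D. Df (%e. D (e 0) (e 1)) & sj k K & (ALL g. g \<E> K --> g \<E> HL k) &
        (ALL n. n \<E> k --> (N (j n) x \<longleftrightarrow> (EX g. g \<E> K & G g & D n g)))"
        using K(1,2) by (intro exI[of _ K] exI[of _ "%n g. D g n (nm 1)"]) simp
    qed
    have "k = om | k = w1 | sub w2 k"
    proof (cases "om \<E> k")
      case True
      hence w: "sub w1 k" using nx_le[OF Ck] unfolding w1_def by blast
      show ?thesis
      proof (cases "w1 \<E> k")
        case True thus ?thesis using nx_le[OF Ck] unfolding w2_def by blast
      next
        case False thus ?thesis using Ord_sub_cases[OF w1(2) k(1) w] by blast
      qed
    next
      case False thus ?thesis using Ord_sub_cases[OF Ord_om k(1) ok] by blast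
    qed
    then consider "k = om" | "k = w1" | "sub w2 k" by blast
    thus ?thesis
    proof cases
      case 1
      have ds: "dff N (%e. N.sn (e 0))" by (intro df)
      have T: "N t (N.Im N.sn Gn) \<longleftrightarrow> (EX q. GC q & t = j q)" for t
      proof
        assume "N t (N.Im N.sn Gn)"
        then obtain g where g: "G g" "t = N.sn (j g)" unfolding N.mem_Im[OF ds] mem_Gn by blast
        obtain p q where "g = opr p q" using G_E[OF g(1)] by blast
        hence "GC q & t = j q" using g GC_I by (simp add: Ck.h_opr)
        thus "EX q. GC q & t = j q" by blast
      next
        assume "EX q. GC q & t = j q"
        then obtain p q where "G (opr p q)" "t = j q" unfolding GC_def by blast
        hence "N (j (opr p q)) Gn & t = N.sn (j (opr p q))" unfolding mem_Gn by (auto simp: Ck.h_opr)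
        thus "N t (N.Im N.sn Gn)" unfolding N.mem_Im[OF ds] by blast
      qed
      show ?thesis
      proof (rule subs_count[OF Ck ok T])
        fix x
        obtain D where D: "decides D om (%n v. cb x (j n) (j v))" using decide_cb by blast
        obtain p q0 where p: "G (opr p q0)" "!!n. n \<E> om ==> EX q v. G (opr p q) & D (opr p q) n v" using dec_fused[OF D] by blast
        note [df] = dfp3[OF dec_df[OF D]]
        have "Df (%e. D (opr p (e 1)) (e 0) (nm 1))" by (intro df)
        moreover have "N (j n) x \<longleftrightarrow> (EX g. g \<E> CC & GC g & D (opr p g) n (nm 1))" if n: "n \<E> k" for n
        proof -
          note n' = n[unfolded 1]
          show ?thesis
          proof
            assume "EX g. g \<E> CC & GC g & D (opr p g) n (nm 1)"
            then obtain g where "GC g" "D (opr p g) n (nm 1)" by blast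
            thus "N (j n) x" using cb_1[OF dec_R[OF D n']] G_mix[OF p(1)] by blast
          next
            assume x: "N (j n) x"
            obtain q v where q: "G (opr p q)" "D (opr p q) n v" using p(2)[OF n'] by blast
            have "v = nm 1" using cb_1[OF dec_R[OF D n' q]] x by blast
            moreover have "isC q" using G_E[OF q(1)] by auto
            ultimately show "EX g. g \<E> CC & GC g & D (opr p g) n (nm 1)" using q GC_I mem_CC by blast
          qed
        qed
        ultimately show "EX K D. Df (%e. D (e 0) (e 1)) & sj k K & (ALL g. g \<E> K --> g \<E> HL k) &
          (ALL n. n \<E> k --> (N (j n) x \<longleftrightarrow> (EX g. g \<E> K & GC g & D n g)))"
          using sj_CC CC_HL 1 mem_CC by (intro exI[of _ CC] exI[of _ "%n g. D (opr p g) n (nm 1)"]) simp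
      qed
    next
      case 2
      show ?thesis
      proof (rule big)
        fix D x assume "decides D k (%n v. cb x (j n) (j v))"
        from dec_small[OF this[unfolded 2]] show "EX K. sj k K & (ALL g. g \<E> K --> g \<E> HL k) & (ALL n. n \<E> k --> (EX g v. G g & g \<E> K & D g n v))"
          unfolding 2 using QQ_HL subD by blast
      qed
    next
      case 3
      have 31: "sub w1 k" using sub_trans[OF w2(3) 3] .
      show ?thesis
      proof (rule big)
        fix D x assume D: "decides D k (%n v. cb x (j n) (j v))"
        have "sj k QQ" using sj_mono[OF sj_QQ 3 sub_refl] .
        moreover have "ALL g. g \<E> QQ --> g \<E> HL k" using QQ_HL HL_mono[OF 31 w1(2) k(1)] by blast
        ultimately show "EX K. sj k K & (ALL g. g \<E> K --> g \<E> HL k) & (ALL n. n \<E> k --> (EX g v. G g & g \<E> K & D g n v))"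
          using dec_ex[OF D] G_P by blast
      qed
    qed
  qed
  thus ?thesis unfolding k(2) by (rule N.sj_mono[OF _ N_nx_sub N.sub_refl])
qed

end

section \<open>The generic colouring\<close>

context qgen
begin

definition "fN = N.Unn (N.Im (%g. N.fs (N.sn (N.fs g))) Gn)"
abbreviation "fval x y z \<equiv> N (N.opr x (N.opr y z)) fN"
lemma mem_fN: "N z fN \<longleftrightarrow> (EX p q x. G (opr p q) & z = j x & x \<E> fP p)"
proof -
  have d: "dff N (%e. N.fs (N.sn (N.fs (e 0))))" by (intro df)
  have f: "N.fs (N.sn (N.fs (j (opr p q)))) = j (fP p)" if "isP p" for p q
    using arg_cong[OF isP_eq[OF that], of "%p. N.fs (N.sn (j p))"] by (simp add: Ck.h_opr)
  show ?thesis
  proof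
    assume "N z fN"
    then obtain g where g: "G g" "N z (N.fs (N.sn (N.fs (j g))))" unfolding fN_def N.mem_Un N.mem_Im[OF d] mem_Gn by blast
    obtain p q where "g = opr p q" "isP p" using G_E[OF g(1)] by blast
    thus "EX p q x. G (opr p q) & z = j x & x \<E> fP p" using g f[of p q] Ck.mem_h by metis
  next
    assume "EX p q x. G (opr p q) & z = j x & x \<E> fP p"
    then obtain p q x where x: "G (opr p q)" "z = j x" "x \<E> fP p" by blast
    have "isP p" using G_E[OF x(1)] by auto
    thus "N z fN" unfolding fN_def N.mem_Un N.mem_Im[OF d] mem_Gn using f[of p q] x Ck.h_mem by metis
  qed
qed
lemma fval_j: "fval (j a) (j b) (j c) \<longleftrightarrow> (EX p q. G (opr p q) & opr a (opr b c) \<E> fP p)"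
  unfolding mem_fN h_simps by blast
lemma fval_E: assumes "fval x y z" obtains a b c where "x = j a" "y = j b" "z = j c" "a \<E> b" "b \<E> w2" "c \<E> w1"
proof -
  obtain p q u where u: "G (opr p q)" "N.opr x (N.opr y z) = j u" "u \<E> fP p" using assms mem_fN by blast
  have p: "isP p" using G_E[OF u(1)] by auto
  obtain a b c where abc: "b \<E> aP p" "a \<E> b" "c \<E> w1" "u = opr a (opr b c)" using isP_f3[OF p u(3)] by blast
  show ?thesis
    by (rule that[of a b c]) (use u(2) abc subD[OF isP_a(1)[OF p] abc(1)] in \<open>simp_all add: Ck.h_opr\<close>)
qed
lemma G_point: assumes "b \<E> w2" "a \<E> w2" shows "EX p q. G (opr p q) & a \<E> aP p & b \<E> aP p"
proof -
  have "EX r. leQ r x & a \<E> aP (fs r) & b \<E> aP (fs r)" if xQ: "x \<E> QQ" for x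
  proof -
    obtain p q where x: "x = opr p q" "isP p" "isC q" using xQ mem_QQ by blast
    have "upair a b = un (sing a) (sing b)" by (rule ext) simp
    hence "sj om (upair a b)" using fin_om[OF fin_un[OF fin_sing fin_sing]] by simp
    moreover have "sub (upair a b) w2" using assms by (auto simp: sub_def)
    ultimately obtain s where "leP s p" "sub (upair a b) (aP s)" using add_points[OF x(2)] by blast
    thus ?thesis using leC_refl[OF x(3)] unfolding x(1) by (intro exI[of _ "opr s q"]) (simp add: sub_def)
  qed
  moreover have "Dp (%r. a \<E> aP (fs r) & b \<E> aP (fs r))" by (intro df)
  ultimately obtain r where r: "G r" "a \<E> aP (fs r)" "b \<E> aP (fs r)"
    using G_meet[of "%r. a \<E> aP (fs r) & b \<E> aP (fs r)"] by blast
  obtain p q where "r = opr p q" using G_E[OF r(1)] by blast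
  thus ?thesis using r by auto
qed
lemma fval_uniq: assumes "fval x y z" "fval x y z'" shows "z = z'"
proof -
  obtain a b c where abc: "x = j a" "y = j b" "z = j c" "a \<E> b" using fval_E[OF assms(1)] by metis
  obtain c' where c': "z' = j c'" using fval_E[OF assms(2)] by metis
  obtain p q p' q' where p: "G (opr p q)" "opr a (opr b c) \<E> fP p" "G (opr p' q')" "opr a (opr b c') \<E> fP p'"
    using assms unfolding abc(1-3) c' fval_j by blast
  obtain r s where r: "G (opr r s)" "leP r p" "leP r p'" using G_common[OF p(1,3)] by metis
  have m: "opr a (opr b c) \<E> fP r" "opr a (opr b c') \<E> fP r" using leP_sub(2)[OF r(2)] leP_sub(2)[OF r(3)] p subD by blast+
  have i: "isP r" using leP_isP r(2) by blast
  show ?thesis using isP_f2[OF i _ _ abc(4)] isP_f[OF i m(1)] m abc(3) c' by metis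
qed

text \<open>The values of a sequence \<open>t\<close> of the extension that a Cohen condition \<open>r\<close> still allows form a set \<open>B r\<close>
  of the ground model. All infinite \<open>B r\<close> are promised by one condition, and the Cohen conditions of the generic
  filter have infinite \<open>B r\<close>.\<close>
lemma fN_negative:
  assumes t: "!!n. N n N.om ==> N (N.ap t n) (j w2)" and inj: "!!n m. N n N.om ==> N m N.om ==> N.ap t n = N.ap t m ==> n = m"
    and c: "N c (j w1)"
  shows "EX X. N.sj N.om X & (ALL a. N a (j w2) --> ~ N a X --> (ALL n. N n N.om --> N a (N.ap t n)) --> (EX n. N n N.om & fval a (N.ap t n) c))"
proof -
  obtain d where d: "c = j d" "d \<E> w1" using c Ck.mem_h by blast
  obtain D where D0: "decides D om (%n v. (N.ap t (j n) = j v & v \<E> w2) | (~ N (N.ap t (j n)) (j w2) & v = emp))"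
    using decide_ap by blast
  have om: "N x N.om \<longleftrightarrow> (EX n. n \<E> om & x = j n)" for x unfolding Ck.h_om[symmetric] Ck.mem_h by blast
  have D: "N.ap t (j n) = j v & v \<E> w2" if "n \<E> om" "G g" "D g n v" for n g v
    using dec_R[OF D0 that] t[of "j n"] om that(1) by blast
  note [df] = dfp3[OF dec_df[OF D0]]
  obtain p0 q0 where p0: "G (opr p0 q0)" "!!n. n \<E> om ==> EX q v. G (opr p0 q) & D (opr p0 q) n v" using dec_fused[OF D0] by blast
  have ip0: "isP p0" "isC q0" using G_E[OF p0(1)] by auto
  have "dfp N (%e. EX n. N n N.om & N.ap t n = e 0)" by (intro df)
  note L = N.lst[OF this]
  \<comment> \<open>The least value of the sequence. Possible values below it are discarded, so that
    a point below the whole sequence is below every element of \<open>B r\<close>.\<close>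
  define b' where "b' = N.lst (%x. EX n. N n N.om & N.ap t n = x)"
  have w2N: "N.Ord (j w2)" using w2(2) Ck.h_Ord by blast
  have L1: "N.Ord (N.ap t n)" if "N n N.om" for n using N.Ord_memD[OF w2N t[OF that]] .
  obtain n0 where n0: "N n0 N.om" "N.ap t n0 = b'" using L(2)[OF L1[OF N.om_emp]] N.om_emp unfolding b'_def by blast
  obtain b0 where b0: "b' = j b0" "b0 \<E> w2" using t[OF n0(1)] unfolding n0(2) Ck.mem_h by blast
  have b0min: "~ N (N.ap t n) (j b0)" if "N n N.om" for n
    using L(3)[OF L1[OF that]] that unfolding b0(1)[symmetric] b'_def by blast
  \<comment> \<open>All values that a Cohen condition can decide together with \<open>p0\<close>: a
    countable set of the ground model.\<close>
  define W where "W = Sep w2 (%v. EX n q. n \<E> om & isC q & D (opr p0 q) n v)"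
  have W: "v \<E> W \<longleftrightarrow> v \<E> w2 & (EX n q. n \<E> om & isC q & D (opr p0 q) n v)" for v
    unfolding W_def by (rule mem_Sep) (intro df)
  have sW: "sj om W"
  proof (rule sj_trans[OF om_prd[OF sj_CC sj_refl]], rule sjI[where F="%z. Th (%v. D (opr p0 (fs z)) (sn z) v)"])
    show "Dg (%z. Th (%v. D (opr p0 (fs z)) (sn z) v))" by (intro df)
    fix v assume "v \<E> W"
    then obtain n q where n: "n \<E> om" "isC q" "D (opr p0 q) n v" using W by blast
    have "Th (D (opr p0 q) n) = v" by (rule Th_eq[of "D (opr p0 q) n", OF n(3)]) (rule dec_uniq[OF D0 _ n(3)])
    thus "EX z. z \<E> prd CC om & Th (%v. D (opr p0 (fs z)) (sn z) v) = v"
      using n mem_CC by (intro exI[of _ "opr q n"]) simp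
  qed
  define B where "B r = Sep W (%v. ~ v \<E> b0 & (EX n q. n \<E> om & leC q r & D (opr p0 q) n v))" for r
  have dB: "Dg B" unfolding B_def by (intro df)
  note [df] = dff1[OF dB]
  have B: "v \<E> B r \<longleftrightarrow> v \<E> W & ~ v \<E> b0 & (EX n q. n \<E> om & leC q r & D (opr p0 q) n v)" for v r
    unfolding B_def by (rule mem_Sep) (intro df)
  have "EX r. leQ r x & sub W (aP (fs r)) & d \<E> aP (fs r) & (ALL q. q \<E> CC --> ~ fin (B q) --> B q \<E> sP (fs r))"
    if xQ: "leQ x (opr p0 q0)" for x
  proof -
    obtain p q where x: "x = opr p q" "isP p" "isC q" using Q.le_P[OF xQ] mem_QQ by blast
    have dw: "d \<E> w2" using subD[OF w2(3) d(2)] .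
    have "sub (un W (sing d)) w2" using W dw by (auto simp: sub_def)
    moreover have "sj om (un W (sing d))" using om_un[OF sW fin_om[OF fin_sing]] .
    ultimately obtain s where s: "leP s p" "sub (un W (sing d)) (aP s)" using add_points[OF x(2)] by blast
    define S where "S = Sep (Im B CC) (%b. ~ fin b)"
    have S: "b \<E> S \<longleftrightarrow> (EX q. q \<E> CC & b = B q) & ~ fin b" for b
      unfolding S_def mem_Im[OF dB, symmetric] by (rule mem_Sep) (intro df)
    have "sj om S" by (rule om_sub[OF om_Im[OF dB sj_CC]]) (auto simp: sub_def S mem_Im[OF dB])
    moreover have "sub b (aP s) & ~ fin b" if "b \<E> S" for b
      using that s(2) B unfolding S sub_def by auto
    ultimately obtain s' where s': "leP s' s" "sub S (sP s')" "aP s' = aP s" using add_promises[OF leP_isP(1)[OF s(1)], of S] by metis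
    have "leQ (opr s' q) x" unfolding x(1) using leP_trans[OF s'(1) s(1)] leC_refl[OF x(3)] by simp
    moreover have "B r \<E> sP s'" if "r \<E> CC" "~ fin (B r)" for r using subD[OF s'(2)] S that by blast
    ultimately show ?thesis using s(2) s'(3) by (intro exI[of _ "opr s' q"]) (simp add: sub_def)
  qed
  note dense = this
  let ?E = "%r. sub W (aP (fs r)) & d \<E> aP (fs r) & (ALL q. q \<E> CC --> ~ fin (B q) --> B q \<E> sP (fs r))"
  have "Dp ?E" by (intro df)
  from G_below[of ?E, OF this p0(1) dense] obtain g1 where g1: "G g1" "leQ g1 (opr p0 q0)" "sub W (aP (fs g1))" "d \<E> aP (fs g1)"
    "!!q. q \<E> CC ==> ~ fin (B q) ==> B q \<E> sP (fs g1)" by blast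
  obtain p1 q1 where pq1: "g1 = opr p1 q1" "isP p1" "isC q1" using G_E[OF g1(1)] by blast
  have p10: "leP p1 p0" using g1(2) pq1(1) by simp
  \<comment> \<open>For \<open>q\<close> in the filter, \<open>B q\<close> contains the whole range
    of the injective sequence.\<close>
  have inf: "~ fin (B q)" if Gpq: "G (opr p q)" for p q
  proof
    assume f: "fin (B q)"
    have v: "N (N.ap t x) (j (B q))" if x: "N x N.om" for x
    proof -
      obtain n where n: "n \<E> om" "x = j n" using x om by blast
      obtain q' v where q': "G (opr p0 q')" "D (opr p0 q') n v" using p0(2)[OF n(1)] by blast
      obtain r s where r: "leC s q" "leC s q'" using G_common[OF Gpq q'(1)] by metis
      have "leQ (opr p0 s) (opr p0 q')" using r(2) leP_refl[OF ip0(1)] by simp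
      hence d: "D (opr p0 s) n v" using dec_mono[OF D0 q'(2)] by blast
      have v: "N.ap t x = j v" "v \<E> w2" using D[OF n(1) q'] n(2) by simp_all
      have "~ v \<E> b0" using b0min[OF x] unfolding v(1) Ck.h_mem[symmetric] .
      hence "v \<E> B q" unfolding B W using v(2) n(1) d r(1) leC_isC by blast
      thus ?thesis unfolding v(1) using Ck.h_mem by blast
    qed
    have "N.sj (j (B q)) N.om"
      by (rule N.sj_inj[of "N.ap t"]) (intro df, use v inj in blast, use inj in blast)
    moreover have "N.fin (j (B q))" using f Ck.h_sj om unfolding fin_def N.fin_def by blast
    ultimately show False using N.fin_sj N.not_fin_om by blast
  qed
  have "EX n. N n N.om & fval a (N.ap t n) c" if a: "N a (j w2)" "~ N a (j (aP p1))" "!!n. N n N.om ==> N a (N.ap t n)" for a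
  proof -
    obtain a0 where a0: "a = j a0" "a0 \<E> w2" using a(1) Ck.mem_h by blast
    have an: "~ a0 \<E> aP p1" using a(2) unfolding a0(1) Ck.h_mem[symmetric] .
    have "N a b'" using a(3)[OF n0(1)] n0(2) by simp
    hence ab: "a0 \<E> b0" unfolding a0(1) b0(1) Ck.h_mem[symmetric] .
    \<comment> \<open>The second alternative is there to make the set dense; by \<open>inf\<close>
      it fails in \<open>G\<close>.\<close>
    let ?C = "%g. (EX n v. n \<E> om & D g n v & opr a0 (opr v d) \<E> fP (fs g)) | fin (B (sn g))"
    have "Dp ?C" by (intro df)
    moreover have "EX r. leQ r g & ?C r" if gg: "leQ g g1" for g
    proof -
      obtain p q where g: "g = opr p q" "leP p p1" "leC q q1" using gg unfolding pq1(1) leQ_def by auto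
      have ip: "isP p" "isC q" using leP_isP[OF g(2)] leC_isC[OF g(3)] by blast+
      show ?thesis
      proof (cases "fin (B q)")
        case True thus ?thesis using leP_refl[OF ip(1)] leC_refl[OF ip(2)] g(1) by (intro exI[of _ g]) simp
      next
        case False
        have "sub (sing a0) w2" using a0(2) by (simp add: sub_def)
        then obtain s where s: "leP s p" "sub (sing a0) (aP s)" using add_points[OF ip(1) _ fin_om[OF fin_sing]] by metis
        have sp: "leP s p1" using leP_trans[OF s(1) g(2)] .
        have "EX v. v \<E> B q & opr a0 (opr v d) \<E> fP s"
        proof (rule leP_new[OF sp _ an])
          show "a0 \<E> aP s" using s(2) by (simp add: sub_def)
          show "B q \<E> sP p1" using g1(5)[OF _ False] mem_CC ip(2) pq1(1) by simp
          show "d \<E> aP p1" using g1(4) pq1(1) by simp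
          show "d \<E> w1" by (rule d(2))
          fix v assume "v \<E> B q"
          hence v: "~ v \<E> b0" "v \<E> w2" using B W by blast+
          have "sub b0 v" using Ord_not_mem[OF Ord_memD[OF w2(2) v(2)] Ord_memD[OF w2(2) b0(2)]] v(1) by blast
          thus "a0 \<E> v" using ab subD by blast
        qed
        then obtain v where v: "v \<E> B q" "opr a0 (opr v d) \<E> fP s" by blast
        \<comment> \<open>The colour appears at a merely possible value; passing to
          \<open>q'\<close> makes this an actual value of the sequence.\<close>
        from v(1)[unfolded B] obtain n q' where q': "n \<E> om" "leC q' q" "D (opr p0 q') n v" by blast
        have "leQ (opr s q') (opr p0 q')" using leP_trans[OF sp p10] leC_refl leC_isC[OF q'(2)] by simp
        hence "D (opr s q') n v" using dec_mono[OF D0 q'(3)] by blast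
        moreover have "leQ (opr s q') g" unfolding g(1) using s(1) q'(2) by simp
        ultimately show ?thesis using q'(1) v(2) by (intro exI[of _ "opr s q'"]) auto
      qed
    qed
    ultimately obtain g where g: "G g" "?C g" using G_below[of ?C, OF _ g1(1)] by blast
    obtain p q where pq: "g = opr p q" using G_E[OF g(1)] by blast
    have "~ fin (B (sn g))" using inf g(1) pq by simp
    then obtain n v where n: "n \<E> om" "D g n v" "opr a0 (opr v d) \<E> fP p" using g(2) pq by auto
    have "N.ap t (j n) = j v" using D[OF n(1) g(1) n(2)] by blast
    moreover have "fval (j a0) (j v) (j d)" unfolding fval_j using g(1) n(3) pq by blast
    ultimately show ?thesis unfolding a0(1) d(1) using n(1) om by (intro exI[of _ "j n"]) auto
  qed
  moreover have "N.sj N.om (j (aP p1))" using Ck.h_sj[OF isP_a(2)[OF pq1(2)]] unfolding Ck.h_om .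
  ultimately show ?thesis by blast
qed

end

section \<open>The Cohen colouring does not embed\<close>

context VL
begin

text \<open>The index of \<open>a\<close> in the enumeration of \<open>x\<close> that has the least
  name. For \<open>x\<close> below \<open>w1\<close> these are the injections into \<open>om\<close>
  from which \<open>g\<close> is built.\<close>

definition "enu x a = lst (%i. i \<E> om & ap (cho (%s. ALL y. y \<E> x --> (EX i. i \<E> om & ap s i = y))) i = a)"
lemma df_enu[df]: "Dt t ==> Dt s ==> Dt (%e. enu (t e) (s e))" unfolding enu_def by (intro df dff_Suc)
lemma enu: assumes "sj om x" "a \<E> x" shows "enu x a \<E> om" and enu_inj: "b \<E> x ==> enu x a = enu x b ==> a = b"
proof -
  define s where "s = cho (%s. ALL y. y \<E> x --> (EX i. i \<E> om & ap s i = y))"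
  have "Dp (%s. ALL y. y \<E> x --> (EX i. i \<E> om & ap s i = y))" by (intro df)
  from cho[OF this] have s: "EX i. i \<E> om & ap s i = y" if "y \<E> x" for y using assms(1) that unfolding sj_def s_def by blast
  have e: "enu x y \<E> om & ap s (enu x y) = y" if y: "y \<E> x" for y
  proof -
    obtain i where i: "i \<E> om & ap s i = y" using s[OF y] by blast
    have "Dp (%i. i \<E> om & ap s i = y)" by (intro df)
    from lst_P[of "%i. i \<E> om & ap s i = y", OF this _ i] show ?thesis using om_Ord i unfolding enu_def s_def by blast
  qed
  show "enu x a \<E> om" using e assms(2) by blast
  show "b \<E> x ==> enu x a = enu x b ==> a = b" using e assms(2) by metis
qed
definition "ee = lam (prd w1 w1) (%z. enu (sn z) (fs z))"
lemma ap_ee: "a \<E> w1 ==> x \<E> w1 ==> ap ee (opr a x) = enu x a"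
proof -
  assume "a \<E> w1" "x \<E> w1"
  moreover have "Dg (%z. enu (sn z) (fs z))" by (intro df)
  ultimately show ?thesis unfolding ee_def by (simp add: ap_lam)
qed

end

context zf
begin

text \<open>The collapse sends each element to a finite ordinal, and it is injective.\<close>

lemma countable_if_fin_segments: assumes "!!x. x \<E> Y ==> Ord x" "!!x. x \<E> Y ==> fin (Sep x (%y. y \<E> Y))" shows "sj om Y"
proof (rule sj_inj[of "col Y"])
  have d: "Dg (col Y)" by (intro df)
  show "Dg (col Y)" by (rule d)
  show "y = z" if "y \<E> Y" "z \<E> Y" "col Y y = col Y z" for y z
    using col_inj[OF extnl_Ord that] assms(1) by blast
  fix x assume x: "x \<E> Y"
  have m: "y \<E> Sep x (%y. y \<E> Y) \<longleftrightarrow> y \<E> x & y \<E> Y" for y by (rule mem_Sep) (intro df)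
  have "col Y x = Im (col Y) (Sep x (%y. y \<E> Y))" by (rule ext) (unfold mem_Im[OF d] m col[OF x], blast)
  hence "fin (col Y x)" using fin_Im[OF d assms(2)[OF x]] by simp
  hence "~ sub om (col Y x)" using not_fin_om fin_sub by blast
  thus "col Y x \<E> om" using Ord_cases[OF col_Ord(1)[of Y, OF assms(1) x] Ord_om] by blast
qed

end

context qgen
begin

definition "cG = N.Unn (N.Im (%g. N.sn (N.sn g)) Gn)"
lemma mem_cG: "N z cG \<longleftrightarrow> (EX q i. GC q & z = j i & i \<E> sn q)"
proof -
  have d: "dff N (%e. N.sn (N.sn (e 0)))" by (intro df)
  have f: "N.sn (N.sn (j (opr p q))) = j (sn q)" if "isC q" for p q
  proof -
    obtain n s where "q = opr n s" using \<open>isC q\<close> isC_def by blast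
    thus ?thesis by (simp add: Ck.h_opr)
  qed
  show ?thesis
  proof
    assume "N z cG"
    then obtain g where g: "G g" "N z (N.sn (N.sn (j g)))" unfolding cG_def N.mem_Un N.mem_Im[OF d] mem_Gn by blast
    obtain p q where "g = opr p q" "isC q" using G_E[OF g(1)] by blast
    thus "EX q i. GC q & z = j i & i \<E> sn q" using g f[of q p] Ck.mem_h GC_I by metis
  next
    assume "EX q i. GC q & z = j i & i \<E> sn q"
    then obtain p q i where x: "G (opr p q)" "z = j i" "i \<E> sn q" unfolding GC_def by blast
    have "isC q" using G_E[OF x(1)] by auto
    thus "N z cG" unfolding cG_def N.mem_Un N.mem_Im[OF d] mem_Gn using f[of q p] x Ck.h_mem by metis
  qed
qed
lemma cG_bit: assumes q: "G (opr p q)" and i: "i \<E> fs q" shows "N (j i) cG \<longleftrightarrow> i \<E> sn q"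
proof
  assume "i \<E> sn q" thus "N (j i) cG" unfolding mem_cG using GC_I[OF q] by blast
next
  assume "N (j i) cG"
  then obtain p' q' where q': "G (opr p' q')" "i \<E> sn q'" unfolding mem_cG GC_def by (metis Ck.h_inj)
  obtain s where s: "leC s q" "leC s q'" using G_common[OF q q'(1)] by metis
  obtain n t where "q' = opr n t" "sub t n" using leC_isC(2)[OF s(2)] isC_def by blast
  hence "i \<E> fs q'" using q'(2) subD by simp
  thus "i \<E> sn q" using s i q'(2) unfolding leC_def by blast
qed

lemma no_embedding:
  assumes F: "!!x. N x (j w1) ==> N (N.ap F x) (j w2)"
    and inj: "!!x y. N x (j w1) ==> N y (j w1) ==> N.ap F x = N.ap F y ==> x = y"
    and emb: "!!x y z. N x y ==> N y (j w1) ==> fval (N.ap F x) (N.ap F y) z | fval (N.ap F y) (N.ap F x) z ==>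
      z = N.nm 1 \<longleftrightarrow> N (N.ap (j ee) (N.opr x y)) cG"
  shows False
proof -
  obtain D where D0: "decides D w1 (%n v. (N.ap F (j n) = j v & v \<E> w2) | (~ N (N.ap F (j n)) (j w2) & v = emp))"
    using decide_ap by blast
  have D: "N.ap F (j n) = j v & v \<E> w2" if "n \<E> w1" "G g" "D g n v" for n g v
    using dec_R[OF D0 that] F[of "j n"] Ck.h_mem that(1) by blast
  note [df] = dfp3[OF dec_df[OF D0]]
  \<comment> \<open>A condition that knows both images, the colour of the image pair and the Cohen
    bit of \<open>a\<close>, \<open>x\<close>, where colour and bit disagree. This would refute the
    embedding if the condition were in \<open>G\<close>.\<close>
  define bad where "bad g a x u v c \<longleftrightarrow> a \<E> x & x \<E> w1 & (opr u (opr v c) \<E> fP (fs g) | opr v (opr u c) \<E> fP (fs g)) & D g a u & D g x v &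
    enu x a \<E> fs (sn g) & (enu x a \<E> sn (sn g) \<longleftrightarrow> c ~= nm 1)" for g a x u v c
  define Bad where "Bad g \<longleftrightarrow> (EX a x u v c. bad g a x u v c)" for g
  have dB: "Dp Bad" unfolding Bad_def bad_def by (intro df)
  note [df] = dfp1[OF dB]
  have nBad: "~ Bad g" if G: "G g" for g
  proof
    assume "Bad g"
    then obtain a x u v c where b: "bad g a x u v c" unfolding Bad_def by blast
    note b = b[unfolded bad_def]
    obtain p q where pq: "g = opr p q" using G_E[OF G] by blast
    have a: "a \<E> w1" using Ord_trans[OF w1(2)] b by blast
    have "N.ap F (j a) = j u" "N.ap F (j x) = j v" using D[OF a G] D[OF _ G, of x] b by blast+
    moreover have "fval (j u) (j v) (j c) | fval (j v) (j u) (j c)" unfolding fval_j using b G pq by auto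
    moreover have "N (j a) (j x)" "N (j x) (j w1)" using b unfolding Ck.h_mem[symmetric] by blast+
    ultimately have "j c = N.nm 1 \<longleftrightarrow> N (N.ap (j ee) (N.opr (j a) (j x))) cG" using emb[of "j a" "j x" "j c"] by simp
    hence "c = nm 1 \<longleftrightarrow> N (j (enu x a)) cG" unfolding Ck.h_nm[symmetric] Ck.h_inj Ck.h_opr[symmetric] Ck.h_ap[symmetric] using ap_ee[OF a] b by simp
    moreover have "N (j (enu x a)) cG \<longleftrightarrow> enu x a \<E> sn q" by (rule cG_bit[of p]) (use b G pq in simp_all)
    ultimately show False using b pq by simp
  qed
  \<comment> \<open>By genericity some \<open>g1\<close> in \<open>G\<close> has no bad extension
    whatsoever; the contradiction will come from an extension that may lie outside
    \<open>G\<close>.\<close>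
  let ?E = "%g. Bad g | (ALL g'. leQ g' g --> ~ Bad g')"
  have "Dp ?E" by (intro df)
  moreover have "EX g'. leQ g' g & ?E g'" if "g \<E> QQ" for g using Q.le_refl[OF that] by blast
  ultimately obtain g1 where g1: "G g1" "?E g1" using G_meet[of ?E] by blast
  hence nb: "~ Bad g" if "leQ g g1" for g using nBad that by blast
  define DD where "DD = Sep (prd QQ w1) (%z. leQ (fs z) g1 & (EX v. D (fs z) (sn z) v))"
  have DD: "opr g n \<E> DD \<longleftrightarrow> n \<E> w1 & leQ g g1 & (EX v. D g n v)" for g n
  proof -
    have "opr g n \<E> DD \<longleftrightarrow> opr g n \<E> prd QQ w1 & leQ (fs (opr g n)) g1 & (EX v. D (fs (opr g n)) (sn (opr g n)) v)"
      unfolding DD_def by (rule mem_Sep) (intro df)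
    thus ?thesis using Q.le_P by auto
  qed
  \<comment> \<open>Arguments whose image is decided by a condition of \<open>G\<close> below
    \<open>g1\<close> with Cohen part \<open>q\<close>. Countably many such sets cover
    \<open>w1\<close> in the extension, so one of them is uncountable.\<close>
  define Y where "Y q = N.Sep (j w1) (%n. EX g. N g Gn & N.sn g = q & N (N.opr g n) (j DD))" for q
  have dY: "dff N (%e. Y (e 0))" unfolding Y_def by (intro df)
  have Y0: "N n (Y q) \<longleftrightarrow> N n (j w1) & (EX g. N g Gn & N.sn g = q & N (N.opr g n) (j DD))" for n q
    unfolding Y_def by (rule N.mem_Sep) (intro df)
  have Y: "N x (Y (j q)) \<longleftrightarrow> (EX n p v. n \<E> w1 & x = j n & G (opr p q) & leQ (opr p q) g1 & D (opr p q) n v)" (is "_ \<longleftrightarrow> ?R") for x q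
  proof
    assume "N x (Y (j q))"
    then obtain n g where n: "n \<E> w1" "x = j n" "G g" "N.sn (j g) = j q" "N (N.opr (j g) (j n)) (j DD)"
      unfolding Y0 Ck.mem_h mem_Gn by blast
    obtain p q' where g: "g = opr p q'" using G_E[OF n(3)] by blast
    have "q' = q" using n(4) unfolding g by (simp add: Ck.h_opr Ck.h_inj)
    thus ?R using n(1-3,5) DD unfolding g h_simps by blast
  next
    assume ?R
    then obtain n p v where n: "n \<E> w1" "x = j n" "G (opr p q)" "leQ (opr p q) g1" "D (opr p q) n v" by blast
    have "N (N.opr (j (opr p q)) (j n)) (j DD)" unfolding Ck.h_opr[symmetric] Ck.h_mem[symmetric] DD using n by blast
    moreover have "N (j (opr p q)) Gn" using mem_Gn n(3) by blast
    moreover have "N.sn (j (opr p q)) = j q" by (simp add: Ck.h_opr)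
    moreover have "N x (j w1)" unfolding n(2) Ck.h_mem[symmetric] by (rule n(1))
    ultimately show "N x (Y (j q))" unfolding Y0 n(2) by blast
  qed
  have "EX q. isC q & ~ N.sj N.om (Y (j q))"
  proof (rule ccontr)
    assume n: "~ ?thesis"
    have "N.sj N.om (N.Unn (N.Im Y (j CC)))"
    proof (rule N.sj_Unn[OF N.om_sq])
      show "N.sj N.om (N.Im Y (j CC))" using N.sj_trans[OF Ck.h_sj[OF sj_CC, unfolded Ck.h_om] N.sj_Im[OF dY]] .
      show "N.sj N.om x" if "N x (N.Im Y (j CC))" for x
        using that n mem_CC unfolding N.mem_Im[OF dY] Ck.mem_h by blast
    qed
    moreover have "N.sub (j w1) (N.Unn (N.Im Y (j CC)))"
    proof (rule N.subI)
      fix x assume "N x (j w1)"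
      then obtain n where n: "x = j n" "n \<E> w1" unfolding Ck.mem_h by blast
      obtain g v where g: "G g" "D g n v" using dec_ex[OF D0 n(2)] by blast
      obtain g' where g': "G g'" "leQ g' g" "leQ g' g1" using G_dir[OF g(1) g1(1)] by blast
      obtain p q where pq: "g' = opr p q" "isC q" using G_E[OF g'(1)] by blast
      have "N x (Y (j q))" unfolding Y using n g' dec_mono[OF D0 g(2) g'(2)] pq(1) by blast
      moreover have "N (j q) (j CC)" using pq(2) mem_CC Ck.h_mem by blast
      ultimately show "N x (N.Unn (N.Im Y (j CC)))" unfolding N.mem_Un N.mem_Im[OF dY] by blast
    qed
    ultimately have "N.sj N.om (j w1)" using N.sj_mono[OF _ N.sub_refl] by blast
    thus False using N.nx(2)[of N.om] unfolding N_w1 by blast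
  qed
  then obtain q where q: "isC q" "~ N.sj N.om (Y (j q))" by blast
  have w1N: "N.Ord (j w1)" using w1(2) Ck.h_Ord by blast
  have Yw: "N x (j w1)" if "N x (Y (j q))" for x using that Y0 by blast
  \<comment> \<open>An uncountable set of ordinals has an element with infinitely many predecessors
    in the set.\<close>
  have "EX x. N x (Y (j q)) & ~ N.fin (N.Sep x (%y. N y (Y (j q))))"
    using N.countable_if_fin_segments[of "Y (j q)"] q(2) Yw N.Ord_memD[OF w1N] by blast
  then obtain x where x: "N x (Y (j q))" "~ N.fin (N.Sep x (%y. N y (Y (j q))))" by blast
  obtain x0 p2 v where x0: "x0 \<E> w1" "x = j x0" "G (opr p2 q)" "leQ (opr p2 q) g1" "D (opr p2 q) x0 v" using x(1) Y by blast
  have sx: "sj om x0" using nx(3) x0(1) unfolding w1_def by blast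
  have Sx: "N y (N.Sep x (%y. N y (Y (j q)))) \<longleftrightarrow> N y x & N y (Y (j q))" for y by (rule N.mem_Sep) (intro df)
  have ap: "N.ap (j ee) (N.opr (j a) x) = j (enu x0 a)" if "a \<E> x0" for a
    unfolding x0(2) Ck.h_opr[symmetric] Ck.h_ap[symmetric] using ap_ee[OF Ord_trans[OF w1(2) that x0(1)] x0(1)] by simp
  \<comment> \<open>Only finitely many bits are decided by \<open>q\<close> and
    \<open>enu x0\<close> is injective, so not all of the infinitely many predecessors lead to a
    decided bit.\<close>
  have "EX a. a \<E> x0 & N (j a) (Y (j q)) & ~ enu x0 a \<E> fs q"
  proof (rule ccontr)
    assume n: "~ ?thesis"
    have "N.sj (j (fs q)) (N.Sep x (%y. N y (Y (j q))))"
    proof (rule N.sj_inj[of "%y. N.ap (j ee) (N.opr y x)"])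
      show "dff N (%e. N.ap (j ee) (N.opr (e 0) x))" by (intro df)
      have m: "EX a. y = j a & a \<E> x0 & enu x0 a \<E> fs q" if "N y (N.Sep x (%y. N y (Y (j q))))" for y
        using that n unfolding x0(2) Sx[unfolded x0(2)] Ck.mem_h by blast
      show "N (N.ap (j ee) (N.opr y x)) (j (fs q))" if "N y (N.Sep x (%y. N y (Y (j q))))" for y
        using m[OF that] ap Ck.h_mem by auto
      show "y = z" if "N y (N.Sep x (%y. N y (Y (j q))))" "N z (N.Sep x (%y. N y (Y (j q))))"
        "N.ap (j ee) (N.opr y x) = N.ap (j ee) (N.opr z x)" for y z
        using m[OF that(1)] m[OF that(2)] that(3) ap enu_inj[OF sx] Ck.h_inj by auto
    qed
    moreover have "N.fin (j (fs q))"
    proof -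
      have "fs q \<E> om" using q(1) isC_def by auto
      hence "N (j (fs q)) N.om" unfolding Ck.h_om[symmetric] Ck.h_mem[symmetric] .
      thus ?thesis by (rule N.fin_nat)
    qed
    ultimately show False using x(2) N.fin_sj by blast
  qed
  then obtain a where a: "a \<E> x0" "N (j a) (Y (j q))" "~ enu x0 a \<E> fs q" by blast
  obtain p1 u where u: "a \<E> w1" "G (opr p1 q)" "leQ (opr p1 q) g1" "D (opr p1 q) a u" using a(2) unfolding Y by (auto simp: Ck.h_inj)
  have Fu: "N.ap F (j a) = j u" "u \<E> w2" using D[OF u(1,2,4)] by blast+
  have Fv: "N.ap F (j x0) = j v" "v \<E> w2" using D[OF x0(1,3,5)] by blast+
  have "u ~= v"
  proof
    assume "u = v"
    hence "j a = j x0" using inj[of "j a" "j x0"] Fu(1) Fv(1) u(1) x0(1) Ck.h_mem by simp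
    thus False using a(1) unfolding Ck.h_inj by simp
  qed
  hence uv: "u \<E> v | v \<E> u" using Ord_lin_mem[OF w2(2) Fu(2) Fv(2)] by blast
  \<comment> \<open>The \<open>P\<close>-parts all come from \<open>G\<close>, so they have a common
    extension, which may also be taken to contain \<open>u\<close> and \<open>v\<close> and so to
    fix their colour. The Cohen part is still \<open>q\<close>.\<close>
  obtain r s where r: "G (opr r s)" "leP r p1" "leP r p2" using G_common[OF u(2) x0(3)] by metis
  obtain p3 q3 where p3: "G (opr p3 q3)" "u \<E> aP p3" "v \<E> aP p3" using G_point[OF Fv(2) Fu(2)] by blast
  obtain t s' where t: "G (opr t s')" "leP t r" "leP t p3" using G_common[OF r(1) p3(1)] by metis
  have it: "isP t" using leP_isP t(2) by blast
  have uvt: "u \<E> aP t" "v \<E> aP t" using subD[OF leP_sub(1)[OF t(3)]] p3 by blast+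
  obtain c where c: "opr u (opr v c) \<E> fP t | opr v (opr u c) \<E> fP t"
    using uv isP_f2[OF it uvt(1,2)] isP_f2[OF it uvt(2,1)] by blast
  \<comment> \<open>The undecided bit is set against the colour that \<open>t\<close> has
    fixed.\<close>
  obtain q' where q': "leC q' q" "enu x0 a \<E> fs q'" "enu x0 a \<E> sn q' \<longleftrightarrow> c ~= nm 1" using leC_bit[OF q(1) enu(1)[OF sx a(1)] a(3)] by blast
  have l: "leQ (opr t q') (opr p1 q)" "leQ (opr t q') (opr p2 q)" using leP_trans[OF t(2)] r q'(1) by simp_all
  have "bad (opr t q') a x0 u v c" unfolding bad_def
    using a(1) x0(1) c q'(2,3) dec_mono[OF D0 u(4) l(1)] dec_mono[OF D0 x0(5) l(2)] by simp
  moreover have "leQ (opr t q') g1" using Q.le_trans[OF l(1) u(3)] .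
  ultimately show False using nb unfolding Bad_def by blast
qed

end

section \<open>Soundness and completeness\<close>

text \<open>Quantifiers range over \<open>S\<close> because the Henkin model is a set of classes and
  not a whole type.\<close>

primrec tr :: "'a set => ('a => 'a => bool) => (nat => 'a) => fm => bool" where
  "tr S E v (Mem x y) = E (v x) (v y)"
| "tr S E v (Eq x y) = (v x = v y)"
| "tr S E v (Neg p) = (~ tr S E v p)"
| "tr S E v (Imp p q) = (tr S E v p --> tr S E v q)"
| "tr S E v (All x p) = (\<forall>a\<in>S. tr S E (v(x := a)) p)"

primrec bv :: "fm => nat set" where
  "bv (Mem x y) = {}" | "bv (Eq x y) = {}" | "bv (Neg p) = bv p"
| "bv (Imp p q) = bv p \<union> bv q" | "bv (All x p) = insert x (bv p)"

primrec ren :: "(nat => nat) => fm => fm" where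
  "ren g (Mem x y) = Mem (g x) (g y)" | "ren g (Eq x y) = Eq (g x) (g y)" | "ren g (Neg p) = Neg (ren g p)"
| "ren g (Imp p q) = Imp (ren g p) (ren g q)" | "ren g (All x p) = All (g x) (ren g p)"

lemma finite_vars[simp]: "finite (vars p)" by (induction p) auto
lemma fv_vars: "fv p \<subseteq> vars p" by (induction p) auto
lemma tr_cong: "(!!x. x \<in> fv p ==> v x = w x) ==> tr S E v p = tr S E w p"
proof (induction p arbitrary: v w)
  case (All x p)
  have "tr S E (v(x := a)) p = tr S E (w(x := a)) p" for a by (rule All.IH) (use All.prems in auto)
  thus ?case by simp
next
  case (Imp p q)
  have "tr S E v p = tr S E w p" "tr S E v q = tr S E w q" by (rule Imp.IH, use Imp.prems in simp)+
  thus ?case by simp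
next
  case (Neg p)
  have "tr S E v p = tr S E w p" by (rule Neg.IH) (use Neg.prems in simp)
  thus ?case by simp
qed simp_all
lemma subst_id: "x \<notin> fv p ==> subst x y p = p" by (induction p) auto
lemma subst_self: "subst x x p = p" by (induction p) auto
lemma free_for_self: "free_for x x p" by (induction p) auto
lemma free_for_bv: "y \<notin> bv p ==> free_for x y p" by (induction p) auto
lemma bv_subst[simp]: "bv (subst x y p) = bv p" by (induction p) auto
lemma fv_subst: "fv (subst x y p) \<subseteq> insert y (fv p - {x})" by (induction p) auto
lemma size_subst[simp]: "size (subst x y p) = size p" by (induction p) auto
lemma tr_subst: "free_for x y p ==> tr S E v (subst x y p) = tr S E (v(x := v y)) p"
proof (induction p arbitrary: v)
  case (All z p)
  show ?case
  proof (cases "x \<in> fv (All z p)")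
    case True
    hence "z ~= x" "z ~= y" "free_for x y p" using All.prems by auto
    hence "(v(z := a))(x := (v(z := a)) y) = (v(x := v y))(z := a)" for a by (auto simp: fun_eq_iff)
    hence "tr S E (v(z := a)) (subst x y p) = tr S E ((v(x := v y))(z := a)) p" for a
      using All.IH[OF \<open>free_for x y p\<close>, of "v(z := a)"] by (simp only:)
    thus ?thesis using \<open>z ~= x\<close> by (simp only: subst.simps tr.simps if_False)
  next
    case False
    thus ?thesis unfolding subst_id[OF False] by (intro tr_cong) auto
  qed
qed auto

lemma soundness: "provable T p ==> (!!q v. q \<in> T ==> tr UNIV E v q) ==> tr UNIV E v p"
proof (induction p arbitrary: v rule: provable.induct)
  case (ax_inst x y p)
  thus ?case by (auto simp: tr_subst)
next
  case (ax_dist x p q)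
  have "tr UNIV E (v(x := a)) p = tr UNIV E v p" for a by (rule tr_cong) (use ax_dist in auto)
  thus ?case by simp
qed auto

lemma tr_ren: "inj_on g (vars p) ==> tr S E v (ren g p) = tr S E (v \<circ> g) p"
proof (induction p arbitrary: v)
  case (All x p)
  have i: "inj_on g (vars p)" using All.prems by (auto intro: inj_on_subset)
  have "tr S E (v(g x := a) \<circ> g) p = tr S E ((v \<circ> g)(x := a)) p" for a
    by (rule tr_cong) (use All.prems fv_vars in \<open>auto simp: inj_on_def\<close>)
  thus ?case by (simp only: ren.simps tr.simps All.IH[OF i])
next
  case (Imp p q)
  have "inj_on g (vars p)" "inj_on g (vars q)" using Imp.prems by (auto intro: inj_on_subset)
  thus ?case using Imp.IH by simp
qed auto
lemma fv_ren: "inj_on g (vars p) ==> fv (ren g p) = g ` fv p"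
proof (induction p)
  case (All x p)
  have i: "inj_on g (vars p)" using All.prems by (auto intro: inj_on_subset)
  show ?case using All.IH[OF i] All.prems fv_vars[of p] by (auto simp: inj_on_def)
next
  case (Imp p q)
  have "inj_on g (vars p)" "inj_on g (vars q)" using Imp.prems by (auto intro: inj_on_subset)
  thus ?case using Imp.IH by auto
qed auto
lemma bv_ren: "bv (ren g p) = g ` bv p" by (induction p) auto
lemma ren_subst: "inj_on g (insert x (insert y (vars p))) ==> ren g (subst x y p) = subst (g x) (g y) (ren g p)"
proof (induction p)
  case (Imp p q)
  have "inj_on g (insert x (insert y (vars p)))" "inj_on g (insert x (insert y (vars q)))" 
    using Imp.prems by (auto intro: inj_on_subset)
  thus ?case using Imp.IH by simp
next
  case (All z p)
  have "inj_on g (insert x (insert y (vars p)))" using All.prems by (auto intro: inj_on_subset)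
  thus ?case using All.IH All.prems by (auto simp: inj_on_def)
qed (auto simp: inj_on_def)
lemma ren_free_for: "inj_on g (insert x (insert y (vars p))) ==> free_for x y p ==> free_for (g x) (g y) (ren g p)"
proof (induction p)
  case (Imp p q)
  have "inj_on g (insert x (insert y (vars p)))" "inj_on g (insert x (insert y (vars q)))" 
    using Imp.prems by (auto intro: inj_on_subset)
  thus ?case using Imp by simp
next
  case (All z p)
  have i: "inj_on g (insert x (insert y (vars p)))" "inj_on g (vars (All z p))" using All.prems by (auto intro: inj_on_subset)
  show ?case
  proof (cases "x \<in> fv (All z p)")
    case True
    hence "z ~= y" "free_for x y p" using All.prems by auto
    moreover have "g z ~= g y" using \<open>z ~= y\<close> All.prems(1) by (auto simp: inj_on_def)
    ultimately show ?thesis using All.IH[OF i(1)] by simp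
  next
    case False
    hence "g x \<notin> g ` fv (All z p)" using All.prems(1) fv_vars[of "All z p"] by (auto simp: inj_on_def)
    hence "g x \<notin> fv (ren g (All z p))" using fv_ren[OF i(2)] by simp
    thus ?thesis by simp
  qed
qed (auto simp: inj_on_def)
lemma ren_inv: "(!!i. i \<in> vars p ==> g (f i) = i) ==> ren g (ren f p) = p" by (induction p) auto
lemma vars_ren: "vars (ren g p) = g ` vars p" by (induction p) auto

text \<open>Doubling the variables of a theory frees the odd ones. A derivation uses finitely many
  variables, and a renaming that is injective on them and undoes the doubling carries the derivation
  back.\<close>

lemma provable_ren: assumes "provable (ren (%i. 2 * i) ` T) p"
  shows "EX F. finite F & (ALL g. inj_on g F & (ALL i. 2 * i \<in> F --> g (2 * i) = i) --> provable T (ren g p))"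
  using assms
proof induction
  case (hyp p)
  then obtain q where q: "q \<in> T" "p = ren (%i. 2 * i) q" by blast
  show ?case
  proof (intro exI[of _ "vars p"] conjI allI impI)
    fix g :: "nat => nat" assume g: "inj_on g (vars p) & (ALL i. 2 * i \<in> vars p --> g (2 * i) = i)"
    have "ren g p = q" unfolding q(2) by (rule ren_inv) (use g q(2) vars_ren in auto)
    thus "provable T (ren g p)" using q(1) provable.hyp by simp
  qed simp
next
  case (ax_inst x y p)
  show ?case
    by (rule exI[of _ "insert x (insert y (vars p))"]) (use ax_inst in \<open>auto simp: ren_subst intro!: provable.ax_inst ren_free_for\<close>)
next
  case (ax_dist x p q)
  show ?case
  proof (intro exI[of _ "insert x (vars p)"] conjI allI impI)
    fix g :: "nat => nat" assume g: "inj_on g (insert x (vars p)) & (ALL i. 2 * i \<in> insert x (vars p) --> g (2 * i) = i)"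
    have i: "inj_on g (vars p)" using g by (auto intro: inj_on_subset)
    have "g x \<notin> g ` fv p" using g ax_dist fv_vars[of p] by (auto simp: inj_on_def)
    hence "g x \<notin> fv (ren g p)" using fv_ren[OF i] by simp
    thus "provable T (ren g (Imp (All x (Imp p q)) (Imp p (All x q))))" by (simp add: provable.ax_dist)
  qed simp
next
  case (mp p q)
  from mp.IH obtain F1 F2 where F: "finite F1" "finite F2"
    "ALL g. inj_on g F1 & (ALL i. 2 * i \<in> F1 --> g (2 * i) = i) --> provable T (ren g (Imp p q))"
    "ALL g. inj_on g F2 & (ALL i. 2 * i \<in> F2 --> g (2 * i) = i) --> provable T (ren g p)" by (elim exE conjE) iprover
  show ?case
  proof (intro exI[of _ "F1 \<union> F2"] conjI allI impI)
    fix g :: "nat => nat" assume g: "inj_on g (F1 \<union> F2) & (ALL i. 2 * i \<in> F1 \<union> F2 --> g (2 * i) = i)"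
    have "provable T (ren g (Imp p q))" by (rule F(3)[rule_format]) (use g in \<open>auto intro: inj_on_subset\<close>)
    moreover have "provable T (ren g p)" by (rule F(4)[rule_format]) (use g in \<open>auto intro: inj_on_subset\<close>)
    ultimately show "provable T (ren g q)" using provable.mp by simp
  qed (use F in simp)
next
  case (gen p x)
  then obtain F where "finite F" "!!g. inj_on g F & (ALL i. 2 * i \<in> F --> g (2 * i) = i) ==> provable T (ren g p)" by blast
  thus ?case by (intro exI[of _ F]) (auto intro: provable.gen)
qed (rule exI[of _ "{}"]; auto intro: provable.intros)+

lemma consistent_ren: assumes "consistent T" shows "consistent (ren (%i. 2 * i) ` T)"
  unfolding consistent_def
proof
  assume "EX p. provable (ren (%i. 2 * i) ` T) p & provable (ren (%i. 2 * i) ` T) (Neg p)"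
  then obtain p where p: "provable (ren (%i. 2 * i) ` T) p" "provable (ren (%i. 2 * i) ` T) (Neg p)" by blast
  from provable_ren[OF p(1)] provable_ren[OF p(2)] obtain F1 F2 where F: "finite F1" "finite F2"
    "ALL g. inj_on g F1 & (ALL i. 2 * i \<in> F1 --> g (2 * i) = i) --> provable T (ren g p)"
    "ALL g. inj_on g F2 & (ALL i. 2 * i \<in> F2 --> g (2 * i) = i) --> provable T (ren g (Neg p))" by (elim exE conjE) iprover
  define M where "M = Suc (Max (F1 \<union> F2))"
  have M: "i < M" if "i \<in> F1 \<union> F2" for i using Max_ge[OF _ that] F unfolding M_def by simp
  \<comment> \<open>Odd variables go above \<open>M\<close> and even ones are halved to values below
    \<open>M\<close>, so no two variables of the finite set are identified.\<close>
  define g where "g i = (if even i then i div 2 else M + i)" for i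
  have "inj_on g (F1 \<union> F2)"
  proof (rule inj_onI)
    fix a b assume ab: "a \<in> F1 \<union> F2" "b \<in> F1 \<union> F2" "g a = g b"
    have "a div 2 < M" "b div 2 < M" using M[OF ab(1)] M[OF ab(2)] by auto
    thus "a = b" using ab(3) unfolding g_def by (cases "even a"; cases "even b"; simp; presburger)
  qed
  hence "inj_on g F1" "inj_on g F2" by (auto intro: inj_on_subset)
  moreover have "g (2 * i) = i" for i unfolding g_def by simp
  ultimately have "provable T (ren g p)" "provable T (ren g (Neg p))" using F by simp_all
  thus False using assms unfolding consistent_def by auto
qed

text \<open>Generalization acts on theorems of \<open>T\<close> and never on assumptions, so the
  deduction theorem holds without side conditions.\<close>

inductive ded :: "fm set => fm set => fm => bool" for T \<Gamma> where
  ax: "provable T p ==> ded T \<Gamma> p"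
| asm: "p \<in> \<Gamma> ==> ded T \<Gamma> p"
| mp: "ded T \<Gamma> (Imp p q) ==> ded T \<Gamma> p ==> ded T \<Gamma> q"

lemma ded_mono: "ded T \<Gamma> p ==> \<Gamma> \<subseteq> \<Delta> ==> ded T \<Delta> p"
  by (induction rule: ded.induct) (auto intro: ded.intros)
lemma ded_K: "ded T \<Gamma> p ==> ded T \<Gamma> (Imp q p)" using ded.mp ded.ax provable.ax_K by blast
lemma ded_refl: "ded T \<Gamma> (Imp p p)"
  using ded.mp[OF ded.mp[OF ded.ax[OF provable.ax_S] ded.ax[OF provable.ax_K]] ded.ax[OF provable.ax_K[of T p p]]] .
lemma ded_imp: "ded T (insert a \<Gamma>) p ==> ded T \<Gamma> (Imp a p)"
proof (induction rule: ded.induct)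
  case (asm p) thus ?case using ded_refl ded_K ded.asm by blast
next
  case (mp p q) thus ?case using ded.mp ded.ax provable.ax_S by meson
qed (rule ded_K, rule ded.ax)
lemma ded_contr: "ded T \<Gamma> p ==> ded T \<Gamma> (Neg p) ==> ded T \<Gamma> q"
  using ded.mp ded.ax provable.ax_contra ded_K by meson
lemma ded_dneg: "ded T \<Gamma> (Neg (Neg p)) ==> ded T \<Gamma> p"
  using ded.mp[OF ded.mp[OF ded.ax[OF provable.ax_contra]] ded_refl] ded_K by blast
lemma ded_neg: assumes "ded T (insert a \<Gamma>) p" "ded T (insert a \<Gamma>) (Neg p)" shows "ded T \<Gamma> (Neg a)"
proof -
  let ?\<Delta> = "insert (Neg (Neg a)) \<Gamma>"
  have a: "ded T ?\<Delta> a" using ded_dneg ded.asm by blast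
  have "ded T ?\<Delta> (Imp a q)" if "ded T (insert a \<Gamma>) q" for q using ded_imp that ded_mono by blast
  hence "ded T ?\<Delta> p" "ded T ?\<Delta> (Neg p)" using assms a ded.mp by blast+
  hence "ded T \<Gamma> (Imp (Neg (Neg a)) p)" "ded T \<Gamma> (Imp (Neg (Neg a)) (Neg p))" using ded_imp by blast+
  thus ?thesis using ded.mp ded.ax provable.ax_contra by meson
qed
lemma ded_empty: "ded T {} p ==> provable T p"
  by (induction rule: ded.induct) (auto intro: provable.mp)
lemma provable_all_mp: "provable T (Imp (All y (Imp p q)) (Imp (All y p) (All y q)))"
proof -
  have "ded T {All y p, All y (Imp p q)} (Imp p q)" "ded T {All y p, All y (Imp p q)} p"
    using ded.mp[OF ded.ax[OF provable.ax_inst[OF free_for_self]] ded.asm] subst_self by fastforce+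
  hence "ded T {} (Imp (All y (Imp p q)) (Imp (All y p) q))" using ded.mp ded_imp by blast
  hence "provable T (Imp (All y (Imp p q)) (All y (Imp (All y p) q)))"
    by (intro provable.mp[OF provable.ax_dist provable.gen] ded_empty) simp_all
  moreover have "provable T (Imp (All y (Imp (All y p) q)) (Imp (All y p) (All y q)))" by (rule provable.ax_dist) simp
  ultimately have "ded T {All y (Imp p q)} (Imp (All y p) (All y q))"
    by (intro ded.mp[OF ded.ax ded.mp[OF ded.ax ded.asm]]) simp_all
  thus ?thesis using ded_empty ded_imp by blast
qed
lemma ded_gen: "ded T \<Gamma> p ==> (!!q. q \<in> \<Gamma> ==> y \<notin> fv q) ==> ded T \<Gamma> (All y p)"
proof (induction rule: ded.induct)
  case (ax p) thus ?case using provable.gen ded.ax by blast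
next
  case (asm p)
  have "provable T (Imp p (All y p))"
    using provable.mp[OF provable.ax_dist provable.gen] ded_empty[OF ded_refl] asm by blast
  thus ?case using ded.mp ded.ax ded.asm asm by blast
next
  case (mp p q) thus ?case using ded.mp ded.ax provable_all_mp by meson
qed
lemma subst_back: "y \<notin> vars p ==> subst y x (subst x y p) = p"
proof (induction p)
  case (All z p)
  have "y \<notin> fv p" using All.prems fv_vars by auto
  thus ?case using All by (simp add: subst_id)
qed auto
lemma free_for_back: "y \<notin> vars p ==> free_for y x (subst x y p)"
proof (induction p)
  case (All z p)
  thus ?case using fv_vars[of p] by auto
qed auto
text \<open>Generalize over the fresh \<open>y\<close>; since \<open>y\<close> does not occur in
  \<open>p\<close>, it can be renamed back to \<open>x\<close>.\<close>

lemma ded_fresh: assumes "ded T \<Gamma> (subst x y p)" "!!q. q \<in> \<Gamma> ==> y \<notin> fv q" "y \<notin> vars p" shows "ded T \<Gamma> (All x p)"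
proof -
  have "provable T (Imp (All y (subst x y p)) p)"
    using provable.ax_inst[OF free_for_back[OF assms(3)]] subst_back[OF assms(3)] by metis
  moreover have "x = y | x \<notin> fv (All y (subst x y p))" using fv_subst[of x y p] by auto
  ultimately have "provable T (Imp (All y (subst x y p)) (All x p))"
    using provable.mp[OF provable.ax_dist provable.gen] by (metis subst_self ded_empty ded_refl)
  thus ?thesis using ded_gen[OF assms(1,2)] ded.mp ded.ax by blast
qed

section \<open>The Henkin construction\<close>

instance fm :: countable by countable_datatype

definition Con :: "fm set => fm set => bool" where "Con T \<Gamma> \<longleftrightarrow> ~ (EX p. ded T \<Gamma> p & ded T \<Gamma> (Neg p))"
text \<open>Odd variables serve as Henkin constants, even variables as bound variables, so that no capture can occur.\<close>
definition good :: "fm => bool" where "good p \<longleftrightarrow> (\<forall>x\<in>bv p. even x) & (\<forall>x\<in>fv p. odd x)"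
definition fresh :: "fm set => nat" where "fresh \<Gamma> = (LEAST y. odd y & (\<forall>q\<in>\<Gamma>. y \<notin> vars q))"
text \<open>Only negated universal formulas get a witness, as existential quantifiers abbreviate
  them.\<close>

definition wit :: "fm set => fm => fm set" where
  "wit \<Gamma> p = (case p of Neg (All x q) => {Neg (subst x (fresh (insert p \<Gamma>)) q)} | _ => {})"
text \<open>Each formula is considered at the step of its own number. A good one that is skipped as
  inconsistent has a derivable negation.\<close>

primrec stage :: "fm set => nat => fm set" where
  "stage T 0 = {}"
| "stage T (Suc n) = (let p = from_nat n in
     if good p & Con T (insert p (stage T n)) then wit (stage T n) p \<union> insert p (stage T n) else stage T n)"

lemma fresh: assumes "finite \<Gamma>" shows "odd (fresh \<Gamma>)" "q \<in> \<Gamma> ==> fresh \<Gamma> \<notin> vars q"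
proof -
  have "finite (\<Union> (vars ` \<Gamma>))" using assms by auto
  then obtain m where m: "!!x. x \<in> \<Union> (vars ` \<Gamma>) ==> x \<le> m" by (meson finite_nat_set_iff_bounded_le)
  hence "odd (2 * m + 1) & (\<forall>q\<in>\<Gamma>. 2 * m + 1 \<notin> vars q)" by fastforce
  from LeastI[of "%y. odd y & (\<forall>q\<in>\<Gamma>. y \<notin> vars q)", OF this]
  show "odd (fresh \<Gamma>)" "q \<in> \<Gamma> ==> fresh \<Gamma> \<notin> vars q" unfolding fresh_def by auto
qed
lemma wit_cases: "wit \<Gamma> p = {} | (EX x q. p = Neg (All x q) & wit \<Gamma> p = {Neg (subst x (fresh (insert p \<Gamma>)) q)})"
  unfolding wit_def by (auto split: fm.splits)
lemma Con_wit: assumes "finite \<Gamma>" "Con T (insert p \<Gamma>)" shows "Con T (wit \<Gamma> p \<union> insert p \<Gamma>)"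
proof (cases "wit \<Gamma> p = {}")
  case True thus ?thesis using assms by simp
next
  case False
  define y where "y = fresh (insert p \<Gamma>)"
  obtain x q where q: "p = Neg (All x q)" "wit \<Gamma> p = {Neg (subst x y q)}" using False wit_cases y_def by blast
  have y: "r \<in> insert p \<Gamma> ==> y \<notin> vars r" for r unfolding y_def using fresh(2)[of "insert p \<Gamma>"] assms by blast
  show ?thesis
  proof (rule ccontr)
    assume "~ ?thesis"
    hence "ded T (insert p \<Gamma>) (Neg (Neg (subst x y q)))" unfolding q(2) Con_def insert_is_Un[symmetric] using ded_neg by blast
    hence "ded T (insert p \<Gamma>) (subst x y q)" by (rule ded_dneg)
    moreover have "y \<notin> vars q" using y[of p] q(1) by simp
    ultimately have "ded T (insert p \<Gamma>) (All x q)" using ded_fresh y fv_vars by blast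
    moreover have "ded T (insert p \<Gamma>) (Neg (All x q))" using q(1) ded.asm by blast
    ultimately show False using assms(2) unfolding Con_def by blast
  qed
qed
lemma stage: assumes "consistent T" shows "finite (stage T n) & Con T (stage T n)"
proof (induction n)
  case 0 show ?case using assms ded_empty[of T] unfolding consistent_def Con_def by auto
next
  case (Suc n)
  have "finite (wit (stage T n) p)" for p
    using wit_cases[of "stage T n" p] by (elim disjE exE conjE) simp_all
  thus ?case using Suc Con_wit by (auto simp: Let_def)
qed
lemma stage_mono: "m \<le> n ==> stage T m \<subseteq> stage T n"
  by (rule lift_Suc_mono_le) (auto simp: Let_def)

lemma henkin_model: assumes T: "consistent T" and gT: "!!p. p \<in> T ==> good p"
  shows "EX (S :: nat set set) E v. countable S & S ~= {} & range v \<subseteq> S & (\<forall>p\<in>T. tr S E v p)"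
proof -
  \<comment> \<open>Derivability from some stage takes the place of membership in a maximal
    consistent set; on good formulas it is complete.\<close>
  define H where "H p \<longleftrightarrow> (EX n. ded T (stage T n) p)" for p
  have H_thm: "H p" if "provable T p" for p unfolding H_def using ded.ax that by blast
  have H_mp: "H q" if "H (Imp p q)" "H p" for p q
  proof -
    obtain m n where "ded T (stage T m) (Imp p q)" "ded T (stage T n) p" using \<open>H (Imp p q)\<close> \<open>H p\<close> unfolding H_def by blast
    hence "ded T (stage T (max m n)) (Imp p q)" "ded T (stage T (max m n)) p"
      using ded_mono[OF _ stage_mono] max.cobounded1 max.cobounded2 by blast+
    thus ?thesis unfolding H_def using ded.mp by blast
  qed
  have H_con: "~ (H p & H (Neg p))" for p
  proof
    assume "H p & H (Neg p)"
    then obtain m n where "ded T (stage T m) p" "ded T (stage T n) (Neg p)" unfolding H_def by blast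
    hence "ded T (stage T (max m n)) p" "ded T (stage T (max m n)) (Neg p)"
      using ded_mono[OF _ stage_mono] max.cobounded1 max.cobounded2 by blast+
    thus False using stage[OF T] unfolding Con_def by blast
  qed
  have H_step: "(H p & (EX n. wit (stage T n) p \<subseteq> {q. H q} & finite (insert p (stage T n)))) | H (Neg p)" if g: "good p" for p
  proof (cases "Con T (insert p (stage T (to_nat p)))")
    case True
    hence "wit (stage T (to_nat p)) p \<union> {p} \<subseteq> stage T (Suc (to_nat p))" using g by (auto simp: Let_def)
    hence "wit (stage T (to_nat p)) p \<union> {p} \<subseteq> {q. H q}" unfolding H_def using ded.asm by blast
    thus ?thesis using stage[OF T] by blast
  next
    case False
    thus ?thesis unfolding Con_def H_def using ded_neg by blast
  qed
  have H_neg: "H (Neg p) \<longleftrightarrow> ~ H p" if "good p" for p using H_step[OF that] H_con by blast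
  have H_imp: "H (Imp p q) \<longleftrightarrow> (H p --> H q)" if "good p" for p q
  proof -
    have "H (Imp p q)" if "H (Neg p)"
    proof -
      obtain n where "ded T (stage T n) (Neg p)" using \<open>H (Neg p)\<close> H_def by blast
      hence "ded T (insert p (stage T n)) (Neg p)" using ded_mono[OF _ subset_insertI] by blast
      hence "ded T (insert p (stage T n)) q" by (rule ded_contr[OF ded.asm[OF insertI1]])
      thus ?thesis unfolding H_def using ded_imp by blast
    qed
    thus ?thesis using H_mp H_neg[OF that] H_thm[OF provable.ax_K] by blast
  qed
  have H_all: "H (All x p) \<longleftrightarrow> (ALL y. odd y --> H (subst x y p))" if g: "good (All x p)" for x p
  proof
    assume a: "H (All x p)"
    show "ALL y. odd y --> H (subst x y p)"
    proof (intro allI impI)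
      fix y :: nat assume "odd y"
      hence "free_for x y p" using g free_for_bv unfolding good_def by auto
      thus "H (subst x y p)" using H_mp[OF H_thm[OF provable.ax_inst] a] by blast
    qed
  next
    assume a: "ALL y. odd y --> H (subst x y p)"
    have gn: "good (Neg (All x p))" using g unfolding good_def by simp
    show "H (All x p)"
    proof (rule ccontr)
      assume "~ H (All x p)"
      hence "H (Neg (All x p))" using H_neg[OF g] by blast
      then obtain n where n: "wit (stage T n) (Neg (All x p)) \<subseteq> {q. H q}" "finite (insert (Neg (All x p)) (stage T n))"
        using H_step[OF gn] H_con by blast
      hence "H (Neg (subst x (fresh (insert (Neg (All x p)) (stage T n))) p))" unfolding wit_def by simp
      thus False using a fresh(1)[OF n(2)] H_con by blast
    qed
  qed
  have refl: "H (Eq x x)" for x by (rule H_thm[OF provable.eq_refl])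
  have sym': "H (Eq x z) ==> H (Eq x y) ==> H (Eq y z)" for x y z using H_mp[OF H_mp[OF H_thm[OF provable.eq_Eq]]] by blast
  hence sym: "H (Eq x y) ==> H (Eq y x)" for x y using refl by blast
  have mem: "H (Eq x x') ==> H (Eq y y') ==> H (Mem x y) ==> H (Mem x' y')" for x x' y y'
    using H_mp[OF H_mp[OF H_thm[OF provable.eq_Mem_left]]] H_mp[OF H_mp[OF H_thm[OF provable.eq_Mem_right]]] by blast
  define cl where "cl x = {y. H (Eq x y)}" for x
  have cl: "cl x = cl y \<longleftrightarrow> H (Eq x y)" for x y
  proof
    assume "cl x = cl y"
    moreover have "y \<in> cl y" unfolding cl_def using refl by simp
    ultimately show "H (Eq x y)" unfolding cl_def by blast
  next
    assume "H (Eq x y)" thus "cl x = cl y" unfolding cl_def using sym' sym by blast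
  qed
  define S where "S = cl ` {x. odd x}"
  define E where "E a b \<longleftrightarrow> (EX x y. a = cl x & b = cl y & H (Mem x y))" for a b
  have E: "E (cl x) (cl y) \<longleftrightarrow> H (Mem x y)" for x y unfolding E_def cl using mem sym refl by blast
  define v where "v x = (if odd x then cl x else cl 1)" for x
  have truth: "good p ==> H p \<longleftrightarrow> tr S E v p" for p
  \<comment> \<open>By size, because the universal case passes to substitution instances instead of
    the subformula itself.\<close>
  proof (induction "size p" arbitrary: p rule: less_induct)
    case less
    show ?case
    proof (cases p)
      case (Mem x y) thus ?thesis using less.prems E by (simp add: good_def v_def)
    next
      case (Eq x y) thus ?thesis using less.prems cl by (simp add: good_def v_def)
    next
      case (Neg q)
      have "good q" using less.prems Neg unfolding good_def by simp
      thus ?thesis using less.hyps[of q] H_neg Neg by simp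
    next
      case (Imp q r)
      have "good q" "good r" using less.prems Imp unfolding good_def by auto
      thus ?thesis using less.hyps[of q] less.hyps[of r] H_imp Imp by simp
    next
      case (All x q)
      note g = less.prems[unfolded All]
      have "tr S E (v(x := cl y)) q \<longleftrightarrow> H (subst x y q)" if y: "odd y" for y
      proof -
        have "good (subst x y q)" using g y fv_subst[of x y q] unfolding good_def by auto
        hence "H (subst x y q) \<longleftrightarrow> tr S E v (subst x y q)" using less.hyps All by simp
        also have "\<dots> \<longleftrightarrow> tr S E (v(x := v y)) q" by (rule tr_subst[OF free_for_bv]) (use g y in \<open>auto simp: good_def\<close>)
        finally show ?thesis using y v_def by simp
      qed
      thus ?thesis unfolding All H_all[OF g] S_def by auto
    qed
  qed
  have "cl 1 \<in> S" "range v \<subseteq> S" unfolding S_def v_def by auto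
  moreover have "countable S" unfolding S_def by simp
  moreover have "\<forall>p\<in>T. tr S E v p" using truth gT H_thm provable.hyp by blast
  ultimately show ?thesis by blast
qed

lemma completeness: assumes T: "consistent T" and s: "!!p. p \<in> T ==> fv p = {}"
  shows "EX (S :: nat set set) E. countable S & S ~= {} & (\<forall>p\<in>T. ALL v. tr S E v p)"
proof -
  let ?r = "ren (%i. 2 * i)"
  have i: "inj_on (%i. 2 * i) A" for A :: "nat set" by (auto simp: inj_on_def)
  have g: "good p" if "p \<in> ?r ` T" for p using that s fv_ren[OF i] unfolding good_def by (auto simp: bv_ren)
  have "EX (S :: nat set set) E v. countable S & S ~= {} & range v \<subseteq> S & (\<forall>p\<in>?r ` T. tr S E v p)"
    by (rule henkin_model[OF consistent_ren[OF T]]) (rule g)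
  then obtain S :: "nat set set" and E v
    where "countable S & S ~= {} & range v \<subseteq> S & (\<forall>p\<in>?r ` T. tr S E v p)" by (elim exE)
  hence M: "countable S" "S ~= {}" "!!p. p \<in> T ==> tr S E v (?r p)" by simp_all
  have "tr S E w p" if p: "p \<in> T" for p w
  proof -
    have "tr S E w p = tr S E (v \<circ> (%i. 2 * i)) p" by (rule tr_cong) (use s[OF p] in simp)
    thus ?thesis using M(3)[OF p] tr_ren[OF i] by metis
  qed
  thus ?thesis using M(1,2) by blast
qed

section \<open>Models of ZFC\<close>

lemma tr_forms: "tr S E v ((x \<^bold>\<in> y) n) \<longleftrightarrow> E (v x) (v y)" "tr S E v ((x \<^bold>= y) n) \<longleftrightarrow> v x = v y"
  "tr S E v ((\<^bold>\<not> p) n) \<longleftrightarrow> ~ tr S E v (p n)" "tr S E v ((p \<^bold>\<and> q) n) \<longleftrightarrow> tr S E v (p n) & tr S E v (q n)"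
  "tr S E v ((p \<^bold>\<or> q) n) \<longleftrightarrow> tr S E v (p n) | tr S E v (q n)" "tr S E v ((p \<^bold>\<longrightarrow> q) n) \<longleftrightarrow> (tr S E v (p n) --> tr S E v (q n))"
  "tr S E v ((p \<^bold>\<longleftrightarrow> q) n) \<longleftrightarrow> (tr S E v (p n) \<longleftrightarrow> tr S E v (q n))"
  "tr S E v (all P n) \<longleftrightarrow> (\<forall>a\<in>S. tr S E (v(n := a)) (P n (Suc n)))"
  "tr S E v (ex P n) \<longleftrightarrow> (\<exists>a\<in>S. tr S E (v(n := a)) (P n (Suc n)))"
  by (auto simp: mem_def eq_def neg_def conj_def disj_def imp_def iff_def all_def ex_def Conj_def Disj_def Iff_def Ex_def)
lemma tr_ex1: "tr S E v (ex1 P n) \<longleftrightarrow> (\<exists>a\<in>S. tr S E (v(n := a)) (P n (Suc n)) &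
    (\<forall>b\<in>S. tr S E (v(n := a, Suc n := b)) (P (Suc n) (Suc (Suc n))) --> b = a))"
  by (simp add: ex1_def tr_forms)
lemma tr_fms: "tr S E v (Conj p q) \<longleftrightarrow> tr S E v p & tr S E v q" "tr S E v (Disj p q) \<longleftrightarrow> tr S E v p | tr S E v q"
  "tr S E v (Iff p q) \<longleftrightarrow> (tr S E v p \<longleftrightarrow> tr S E v q)" "tr S E v (Ex x p) \<longleftrightarrow> (\<exists>a\<in>S. tr S E (v(x := a)) p)"
  by (auto simp: Conj_def Disj_def Iff_def Ex_def)

lemma atm_fm: "atm r ==> EX x d. ALL e c. c k = d --> (if even x then e (x div 2) else c (x div 2)) = r e"
  unfolding atm_def
proof (elim disjE exE)
  fix i assume "r = (%e. e i)" thus ?thesis by (intro exI[of _ "2 * i"]) simp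
next
  fix d assume "r = (%e. d)" thus ?thesis by (intro exI[of _ "2 * k + 1"] exI[of _ d]) simp
qed
lemma atm_fm2: assumes "atm t" "atm s"
  shows "EX x y c. ALL e. t e = (if even x then e (x div 2) else c (x div 2)) & s e = (if even y then e (y div 2) else c (y div 2))"
proof -
  obtain x d where x: "ALL e c. c 0 = d --> (if even x then e (x div 2) else c (x div 2)) = t e" using atm_fm[OF assms(1), of 0] by blast
  obtain y d' where y: "ALL e c. c 1 = d' --> (if even y then e (y div 2) else c (y div 2)) = s e" using atm_fm[OF assms(2), of 1] by blast
  define c where "c i = (if i = (0::nat) then d else d')" for i
  have c: "c 0 = d" "c 1 = d'" unfolding c_def by simp_all
  have "ALL e. t e = (if even x then e (x div 2) else c (x div 2))" "ALL e. s e = (if even y then e (y div 2) else c (y div 2))"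
    using x y c by metis+
  thus ?thesis by blast
qed

text \<open>Even variables carry the assignment and odd ones the parameters, so a definable
  predicate is given by a formula and a valuation of its parameters.\<close>

lemma dfp_fm: "dfp E P ==> EX p c. ALL e. P e \<longleftrightarrow> tr UNIV E (%i. if even i then e (i div 2) else c (i div 2)) p"
proof (induction rule: dfp.induct)
  case (dfp_mem t s)
  obtain x y c where "ALL e. t e = (if even x then e (x div 2) else c (x div 2)) & s e = (if even y then e (y div 2) else c (y div 2))"
    using atm_fm2[OF dfp_mem] by (elim exE)
  thus ?case by (intro exI[of _ "Mem x y"] exI[of _ c]) simp
next
  case (dfp_eq t s)
  obtain x y c where "ALL e. t e = (if even x then e (x div 2) else c (x div 2)) & s e = (if even y then e (y div 2) else c (y div 2))"
    using atm_fm2[OF dfp_eq] by (elim exE)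
  thus ?case by (intro exI[of _ "Eq x y"] exI[of _ c]) simp
next
  case (dfp_not P)
  then obtain p c where "ALL e. P e \<longleftrightarrow> tr UNIV E (%i. if even i then e (i div 2) else c (i div 2)) p" by blast
  thus ?case by (intro exI[of _ "Neg p"] exI[of _ c]) simp
next
  case (dfp_conj P Q)
  then obtain p c q d where p: "!!e. P e \<longleftrightarrow> tr UNIV E (%i. if even i then e (i div 2) else c (i div 2)) p"
    "!!e. Q e \<longleftrightarrow> tr UNIV E (%i. if even i then e (i div 2) else d (i div 2)) q" by blast
  \<comment> \<open>For \<open>r\<close> equal to 1 and 3 the odd variables go to the residues 3 and
    1 modulo 4, so the parameters of the two formulas do not collide; \<open>b\<close> interleaves
    them.\<close>
  define f where "f r i = (if even i then i else 2 * i + r)" for r i :: nat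
  define b where "b i = (if odd i then c (i div 2) else d (i div 2 - 1))" for i
  let ?m = "%e i. if even i then e (i div 2) else b (i div 2)"
  have "inj (f r)" if "odd r" for r
  proof (rule injI)
    fix x y assume "f r x = f r y"
    moreover have "~ even (2 * z + r)" for z using that by simp
    ultimately show "x = y" unfolding f_def by (metis add_right_cancel mult_cancel1 zero_neq_numeral)
  qed
  hence i: "inj (f 1)" "inj (f 3)" by simp_all
  have h: "odd i ==> Suc i div 2 - 1 = i div 2" "(2 * i + 1) div 2 = i" "(2 * i + 3) div 2 = Suc i" for i :: nat by presburger+
  have e: "?m e \<circ> f 1 = (%i. if even i then e (i div 2) else c (i div 2))" "?m e \<circ> f 3 = (%i. if even i then e (i div 2) else d (i div 2))" for e
    by (rule HOL.ext, auto simp: f_def b_def h simp del: One_nat_def)+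
  have "P e & Q e \<longleftrightarrow> tr UNIV E (?m e) (Conj (ren (f 1) p) (ren (f 3) q))" for e
    unfolding tr_fms tr_ren[OF inj_on_subset[OF i(1) subset_UNIV]] tr_ren[OF inj_on_subset[OF i(2) subset_UNIV]] e p ..
  thus ?case by blast
next
  case (dfp_ex P)
  then obtain p c where p: "!!e. P e \<longleftrightarrow> tr UNIV E (%i. if even i then e (i div 2) else c (i div 2)) p" by blast
  \<comment> \<open>Variable 1 is freed to be the bound one: the variable 0 moves to it, the rest of
    the assignment moves down one place and the parameters up one place.\<close>
  define f :: "nat => nat" where "f i = (if i = 0 then 1 else if even i then i - 2 else i + 2)" for i
  have i: "inj f"
  proof (rule injI)
    fix x y assume "f x = f y"
    thus "x = y" unfolding f_def by (cases "even x"; cases "even y"; cases "x = 0"; cases "y = 0"; simp; presburger)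
  qed
  let ?m = "%e i. if even i then e (i div 2) else c (i div 2 - 1)"
  have e: "(?m e)(1 := x) \<circ> f = (%i. if even i then case_nat x e (i div 2) else c (i div 2))" for e x
  proof
    fix i :: nat
    consider "i = 0" | k where "i = 2 * Suc k" | k where "i = 2 * k + 1" by (metis not0_implies_Suc oddE evenE mult_0_right)
    thus "((?m e)(1 := x) \<circ> f) i = (if even i then case_nat x e (i div 2) else c (i div 2))" by cases (simp_all add: f_def)
  qed
  have "(EX x. P (case_nat x e)) \<longleftrightarrow> tr UNIV E (?m e) (Ex 1 (ren f p))" for e
    unfolding tr_fms tr_ren[OF inj_on_subset[OF i subset_UNIV]] e p by simp
  thus ?case by (intro exI[of _ "Ex 1 (ren f p)"] exI[of _ "%k. c (k - 1)"]) blast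
qed

text \<open>The converse of \<open>dfp_fm\<close>; through it a model of the locale axioms satisfies
  the first-order schemas.\<close>

lemma dfp_tr: "(!!i. dff E (t i)) ==> dfp E (%e. tr UNIV E (%i. t i e) p)"
proof (induction p arbitrary: t)
  case (Mem x y) show ?case unfolding tr.simps by (intro df Mem)
next
  case (Eq x y) show ?case unfolding tr.simps by (intro df Eq)
next
  case (Neg p) show ?case unfolding tr.simps by (intro df Neg)
next
  case (Imp p q) show ?case unfolding tr.simps by (intro df Imp.IH Imp.prems)
next
  case (All x p)
  have "dff E (%e. ((%i. t i (%n. e (Suc n)))(x := e 0)) i)" for i
    using dff_Suc[OF All.prems] df_var by (cases "i = x") simp_all
  from df_all[of E "%a e. tr UNIV E ((%i. t i e)(x := a)) p", OF All.IH[OF this]] show ?case by simp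
qed

lemma tr_foldr: "tr UNIV E v (foldr All xs p) ==> (!!x. x \<notin> set xs ==> w x = v x) ==> tr UNIV E w p"
proof (induction xs arbitrary: v)
  case Nil
  have "w = v" by (rule ext) (simp add: Nil)
  thus ?case using Nil by simp
next
  case (Cons x xs)
  have "tr UNIV E (v(x := w x)) (foldr All xs p)" using Cons.prems(1) by simp
  thus ?case by (rule Cons.IH) (use Cons.prems(2) in auto)
qed
lemma foldr_tr: "(!!v. tr UNIV E v p) ==> tr UNIV E v (foldr All xs p)" by (induction xs arbitrary: v) auto
lemma fv_foldr: "fv (foldr All xs p) = fv p - set xs" by (induction xs) auto
lemma closures_I: "foldr All [0..<Suc (Max (vars p))] p \<in> closures p"
proof -
  have "x \<in> set [0..<Suc (Max (vars p))]" if "x \<in> fv p" for x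
    using Max_ge[OF finite_vars, of x p] fv_vars[of p] that by (auto simp del: upt_Suc simp: le_imp_less_Suc)
  hence "fv (foldr All [0..<Suc (Max (vars p))] p) = {}" unfolding fv_foldr by blast
  thus ?thesis unfolding closures_def by blast
qed
lemma tr_closures: assumes "!!q v. q \<in> closures p ==> tr UNIV E v q" shows "tr UNIV E w p"
proof (rule tr_foldr[where v="%i. if i \<in> set [0..<Suc (Max (vars p))] then undefined i else w i"])
  show "tr UNIV E (%i. if i \<in> set [0..<Suc (Max (vars p))] then undefined i else w i) (foldr All [0..<Suc (Max (vars p))] p)"
    by (rule assms[OF closures_I])
qed auto

lemmas axiom_defs = extensionality_def foundation_def pairing_def union_def power_set_def infinity_def choice_def
  is_empty_def subset_def is_upair_def is_succ_def is_power_def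

lemma tr_sep: assumes "x < n" "!!v. v \<in> vars p ==> v < n"
  shows "tr UNIV E v (separation_inst x p n) \<longleftrightarrow> (ALL a. EX b. ALL z. E z b \<longleftrightarrow> E z a & tr UNIV E (v(x := z)) p)"
proof -
  have "tr UNIV E (v(n := a, Suc n := b, x := z)) p = tr UNIV E (v(x := z)) p" for a b z
    by (rule tr_cong) (use assms(2) fv_vars[of p] in fastforce)
  thus ?thesis using assms(1) by (simp add: separation_inst_def tr_fms)
qed
lemma tr_rep: assumes "x < n" "y < n" "x ~= y" "!!v. v \<in> vars p ==> v < n"
  shows "tr UNIV E v (replacement_inst x y p n) \<longleftrightarrow> (ALL a. (ALL z. E z a --> (EX c. ALL u. tr UNIV E (v(x := z, y := u)) p \<longleftrightarrow> u = c)) -->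
    (EX b. ALL z. E z a --> (EX u. E u b & tr UNIV E (v(x := z, y := u)) p)))"
proof -
  have "tr UNIV E (v(n := a, x := z, Suc (Suc n) := c, y := u)) p = tr UNIV E (v(x := z, y := u)) p"
    "tr UNIV E (v(n := a, Suc n := b, x := z, y := u)) p = tr UNIV E (v(x := z, y := u)) p" for a b c z u
    by (rule tr_cong, use assms(4) fv_vars[of p] in fastforce)+
  thus ?thesis using assms(1-3) by (simp add: replacement_inst_def tr_fms)
qed

lemma zf_of_ZFC: fixes E :: "'a => 'a => bool" assumes M: "!!q v. q \<in> ZFC ==> tr UNIV E v q" shows "zf E"
proof
  have ax: "tr UNIV E v (extensionality 0)" "tr UNIV E v (foundation 0)" "tr UNIV E v (pairing 0)" "tr UNIV E v (union 0)"
    "tr UNIV E v (power_set 0)" "tr UNIV E v (infinity 0)" for v by (rule M, simp add: ZFC_def)+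
  note ax = ax[unfolded axiom_defs tr_forms, simplified]
  show "x = y" if "!!z. E z x \<longleftrightarrow> E z y" for x y using ax(1) that by blast
  show "EX y. E y x & (ALL z. E z y --> ~ E z x)" if "E y x" for x y using ax(2) that by blast
  show "EX p. E a p & E b p" for a b using ax(3) by metis
  show "EX u. ALL x z. E x a --> E z x --> E z u" for a using ax(4) by meson
  show "EX p. ALL z. (ALL y. E y z --> E y a) --> E z p" for a using ax(5) by meson
  show "EX w. (EX z. E z w & (ALL y. ~ E y z)) & (ALL x. E x w --> (EX y. E y w & (ALL z. E z y \<longleftrightarrow> E z x | z = x)))"
    using ax(6) by meson
  have dv: "even i ==> i div 2 = 0 \<longleftrightarrow> i = 0" "even i ==> i div 2 = Suc 0 \<longleftrightarrow> i = 2" for i :: nat by presburger+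
  have max: "z < Suc (Max (insert 2 (vars p)))" if "z \<in> insert 2 (vars p)" for z p
    using Max_ge[OF _ that] by (simp add: le_imp_less_Suc)
  show "EX b. ALL x. E x b \<longleftrightarrow> E x a & P x" if P: "dfp E (%e. P (e 0))" for P :: "'a => bool" and a
  proof -
    obtain p c where p: "!!e. P (e 0) \<longleftrightarrow> tr UNIV E (%i. if even i then e (i div 2) else c (i div 2)) p" using dfp_fm[OF P] by blast
    let ?n = "Suc (Max (insert 2 (vars p)))" and ?v = "%i. if even i then a else c (i div 2)"
    have n: "0 < ?n" "v \<in> vars p ==> v < ?n" for v using max[of v p] by auto
    have "q \<in> ZFC" if "q \<in> closures (separation_inst 0 p ?n)" for q
      using that n unfolding ZFC_def separation_axioms_def by blast
    hence "tr UNIV E ?v (separation_inst 0 p ?n)" using M tr_closures by blast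
    hence "ALL a'. EX b. ALL z. E z b \<longleftrightarrow> E z a' & tr UNIV E (?v(0 := z)) p" using tr_sep[OF n, of p E ?v] by simp
    moreover have "tr UNIV E (?v(0 := z)) p \<longleftrightarrow> P z" for z
    proof -
      have "?v(0 := z) = (%i. if even i then ((%_. a)(0 := z)) (i div 2) else c (i div 2))" by (rule HOL.ext) (auto simp: dv)
      thus ?thesis using p[of "(%_. a)(0 := z)"] by simp
    qed
    ultimately show ?thesis by simp
  qed
  show "EX b. ALL x. E x a --> (EX y. E y b & Q x y)"
    if Q: "dfp E (%e. Q (e 0) (e 1))" and fn: "!!x. E x a ==> EX c. ALL y. Q x y \<longleftrightarrow> y = c" for Q :: "'a => 'a => bool" and a
  proof -
    obtain p c where p: "!!e. Q (e 0) (e 1) \<longleftrightarrow> tr UNIV E (%i. if even i then e (i div 2) else c (i div 2)) p" using dfp_fm[OF Q] by blast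
    \<comment> \<open>The variables 0 and 2 hold the two arguments of \<open>Q\<close>, by the
      convention that even variables carry the assignment.\<close>
    let ?n = "Suc (Max (insert 2 (vars p)))" and ?v = "%i. if even i then a else c (i div 2)"
    have n: "0 < ?n" "2 < ?n" "(0::nat) ~= 2" "v \<in> vars p ==> v < ?n" for v using max[of v p] max[of 2 p] by auto
    have "q \<in> ZFC" if "q \<in> closures (replacement_inst 0 2 p ?n)" for q
      using that n unfolding ZFC_def replacement_axioms_def by blast
    hence "tr UNIV E ?v (replacement_inst 0 2 p ?n)" using M tr_closures by blast
    moreover have "tr UNIV E (?v(0 := z, 2 := u)) p \<longleftrightarrow> Q z u" for z u
    proof -
      have "?v(0 := z, 2 := u) = (%i. if even i then ((%_. a)(0 := z, 1 := u)) (i div 2) else c (i div 2))"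
        by (rule HOL.ext) (auto simp: dv)
      thus ?thesis using p[of "(%_. a)(0 := z, 1 := u)"] by simp
    qed
    ultimately have "ALL a. (ALL z. E z a --> (EX c. ALL u. Q z u \<longleftrightarrow> u = c)) --> (EX b. ALL z. E z a --> (EX u. E u b & Q z u))"
      using tr_rep[OF n, of p E ?v] by simp
    thus ?thesis using fn by blast
  qed
qed

text \<open>In a finite universe pairing and union produce an element \<open>u\<close> that contains
  everything including itself, and its singleton violates foundation.\<close>

lemma infinite_model: assumes "S ~= {}" and M: "!!q v. q \<in> ZFC ==> tr S E v q" shows "infinite S"
proof
  assume fin: "finite S"
  have "tr S E v (pairing 0)" "tr S E v (union 0)" "tr S E v (foundation 0)" for v by (rule M, simp add: ZFC_def)+
  note ax = this[unfolded axiom_defs tr_forms, simplified]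
  obtain s where s: "s \<in> S" using assms(1) by blast
  have "\<exists>u\<in>S. \<forall>x\<in>F. E x u" if "finite F" "F \<subseteq> S" for F
    using that
  proof (induction F)
    case empty thus ?case using s by blast
  next
    case (insert a F)
    then obtain u where u: "u \<in> S" "\<forall>x\<in>F. E x u" and a: "a \<in> S" by blast
    obtain p where p: "p \<in> S" "E a p" using ax(1) a by blast
    obtain q where q: "q \<in> S" "E u q" "E p q" using ax(1) u p by blast
    obtain w where "w \<in> S" "\<forall>z\<in>S. E z w \<longleftrightarrow> (\<exists>x\<in>S. E x q & E z x)" using ax(2) q(1) by blast
    thus ?case using u p q a insert.prems by (intro bexI[of _ w]) auto
  qed
  from this[OF fin] obtain u where u: "u \<in> S" "\<forall>x\<in>S. E x u" by blast
  obtain p where p: "p \<in> S" "\<forall>z\<in>S. E z p \<longleftrightarrow> z = u" using ax(1) u(1) by blast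
  show False using ax(3) p u by metis
qed

lemma tr_bij: assumes f: "bij_betw f S UNIV" and v: "range v \<subseteq> S"
  shows "tr S E v p \<longleftrightarrow> tr UNIV (%a b. E (inv_into S f a) (inv_into S f b)) (f \<circ> v) p"
  using v
proof (induction p arbitrary: v)
  case (Mem x y)
  have "inv_into S f (f (v z)) = v z" for z using f Mem by (auto simp: bij_betw_def intro!: inv_into_f_f)
  thus ?case by simp
next
  case (Eq x y)
  have "v x \<in> S" "v y \<in> S" using Eq by auto
  thus ?case using f by (auto simp: bij_betw_def inj_on_eq_iff)
next
  case (All x p)
  have "tr S E (v(x := a)) p \<longleftrightarrow> tr UNIV (%a b. E (inv_into S f a) (inv_into S f b)) ((f \<circ> v)(x := f a)) p" if "a \<in> S" for a
  proof -
    have "range (v(x := a)) \<subseteq> S" using All.prems that by auto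
    moreover have "f \<circ> v(x := a) = (f \<circ> v)(x := f a)" by auto
    ultimately show ?thesis using All.IH[of "v(x := a)"] by (simp only:)
  qed
  moreover have "(\<forall>b\<in>UNIV. Q b) \<longleftrightarrow> (\<forall>a\<in>S. Q (f a))" for Q unfolding bij_betw_imp_surj_on[OF f, symmetric] by blast
  ultimately show ?case unfolding tr.simps by (simp only:) blast
qed simp_all

lemma ZFC_sentences: "p \<in> ZFC ==> fv p = {}"
  unfolding ZFC_def separation_axioms_def replacement_axioms_def closures_def
  by (auto simp: axiom_defs mem_def eq_def neg_def conj_def disj_def imp_def iff_def all_def ex_def ex1_def Conj_def Disj_def Iff_def Ex_def)

lemma zf_model: assumes "consistent ZFC" shows "EX E :: nat => nat => bool. zf E"
proof -
  obtain S :: "nat set set" and E where S: "countable S" "S ~= {}" "!!p v. p \<in> ZFC ==> tr S E v p"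
    using completeness[OF assms ZFC_sentences] by blast
  have "bij_betw (to_nat_on S) S UNIV" by (rule to_nat_on_infinite[OF S(1) infinite_model[OF S(2,3)]])
  note b = tr_bij[OF this]
  have "tr UNIV (%a b. E (inv_into S (to_nat_on S) a) (inv_into S (to_nat_on S) b)) v p" if p: "p \<in> ZFC" for p v
  proof -
    obtain s where "s \<in> S" using S(2) by blast
    hence "tr UNIV (%a b. E (inv_into S (to_nat_on S) a) (inv_into S (to_nat_on S) b)) (to_nat_on S \<circ> (%_. s)) p"
      using b[of "%_. s"] S(3)[OF p] by auto
    thus ?thesis using tr_cong[of p v] ZFC_sentences[OF p] by (metis empty_iff)
  qed
  thus ?thesis using zf_of_ZFC by blast
qed

context zf
begin

text \<open>If L were finite, it would be a set with names bounded by some \<open>g\<close>. The set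
  of everything named below a larger closed ordinal would then have a name below \<open>g\<close>
  and be an element of itself.\<close>

lemma infinite_inL: "infinite {z. inL z}"
proof
  assume fin: "finite {z. inL z}"
  have "EX s. ALL z. z \<E> s \<longleftrightarrow> z \<in> F" if "finite F" for F
    using that
  proof (induction F)
    case empty show ?case by (rule exI[of _ emp]) simp
  next
    case (insert a F)
    then obtain s where "ALL z. z \<E> s \<longleftrightarrow> z \<in> F" by blast
    thus ?case by (intro exI[of _ "un s (sing a)"]) auto
  qed
  from this[OF fin] obtain s where s: "!!z. z \<E> s \<longleftrightarrow> inL z" by auto
  obtain g where g: "Ord g" "!!y. inL y ==> EX x. x \<E> g & y = Lf x" using inL_bound[of s] s by blast
  have "Dg (%x. x)" by (intro df)
  from closed_ordinal[OF this _ g(1)] obtain m where m: "Jcl m" "g \<E> m" by blast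
  have om: "Ord m" using m(1) Jcl_def by blast
  have em: "emp \<E> m" using emp_mem[OF om] m(2) mem_emp by metis
  text \<open>The code of a formula that is always true.\<close>
  define e where "e = J (nm 3) (J (J (nm 6) emp) (J (nm 6) emp))"
  have e: "Ord e" "Ord (J (nm 6) emp)" unfolding e_def by simp_all
  \<comment> \<open>Tag 6 belongs to no clause of \<open>sat\<close>, so this code is never
    satisfied, and the nand of it with itself always is.\<close>
  have "~ u \<E> St m (J (nm 6) emp)" for u
    unfolding St_def by (subst sat_unfold[OF e(2)]) (simp del: nm.simps)
  hence "u \<E> St m e \<longleftrightarrow> u \<E> m" for u
    using sat_unfold[OF e(1), of u m "lam m Lf"] unfolding St_def e_def by (simp del: nm.simps)
  hence L: "z \<E> Lf (J m e) \<longleftrightarrow> (EX y. y \<E> m & z = Lf y)" for z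
    unfolding mem_Lf_J[OF om e(1)] using m(1) em unfolding Jcl_def by blast
  have "inL (Lf (J m e))" unfolding inL_def using Ord_J[OF om e(1)] by blast
  then obtain x where "x \<E> g" "Lf (J m e) = Lf x" using g(2) by blast
  hence "Lf (J m e) \<E> Lf (J m e)" unfolding L using Ord_trans[OF om _ m(2)] by blast
  thus False by simp
qed

end

text \<open>L of a countable model is again countable, and it is infinite, so it can be moved to the
  natural numbers, where generic filters exist.\<close>

lemma qgen_exists: assumes "consistent ZFC" shows "EX E G. qgen E G"
proof -
  obtain E :: "nat => nat => bool" where "zf E" using zf_model[OF assms] by blast
  then interpret zf E .
  have b: "bij_betw (from_nat_into {z. inL z}) UNIV {z. inL z}" by (intro bij_betw_from_nat_into infinite_inL) simp
  interpret constr E "from_nat_into {z. inL z}"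
    by unfold_locales (use b in \<open>auto simp: bij_betw_def inj_def image_def\<close>)
  interpret W: VLn EL by unfold_locales
  obtain G where "W.Q.generic_filter G" using W.Q.generic_exists by blast
  hence "qgen EL G" by unfold_locales
  thus ?thesis by blast
qed

section \<open>Truth of the formulas in a model\<close>

context zf
begin

abbreviation "T \<equiv> tr UNIV E"

definition "isfn f X Y \<longleftrightarrow> (ALL p. p \<E> f --> (EX x y. x \<E> X & y \<E> Y & p = opr x y)) &
  (ALL x. x \<E> X --> (EX y. opr x y \<E> f & (ALL y'. opr x y' \<E> f --> y' = y)))"
definition "isinj f X Y \<longleftrightarrow> isfn f X Y & (ALL x x' y. opr x y \<E> f & opr x' y \<E> f --> x = x')"
definition "isbij f X Y \<longleftrightarrow> isinj f X Y & (ALL y. y \<E> Y --> (EX x. opr x y \<E> f))"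
definition "eqn X Y \<longleftrightarrow> (EX f. isbij f X Y)"
definition "ot A a \<longleftrightarrow> (EX h. isbij h a A & (ALL x y u v. opr x u \<E> h & opr y v \<E> h & x \<E> y --> u \<E> v))"
text \<open>With \<open>A\<close> and \<open>B\<close> equal this is the set of two-element subsets,
  so one notion serves both kinds of pairs in the formula.\<close>

definition "prb A B = Im (%z. upair (fs z) (sn z)) (Sep (prd A B) (%z. fs z ~= sn z))"

lemma mem_prb: "p \<E> prb A B \<longleftrightarrow> (EX a b. a \<E> A & b \<E> B & a ~= b & p = upair a b)"
proof -
  have d: "Dg (%z. upair (fs z) (sn z))" by (intro df)
  have m: "z \<E> Sep (prd A B) (%z. fs z ~= sn z) \<longleftrightarrow> z \<E> prd A B & fs z ~= sn z" for z by (rule mem_Sep) (intro df)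
  show ?thesis unfolding prb_def mem_Im[OF d] m mem_prd by (metis fs_opr sn_opr)
qed

lemma isfn_ap: assumes "isfn f X Y" "x \<E> X" shows "ap f x \<E> Y" "opr x y \<E> f \<longleftrightarrow> y = ap f x"
proof -
  obtain z where z: "opr x z \<E> f" "ALL y'. opr x y' \<E> f --> y' = z" using assms isfn_def by blast
  have "ap f x = z" unfolding ap_def by (rule Th_eq) (use z in blast)+
  thus "opr x y \<E> f \<longleftrightarrow> y = ap f x" using z by blast
  obtain x' y' where "y' \<E> Y" "opr x z = opr x' y'" using assms(1) z(1) isfn_def by blast
  thus "ap f x \<E> Y" using \<open>ap f x = z\<close> by simp
qed
lemma isfn_dom: "isfn f X Y ==> opr x y \<E> f ==> x \<E> X & y \<E> Y" unfolding isfn_def by fastforce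
lemma isinj_ap: "isinj f X Y ==> x \<E> X ==> x' \<E> X ==> ap f x = ap f x' ==> x = x'"
  unfolding isinj_def using isfn_ap(2) by metis
lemma eqnI: assumes H: "Dg H" "!!x. x \<E> X ==> H x \<E> Y" "!!x x'. x \<E> X ==> x' \<E> X ==> H x = H x' ==> x = x'"
  "!!y. y \<E> Y ==> EX x. x \<E> X & H x = y" shows "eqn X Y"
proof -
  have m: "opr x y \<E> lam X H \<longleftrightarrow> x \<E> X & y = H x" for x y unfolding mem_lam[OF H(1)] by auto
  have "isfn (lam X H) X Y" unfolding isfn_def m using H(2) by (auto simp: mem_lam[OF H(1)])
  hence "isbij (lam X H) X Y" unfolding isbij_def isinj_def m using H(3,4) by metis
  thus ?thesis unfolding eqn_def by blast
qed
lemma eqn_sym: assumes "eqn X Y" shows "eqn Y X"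
proof -
  obtain f where f: "isbij f X Y" using assms eqn_def by blast
  hence i: "isinj f X Y" "isfn f X Y" unfolding isbij_def isinj_def by blast+
  define H where "H y = Th (%x. opr x y \<E> f)" for y
  have H: "H y = x \<longleftrightarrow> opr x y \<E> f" if "y \<E> Y" for x y
  proof -
    obtain z where z: "opr z y \<E> f" using f \<open>y \<E> Y\<close> isbij_def by blast
    have "H y = z" unfolding H_def by (rule Th_eq[of "%x. opr x y \<E> f", OF z]) (use i(1) z isinj_def in blast)
    thus ?thesis using z i(1) isinj_def by blast
  qed
  show ?thesis
  proof (rule eqnI[of H])
    show "Dg H" unfolding H_def by (intro df)
    show "H y \<E> X" if "y \<E> Y" for y using H[OF that] isfn_dom[OF i(2)] by blast
    show "y = y'" if "y \<E> Y" "y' \<E> Y" "H y = H y'" for y y'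
      using H[OF that(1)] H[OF that(2)] that(3) isfn_dom[OF i(2)] isfn_ap(2)[OF i(2)] by metis
    show "EX y. y \<E> Y & H y = x" if "x \<E> X" for x using H isfn_ap[OF i(2) that] by blast
  qed
qed
lemma eqn_sj: assumes "eqn X Y" shows "sj X Y"
proof -
  obtain f where f: "isbij f X Y" using assms eqn_def by blast
  hence i: "isfn f X Y" unfolding isbij_def isinj_def by blast
  have "EX x. x \<E> X & ap f x = y" if "y \<E> Y" for y
    using f that isfn_dom[OF i] isfn_ap(2)[OF i] unfolding isbij_def by metis
  thus ?thesis unfolding sj_def by blast
qed
text \<open>The least preimages form a set of ordinals in bijection with \<open>B\<close>, and
  collapsing it does not lead above \<open>x\<close>.\<close>

lemma sj_eqn: assumes x: "Ord x" "sj x B" shows "EX t. Ord t & sub t x & eqn B t"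
proof -
  obtain f where f: "ALL y. y \<E> B --> (EX i. i \<E> x & ap f i = y)" using x(2) sj_def by blast
  define H where "H y = lst (%i. i \<E> x & ap f i = y)" for y
  have dH: "Dg H" unfolding H_def by (intro df)
  note [df] = dff1[OF dH]
  have H: "H y \<E> x & ap f (H y) = y" if y: "y \<E> B" for y
  proof -
    obtain i where i: "i \<E> x & ap f i = y" using f y by blast
    have "Dp (%i. i \<E> x & ap f i = y)" by (intro df)
    from lst_P[of "%i. i \<E> x & ap f i = y", OF this _ i] show ?thesis using Ord_memD[OF x(1)] i unfolding H_def by blast
  qed
  define A where "A = Im H B"
  have A: "z \<E> A \<longleftrightarrow> (EX y. y \<E> B & z = H y)" for z unfolding A_def by (rule mem_Im[OF dH])
  have oA: "Ord z" if "z \<E> A" for z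
  proof -
    from that[unfolded A] obtain y where "y \<E> B" "z = H y" by blast
    thus ?thesis using Ord_memD[OF x(1)] H[of y] by simp
  qed
  have ot: "Ord (otp A)" by (rule otp_Ord[OF oA])
  have "sub (otp A) x"
  proof (rule subI)
    fix z assume "z \<E> otp A"
    then obtain y where y: "y \<E> B" "z = col A (H y)" unfolding mem_otp A by blast
    have HA: "H y \<E> A" using A y by blast
    have "Ord z" "sub z (H y)" using col_Ord[OF oA HA] y(2) by blast+
    thus "z \<E> x" using Ord_le_less[OF oA[OF HA] x(1)] H[OF y(1)] by blast
  qed
  moreover have "eqn B (otp A)"
  proof (rule eqnI[of "%y. col A (H y)"])
    show "Dg (%y. col A (H y))" by (intro df)
    show "col A (H y) \<E> otp A" if "y \<E> B" for y using that mem_otp A by blast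
    show "y = y'" if "y \<E> B" "y' \<E> B" "col A (H y) = col A (H y')" for y y'
    proof -
      have "H y = H y'" by (rule col_inj[OF extnl_Ord[OF oA] _ _ that(3)]) (use A that in blast)+
      hence "ap f (H y) = ap f (H y')" by simp
      thus ?thesis using H[OF that(1)] H[OF that(2)] by simp
    qed
    show "EX y. y \<E> B & col A (H y) = z" if "z \<E> otp A" for z using that unfolding mem_otp A by blast
  qed
  ultimately show ?thesis using ot by blast
qed
text \<open>Cardinals were introduced by partial surjections, while the formula speaks of
  bijections; \<open>sj_eqn\<close> turns the former into the latter.\<close>

lemma Card_iff: "Card k \<longleftrightarrow> Ord k & ~ (EX x. x \<E> k & eqn x k)"
proof -
  have "EX y. y \<E> k & eqn y k" if k: "Ord k" "x \<E> k" "sj x k" for x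
  proof -
    obtain t where t: "Ord t" "sub t x" "eqn k t" using sj_eqn[OF Ord_memD[OF k(1,2)] k(3)] by blast
    thus ?thesis using Ord_le_less[OF Ord_memD[OF k(1,2)] k(1) t(1,2) k(2)] eqn_sym by blast
  qed
  thus ?thesis unfolding Card_def using eqn_sj by blast
qed

lemma nm_mem: "i < k ==> nm i \<E> nm k"
  by (induction k) (auto simp: less_Suc_eq)
lemma sub_empty: "(ALL z. ~ z \<E> x) \<longleftrightarrow> x = emp" using ext[of x emp] by auto
lemma eq_upair: "(ALL z. z \<E> p \<longleftrightarrow> z = a | z = b) \<longleftrightarrow> p = upair a b" using ext[of p "upair a b"] by auto
lemma eq_suc: "(ALL z. z \<E> y \<longleftrightarrow> z \<E> x | z = x) \<longleftrightarrow> y = suc x" using ext[of y "suc x"] by auto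
lemma eq_Pw: "(ALL z. z \<E> p \<longleftrightarrow> sub z x) \<longleftrightarrow> p = Pw x" using ext[of p "Pw x"] by auto
lemma eq_prb: "(ALL p. p \<E> D \<longleftrightarrow> (EX a. a \<E> A & (EX b. b \<E> B & a ~= b & p = upair a b))) \<longleftrightarrow> D = prb A B"
proof -
  have "(ALL p. p \<E> D \<longleftrightarrow> p \<E> prb A B) \<longleftrightarrow> D = prb A B" using ext[of D "prb A B"] by auto
  thus ?thesis by (simp add: mem_prb)
qed

lemma T_empty: "x < n ==> T v (is_empty x n) \<longleftrightarrow> v x = emp"
  by (simp add: is_empty_def tr_forms sub_empty)
lemma T_sub: "x < n ==> y < n ==> T v ((x \<^bold>\<subseteq> y) n) \<longleftrightarrow> sub (v x) (v y)"
  by (simp add: subset_def tr_forms sub_def)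
lemma T_upair: "a < n ==> b < n ==> p < n ==> T v (is_upair a b p n) \<longleftrightarrow> v p = upair (v a) (v b)"
  by (simp add: is_upair_def tr_forms eq_upair)
lemma T_succ: "x < n ==> y < n ==> T v (is_succ x y n) \<longleftrightarrow> v y = suc (v x)"
  by (simp add: is_succ_def tr_forms eq_suc del: mem_suc)
lemma T_power: "x < n ==> P < n ==> T v (is_power x P n) \<longleftrightarrow> v P = Pw (v x)"
  by (simp add: is_power_def tr_forms T_sub eq_Pw)
lemma T_opair: "a < n ==> b < n ==> p < n ==> T v (is_opair a b p n) \<longleftrightarrow> v p = opr (v a) (v b)"
  by (simp add: is_opair_def tr_forms T_upair opr_def sing_def)
lemma T_maps: "f < n ==> a < n ==> b < n ==> T v (maps f a b n) \<longleftrightarrow> opr (v a) (v b) \<E> v f"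
  by (simp add: maps_def tr_forms T_opair)
lemma T_fn: "f < n ==> X < n ==> Y < n ==> T v (is_function f X Y n) \<longleftrightarrow> isfn (v f) (v X) (v Y)"
  by (simp add: is_function_def tr_forms tr_ex1 T_opair T_maps isfn_def)
lemma T_inj: "f < n ==> X < n ==> Y < n ==> T v (is_injection f X Y n) \<longleftrightarrow> isinj (v f) (v X) (v Y)"
  by (simp add: is_injection_def tr_forms T_fn T_maps isinj_def)
lemma T_bij: "f < n ==> X < n ==> Y < n ==> T v (is_bijection f X Y n) \<longleftrightarrow> isbij (v f) (v X) (v Y)"
  by (simp add: is_bijection_def tr_forms T_inj T_maps isbij_def)
lemma T_eqn: "X < n ==> Y < n ==> T v (equinumerous X Y n) \<longleftrightarrow> eqn (v X) (v Y)"
  by (simp add: equinumerous_def tr_forms T_bij eqn_def)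
lemma T_Ord: "a < n ==> T v (is_ordinal a n) \<longleftrightarrow> Ord (v a)"
  by (simp add: is_ordinal_def tr_forms T_sub Ord_def)
lemma T_Card: "a < n ==> T v (is_cardinal a n) \<longleftrightarrow> Card (v a)"
  by (simp add: is_cardinal_def tr_forms T_Ord T_eqn Card_iff)
definition "islim a \<longleftrightarrow> Ord a & a ~= emp & (ALL x. x \<E> a --> (EX y. y \<E> a & x \<E> y))"
lemma T_lim: "a < n ==> T v (is_limit a n) \<longleftrightarrow> islim (v a)"
  by (simp add: is_limit_def tr_forms T_Ord T_empty islim_def)
lemma om_iff: "islim w & (ALL x. x \<E> w --> ~ islim x) \<longleftrightarrow> w = om"
proof -
  have lo: "islim om" unfolding islim_def using om_suc by (metis Ord_om mem_suc om_emp mem_emp)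
  have "sub om a" if "islim a" for a
  proof (rule om_least)
    show "Ord a" "emp \<E> a" using that emp_mem unfolding islim_def by blast+
    show "suc x \<E> a" if x: "x \<E> a" for x
    proof -
      obtain y where y: "y \<E> a" "x \<E> y" using \<open>islim a\<close> x islim_def by blast
      have o: "Ord a" using \<open>islim a\<close> islim_def by blast
      have "sub (suc x) y" using suc_le[OF Ord_memD[OF o x] Ord_memD[OF o y(1)]] y(2) by blast
      thus ?thesis using Ord_le_less[OF Ord_memD[OF o y(1)] o Ord_suc[OF Ord_memD[OF o x]] _ y(1)] by blast
    qed
  qed
  hence a: "om = a | om \<E> a" "~ a \<E> om" if "islim a" for a
    using that Ord_sub_cases[OF Ord_om] Ord_not_mem[OF _ Ord_om] unfolding islim_def by blast+
  show ?thesis using lo a by blast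
qed
lemma T_om: "w < n ==> T v (is_omega w n) \<longleftrightarrow> v w = om"
  by (simp add: is_omega_def tr_forms T_lim om_iff)
lemma T_nm: "x < n ==> T v (is_numeral k x n) \<longleftrightarrow> v x = nm k"
  by (induction k arbitrary: x n v) (simp_all add: tr_forms T_empty T_succ)
lemma T_inf: "a < n ==> T v (is_infinite_cardinal a n) \<longleftrightarrow> Card (v a) & sub om (v a)"
  by (simp add: is_infinite_cardinal_def tr_forms T_Card T_om T_sub)
lemma T_pairs: "X < n ==> D < n ==> T v (is_pairs X D n) \<longleftrightarrow> v D = prb (v X) (v X)"
  by (simp add: is_pairs_def tr_forms T_upair eq_prb)
lemma T_pairs_between: "A < n ==> B < n ==> D < n ==> T v (is_pairs_between A B D n) \<longleftrightarrow> v D = prb (v A) (v B)"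
  by (simp add: is_pairs_between_def tr_forms T_upair eq_prb)
lemma T_image: "f < n ==> D < n ==> I < n ==> T v (is_image f D I n) \<longleftrightarrow> (ALL c. c \<E> v I \<longleftrightarrow> (EX p. p \<E> v D & opr p c \<E> v f))"
  by (simp add: is_image_def tr_forms T_maps)
lemma T_colouring: "f < n ==> X < n ==> C < n ==> T v (is_colouring f X C n) \<longleftrightarrow> isfn (v f) (prb (v X) (v X)) (v C)"
  by (simp add: is_colouring_def tr_forms T_pairs T_fn)
lemma T_ot: "A < n ==> a < n ==> T v (has_order_type A a n) \<longleftrightarrow> ot (v A) (v a)"
  by (simp add: has_order_type_def tr_forms T_bij T_maps ot_def)
lemma T_establishes: "f < n ==> w < n ==> w1 < n ==> w2 < n ==> m < n ==> T v (establishes f w w1 w2 m n) \<longleftrightarrow>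
  isfn (v f) (prb (v w2) (v w2)) (v m) & (ALL A B. sub A (v w2) & ot A (v w1) & sub B (v w2) & ot B (v w) &
    (ALL a b. a \<E> A & b \<E> B --> a \<E> b) --> (ALL c. c \<E> v m \<longleftrightarrow> (EX p. p \<E> prb A B & opr p c \<E> v f)))"
  by (simp add: establishes_def tr_forms T_colouring T_sub T_ot T_pairs_between T_image)
lemma T_embeds: "d < n ==> Y < n ==> f < n ==> X < n ==> T v (embeds d Y f X n) \<longleftrightarrow>
  (EX F. isinj F (v Y) (v X) & (ALL y y'. y \<E> v Y & y' \<E> v Y & y ~= y' -->
     (EX x x' c. opr y x \<E> F & opr y' x' \<E> F & opr (upair y y') c \<E> v d & opr (upair x x') c \<E> v f)))"
  by (simp add: embeds_def tr_forms T_inj T_maps T_upair)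

end

section \<open>Axioms and GCH in a model with choice\<close>

context zfc
begin

lemma nx_iff: assumes "Ord k" shows "Card l & k \<E> l & (ALL m. Card m & k \<E> m --> sub l m) \<longleftrightarrow> l = nx k"
  using Card_nx nx_gt[OF assms] nx_le sub_antisym by blast
lemma T_succ_card: "k < n ==> l < n ==> Ord (v k) ==> T v (is_succ_cardinal k l n) \<longleftrightarrow> v l = nx (v k)"
  by (simp add: is_succ_cardinal_def tr_forms T_Card T_sub nx_iff)
lemma T_omega_sub: "x < n ==> T v (is_omega_sub i x n) \<longleftrightarrow> v x = (nx ^^ i) om"
proof (induction i arbitrary: x n v)
  case 0 thus ?case by (simp add: T_om)
next
  case (Suc i)
  have "Ord ((nx ^^ i) om)" using nx(1) by (cases i) simp_all
  thus ?case using Suc.prems by (auto simp: tr_forms Suc.IH T_succ_card)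
qed
text \<open>A map of the successor onto the power set yields a bijection of the power set with an
  ordinal up to that successor; Cantor's theorem excludes the smaller ones.\<close>

lemma GCH_true: assumes "!!k. Card k ==> sub om k ==> sj (nx k) (Pw k)" shows "T v (GCH 0)"
proof -
  have "eqn (Pw k) (nx k)" if k: "Card k" "sub om k" for k
  proof -
    obtain t where t: "Ord t" "sub t (nx k)" "eqn (Pw k) t" using sj_eqn[OF nx(1) assms[OF k]] by blast
    have "~ t \<E> nx k"
    proof
      assume "t \<E> nx k"
      hence "sj k (Pw k)" using nx(3) eqn_sj[OF eqn_sym[OF t(3)]] sj_trans by blast
      thus False using cantor by blast
    qed
    hence "t = nx k" using Ord_sub_cases[OF t(1) nx(1) t(2)] by blast
    thus ?thesis using t(3) by simp
  qed
  moreover have "Card k ==> Ord k" for k unfolding Card_def by blast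
  ultimately show ?thesis
    unfolding GCH_def by (auto simp: tr_forms T_inf T_power T_eqn T_succ_card)
qed

lemma T_choice: "T v (choice 0)"
proof -
  have "EX C. ALL x. x \<E> F --> (EX z. (z \<E> x & z \<E> C) & (ALL y. y \<E> x & y \<E> C --> y = z))"
    if ne: "!!x. x \<E> F ==> EX z. z \<E> x" and dj: "!!x y z. x \<E> F ==> y \<E> F ==> x ~= y ==> ~ (z \<E> x & z \<E> y)" for F
  proof -
    have "Df (%e. e 1 \<E> e 0)" by (intro df)
    hence "EX f. ALL x. x \<E> F --> ap f x \<E> Unn F & ap f x \<E> x"
      by (rule choice_fun[of "%x z. z \<E> x" F "Unn F"]) (metis ne mem_Un)
    then obtain f where f: "!!x. x \<E> F ==> ap f x \<E> x" by blast
    have d: "Dg (ap f)" by (intro df)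
    show ?thesis
      by (rule exI[of _ "Im (ap f) F"]) (unfold mem_Im[OF d], metis f dj)
  qed
  thus ?thesis unfolding choice_def by (simp add: tr_forms tr_ex1)
qed

lemma ZFC_true: assumes "q \<in> ZFC" shows "T v q"
proof -
  have "T v (extensionality 0)" unfolding extensionality_def by (simp add: tr_forms) (metis ext)
  moreover have "T v (foundation 0)" unfolding foundation_def by (simp add: tr_forms) (metis foundation)
  moreover have "T v (pairing 0)" unfolding pairing_def by (simp add: tr_forms T_upair)
  moreover have "T v (union 0)" unfolding union_def by (simp add: tr_forms) (metis mem_Un)
  moreover have "T v (power_set 0)" unfolding power_set_def by (simp add: tr_forms T_power)
  moreover have "T v (infinity 0)" unfolding infinity_def by (simp add: tr_forms T_empty T_succ) (rule exI[of _ om], simp)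
  moreover have sep: "T w (separation_inst x p n)" if h: "\<forall>v \<in> insert x (vars p). v < n" for w x p n
  proof -
    have "EX b. ALL z. z \<E> b \<longleftrightarrow> z \<E> a & T (w(x := z)) p" for a
    proof (rule separation[of "%z. T (w(x := z)) p"])
      have "Dt (%e. (w(x := e 0)) i)" for i by (cases "i = x") (simp_all add: df_var df_const)
      thus "Dp (%z. T (w(x := z)) p)" by (rule dfp_tr)
    qed
    thus ?thesis using tr_sep[of x n p E w] h by simp
  qed
  moreover have rep: "T w (replacement_inst x y p n)" if h: "x ~= y" "\<forall>v \<in> insert x (insert y (vars p)). v < n" for w x y p n
  proof -
    have "EX b. ALL z. z \<E> a --> (EX u. u \<E> b & T (w(x := z, y := u)) p)"
      if "!!z. z \<E> a ==> EX c. ALL u. T (w(x := z, y := u)) p \<longleftrightarrow> u = c" for a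
    proof (rule replacement[of "%z u. T (w(x := z, y := u)) p", OF _ that])
      have "Dt (%e. (w(x := e 0, y := e 1)) i)" for i by (cases "i = y"; cases "i = x") (simp_all add: df_var df_const)
      thus "Df (%e. T (w(x := e 0, y := e 1)) p)" by (rule dfp_tr)
    qed
    thus ?thesis using tr_rep[of x n y p E w] h by simp
  qed
  moreover have cl: "T v q" if "q \<in> closures p" "!!v. T v p" for p
    using that(1) foldr_tr[of E p, OF that(2)] unfolding closures_def by blast
  have "T v q" if "q \<in> separation_axioms"
  proof -
    from that obtain x p n where "q \<in> closures (separation_inst x p n)" "\<forall>v \<in> insert x (vars p). v < n"
      unfolding separation_axioms_def by blast
    thus ?thesis using cl sep by blast
  qed
  moreover have "T v q" if "q \<in> replacement_axioms"
  proof -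
    from that obtain x y p n where q: "q \<in> closures (replacement_inst x y p n)" "x ~= y" "\<forall>v \<in> insert x (insert y (vars p)). v < n"
      unfolding replacement_axioms_def by blast
    show ?thesis by (rule cl[OF q(1) rep[OF q(2,3)]])
  qed
  ultimately show ?thesis using assms T_choice[of v] unfolding ZFC_def by blast
qed

end

context zf
begin

text \<open>Membership orders the two elements of a pair of ordinals, so a function of increasing
  pairs is well defined on unordered ones.\<close>

lemma pair_fn: assumes W: "Ord W" and dH: "Dt (%e. H (e 0) (e 1))" and H: "!!a b. a \<E> b ==> b \<E> W ==> H a b \<E> C"
  shows "EX f. isfn f (prb W W) C & (ALL a b c. a \<E> b --> b \<E> W --> (opr (upair a b) c \<E> f \<longleftrightarrow> c = H a b))"
proof -
  note [df] = dff2[OF dH]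
  define f where "f = Im (%z. opr (upair (fs z) (sn z)) (H (fs z) (sn z))) (Sep (prd W W) (%z. fs z \<E> sn z))"
  have d: "Dg (%z. opr (upair (fs z) (sn z)) (H (fs z) (sn z)))" by (intro df)
  have m: "z \<E> Sep (prd W W) (%z. fs z \<E> sn z) \<longleftrightarrow> z \<E> prd W W & fs z \<E> sn z" for z by (rule mem_Sep) (intro df)
  have f: "t \<E> f \<longleftrightarrow> (EX a b. a \<E> b & b \<E> W & t = opr (upair a b) (H a b))" for t
    unfolding f_def mem_Im[OF d] m mem_prd using Ord_trans[OF W] by (metis fs_opr sn_opr)
  have u: "a = a' & b = b'" if "a \<E> b" "a' \<E> b'" "upair a b = upair a' b'" for a b a' b'
    using that(3)[unfolded upair_eq] mem_asym[OF that(1)] that(2) by blast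
  have v: "opr (upair a b) c \<E> f \<longleftrightarrow> c = H a b" if "a \<E> b" "b \<E> W" for a b c
    unfolding f using that u[OF that(1)] by (metis opr_inj)
  have p: "EX a b. a \<E> b & b \<E> W & p = upair a b" if "p \<E> prb W W" for p
    using that Ord_lin_mem[OF W] upair_eq unfolding mem_prb by metis
  have "isfn f (prb W W) C"
    unfolding isfn_def
  proof (intro conjI allI impI)
    fix t assume "t \<E> f"
    then obtain a b where ab: "a \<E> b" "b \<E> W" "t = opr (upair a b) (H a b)" unfolding f by blast
    have "a ~= b" using ab(1) by auto
    hence "upair a b \<E> prb W W" unfolding mem_prb using ab(1,2) Ord_trans[OF W] by blast
    thus "EX x y. x \<E> prb W W & y \<E> C & t = opr x y" using H[OF ab(1,2)] ab(3) by blast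
  next
    fix x assume "x \<E> prb W W"
    then obtain a b where ab: "a \<E> b" "b \<E> W" "x = upair a b" using p by blast
    show "EX y. opr x y \<E> f & (ALL y'. opr x y' \<E> f --> y' = y)" unfolding ab(3) v[OF ab(1,2)] by blast
  qed
  thus ?thesis using v by blast
qed

end

context zfc
begin

definition "cval \<mu> = (case \<mu> of Fin k => nm k | Omega => om | Omega1 => nx om)"
lemma T_colours: "x < n ==> T v (is_colours \<mu> x n) \<longleftrightarrow> v x = cval \<mu>"
  by (cases \<mu>) (simp_all add: cval_def T_nm T_om T_omega_sub del: is_omega_sub.simps)
lemma om_sub_nx: "sub om (nx om)" using Ord_subD[OF nx(1) nx_gt[OF Ord_om]] .
lemma cval: assumes "!!k. \<mu> = Fin k ==> 2 \<le> k" shows "emp \<E> cval \<mu>" "nm 1 \<E> cval \<mu>" "sub (cval \<mu>) (nx om)"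
proof -
  have o: "x \<E> nx om" if "x \<E> om" for x using subD[OF om_sub_nx that] .
  have "nm 0 \<E> cval \<mu>" "nm 1 \<E> cval \<mu>"
    using assms nm_mem[of 0] nm_mem[of 1] nm_om[of 0] nm_om[of 1] o unfolding cval_def
    by (cases \<mu>; simp del: nm.simps nm_om)+
  thus "emp \<E> cval \<mu>" "nm 1 \<E> cval \<mu>" by simp_all
  show "sub (cval \<mu>) (nx om)"
    unfolding cval_def sub_def using o om_mem[OF nm_om] by (cases \<mu>) auto
qed
lemma T_non_embedding: "T v (non_embedding \<mu> 0) \<longleftrightarrow> (EX f. isfn f (prb (nx (nx om)) (nx (nx om))) (cval \<mu>) &
  (ALL A B. sub A (nx (nx om)) & ot A (nx om) & sub B (nx (nx om)) & ot B om & (ALL a b. a \<E> A & b \<E> B --> a \<E> b) -->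
    (ALL c. c \<E> cval \<mu> \<longleftrightarrow> (EX p. p \<E> prb A B & opr p c \<E> f))) &
  (EX g. isfn g (prb (nx om) (nx om)) (nm 2) &
    ~ (EX F. isinj F (nx om) (nx (nx om)) & (ALL y y'. y \<E> nx om & y' \<E> nx om & y ~= y' -->
     (EX x x' c. opr y x \<E> F & opr y' x' \<E> F & opr (upair y y') c \<E> g & opr (upair x x') c \<E> f)))))"
  unfolding non_embedding_def
  by (simp add: tr_forms T_omega_sub T_colours T_nm T_establishes T_colouring T_embeds numeral_2_eq_2 del: is_omega_sub.simps is_numeral.simps nm.simps)

end

section \<open>The combinatorial statement in the extension\<close>

context qgen
begin

lemma non_embedding_true: assumes \<mu>: "!!k. \<mu> = Fin k ==> 2 \<le> k" shows "N.T v (non_embedding \<mu> 0)"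
proof -
  define m where "m = N.cval \<mu>"
  have m: "N N.emp m" "N (N.nm 1) m" "N.sub m (j w1)" using N.cval[OF \<mu>] unfolding m_def N_w1 by blast+
  have o: "N.Ord (j w1)" "N.Ord (j w2)" using w1(2) w2(2) Ck.h_Ord by blast+
  \<comment> \<open>The retraction of the colours onto \<open>m\<close>: everything outside goes to
    \<open>emp\<close>. The colour 1 is its own only preimage, which lets
    \<open>no_embedding\<close> be applied to the unretracted colours.\<close>
  define cc where "cc z = (if N z m then z else N.emp)" for z
  have dcc: "dff N (%e. cc (e 0))" unfolding cc_def by (intro df)
  have cm: "N (cc z) m" for z unfolding cc_def using m(1) by simp
  note [df] = dff1[OF dcc]
  define Hf where "Hf a b = cc (N.Th (%z. fval a b z))" for a b
  have "dff N (%e. Hf (e 0) (e 1))" unfolding Hf_def by (intro df)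
  from N.pair_fn[OF o(2) this, of m] obtain f where f: "N.isfn f (N.prb (j w2) (j w2)) m"
    "!!a b c. N a b ==> N b (j w2) ==> N (N.opr (N.upair a b) c) f \<longleftrightarrow> c = Hf a b" using cm unfolding Hf_def by blast
  have f2: "N a b & (N (N.opr (N.upair a b) c) f \<longleftrightarrow> c = cc z)" if z: "fval a b z" for a b c z
  proof -
    have ab: "N a b" "N b (j w2)" using fval_E[OF z] Ck.h_mem by metis+
    have "N.Th (%z. fval a b z) = z" by (rule N.Th_eq[of "%z. fval a b z", OF z]) (rule fval_uniq[OF _ z])
    thus ?thesis using f(2)[OF ab] ab unfolding Hf_def by simp
  qed
  define Hg where "Hg x y = (if N (N.ap (j ee) (N.opr x y)) cG then N.nm 1 else N.emp)" for x y
  have n2: "N N.emp (N.nm 2)" "N (N.nm 1) (N.nm 2)" using N.nm_mem[of 0 2] N.nm_mem[of 1 2] by simp_all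
  have Hg: "N (Hg a b) (N.nm 2)" for a b unfolding Hg_def using n2 by simp
  have "dff N (%e. Hg (e 0) (e 1))" unfolding Hg_def by (intro df)
  from N.pair_fn[OF o(1) this, of "N.nm 2"] obtain g where g: "N.isfn g (N.prb (j w1) (j w1)) (N.nm 2)"
    "!!a b c. N a b ==> N b (j w1) ==> N (N.opr (N.upair a b) c) g \<longleftrightarrow> c = Hg a b" using Hg by blast
  have est: "N c m \<longleftrightarrow> (EX p. N p (N.prb A B) & N (N.opr p c) f)"
    if A: "N.sub A (j w2)" "N.ot A (j w1)" and B: "N.sub B (j w2)" "N.ot B N.om" and AB: "!!a b. N a A ==> N b B ==> N a b" for A B c
  proof
    assume "EX p. N p (N.prb A B) & N (N.opr p c) f"
    thus "N c m" using N.isfn_dom[OF f(1)] by blast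
  next
    assume c: "N c m"
    obtain t where t: "N.isbij t N.om B" using B(2) N.ot_def by blast
    hence ti: "N.isinj t N.om B" "N.isfn t N.om B" unfolding N.isbij_def N.isinj_def by blast+
    have tB: "N (N.ap t n) B" if "N n N.om" for n using N.isfn_ap(1)[OF ti(2) that] .
    have "N (N.ap t n) (j w2)" if "N n N.om" for n using tB[OF that] N.subD[OF B(1)] by blast
    from fN_negative[OF this N.isinj_ap[OF ti(1)] N.subD[OF m(3) c]] obtain X where X: "N.sj N.om X"
      "!!a. N a (j w2) ==> ~ N a X ==> (!!n. N n N.om ==> N a (N.ap t n)) ==> EX n. N n N.om & fval a (N.ap t n) c" by blast
    \<comment> \<open>A set of order type \<open>w1\<close> is not covered by the countable set of
      exceptional points.\<close>
    have "EX a. N a A & ~ N a X"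
    proof (rule ccontr)
      assume "~ ?thesis"
      hence "N.sub A X" unfolding N.sub_def by blast
      hence 1: "N.sj N.om A" using N.sj_mono[OF X(1) N.sub_refl] by blast
      obtain h where "N.isbij h (j w1) A" using A(2) N.ot_def by blast
      hence "N.eqn (j w1) A" unfolding N.eqn_def by blast
      hence "N.sj A (j w1)" by (rule N.eqn_sj[OF N.eqn_sym])
      hence "N.sj N.om (j w1)" using N.sj_trans[OF 1] by blast
      thus False using N.nx(2)[of N.om] unfolding N_w1 by blast
    qed
    then obtain a where a: "N a A" "~ N a X" by blast
    obtain n where n: "N n N.om" "fval a (N.ap t n) c" using X(2)[OF N.subD[OF A(1) a(1)] a(2)] AB[OF a(1) tB] by blast
    have cc: "cc c = c" unfolding cc_def using c by simp
    have "N (N.opr (N.upair a (N.ap t n)) c) f" "N a (N.ap t n)" using f2[OF n(2), of c] cc by simp_all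
    moreover have "a ~= N.ap t n" using \<open>N a (N.ap t n)\<close> by auto
    ultimately show "EX p. N p (N.prb A B) & N (N.opr p c) f" unfolding N.mem_prb using a(1) tB[OF n(1)] by blast
  qed
  have no: False if F: "N.isinj F (j w1) (j w2)" and e: "!!y y'. N y (j w1) ==> N y' (j w1) ==> y ~= y' ==>
     EX x x' c. N (N.opr y x) F & N (N.opr y' x') F & N (N.opr (N.upair y y') c) g & N (N.opr (N.upair x x') c) f" for F
  proof -
    have Ff: "N.isfn F (j w1) (j w2)" using F N.isinj_def by blast
    show False
    proof (rule no_embedding[of F])
      show "N (N.ap F x) (j w2)" if "N x (j w1)" for x using N.isfn_ap(1)[OF Ff that] .
      show "x = y" if "N x (j w1)" "N y (j w1)" "N.ap F x = N.ap F y" for x y using N.isinj_ap[OF F that] .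
      fix x y z assume xy: "N x y" "N y (j w1)" and z: "fval (N.ap F x) (N.ap F y) z | fval (N.ap F y) (N.ap F x) z"
      have x: "N x (j w1)" using N.Ord_trans[OF o(1) xy] .
      have "x ~= y" using xy(1) by auto
      then obtain u u' c where c: "N (N.opr x u) F" "N (N.opr y u') F" "N (N.opr (N.upair x y) c) g" "N (N.opr (N.upair u u') c) f"
        using e[OF x xy(2)] by blast
      have u: "u = N.ap F x" "u' = N.ap F y" using c(1,2) N.isfn_ap(2)[OF Ff x] N.isfn_ap(2)[OF Ff xy(2)] by blast+
      have "N.upair u u' = N.upair u' u" unfolding N.upair_eq by blast
      \<comment> \<open>The images of \<open>x\<close> and \<open>y\<close> may come in either
        order, but the unordered pair carries the same colour.\<close>
      hence "c = cc z" using z f2[of u u' z c] f2[of u' u z c] c(4) unfolding u by metis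
      moreover have "c = Hg x y" using g(2)[OF xy] c(3) by blast
      moreover have "N.nm 1 ~= N.emp" by simp
      ultimately show "z = N.nm 1 \<longleftrightarrow> N (N.ap (j ee) (N.opr x y)) cG" unfolding Hg_def cc_def using m(2) by metis
    qed
  qed
  show ?thesis unfolding N.T_non_embedding N_w1 N_w2 m_def[symmetric]
    by (rule exI[of _ f], intro conjI exI[of _ g]) (use f(1) g(1) est no in blast)+
qed

end

theorem theorem2p4:
  fixes \<mu> :: colours
  assumes "\<And>k. \<mu> = Fin k \<Longrightarrow> 2 \<le> k"
    and "consistent ZFC"
  shows "consistent (ZFC \<union> {GCH 0, non_embedding \<mu> 0})"
proof -
  obtain E G where "qgen E G" using qgen_exists[OF assms(2)] by blast
  then interpret qgen E G .
  have "tr UNIV N v q" if "q \<in> ZFC \<union> {GCH 0, non_embedding \<mu> 0}" for q v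
    using that N.ZFC_true N.GCH_true[OF N_gch] non_embedding_true[OF assms(1)] by blast
  hence s: "tr UNIV N v p" if "provable (ZFC \<union> {GCH 0, non_embedding \<mu> 0}) p" for v p using soundness[OF that] by blast
  show ?thesis
    unfolding consistent_def
  proof
    assume "EX p. provable (ZFC \<union> {GCH 0, non_embedding \<mu> 0}) p & provable (ZFC \<union> {GCH 0, non_embedding \<mu> 0}) (Neg p)"
    then obtain p where "tr UNIV N v p" "tr UNIV N v (Neg p)" for v using s by blast
    thus False by simp
  qed
qed

end
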